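(* Let $k$ be a commutative ring with unit, $A$ and $B$ unital $k$-algebras, $M$ an $(A,B)$-bimodule, $E=\begin{pmatrix} A & M\\ 0 & B\end{pmatrix}$ the triangular matrix algebra, and $X$ an $E$-bimodule. There exists a long exact sequence of $k$-modules $$0\to \mathrm{Ext}^0_{E\otimes B^{\mathrm{op}},k}(B_E,X1_B)\to \mathrm{H}^0(E,X)\to \mathrm{H}^0(A,X_{AA})\to \mathrm{Ext}^1_{E\otimes B^{\mathrm{op}},k}(B_E,X1_B)\to \mathrm{H}^1(E,X)\to \mathrm{H}^1(A,X_{AA})\to\cdots .$$
   Context: All algebras are unital and $\otimes=\otimes_k$. The ring $k$ acts centrally on all bimodules. $1_A,1_B$ are the units of $A$ and $B$, regarded as the idempotents $\begin{pmatrix}1&0\\0&0\end{pmatrix}$ and $\begin{pmatrix}0&0\\0&1\end{pmatrix}$ of $E$. Put $X_{AA}=1_AX1_A$ (an $A$-bimodule). $X1_B$ is regarded as an $(E,B)$-bimodule, i.e. a left $E\otimes B^{\mathrm{op}}$-module. $B_E$ denotes $B$ considered as an $E$-bimodule via the ring morphism $\pi:E\to B$, $\pi\begin{pmatrix}a&m\\0&b\end{pmatrix}=b$. In particular $B_E$ is an $(E,B)$-bimodule, i.e. a left $E\otimes B^{\mathrm{op}}$-module. For a $k$-algebra $C$ let $C^e=C\otimes C^{\mathrm{op}}$ and $C^n=C^{\otimes n}$. The canonical resolution $(C^{*+2},b'_* )$ of $C$ has $C^{n+2}$ in degree $n$ and $b'_n(x_0\otimes\cdots\otimes x_{n+1})=\sum_{j=0}^{n}(-1)^j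 x_0\otimes\cdots\otimes x_jx_{j+1}\otimes\cdots\otimes x_{n+1}$. For a $C$-bimodule $Y$, the Hochschild cohomology is $\mathrm{H}^n(C,Y)=\mathrm{H}^n(\mathrm{Hom}_{C^e}((C^{*+2},b'_* ),Y))$. $\mathrm{Ext}^*_{E\otimes B^{\mathrm{op}},k}$ denotes the Ext groups relative to the family of the $E\otimes B^{\mathrm{op}}$-linear epimorphisms which split as $k$-linear morphisms. That is, they are computed from a resolution of the first argument by relatively projective modules that is contractible as a complex of $k$-modules. *)

theory Defs
  imports "HOL-Algebra.Module" "HOL-Algebra.AbelCoset"
begin

section \<open>Algebras, modules and bimodules over a commutative ring\<close>

text \<open>
  Everything is a module over the commutative ring \<open>k\<close>.  Associative unital \<open>k\<close>-algebras and plain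
  \<open>k\<close>-modules both use the record type \<open>module\<close> of HOL-Algebra; the fields \<open>mult\<close> and \<open>one\<close>
  are irrelevant for plain modules.  (The locale \<open>algebra\<close> of the library
  requires commutativity.)
\<close>

locale k_algebra = module k A + A: ring A
  for k (structure) and A (structure) +
  assumes smult_mult_left:
      "\<lbrakk>c \<in> carrier k; x \<in> carrier A; y \<in> carrier A\<rbrakk>
        \<Longrightarrow> c \<odot>\<^bsub>A\<^esub> (x \<otimes>\<^bsub>A\<^esub> y) = (c \<odot>\<^bsub>A\<^esub> x) \<otimes>\<^bsub>A\<^esub> y"
    and smult_mult_right:
      "\<lbrakk>c \<in> carrier k; x \<in> carrier A; y \<in> carrier A\<rbrakk>
        \<Longrightarrow> c \<odot>\<^bsub>A\<^esub> (x \<otimes>\<^bsub>A\<^esub> y) = x \<otimes>\<^bsub>A\<^esub> (c \<odot>\<^bsub>A\<^esub> y)"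

record ('k, 'r, 'x) lmod = "('k, 'x) module" +
  lact :: "'r \<Rightarrow> 'x \<Rightarrow> 'x"

record ('k, 'l, 'r, 'x) bimod = "('k, 'l, 'x) lmod" +
  ract :: "'x \<Rightarrow> 'r \<Rightarrow> 'x"

locale left_module = k_algebra k R + N: module k N
  for k :: "('k, 'z) ring_scheme" (structure) and R :: "('k, 'r, 'w) module_scheme"
    and N :: "('k, 'r, 'x, 'v) lmod_scheme" +
  assumes lact_closed:
      "\<lbrakk>r \<in> carrier R; x \<in> carrier N\<rbrakk> \<Longrightarrow> lact N r x \<in> carrier N"
    and lact_add_left:
      "\<lbrakk>r \<in> carrier R; s \<in> carrier R; x \<in> carrier N\<rbrakk>
        \<Longrightarrow> lact N (r \<oplus>\<^bsub>R\<^esub> s) x = lact N r x \<oplus>\<^bsub>N\<^esub> lact N s x"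
    and lact_add_right:
      "\<lbrakk>r \<in> carrier R; x \<in> carrier N; y \<in> carrier N\<rbrakk>
        \<Longrightarrow> lact N r (x \<oplus>\<^bsub>N\<^esub> y) = lact N r x \<oplus>\<^bsub>N\<^esub> lact N r y"
    and lact_mult:
      "\<lbrakk>r \<in> carrier R; s \<in> carrier R; x \<in> carrier N\<rbrakk>
        \<Longrightarrow> lact N (r \<otimes>\<^bsub>R\<^esub> s) x = lact N r (lact N s x)"
    and lact_one:
      "x \<in> carrier N \<Longrightarrow> lact N \<one>\<^bsub>R\<^esub> x = x"
    and lact_smult:
      "\<lbrakk>c \<in> carrier k; r \<in> carrier R; x \<in> carrier N\<rbrakk>
        \<Longrightarrow> lact N (c \<odot>\<^bsub>R\<^esub> r) x = c \<odot>\<^bsub>N\<^esub> lact N r x"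

text \<open>
  \<open>lact_smult\<close> and \<open>ract_smult\<close> below refer to the same \<open>k\<close>-module structure on \<open>N\<close>:
  \<open>k\<close> acts centrally on bimodules.
\<close>

locale bimodule = left_module k A N + B: k_algebra k B
  for k :: "('k, 'z) ring_scheme" (structure) and A :: "('k, 'a, 'w) module_scheme"
    and B :: "('k, 'b, 'w') module_scheme" and N :: "('k, 'a, 'b, 'x, 'v) bimod_scheme" +
  assumes ract_closed:
      "\<lbrakk>x \<in> carrier N; b \<in> carrier B\<rbrakk> \<Longrightarrow> ract N x b \<in> carrier N"
    and ract_add_left:
      "\<lbrakk>x \<in> carrier N; y \<in> carrier N; b \<in> carrier B\<rbrakk>
        \<Longrightarrow> ract N (x \<oplus>\<^bsub>N\<^esub> y) b = ract N x b \<oplus>\<^bsub>N\<^esub> ract N y b"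
    and ract_add_right:
      "\<lbrakk>x \<in> carrier N; b \<in> carrier B; b' \<in> carrier B\<rbrakk>
        \<Longrightarrow> ract N x (b \<oplus>\<^bsub>B\<^esub> b') = ract N x b \<oplus>\<^bsub>N\<^esub> ract N x b'"
    and ract_mult:
      "\<lbrakk>x \<in> carrier N; b \<in> carrier B; b' \<in> carrier B\<rbrakk>
        \<Longrightarrow> ract N x (b \<otimes>\<^bsub>B\<^esub> b') = ract N (ract N x b) b'"
    and ract_one:
      "x \<in> carrier N \<Longrightarrow> ract N x \<one>\<^bsub>B\<^esub> = x"
    and ract_smult:
      "\<lbrakk>c \<in> carrier k; x \<in> carrier N; b \<in> carrier B\<rbrakk>
        \<Longrightarrow> ract N x (c \<odot>\<^bsub>B\<^esub> b) = c \<odot>\<^bsub>N\<^esub> ract N x b"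
    and lact_ract:
      "\<lbrakk>a \<in> carrier A; x \<in> carrier N; b \<in> carrier B\<rbrakk>
        \<Longrightarrow> lact N a (ract N x b) = ract N (lact N a x) b"

definition opposite :: "('k, 'a) module \<Rightarrow> ('k, 'a) module" where
  "opposite A = A\<lparr>mult := \<lambda>x y. y \<otimes>\<^bsub>A\<^esub> x\<rparr>"

definition k_hom ::
  "('k, 'z1) ring_scheme \<Rightarrow> ('k, 'x, 'z2) module_scheme \<Rightarrow> ('k, 'y, 'z3) module_scheme \<Rightarrow> ('x \<Rightarrow> 'y) set"
where
  "k_hom k M N = {f \<in> carrier M \<rightarrow> carrier N.
     (\<forall>x\<in>carrier M. \<forall>y\<in>carrier M. f (x \<oplus>\<^bsub>M\<^esub> y) = f x \<oplus>\<^bsub>N\<^esub> f y) \<and>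
     (\<forall>c\<in>carrier k. \<forall>x\<in>carrier M. f (c \<odot>\<^bsub>M\<^esub> x) = c \<odot>\<^bsub>N\<^esub> f x)}"

definition lmod_hom ::
  "'k ring \<Rightarrow> ('k, 'r) module \<Rightarrow> ('k, 'r, 'x) lmod \<Rightarrow> ('k, 'r, 'y) lmod \<Rightarrow> ('x \<Rightarrow> 'y) set"
where
  "lmod_hom k R M N =
     {f \<in> k_hom k M N. \<forall>r\<in>carrier R. \<forall>x\<in>carrier M. f (lact M r x) = lact N r (f x)}"

text \<open>Functions are made extensional so that equality in \<open>Hom\<^sub>R(M, N)\<close> is equality on \<open>M\<close>.\<close>

definition hom_module ::
  "'k ring \<Rightarrow> ('k, 'r) module \<Rightarrow> ('k, 'r, 'x) lmod \<Rightarrow> ('k, 'r, 'y) lmod \<Rightarrow> ('k, 'x \<Rightarrow> 'y) module"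
where
  "hom_module k R M N =
     \<lparr>carrier = lmod_hom k R M N \<inter> extensional (carrier M),
      mult = undefined, one = undefined,
      zero = (\<lambda>x\<in>carrier M. \<zero>\<^bsub>N\<^esub>),
      add = (\<lambda>f g. \<lambda>x\<in>carrier M. f x \<oplus>\<^bsub>N\<^esub> g x),
      smult = (\<lambda>c f. \<lambda>x\<in>carrier M. c \<odot>\<^bsub>N\<^esub> f x)\<rparr>"

section \<open>Quotients, free modules and tensor products\<close>

definition quot_module :: "('k, 'x) module \<Rightarrow> 'x set \<Rightarrow> ('k, 'x set) module" where
  "quot_module N H =
     \<lparr>carrier = a_rcosets\<^bsub>N\<^esub> H,
      mult = undefined, one = undefined,
      zero = H,
      add = (\<lambda>S T. S <+>\<^bsub>N\<^esub> T),
      smult = (\<lambda>c T. \<Union>t\<in>T. H +>\<^bsub>N\<^esub> (c \<odot>\<^bsub>N\<^esub> t))\<rparr>"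

definition generated_submodule :: "'k ring \<Rightarrow> ('k, 'x) module \<Rightarrow> 'x set \<Rightarrow> 'x set" where
  "generated_submodule k N S = \<Inter> {H. submodule H k N \<and> S \<subseteq> H}"

definition free_module :: "'k ring \<Rightarrow> 'i set \<Rightarrow> ('k, 'i \<Rightarrow> 'k) module" where
  "free_module k S =
     \<lparr>carrier = {f. range f \<subseteq> carrier k \<and> finite {s. f s \<noteq> \<zero>\<^bsub>k\<^esub>} \<and> {s. f s \<noteq> \<zero>\<^bsub>k\<^esub>} \<subseteq> S},
      mult = undefined, one = undefined,
      zero = (\<lambda>s. \<zero>\<^bsub>k\<^esub>),
      add = (\<lambda>f g s. f s \<oplus>\<^bsub>k\<^esub> g s),
      smult = (\<lambda>c f s. c \<otimes>\<^bsub>k\<^esub> f s)\<rparr>"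

definition basis :: "'k ring \<Rightarrow> 'i \<Rightarrow> 'i \<Rightarrow> 'k" where
  "basis k s = (\<lambda>t. if t = s then \<one>\<^bsub>k\<^esub> else \<zero>\<^bsub>k\<^esub>)"

definition presented :: "'k ring \<Rightarrow> 'i set \<Rightarrow> ('i \<Rightarrow> 'k) set \<Rightarrow> ('k, ('i \<Rightarrow> 'k) set) module" where
  "presented k S Rel =
     quot_module (free_module k S) (generated_submodule k (free_module k S) Rel)"

definition presented_gen ::
  "'k ring \<Rightarrow> 'i set \<Rightarrow> ('i \<Rightarrow> 'k) set \<Rightarrow> 'i \<Rightarrow> ('i \<Rightarrow> 'k) set"
where
  "presented_gen k S Rel s =
     generated_submodule k (free_module k S) Rel +>\<^bsub>free_module k S\<^esub> basis k s"

text \<open>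
  The \<open>k\<close>-linear map out of a presented module which sends the class of the generator \<open>s\<close> to \<open>\<phi> s\<close>.
  It is only meaningful if \<open>\<phi>\<close> respects the relations; then all representatives \<open>f\<close> of a class \<open>T\<close>
  give the same value.
\<close>

definition lin_lift ::
  "'k ring \<Rightarrow> ('k, 'x, 'z) module_scheme \<Rightarrow> ('i \<Rightarrow> 'x) \<Rightarrow> ('i \<Rightarrow> 'k) set \<Rightarrow> 'x"
where
  "lin_lift k N \<phi> T =
     (THE y. \<forall>f\<in>T. y = (\<Oplus>\<^bsub>N\<^esub> s\<in>{s. f s \<noteq> \<zero>\<^bsub>k\<^esub>}. f s \<odot>\<^bsub>N\<^esub> \<phi> s))"

definition tensor_rels :: "'k ring \<Rightarrow> ('k, 'm) module \<Rightarrow> ('k, 'n) module \<Rightarrow> ('m \<times> 'n \<Rightarrow> 'k) set" where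
  "tensor_rels k M N =
     (let F = free_module k (carrier M \<times> carrier N); e = (\<lambda>m n. basis k (m, n)) in
      {e (m \<oplus>\<^bsub>M\<^esub> m') n \<ominus>\<^bsub>F\<^esub> (e m n \<oplus>\<^bsub>F\<^esub> e m' n) | m m' n.
         m \<in> carrier M \<and> m' \<in> carrier M \<and> n \<in> carrier N} \<union>
      {e m (n \<oplus>\<^bsub>N\<^esub> n') \<ominus>\<^bsub>F\<^esub> (e m n \<oplus>\<^bsub>F\<^esub> e m n') | m n n'.
         m \<in> carrier M \<and> n \<in> carrier N \<and> n' \<in> carrier N} \<union>
      {e (c \<odot>\<^bsub>M\<^esub> m) n \<ominus>\<^bsub>F\<^esub> (c \<odot>\<^bsub>F\<^esub> e m n) | c m n.
         c \<in> carrier k \<and> m \<in> carrier M \<and> n \<in> carrier N} \<union>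
      {e m (c \<odot>\<^bsub>N\<^esub> n) \<ominus>\<^bsub>F\<^esub> (c \<odot>\<^bsub>F\<^esub> e m n) | c m n.
         c \<in> carrier k \<and> m \<in> carrier M \<and> n \<in> carrier N})"

definition tensor ::
  "'k ring \<Rightarrow> ('k, 'm) module \<Rightarrow> ('k, 'n) module \<Rightarrow> ('k, ('m \<times> 'n \<Rightarrow> 'k) set) module"
where
  "tensor k M N = presented k (carrier M \<times> carrier N) (tensor_rels k M N)"

definition pure_tensor ::
  "'k ring \<Rightarrow> ('k, 'm) module \<Rightarrow> ('k, 'n) module \<Rightarrow> 'm \<Rightarrow> 'n \<Rightarrow> ('m \<times> 'n \<Rightarrow> 'k) set"
where
  "pure_tensor k M N m n =
     presented_gen k (carrier M \<times> carrier N) (tensor_rels k M N) (m, n)"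

definition tensor_algebra ::
  "'k ring \<Rightarrow> ('k, 'a) module \<Rightarrow> ('k, 'b) module \<Rightarrow> ('k, ('a \<times> 'b \<Rightarrow> 'k) set) module"
where
  "tensor_algebra k A B =
     (tensor k A B)
       \<lparr>mult := (\<lambda>s t. lin_lift k (tensor k A B) (\<lambda>(a, b).
                   lin_lift k (tensor k A B) (\<lambda>(a', b').
                     pure_tensor k A B (a \<otimes>\<^bsub>A\<^esub> a') (b \<otimes>\<^bsub>B\<^esub> b')) t) s),
        one := pure_tensor k A B \<one>\<^bsub>A\<^esub> \<one>\<^bsub>B\<^esub>\<rparr>"

text \<open>
  An \<open>(A, B)\<close>-bimodule as a left module over \<open>A \<otimes> B\<^sup>o\<^sup>p\<close>, i.e. over
  \<open>tensor_algebra k A (opposite B)\<close>: \<open>(a \<otimes> b) x = a x b\<close>.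
\<close>

definition bimod_as_left :: "'k ring \<Rightarrow> ('k, 'a, 'b, 'x) bimod \<Rightarrow> ('k, ('a \<times> 'b \<Rightarrow> 'k) set, 'x) lmod"
where
  "bimod_as_left k N =
     \<lparr>carrier = carrier N, mult = mult N, one = one N, zero = zero N, add = add N, smult = smult N,
      lact = (\<lambda>t x. lin_lift k N (\<lambda>(a, b). lact N a (ract N x b)) t)\<rparr>"

text \<open>The tensor power of a module; generators are the lists of length \<open>n\<close>.\<close>

definition power_gens :: "('k, 'c) module \<Rightarrow> nat \<Rightarrow> 'c list set" where
  "power_gens C n = {l. length l = n \<and> set l \<subseteq> carrier C}"

definition power_rels :: "'k ring \<Rightarrow> ('k, 'c) module \<Rightarrow> nat \<Rightarrow> ('c list \<Rightarrow> 'k) set" where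
  "power_rels k C n =
     (let F = free_module k (power_gens C n) in
      {basis k (l[i := x \<oplus>\<^bsub>C\<^esub> y]) \<ominus>\<^bsub>F\<^esub> (basis k (l[i := x]) \<oplus>\<^bsub>F\<^esub> basis k (l[i := y])) | l i x y.
         l \<in> power_gens C n \<and> i < n \<and> x \<in> carrier C \<and> y \<in> carrier C} \<union>
      {basis k (l[i := c \<odot>\<^bsub>C\<^esub> x]) \<ominus>\<^bsub>F\<^esub> (c \<odot>\<^bsub>F\<^esub> basis k (l[i := x])) | c l i x.
         c \<in> carrier k \<and> l \<in> power_gens C n \<and> i < n \<and> x \<in> carrier C})"

definition tensor_power :: "'k ring \<Rightarrow> ('k, 'c) module \<Rightarrow> nat \<Rightarrow> ('k, ('c list \<Rightarrow> 'k) set) module" where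
  "tensor_power k C n = presented k (power_gens C n) (power_rels k C n)"

definition pure_list :: "'k ring \<Rightarrow> ('k, 'c) module \<Rightarrow> 'c list \<Rightarrow> ('c list \<Rightarrow> 'k) set" where
  "pure_list k C l = presented_gen k (power_gens C (length l)) (power_rels k C (length l)) l"

section \<open>Cohomology of a Hom complex\<close>

definition cohomology ::
  "(nat \<Rightarrow> ('k, 'x) module) \<Rightarrow> (nat \<Rightarrow> 'x \<Rightarrow> 'x) \<Rightarrow> nat \<Rightarrow> ('k, 'x set) module"
where
  "cohomology K \<delta> n =
     quot_module ((K n)\<lparr>carrier := {x \<in> carrier (K n). \<delta> n x = \<zero>\<^bsub>K (Suc n)\<^esub>}\<rparr>)
       (case n of 0 \<Rightarrow> {\<zero>\<^bsub>K 0\<^esub>} | Suc m \<Rightarrow> \<delta> m ` carrier (K m))"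

text \<open>Here \<open>d n\<close> is the differential \<open>P (Suc n) \<rightarrow> P n\<close>.\<close>

definition hom_cohomology ::
  "'k ring \<Rightarrow> ('k, 'r) module \<Rightarrow> (nat \<Rightarrow> ('k, 'r, 'p) lmod) \<Rightarrow> (nat \<Rightarrow> 'p \<Rightarrow> 'p) \<Rightarrow>
   ('k, 'r, 'x) lmod \<Rightarrow> nat \<Rightarrow> ('k, ('p \<Rightarrow> 'x) set) module"
where
  "hom_cohomology k R P d N =
     cohomology (\<lambda>n. hom_module k R (P n) N) (\<lambda>n f. compose (carrier (P (Suc n))) f (d n))"

section \<open>Hochschild cohomology\<close>

text \<open>The \<open>C\<close>-bimodule \<open>C\<^sup>n\<^sup>+\<^sup>2\<close>, with \<open>C\<close> acting on the outer tensor factors.\<close>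

definition bar_bimod ::
  "'k ring \<Rightarrow> ('k, 'c) module \<Rightarrow> nat \<Rightarrow> ('k, 'c, 'c, ('c list \<Rightarrow> 'k) set) bimod"
where
  "bar_bimod k C n =
     (let T = tensor_power k C (n + 2) in
      \<lparr>carrier = carrier T, mult = mult T, one = one T, zero = zero T, add = add T, smult = smult T,
       lact = (\<lambda>c. lin_lift k T (\<lambda>l. pure_list k C (l[0 := c \<otimes>\<^bsub>C\<^esub> l ! 0]))),
       ract = (\<lambda>t c. lin_lift k T (\<lambda>l. pure_list k C (l[n + 1 := l ! (n + 1) \<otimes>\<^bsub>C\<^esub> c])) t)\<rparr>)"

definition contract :: "('k, 'c) module \<Rightarrow> 'c list \<Rightarrow> nat \<Rightarrow> 'c list" where
  "contract C l j = take j l @ [l ! j \<otimes>\<^bsub>C\<^esub> l ! (j + 1)] @ drop (j + 2) l"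

text \<open>The map \<open>b'\<^sub>n : C\<^sup>n\<^sup>+\<^sup>2 \<rightarrow> C\<^sup>n\<^sup>+\<^sup>1\<close>.\<close>

definition bar_diff ::
  "'k ring \<Rightarrow> ('k, 'c) module \<Rightarrow> nat \<Rightarrow> ('c list \<Rightarrow> 'k) set \<Rightarrow> ('c list \<Rightarrow> 'k) set"
where
  "bar_diff k C n =
     lin_lift k (tensor_power k C (n + 1)) (\<lambda>l.
       \<Oplus>\<^bsub>tensor_power k C (n + 1)\<^esub> j\<in>{0..n}.
         ((\<ominus>\<^bsub>k\<^esub> \<one>\<^bsub>k\<^esub>) [^]\<^bsub>k\<^esub> j) \<odot>\<^bsub>tensor_power k C (n + 1)\<^esub> pure_list k C (contract C l j))"

definition hochschild ::
  "'k ring \<Rightarrow> ('k, 'c) module \<Rightarrow> ('k, 'c, 'c, 'x) bimod \<Rightarrow> nat \<Rightarrow>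
   ('k, (('c list \<Rightarrow> 'k) set \<Rightarrow> 'x) set) module"
where
  "hochschild k C Y =
     hom_cohomology k (tensor_algebra k C (opposite C))
       (\<lambda>n. bimod_as_left k (bar_bimod k C n)) (\<lambda>n. bar_diff k C (Suc n)) (bimod_as_left k Y)"

section \<open>Relative Ext\<close>

definition k_split_epis ::
  "'k ring \<Rightarrow> ('k, 'r) module \<Rightarrow> ('k, 'r, 'x) lmod \<Rightarrow> ('k, 'r, 'y) lmod \<Rightarrow> ('x \<Rightarrow> 'y) set"
where
  "k_split_epis k R M N =
     {g \<in> lmod_hom k R M N. g ` carrier M = carrier N \<and>
        (\<exists>s\<in>k_hom k N M. \<forall>y\<in>carrier N. g (s y) = y)}"

text \<open>
  \<open>P\<close> is relatively projective if every \<open>R\<close>-linear map from \<open>P\<close> lifts along every \<open>R\<close>-linear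
  epimorphism that splits \<open>k\<close>-linearly.  A formula cannot quantify over types, so the modules
  \<open>M\<close> and \<open>N\<close> are carried by fixed types.  These are large enough to include \<open>N = P\<close> and
  \<open>M = R \<otimes>\<^sub>k P\<close> (carried by \<open>tensor k R P\<close>), for which the identity of \<open>P\<close> lifts
  iff \<open>P\<close> is a direct summand of \<open>R \<otimes>\<^sub>k P\<close>; the latter gives the
  lifting property for modules carried by arbitrary types.
\<close>

definition rel_projective :: "'k ring \<Rightarrow> ('k, 'r) module \<Rightarrow> ('k, 'r, 'p) lmod \<Rightarrow> bool" where
  "rel_projective k R P \<longleftrightarrow> left_module k R P \<and>
     (\<forall>(M :: ('k, 'r, ('r \<times> 'p \<Rightarrow> 'k) set) lmod) (N :: ('k, 'r, 'p) lmod) g f.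
        left_module k R M \<longrightarrow> left_module k R N \<longrightarrow>
        g \<in> k_split_epis k R M N \<longrightarrow> f \<in> lmod_hom k R P N \<longrightarrow>
        (\<exists>h\<in>lmod_hom k R P M. \<forall>x\<in>carrier P. g (h x) = f x))"

text \<open>
  A resolution \<open>\<dots> \<rightarrow> P 1 \<rightarrow> P 0 \<rightarrow> L \<rightarrow> 0\<close> by relatively projective modules, with
  differentials \<open>d n : P (Suc n) \<rightarrow> P n\<close> and augmentation \<open>\<epsilon>\<close>, which is contractible as a complex of
  \<open>k\<close>-modules.  The contracting homotopy consists of \<open>\<sigma> : L \<rightarrow> P 0\<close> and \<open>s n : P n \<rightarrow> P (Suc n)\<close>.
\<close>

definition rel_projective_resolution ::
  "'k ring \<Rightarrow> ('k, 'r) module \<Rightarrow> ('k, 'r, 'l) lmod \<Rightarrow>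
   (nat \<Rightarrow> ('k, 'r, 'p) lmod) \<Rightarrow> (nat \<Rightarrow> 'p \<Rightarrow> 'p) \<Rightarrow> ('p \<Rightarrow> 'l) \<Rightarrow> bool"
where
  "rel_projective_resolution k R L P d \<epsilon> \<longleftrightarrow>
     (\<forall>n. rel_projective k R (P n)) \<and>
     (\<forall>n. d n \<in> lmod_hom k R (P (Suc n)) (P n)) \<and>
     \<epsilon> \<in> lmod_hom k R (P 0) L \<and>
     (\<forall>x\<in>carrier (P 1). \<epsilon> (d 0 x) = \<zero>\<^bsub>L\<^esub>) \<and>
     (\<forall>n. \<forall>x\<in>carrier (P (Suc (Suc n))). d n (d (Suc n) x) = \<zero>\<^bsub>P n\<^esub>) \<and>
     (\<exists>\<sigma>\<in>k_hom k L (P 0). \<exists>s. (\<forall>n. s n \<in> k_hom k (P n) (P (Suc n))) \<and>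
        (\<forall>y\<in>carrier L. \<epsilon> (\<sigma> y) = y) \<and>
        (\<forall>x\<in>carrier (P 0). d 0 (s 0 x) \<oplus>\<^bsub>P 0\<^esub> \<sigma> (\<epsilon> x) = x) \<and>
        (\<forall>n. \<forall>x\<in>carrier (P (Suc n)).
           d (Suc n) (s (Suc n) x) \<oplus>\<^bsub>P (Suc n)\<^esub> s n (d n x) = x))"

text \<open>
  \<open>Ext\<^bsub>R,k\<^esub>\<^sup>n(L, N)\<close>, computed from the resolution \<open>(P, d)\<close> of \<open>L\<close>.
\<close>

definition rel_Ext ::
  "'k ring \<Rightarrow> ('k, 'r) module \<Rightarrow> (nat \<Rightarrow> ('k, 'r, 'p) lmod) \<Rightarrow> (nat \<Rightarrow> 'p \<Rightarrow> 'p) \<Rightarrow>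
   ('k, 'r, 'x) lmod \<Rightarrow> nat \<Rightarrow> ('k, ('p \<Rightarrow> 'x) set) module"
where
  "rel_Ext k R P d N = hom_cohomology k R P d N"

section \<open>Triangular matrix algebras\<close>

text \<open>The triple \<open>(a, m, b)\<close> stands for the matrix with rows \<open>(a m)\<close> and \<open>(0 b)\<close>.\<close>

definition triangular ::
  "('k, 'a) module \<Rightarrow> ('k, 'a, 'b, 'm) bimod \<Rightarrow> ('k, 'b) module \<Rightarrow> ('k, 'a \<times> 'm \<times> 'b) module"
where
  "triangular A M B =
     \<lparr>carrier = carrier A \<times> carrier M \<times> carrier B,
      mult = (\<lambda>(a, m, b) (a', m', b').
                (a \<otimes>\<^bsub>A\<^esub> a', lact M a m' \<oplus>\<^bsub>M\<^esub> ract M m b', b \<otimes>\<^bsub>B\<^esub> b')),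
      one = (\<one>\<^bsub>A\<^esub>, \<zero>\<^bsub>M\<^esub>, \<one>\<^bsub>B\<^esub>),
      zero = (\<zero>\<^bsub>A\<^esub>, \<zero>\<^bsub>M\<^esub>, \<zero>\<^bsub>B\<^esub>),
      add = (\<lambda>(a, m, b) (a', m', b'). (a \<oplus>\<^bsub>A\<^esub> a', m \<oplus>\<^bsub>M\<^esub> m', b \<oplus>\<^bsub>B\<^esub> b')),
      smult = (\<lambda>c (a, m, b). (c \<odot>\<^bsub>A\<^esub> a, c \<odot>\<^bsub>M\<^esub> m, c \<odot>\<^bsub>B\<^esub> b))\<rparr>"

definition inA :: "('k, 'a, 'b, 'm) bimod \<Rightarrow> ('k, 'b) module \<Rightarrow> 'a \<Rightarrow> 'a \<times> 'm \<times> 'b" where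
  "inA M B a = (a, \<zero>\<^bsub>M\<^esub>, \<zero>\<^bsub>B\<^esub>)"

definition inB :: "('k, 'a) module \<Rightarrow> ('k, 'a, 'b, 'm) bimod \<Rightarrow> 'b \<Rightarrow> 'a \<times> 'm \<times> 'b" where
  "inB A M b = (\<zero>\<^bsub>A\<^esub>, \<zero>\<^bsub>M\<^esub>, b)"

definition proj_B :: "'a \<times> 'm \<times> 'b \<Rightarrow> 'b" where
  "proj_B = (\<lambda>(a, m, b). b)"

text \<open>The subset \<open>S\<close> of a bimodule, with scalars acting through \<open>f\<close> on the left and \<open>g\<close> on the right.\<close>

definition restrict_bimod ::
  "'x set \<Rightarrow> ('l' \<Rightarrow> 'l) \<Rightarrow> ('r' \<Rightarrow> 'r) \<Rightarrow> ('k, 'l, 'r, 'x) bimod \<Rightarrow> ('k, 'l', 'r', 'x) bimod"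
where
  "restrict_bimod S f g X =
     \<lparr>carrier = S, mult = mult X, one = one X, zero = zero X, add = add X, smult = smult X,
      lact = (\<lambda>a. lact X (f a)), ract = (\<lambda>x b. ract X x (g b))\<rparr>"

definition regular_bimod :: "('k, 'b) module \<Rightarrow> ('k, 'b, 'b, 'b) bimod" where
  "regular_bimod B =
     \<lparr>carrier = carrier B, mult = mult B, one = one B, zero = zero B, add = add B, smult = smult B,
      lact = mult B, ract = mult B\<rparr>"

definition X_AA ::
  "('k, 'a) module \<Rightarrow> ('k, 'a, 'b, 'm) bimod \<Rightarrow> ('k, 'b) module \<Rightarrow>
   ('k, 'a \<times> 'm \<times> 'b, 'a \<times> 'm \<times> 'b, 'x) bimod \<Rightarrow> ('k, 'a, 'a, 'x) bimod"
where
  "X_AA A M B X =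
     restrict_bimod {lact X (inA M B \<one>\<^bsub>A\<^esub>) (ract X x (inA M B \<one>\<^bsub>A\<^esub>)) | x. x \<in> carrier X}
       (inA M B) (inA M B) X"

definition X_B ::
  "('k, 'a) module \<Rightarrow> ('k, 'a, 'b, 'm) bimod \<Rightarrow> ('k, 'b) module \<Rightarrow>
   ('k, 'a \<times> 'm \<times> 'b, 'a \<times> 'm \<times> 'b, 'x) bimod \<Rightarrow> ('k, 'a \<times> 'm \<times> 'b, 'b, 'x) bimod"
where
  "X_B A M B X =
     restrict_bimod {ract X x (inB A M \<one>\<^bsub>B\<^esub>) | x. x \<in> carrier X} id (inB A M) X"

definition B_E :: "('k, 'b) module \<Rightarrow> ('k, 'a \<times> 'm \<times> 'b, 'b, 'b) bimod" where
  "B_E B = restrict_bimod (carrier B) proj_B id (regular_bimod B)"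

section \<open>Exactness\<close>

definition exact_at ::
  "('k, 'x) module \<Rightarrow> ('x \<Rightarrow> 'y) \<Rightarrow> ('k, 'y) module \<Rightarrow> ('y \<Rightarrow> 'z) \<Rightarrow> ('k, 'z) module \<Rightarrow> bool"
where
  "exact_at U f V g W \<longleftrightarrow> f ` carrier U = {y \<in> carrier V. g y = \<zero>\<^bsub>W\<^esub>}"

text \<open>
  There is a long exact sequence of \<open>k\<close>-modules
  \<open>0 \<rightarrow> U 0 \<rightarrow> V 0 \<rightarrow> W 0 \<rightarrow> U 1 \<rightarrow> V 1 \<rightarrow> W 1 \<rightarrow> \<dots>\<close>
\<close>

definition has_long_exact_sequence ::
  "'k ring \<Rightarrow> (nat \<Rightarrow> ('k, 'x) module) \<Rightarrow> (nat \<Rightarrow> ('k, 'y) module) \<Rightarrow> (nat \<Rightarrow> ('k, 'z) module) \<Rightarrow> bool"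
where
  "has_long_exact_sequence k U V W \<longleftrightarrow>
     (\<exists>\<alpha> \<beta> \<gamma>.
        (\<forall>n. \<alpha> n \<in> k_hom k (U n) (V n) \<and> \<beta> n \<in> k_hom k (V n) (W n) \<and>
             \<gamma> n \<in> k_hom k (W n) (U (Suc n))) \<and>
        inj_on (\<alpha> 0) (carrier (U 0)) \<and>
        (\<forall>n. exact_at (U n) (\<alpha> n) (V n) (\<beta> n) (W n) \<and>
             exact_at (V n) (\<beta> n) (W n) (\<gamma> n) (U (Suc n)) \<and>
             exact_at (W n) (\<gamma> n) (U (Suc n)) (\<alpha> (Suc n)) (V (Suc n))))"

end

theory Submission
 imports Defs
begin

text \<open>
 Everything is compared with explicit Hochschild cochains, that is, multilinear functions on lists
 over \<open>E\<close>. They compute \<open>H\<^sup>*(E, X)\<close> (\<open>hochschild_iso\<close>).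

 Since \<open>1\<^sub>B E = 1\<^sub>B E 1\<^sub>B\<close>, the subset \<open>X1\<^sub>B\<close> is a subbimodule of \<open>X\<close>; the quotient \<open>X / X1\<^sub>B\<close> is
 \<open>X1\<^sub>A\<close> with \<open>E\<close> acting on the right through the projection \<open>E \<rightarrow> A\<close>. As a \<open>k\<close>-module \<open>X\<close> is the
 direct sum of \<open>X1\<^sub>A\<close> and \<open>X1\<^sub>B\<close>, so the
 cochains with values in \<open>X1\<^sub>B\<close>, \<open>X\<close> and \<open>X1\<^sub>A\<close> form a degreewise split short exact sequence of
 complexes, whose long exact sequence (\<open>les_cochains\<close>) is the one of the theorem once its outer
 terms are identified.

 The term of \<open>X1\<^sub>A\<close>. If \<open>E\<close> acts on the right of a bimodule \<open>Z\<close> through \<open>E \<rightarrow> A\<close>, restricting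
 cochains to \<open>A\<close> and multiplying the values by \<open>1\<^sub>A\<close> is a homotopy equivalence onto the cochains of
 \<open>A\<close> with values in \<open>1\<^sub>A Z\<close> (\<open>corner_iso\<close>); the homotopy inserts the letter \<open>1\<^sub>A\<close>. For \<open>Z = X1\<^sub>A\<close>
 this gives \<open>H\<^sup>*(A, X\<^sub>A\<^sub>A)\<close>.

 The term of \<open>X1\<^sub>B\<close>. More generally let \<open>\<pi> : A \<rightarrow> B\<close> be a homomorphism of algebras, \<open>L\<close> the module
 \<open>B\<close> with \<open>A\<close> acting through \<open>\<pi>\<close>, and \<open>Y\<close> an \<open>(A, B)\<close>-bimodule. Then \<open>Ext(L, Y)\<close> is the cohomology of
 \<open>A\<close> with values in \<open>Y\<close>, where \<open>A\<close> acts on the right through \<open>\<pi>\<close> (\<open>rel_Ext_iso\<close>). The standard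
 comparison of resolutions is carried out inside cochains. The \<open>k\<close>-linear contraction of \<open>P\<close> yields
 cochains \<open>uc n\<close> with values in \<open>P n\<close> such that \<open>d\<close> of the next one is the coboundary of the previous
 one, and a homomorphism \<open>g : P n \<rightarrow> Y\<close> is sent to the cochain \<open>g \<circ> uc n\<close>. In the opposite direction,
 relative projectivity splits \<open>R \<otimes> P n \<rightarrow> P n\<close>, so that maps out of \<open>P n\<close> can be averaged; averaging
 over the last letter contracts cochains on \<open>P n\<close>, and iterating this contraction moves a cocycle with
 values in \<open>Y\<close> step by step to a homomorphism \<open>P n \<rightarrow> Y\<close> (\<open>push\<close>). Leibniz' rule for cup products
 shows that this is a right inverse up to coboundaries (\<open>ev_surj\<close>); an endomorphism of \<open>P\<close> homotopic
 to the identity gives injectivity (\<open>ev_inj\<close>).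
\<close>

lemma (in abelian_group) a_inv_zero: "\<ominus> \<zero> = \<zero>" by simp

lemmas (in abelian_group) abelian_group_simprules
 [algebra abelian_group "zero G" "add G" "a_inv G" "a_minus G"] =
 a_closed zero_closed a_inv_closed minus_closed a_assoc l_zero l_neg a_comm minus_eq
 r_zero r_neg r_neg2 r_neg1 minus_add minus_minus a_inv_zero a_lcomm

lemma (in abelian_group) minus_zero_right: "x \<in> carrier G \<Longrightarrow> x \<ominus> \<zero> = x"
 by algebra

section \<open>Linear maps\<close>

lemma k_homI:
 assumes "\<And>x. x \<in> carrier M \<Longrightarrow> f x \<in> carrier N"
  and "\<And>x y. \<lbrakk>x \<in> carrier M; y \<in> carrier M\<rbrakk> \<Longrightarrow> f (x \<oplus>\<^bsub>M\<^esub> y) = f x \<oplus>\<^bsub>N\<^esub> f y"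
  and "\<And>c x. \<lbrakk>c \<in> carrier k; x \<in> carrier M\<rbrakk> \<Longrightarrow> f (c \<odot>\<^bsub>M\<^esub> x) = c \<odot>\<^bsub>N\<^esub> f x"
 shows "f \<in> k_hom k M N"
 using assms by (auto simp: k_hom_def)

lemma k_hom_closed: "\<lbrakk>f \<in> k_hom k M N; x \<in> carrier M\<rbrakk> \<Longrightarrow> f x \<in> carrier N"
 and k_hom_add: "\<lbrakk>f \<in> k_hom k M N; x \<in> carrier M; y \<in> carrier M\<rbrakk> \<Longrightarrow> f (x \<oplus>\<^bsub>M\<^esub> y) = f x \<oplus>\<^bsub>N\<^esub> f y"
 and k_hom_smult: "\<lbrakk>f \<in> k_hom k M N; c \<in> carrier k; x \<in> carrier M\<rbrakk> \<Longrightarrow> f (c \<odot>\<^bsub>M\<^esub> x) = c \<odot>\<^bsub>N\<^esub> f x"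
 by (auto simp: k_hom_def)

lemma k_hom_zero:
 assumes "module k M" "module k N" "f \<in> k_hom k M N"
 shows "f \<zero>\<^bsub>M\<^esub> = \<zero>\<^bsub>N\<^esub>"
proof -
 interpret M: module k M by fact
 interpret N: module k N by fact
 have "f \<zero>\<^bsub>M\<^esub> \<oplus>\<^bsub>N\<^esub> f \<zero>\<^bsub>M\<^esub> = f \<zero>\<^bsub>M\<^esub>"
  using k_hom_add[OF assms(3), of "\<zero>\<^bsub>M\<^esub>" "\<zero>\<^bsub>M\<^esub>"] by simp
 then show ?thesis using k_hom_closed[OF assms(3), of "\<zero>\<^bsub>M\<^esub>"]
  by (metis M.zero_closed N.add.r_cancel_one')
qed

lemma k_hom_a_inv:
 assumes "module k M" "module k N" "f \<in> k_hom k M N" "x \<in> carrier M"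
 shows "f (\<ominus>\<^bsub>M\<^esub> x) = \<ominus>\<^bsub>N\<^esub> f x"
proof -
 interpret M: module k M by fact
 interpret N: module k N by fact
 have "f (\<ominus>\<^bsub>M\<^esub> x) \<oplus>\<^bsub>N\<^esub> f x = \<zero>\<^bsub>N\<^esub>"
  using k_hom_add[OF assms(3), of "\<ominus>\<^bsub>M\<^esub> x" x] assms(4) k_hom_zero[OF assms(1-3)]
  by (simp add: M.M.l_neg)
 then show ?thesis using k_hom_closed[OF assms(3)] assms(4)
  by (metis M.add.inv_closed N.add.inv_equality)
qed

lemma k_hom_minus:
 assumes "module k M" "module k N" "f \<in> k_hom k M N" "x \<in> carrier M" "y \<in> carrier M"
 shows "f (x \<ominus>\<^bsub>M\<^esub> y) = f x \<ominus>\<^bsub>N\<^esub> f y"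
proof -
 interpret M: module k M by fact
 show ?thesis using assms by (simp add: a_minus_def k_hom_add k_hom_a_inv)
qed

lemma k_hom_compose:
 "\<lbrakk>f \<in> k_hom k L M; g \<in> k_hom k M N\<rbrakk> \<Longrightarrow> (\<lambda>x. g (f x)) \<in> k_hom k L N"
 by (auto simp: k_hom_def Pi_iff)

lemma k_hom_cong:
 assumes "f \<in> k_hom k M N" "module k M" "\<And>x. x \<in> carrier M \<Longrightarrow> g x = f x"
 shows "g \<in> k_hom k M N"
proof -
 interpret M: module k M by fact
 show ?thesis using assms by (auto simp: k_hom_def)
qed

lemma k_hom_id: "(\<lambda>x. x) \<in> k_hom k M M"
 by (auto simp: k_hom_def)

lemma k_hom_const_zero:
 assumes "module k N" shows "(\<lambda>x. \<zero>\<^bsub>N\<^esub>) \<in> k_hom k M N"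
proof -
 interpret N: module k N by fact
 show ?thesis by (auto simp: k_hom_def)
qed

lemma k_hom_plus:
 assumes "module k N" "f \<in> k_hom k M N" "g \<in> k_hom k M N"
 shows "(\<lambda>x. f x \<oplus>\<^bsub>N\<^esub> g x) \<in> k_hom k M N"
proof -
 interpret N: module k N by fact
 note h = k_hom_closed[OF assms(2)] k_hom_closed[OF assms(3)]
 show ?thesis using h
  by (intro k_homI) (simp_all add: k_hom_add[OF assms(2)] k_hom_add[OF assms(3)]
    k_hom_smult[OF assms(2)] k_hom_smult[OF assms(3)] N.smult_r_distr N.M.a_ac)
qed

lemma k_hom_uminus:
 assumes "module k N" "f \<in> k_hom k M N"
 shows "(\<lambda>x. \<ominus>\<^bsub>N\<^esub> f x) \<in> k_hom k M N"
proof -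
 interpret N: module k N by fact
 note h = k_hom_closed[OF assms(2)]
 show ?thesis using h
  by (intro k_homI) (simp_all add: k_hom_add[OF assms(2)]
    k_hom_smult[OF assms(2)] N.smult_r_minus N.M.minus_add)
qed

lemma k_hom_sub:
 assumes "module k N" "f \<in> k_hom k M N" "g \<in> k_hom k M N"
 shows "(\<lambda>x. f x \<ominus>\<^bsub>N\<^esub> g x) \<in> k_hom k M N"
 unfolding a_minus_def by (intro k_hom_plus k_hom_uminus assms)

lemma k_hom_scale:
 assumes "module k N" "f \<in> k_hom k M N" "c \<in> carrier k"
 shows "(\<lambda>x. c \<odot>\<^bsub>N\<^esub> f x) \<in> k_hom k M N"
proof -
 interpret N: module k N by fact
 note h = k_hom_closed[OF assms(2)]
 show ?thesis using h assms(3)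
  by (intro k_homI) (simp_all add: k_hom_add[OF assms(2)]
    k_hom_smult[OF assms(2)] N.smult_r_distr N.smult_assoc1[symmetric] N.R.m_comm)
qed

lemma k_hom_finsum:
 assumes "module k M" "module k N" "f \<in> k_hom k M N" "finite I" "g \<in> I \<rightarrow> carrier M"
 shows "f (finsum M g I) = finsum N (\<lambda>i. f (g i)) I"
 using assms(4,5)
proof (induct I)
 case empty
 interpret M: module k M by fact
 interpret N: module k N by fact
 show ?case using k_hom_zero[OF assms(1-3)] by simp
next
 case (insert i I)
 interpret M: module k M by fact
 interpret N: module k N by fact
 from insert have "g i \<in> carrier M" "g \<in> I \<rightarrow> carrier M" by auto
 then show ?case using insert k_hom_closed[OF assms(3)]
  by (subst M.finsum_insert, simp_all add: k_hom_add[OF assms(3)])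
    (subst N.finsum_insert, auto)
qed

section \<open>Quotient modules\<close>

locale submodule_pair = module k N + submodule H k N
 for k :: "'k ring" and N :: "('k, 'x) module" (structure) and H
begin

lemma abelian_subgroup: "abelian_subgroup H N"
 by (rule abelian_subgroupI3)
   (auto simp: additive_subgroup_def subgroup_axioms intro: M.abelian_group_axioms)

lemma H_sub: "H \<subseteq> carrier N" using subset by simp

lemma zero_in: "\<zero> \<in> H"
 using one_closed by simp

lemma coset_eq_iff:
 assumes "x \<in> carrier N" "y \<in> carrier N"
 shows "H +> x = H +> y \<longleftrightarrow> x \<ominus> y \<in> H"
proof -
 interpret H: abelian_subgroup H N by (rule abelian_subgroup)
 have "x \<ominus> y \<in> H \<longleftrightarrow> x \<in> H +> y"
  using H.a_rcos_module[OF assms(2,1)] by (simp add: a_minus_def)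
 also have "\<dots> \<longleftrightarrow> H +> x = H +> y"
  using assms H.a_repr_independence' H.a_rcos_self by auto
 finally show ?thesis by simp
qed

lemma coset_eq_H_iff: "x \<in> carrier N \<Longrightarrow> H +> x = H \<longleftrightarrow> x \<in> H"
 using coset_eq_iff[of x \<zero>] H_sub by (simp add: M.minus_zero_right)

lemma carrier_quot: "carrier (quot_module N H) = (\<lambda>x. H +> x) ` carrier N"
 by (auto simp: quot_module_def A_RCOSETS_defs a_r_coset_def r_coset_def)

lemma zero_quot: "\<zero>\<^bsub>quot_module N H\<^esub> = H +> \<zero>"
 using coset_eq_H_iff[of \<zero>] zero_in by (simp add: quot_module_def)

lemma add_quot: "\<lbrakk>x \<in> carrier N; y \<in> carrier N\<rbrakk> \<Longrightarrow>
  (H +> x) \<oplus>\<^bsub>quot_module N H\<^esub> (H +> y) = H +> (x \<oplus> y)"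
 using abelian_subgroup.a_rcos_sum[OF abelian_subgroup] by (simp add: quot_module_def)

lemma smult_quot:
 assumes "c \<in> carrier k" "x \<in> carrier N"
 shows "c \<odot>\<^bsub>quot_module N H\<^esub> (H +> x) = H +> (c \<odot> x)"
proof -
 interpret H: abelian_subgroup H N by (rule abelian_subgroup)
 have eq: "H +> (c \<odot> t) = H +> (c \<odot> x)" if t: "t \<in> H +> x" for t
 proof -
  have tc: "t \<in> carrier N" using t assms H.a_elemrcos_carrier by blast
  have "t \<ominus> x \<in> H" using t tc assms H.a_rcos_module[of x t] by (simp add: a_minus_def)
  then have "c \<odot> (t \<ominus> x) \<in> H" using assms by blast
  then have "c \<odot> t \<ominus> c \<odot> x \<in> H" using assms tc
   by (simp add: a_minus_def smult_r_distr smult_r_minus)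
  then show ?thesis using coset_eq_iff tc assms by simp
 qed
 have ne: "H +> x \<noteq> {}" using H.a_rcos_self assms by blast
 have "(\<Union>t\<in>H +> x. H +> (c \<odot> t)) = (\<Union>t\<in>H +> x. H +> (c \<odot> x))"
  by (rule SUP_cong) (simp_all add: eq)
 also have "\<dots> = H +> (c \<odot> x)" using ne by simp
 finally show ?thesis by (simp add: quot_module_def)
qed

end

lemma (in submodule_pair) module_quot: "module k (quot_module N H)"
proof (rule moduleI)
 show "cring k" by (rule R.is_cring)
 show "abelian_group (quot_module N H)"
 proof (rule abelian_groupI)
  fix S assume "S \<in> carrier (quot_module N H)"
  then obtain x where x: "x \<in> carrier N" "S = H +> x" by (auto simp: carrier_quot)
  show "\<exists>T\<in>carrier (quot_module N H). T \<oplus>\<^bsub>quot_module N H\<^esub> S = \<zero>\<^bsub>quot_module N H\<^esub>"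
   by (rule bexI[of _ "H +> (\<ominus> x)"]) (use x in \<open>auto simp: carrier_quot zero_quot add_quot M.l_neg\<close>)
 qed (auto simp: carrier_quot zero_quot add_quot M.a_ac)
qed (auto simp: carrier_quot zero_quot add_quot M.a_ac smult_quot smult_l_distr smult_r_distr smult_assoc1)

lemma (in submodule_pair) coset_k_hom: "(\<lambda>x. H +> x) \<in> k_hom k N (quot_module N H)"
 by (rule k_homI) (auto simp: carrier_quot add_quot smult_quot)

section \<open>Modules by generators and relations\<close>

text \<open>
 Free modules, modules of homomorphisms and modules of cochains all consist of functions and inherit
 the module laws pointwise. Negatives come from the scalar \<open>- 1\<close>.
\<close>

lemma module_pointwise:
 fixes K :: "('k, 'i \<Rightarrow> 'x) module"
 assumes N: "module k N"
  and add: "\<And>f g s. \<lbrakk>f \<in> carrier K; g \<in> carrier K; s \<in> I\<rbrakk> \<Longrightarrow> (f \<oplus>\<^bsub>K\<^esub> g) s = f s \<oplus>\<^bsub>N\<^esub> g s"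
  and smult: "\<And>c f s. \<lbrakk>c \<in> carrier k; f \<in> carrier K; s \<in> I\<rbrakk> \<Longrightarrow> (c \<odot>\<^bsub>K\<^esub> f) s = c \<odot>\<^bsub>N\<^esub> f s"
  and zero: "\<And>s. s \<in> I \<Longrightarrow> \<zero>\<^bsub>K\<^esub> s = \<zero>\<^bsub>N\<^esub>"
  and addc: "\<And>f g. \<lbrakk>f \<in> carrier K; g \<in> carrier K\<rbrakk> \<Longrightarrow> f \<oplus>\<^bsub>K\<^esub> g \<in> carrier K"
  and smc: "\<And>c f. \<lbrakk>c \<in> carrier k; f \<in> carrier K\<rbrakk> \<Longrightarrow> c \<odot>\<^bsub>K\<^esub> f \<in> carrier K"
  and zc: "\<zero>\<^bsub>K\<^esub> \<in> carrier K"
  and cl: "\<And>f s. \<lbrakk>f \<in> carrier K; s \<in> I\<rbrakk> \<Longrightarrow> f s \<in> carrier N"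
  and ext: "\<And>f g. \<lbrakk>f \<in> carrier K; g \<in> carrier K; \<And>s. s \<in> I \<Longrightarrow> f s = g s\<rbrakk> \<Longrightarrow> f = g"
 shows "module k K"
proof -
 interpret N: module k N by (rule N)
 note p = add smult zero addc smc zc cl
 have inv: "\<exists>g\<in>carrier K. g \<oplus>\<^bsub>K\<^esub> f = \<zero>\<^bsub>K\<^esub>" if f: "f \<in> carrier K" for f
 proof (intro bexI ext)
  show m: "(\<ominus>\<^bsub>k\<^esub> \<one>\<^bsub>k\<^esub>) \<odot>\<^bsub>K\<^esub> f \<in> carrier K" by (simp add: smc f)
  show "((\<ominus>\<^bsub>k\<^esub> \<one>\<^bsub>k\<^esub>) \<odot>\<^bsub>K\<^esub> f \<oplus>\<^bsub>K\<^esub> f) s = \<zero>\<^bsub>K\<^esub> s" if "s \<in> I" for s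
   using f that m by (simp add: p N.smult_l_minus N.M.l_neg)
 qed (simp_all add: p f)
 show ?thesis
 proof (intro moduleI N.R.is_cring)
  show "abelian_group K" by (intro abelian_groupI zc inv addc ext) (simp_all add: p N.M.a_ac)
 qed (auto intro!: ext simp: p N.M.a_ac N.smult_l_distr N.smult_r_distr N.smult_assoc1)
qed

definition scalars :: "'k ring \<Rightarrow> ('k, 'k) module" where
 "scalars k = \<lparr>carrier = carrier k, mult = mult k, one = one k, zero = zero k, add = add k, smult = mult k\<rparr>"

lemma module_scalars: "cring k \<Longrightarrow> module k (scalars k)"
proof -
 assume "cring k"
 then interpret cring k .
 have inv: "\<exists>y\<in>carrier k. y \<oplus>\<^bsub>k\<^esub> x = \<zero>\<^bsub>k\<^esub>" if "x \<in> carrier k" for x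
  by (rule bexI[of _ "\<ominus>\<^bsub>k\<^esub> x"]) (use that in \<open>simp_all add: l_neg\<close>)
 show ?thesis
  by (intro moduleI abelian_groupI is_cring; simp add: scalars_def inv a_ac m_assoc l_distr r_distr)
qed

lemma module_free_module:
 assumes "cring k" shows "module k (free_module k S)"
proof (rule module_pointwise[OF module_scalars[OF assms], where I = UNIV])
 interpret k: cring k by fact
 fix f assume f: "f \<in> carrier (free_module k S)"
 show "f \<oplus>\<^bsub>free_module k S\<^esub> g \<in> carrier (free_module k S)" if g: "g \<in> carrier (free_module k S)" for g
 proof -
  have "{s. f s \<oplus>\<^bsub>k\<^esub> g s \<noteq> \<zero>\<^bsub>k\<^esub>} \<subseteq> {s. f s \<noteq> \<zero>\<^bsub>k\<^esub>} \<union> {s. g s \<noteq> \<zero>\<^bsub>k\<^esub>}" by auto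
  then show ?thesis using f g by (auto simp: free_module_def image_subset_iff intro: finite_subset)
 qed
 show "c \<odot>\<^bsub>free_module k S\<^esub> f \<in> carrier (free_module k S)" if c: "c \<in> carrier k" for c
 proof -
  have "{s. c \<otimes>\<^bsub>k\<^esub> f s \<noteq> \<zero>\<^bsub>k\<^esub>} \<subseteq> {s. f s \<noteq> \<zero>\<^bsub>k\<^esub>}" using c by auto
  then show ?thesis using f c by (auto simp: free_module_def image_subset_iff intro: finite_subset)
 qed
qed (auto simp: free_module_def scalars_def cring.cring_simprules(2)[OF assms])

lemma free_moduleD:
 assumes "f \<in> carrier (free_module k S)"
 shows "f s \<in> carrier k" "finite {s. f s \<noteq> \<zero>\<^bsub>k\<^esub>}" "s \<notin> S \<Longrightarrow> f s = \<zero>\<^bsub>k\<^esub>" "{s. f s \<noteq> \<zero>\<^bsub>k\<^esub>} \<subseteq> S"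
 using assms by (auto simp: free_module_def)

lemma free_module_ops:
 "f \<oplus>\<^bsub>free_module k S\<^esub> g = (\<lambda>s. f s \<oplus>\<^bsub>k\<^esub> g s)"
 "c \<odot>\<^bsub>free_module k S\<^esub> f = (\<lambda>s. c \<otimes>\<^bsub>k\<^esub> f s)"
 "\<zero>\<^bsub>free_module k S\<^esub> = (\<lambda>s. \<zero>\<^bsub>k\<^esub>)"
 by (auto simp: free_module_def)

lemma basis_in_free: "\<lbrakk>cring k; s \<in> S\<rbrakk> \<Longrightarrow> basis k s \<in> carrier (free_module k S)"
proof -
 assume "cring k" "s \<in> S"
 then interpret k: cring k by simp
 have "{t. basis k s t \<noteq> \<zero>\<^bsub>k\<^esub>} \<subseteq> {s}" by (auto simp: basis_def)
 then show ?thesis using \<open>s \<in> S\<close> finite_subset[of _ "{s}"] by (auto simp: free_module_def basis_def)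
qed

text \<open>
 The value which \<open>lin_lift\<close> reads off from a representative.
\<close>

definition lin_ext ::
 "'k ring \<Rightarrow> ('k, 'x, 'z) module_scheme \<Rightarrow> ('i \<Rightarrow> 'x) \<Rightarrow> ('i \<Rightarrow> 'k) \<Rightarrow> 'x"
where
 "lin_ext k N \<phi> f = (\<Oplus>\<^bsub>N\<^esub> s\<in>{s. f s \<noteq> \<zero>\<^bsub>k\<^esub>}. f s \<odot>\<^bsub>N\<^esub> \<phi> s)"

context
 fixes k :: "'k ring" and N :: "('k, 'x, 'z) module_scheme" (structure) and S :: "'i set" and \<phi> :: "'i \<Rightarrow> 'x"
 assumes mod: "module k N" and phi: "\<And>s. s \<in> S \<Longrightarrow> \<phi> s \<in> carrier N"
begin

interpretation N: module k N by (rule mod)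

lemma lin_ext_superset:
 assumes "f \<in> carrier (free_module k S)" "finite A" "{s. f s \<noteq> \<zero>\<^bsub>k\<^esub>} \<subseteq> A" "A \<subseteq> S"
 shows "lin_ext k N \<phi> f = (\<Oplus> s\<in>A. f s \<odot> \<phi> s)"
 unfolding lin_ext_def
 by (rule N.add.finprod_mono_neutral_cong_left)
   (use assms free_moduleD[OF assms(1)] phi in auto)

lemma lin_ext_closed: "f \<in> carrier (free_module k S) \<Longrightarrow> lin_ext k N \<phi> f \<in> carrier N"
 unfolding lin_ext_def
 by (rule N.finsum_closed) (use free_moduleD[of f k S] phi in auto)

lemma lin_ext_k_hom: "lin_ext k N \<phi> \<in> k_hom k (free_module k S) N"
proof (rule k_homI)
 interpret F: module k "free_module k S" by (rule module_free_module) (rule N.R.is_cring)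
 fix f assume f: "f \<in> carrier (free_module k S)"
 then show "lin_ext k N \<phi> f \<in> carrier N" by (rule lin_ext_closed)
 note fD = free_moduleD[OF f]
 { fix g assume g: "g \<in> carrier (free_module k S)"
  note gD = free_moduleD[OF g]
  define A where "A = {s. f s \<noteq> \<zero>\<^bsub>k\<^esub>} \<union> {s. g s \<noteq> \<zero>\<^bsub>k\<^esub>}"
  have A: "finite A" "A \<subseteq> S" using fD gD by (auto simp: A_def)
  have sub: "{s. (f \<oplus>\<^bsub>free_module k S\<^esub> g) s \<noteq> \<zero>\<^bsub>k\<^esub>} \<subseteq> A"
   by (auto simp: A_def free_module_ops)
  have "lin_ext k N \<phi> (f \<oplus>\<^bsub>free_module k S\<^esub> g) =
    (\<Oplus> s\<in>A. (f \<oplus>\<^bsub>free_module k S\<^esub> g) s \<odot> \<phi> s)"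
   by (rule lin_ext_superset) (use f g A sub in auto)
  also have "\<dots> = (\<Oplus> s\<in>A. f s \<odot> \<phi> s \<oplus> g s \<odot> \<phi> s)"
   by (rule N.M.finsum_cong') (use A fD gD phi in \<open>auto simp: free_module_ops N.smult_l_distr\<close>)
  also have "\<dots> = (\<Oplus> s\<in>A. f s \<odot> \<phi> s) \<oplus> (\<Oplus> s\<in>A. g s \<odot> \<phi> s)"
   by (rule N.M.finsum_addf) (use A fD gD phi in auto)
  also have "\<dots> = lin_ext k N \<phi> f \<oplus> lin_ext k N \<phi> g"
   using lin_ext_superset[OF f A(1) _ A(2)] lin_ext_superset[OF g A(1) _ A(2)] by (simp add: A_def)
  finally show "lin_ext k N \<phi> (f \<oplus>\<^bsub>free_module k S\<^esub> g) = lin_ext k N \<phi> f \<oplus> lin_ext k N \<phi> g" . }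
 { fix c assume c: "c \<in> carrier k"
  have "lin_ext k N \<phi> (c \<odot>\<^bsub>free_module k S\<^esub> f) =
    (\<Oplus> s\<in>{s. f s \<noteq> \<zero>\<^bsub>k\<^esub>}. (c \<odot>\<^bsub>free_module k S\<^esub> f) s \<odot> \<phi> s)"
   by (rule lin_ext_superset) (use f fD c F.smult_closed[OF c f] in \<open>auto simp: free_module_ops\<close>)
  also have "\<dots> = (\<Oplus> s\<in>{s. f s \<noteq> \<zero>\<^bsub>k\<^esub>}. c \<odot> (f s \<odot> \<phi> s))"
   by (rule N.M.finsum_cong') (use fD phi c in \<open>auto simp: free_module_ops N.smult_assoc1\<close>)
  also have "\<dots> = c \<odot> lin_ext k N \<phi> f" unfolding lin_ext_def
   by (rule N.finsum_smult_ldistr[symmetric]) (use fD phi c in auto)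
  finally show "lin_ext k N \<phi> (c \<odot>\<^bsub>free_module k S\<^esub> f) = c \<odot> lin_ext k N \<phi> f" . }
qed

lemma lin_ext_basis:
 assumes "s \<in> S" shows "lin_ext k N \<phi> (basis k s) = \<phi> s"
proof -
 have "lin_ext k N \<phi> (basis k s) = (\<Oplus> t\<in>{s}. basis k s t \<odot> \<phi> t)"
  by (rule lin_ext_superset) (use assms basis_in_free[OF N.R.is_cring] in \<open>auto simp: basis_def\<close>)
 then show ?thesis using phi assms by (simp add: N.M.finsum_insert basis_def)
qed

end

lemma free_module_expand:
 assumes "cring k" "f \<in> carrier (free_module k S)"
 shows "lin_ext k (free_module k S) (basis k) f = f"
proof -
 interpret k: cring k by fact
 interpret F: module k "free_module k S" by (rule module_free_module) fact
 note fD = free_moduleD[OF assms(2)]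
 have ev: "finsum (free_module k S) g A t = finsum k (\<lambda>s. g s t) A"
  if "finite A" "g \<in> A \<rightarrow> carrier (free_module k S)" for g :: "_ \<Rightarrow> _" and A t
  using that
 proof (induct A)
  case (insert a A)
  have c: "g s t \<in> carrier k" if "s \<in> insert a A" for s t
   using insert(4) that by (auto intro!: free_moduleD(1)[of "g s" k S])
  have "finsum (free_module k S) g (insert a A) = g a \<oplus>\<^bsub>free_module k S\<^esub> finsum (free_module k S) g A"
   using insert by (intro F.M.finsum_insert) auto
  moreover have "finsum k (\<lambda>s. g s t) (insert a A) = g a t \<oplus>\<^bsub>k\<^esub> finsum k (\<lambda>s. g s t) A"
   using insert c by (intro k.finsum_insert) auto
  moreover have "finsum (free_module k S) g A t = finsum k (\<lambda>s. g s t) A"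
   using insert by auto
  ultimately show ?case by (simp add: free_module_ops)
 qed (simp add: free_module_ops)
 show ?thesis
 proof
  fix t
  have "lin_ext k (free_module k S) (basis k) f t =
    (\<Oplus>\<^bsub>k\<^esub> s\<in>{s. f s \<noteq> \<zero>\<^bsub>k\<^esub>}. f s \<otimes>\<^bsub>k\<^esub> basis k s t)"
   unfolding lin_ext_def
   by (subst ev) (use fD(2) in simp, use fD(1,4) in \<open>force intro!: F.smult_closed basis_in_free[OF assms(1)]\<close>, simp add: free_module_ops)
  also have "\<dots> = (\<Oplus>\<^bsub>k\<^esub> s\<in>{s. f s \<noteq> \<zero>\<^bsub>k\<^esub>}. if t = s then f s else \<zero>\<^bsub>k\<^esub>)"
   by (rule k.finsum_cong') (use fD in \<open>auto simp: basis_def\<close>)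
  also have "\<dots> = f t"
  proof (cases "f t = \<zero>\<^bsub>k\<^esub>")
   case True
   then have "(\<Oplus>\<^bsub>k\<^esub> s\<in>{s. f s \<noteq> \<zero>\<^bsub>k\<^esub>}. if t = s then f s else \<zero>\<^bsub>k\<^esub>) = (\<Oplus>\<^bsub>k\<^esub> s\<in>{s. f s \<noteq> \<zero>\<^bsub>k\<^esub>}. \<zero>\<^bsub>k\<^esub>)"
    by (intro k.finsum_cong') auto
   then show ?thesis using True by simp
  next
   case False
   then show ?thesis
    using k.add.finprod_singleton[of t "{s. f s \<noteq> \<zero>\<^bsub>k\<^esub>}" f] fD by auto
  qed
  finally show "lin_ext k (free_module k S) (basis k) f t = f t" .
 qed
qed

lemma k_hom_free_eq:
 assumes "module k N" "f \<in> k_hom k (free_module k S) N" "g \<in> k_hom k (free_module k S) N"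
  and "\<And>s. s \<in> S \<Longrightarrow> f (basis k s) = g (basis k s)" "x \<in> carrier (free_module k S)"
 shows "f x = g x"
proof -
 interpret N: module k N by fact
 have cr: "cring k" by (rule N.R.is_cring)
 have F: "module k (free_module k S)" by (rule module_free_module[OF cr])
 interpret F: module k "free_module k S" by (rule F)
 note xD = free_moduleD[OF assms(5)]
 have b: "basis k s \<in> carrier (free_module k S)" if "x s \<noteq> \<zero>\<^bsub>k\<^esub>" for s
  using xD(4) that by (auto intro!: basis_in_free[OF cr])
 have cl: "(\<lambda>s. x s \<odot>\<^bsub>free_module k S\<^esub> basis k s) \<in> {s. x s \<noteq> \<zero>\<^bsub>k\<^esub>} \<rightarrow> carrier (free_module k S)"
  using xD(1,4) by (auto simp: subset_eq intro!: F.smult_closed basis_in_free[OF cr])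
 have *: "h x = (\<Oplus>\<^bsub>N\<^esub> s\<in>{s. x s \<noteq> \<zero>\<^bsub>k\<^esub>}. x s \<odot>\<^bsub>N\<^esub> h (basis k s))"
  if h: "h \<in> k_hom k (free_module k S) N" for h
 proof -
  have "h x = h (lin_ext k (free_module k S) (basis k) x)"
   using free_module_expand[OF cr assms(5)] by simp
  also have "\<dots> = (\<Oplus>\<^bsub>N\<^esub> s\<in>{s. x s \<noteq> \<zero>\<^bsub>k\<^esub>}. h (x s \<odot>\<^bsub>free_module k S\<^esub> basis k s))"
   unfolding lin_ext_def by (rule k_hom_finsum[OF F assms(1) h xD(2) cl])
  also have "\<dots> = (\<Oplus>\<^bsub>N\<^esub> s\<in>{s. x s \<noteq> \<zero>\<^bsub>k\<^esub>}. x s \<odot>\<^bsub>N\<^esub> h (basis k s))"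
   by (rule N.M.finsum_cong')
    (use xD(1) b k_hom_closed[OF h] in \<open>auto simp: k_hom_smult[OF h]\<close>)
  finally show ?thesis .
 qed
 show ?thesis unfolding *[OF assms(2)] *[OF assms(3)]
  by (rule N.M.finsum_cong') (use xD(1,4) assms(4) b k_hom_closed[OF assms(3)] in \<open>auto simp: subset_eq\<close>)
qed

lemma generated_submodule:
 assumes "module k F" "Rel \<subseteq> carrier F"
 shows "submodule (generated_submodule k F Rel) k F" "Rel \<subseteq> generated_submodule k F Rel"
  and "\<And>H. submodule H k F \<Longrightarrow> Rel \<subseteq> H \<Longrightarrow> generated_submodule k F Rel \<subseteq> H"
proof -
 interpret F: module k F by fact
 note E = F.submoduleE
 show "submodule (generated_submodule k F Rel) k F"
 proof (rule F.submoduleI)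
  show "generated_submodule k F Rel \<subseteq> carrier F"
   using F.carrier_is_submodule assms(2) by (auto simp: generated_submodule_def)
  show "\<zero>\<^bsub>F\<^esub> \<in> generated_submodule k F Rel"
   using E(1,2,3,5) by (auto simp: generated_submodule_def)
    (metis (no_types, lifting) E(1) E(2) E(3) E(5) F.M.r_neg ex_in_conv subsetD)
 qed (auto simp: generated_submodule_def E)
qed (auto simp: generated_submodule_def)

lemma kernel_submodule:
 assumes "module k F" "module k N" "f \<in> k_hom k F N"
 shows "submodule {x \<in> carrier F. f x = \<zero>\<^bsub>N\<^esub>} k F"
proof -
 interpret F: module k F by fact
 interpret N: module k N by fact
 show ?thesis
  by (rule F.submoduleI)
    (auto simp: k_hom_zero[OF assms] k_hom_a_inv[OF assms] k_hom_add[OF assms(3)] k_hom_smult[OF assms(3)] N.M.a_inv_zero)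
qed

context
 fixes k :: "'k ring" and S :: "'i set" and Rel :: "('i \<Rightarrow> 'k) set"
 assumes cr: "cring k" and Rel: "Rel \<subseteq> carrier (free_module k S)"
begin

lemma presented_pair: "submodule_pair k (free_module k S) (generated_submodule k (free_module k S) Rel)"
 by (intro submodule_pair.intro module_free_module cr generated_submodule Rel)

lemma module_presented: "module k (presented k S Rel)"
 unfolding presented_def by (rule submodule_pair.module_quot[OF presented_pair])

lemma presented_gen_closed: "s \<in> S \<Longrightarrow> presented_gen k S Rel s \<in> carrier (presented k S Rel)"
 unfolding presented_def presented_gen_def submodule_pair.carrier_quot[OF presented_pair]
 by (intro imageI basis_in_free[OF cr])

lemma presented_gen_rel:
 assumes "x \<in> carrier (free_module k S)" "y \<in> carrier (free_module k S)" "x \<ominus>\<^bsub>free_module k S\<^esub> y \<in> Rel"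
 shows "generated_submodule k (free_module k S) Rel +>\<^bsub>free_module k S\<^esub> x
  = generated_submodule k (free_module k S) Rel +>\<^bsub>free_module k S\<^esub> y"
 using submodule_pair.coset_eq_iff[OF presented_pair assms(1,2)] assms(3)
  generated_submodule(2)[OF module_free_module[OF cr] Rel] by auto

lemma presented_hom_eq:
 assumes N: "module k N" and f: "f \<in> k_hom k (presented k S Rel) N" and g: "g \<in> k_hom k (presented k S Rel) N"
  and eq: "\<And>s. s \<in> S \<Longrightarrow> f (presented_gen k S Rel s) = g (presented_gen k S Rel s)"
  and t: "t \<in> carrier (presented k S Rel)"
 shows "f t = g t"
proof -
 let ?c = "\<lambda>x. generated_submodule k (free_module k S) Rel +>\<^bsub>free_module k S\<^esub> x"
 obtain x where x: "x \<in> carrier (free_module k S)" "t = ?c x"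
  using t by (auto simp: presented_def submodule_pair.carrier_quot[OF presented_pair])
 have c: "?c \<in> k_hom k (free_module k S) (presented k S Rel)"
  unfolding presented_def by (rule submodule_pair.coset_k_hom[OF presented_pair])
 have "(\<lambda>x. f (?c x)) x = (\<lambda>x. g (?c x)) x"
  by (rule k_hom_free_eq[OF N k_hom_compose[OF c f] k_hom_compose[OF c g] _ x(1)])
    (use eq in \<open>simp add: presented_gen_def\<close>)
 then show ?thesis using x by simp
qed

context
 fixes N :: "('k, 'x, 'z) module_scheme" and \<phi> :: "'i \<Rightarrow> 'x"
 assumes N: "module k N" and phi: "\<And>s. s \<in> S \<Longrightarrow> \<phi> s \<in> carrier N"
  and rels: "\<And>x. x \<in> Rel \<Longrightarrow> lin_ext k N \<phi> x = \<zero>\<^bsub>N\<^esub>"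
begin

text \<open>
 If \<open>\<phi>\<close> kills the relations, then \<open>lin_ext\<close> is constant on cosets, and the definite description in
 \<open>lin_lift\<close> picks out this constant value. This is the universal property of generators and relations.
\<close>

lemma lin_lift_coset:
 assumes f: "f \<in> carrier (free_module k S)"
 shows "lin_lift k N \<phi> (generated_submodule k (free_module k S) Rel +>\<^bsub>free_module k S\<^esub> f) = lin_ext k N \<phi> f"
proof -
 let ?G = "generated_submodule k (free_module k S) Rel"
 let ?F = "free_module k S"
 interpret N: module k N by (rule N)
 interpret P: submodule_pair k ?F ?G by (rule presented_pair)
 note L = lin_ext_k_hom[of k N S \<phi>, OF N phi]
 have ker: "?G \<subseteq> {x \<in> carrier ?F. lin_ext k N \<phi> x = \<zero>\<^bsub>N\<^esub>}"
  using rels Rel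
  by (intro generated_submodule(3)[OF P.module_axioms Rel] kernel_submodule[OF P.module_axioms N L]) auto
 have all: "lin_ext k N \<phi> g = lin_ext k N \<phi> f" if "g \<in> ?G +>\<^bsub>?F\<^esub> f" for g
 proof -
  from that obtain h where "h \<in> ?G" "g = h \<oplus>\<^bsub>?F\<^esub> f"
   by (auto simp: a_r_coset_def r_coset_def)
  then show ?thesis using ker k_hom_add[OF L] k_hom_closed[OF L] f by auto
 qed
 have mem: "f \<in> ?G +>\<^bsub>?F\<^esub> f"
  by (rule abelian_subgroup.a_rcos_self[OF P.abelian_subgroup f])
 show ?thesis unfolding lin_lift_def lin_ext_def[symmetric]
 proof (rule the_equality)
  show "\<forall>g\<in>?G +>\<^bsub>?F\<^esub> f. lin_ext k N \<phi> f = lin_ext k N \<phi> g"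
   by (intro ballI all[symmetric])
  show "y = lin_ext k N \<phi> f" if "\<forall>g\<in>?G +>\<^bsub>?F\<^esub> f. y = lin_ext k N \<phi> g" for y
   using that mem by (rule bspec)
 qed
qed

lemma lin_lift_gen: "s \<in> S \<Longrightarrow> lin_lift k N \<phi> (presented_gen k S Rel s) = \<phi> s"
 unfolding presented_gen_def
 by (subst lin_lift_coset) (use basis_in_free[OF cr] lin_ext_basis[of k N S \<phi>, OF N phi] in auto)

lemma lin_lift_k_hom: "lin_lift k N \<phi> \<in> k_hom k (presented k S Rel) N"
proof -
 interpret P: submodule_pair k "free_module k S" "generated_submodule k (free_module k S) Rel"
  by (rule presented_pair)
 note L = lin_ext_k_hom[of k N S \<phi>, OF N phi]
 show ?thesis
  by (rule k_homI)
    (auto simp: presented_def P.carrier_quot P.add_quot P.smult_quot lin_lift_coset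
     k_hom_add[OF L] k_hom_smult[OF L] k_hom_closed[OF L])
qed

end

end

lemma lin_lift_cong:
 assumes "cring k" "Rel \<subseteq> carrier (free_module k S)" "module k N"
  "\<And>s. s \<in> S \<Longrightarrow> \<phi> s = \<psi> s" "\<And>s. s \<in> S \<Longrightarrow> \<phi> s \<in> carrier N"
  "t \<in> carrier (presented k S Rel)"
 shows "lin_lift k N \<phi> t = lin_lift k N \<psi> t"
proof -
 interpret N: module k N by fact
 interpret P: submodule_pair k "free_module k S" "generated_submodule k (free_module k S) Rel"
  by (rule presented_pair) fact+
 have sub: "t \<subseteq> carrier (free_module k S)"
  using assms(6) P.H_sub by (auto simp: presented_def P.carrier_quot a_r_coset_def r_coset_def)
 have "(\<Oplus>\<^bsub>N\<^esub> s\<in>{s. f s \<noteq> \<zero>\<^bsub>k\<^esub>}. f s \<odot>\<^bsub>N\<^esub> \<phi> s) = (\<Oplus>\<^bsub>N\<^esub> s\<in>{s. f s \<noteq> \<zero>\<^bsub>k\<^esub>}. f s \<odot>\<^bsub>N\<^esub> \<psi> s)"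
  if "f \<in> t" for f
 proof -
  have f: "f \<in> carrier (free_module k S)" using that sub by blast
  show ?thesis
   by (rule N.M.finsum_cong') (use free_moduleD[OF f] assms(4,5) in \<open>auto simp: subset_eq\<close>)
 qed
 then show ?thesis unfolding lin_lift_def by (metis (no_types, lifting))
qed

section \<open>Tensor products\<close>

lemma module_transfer:
 assumes "module k N" "carrier N' = carrier N" "zero N' = zero N" "add N' = add N" "smult N' = smult N"
 shows "module k N'"
proof -
 interpret N: module k N by fact
 show ?thesis
 proof (rule moduleI)
  show "abelian_group N'"
  proof (rule abelian_groupI)
   fix x assume "x \<in> carrier N'"
   then show "\<exists>y\<in>carrier N'. y \<oplus>\<^bsub>N'\<^esub> x = \<zero>\<^bsub>N'\<^esub>"
    using assms N.M.l_neg N.M.a_inv_closed by auto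
  qed (simp_all add: assms N.M.a_ac)
 qed (simp_all add: assms N.R.is_cring N.smult_l_distr N.smult_r_distr N.smult_assoc1)
qed

lemma a_inv_transfer:
 assumes "carrier N' = carrier N" "zero N' = zero N" "add N' = add N"
 shows "a_inv N' = a_inv N"
 using assms by (simp add: a_inv_def m_inv_def fun_eq_iff)

lemma a_minus_transfer:
 assumes "carrier N' = carrier N" "zero N' = zero N" "add N' = add N"
 shows "x \<ominus>\<^bsub>N'\<^esub> y = x \<ominus>\<^bsub>N\<^esub> y"
 using a_inv_transfer[OF assms] assms(3) by (simp add: a_minus_def)

definition bilinear where
 "bilinear k M N L \<phi> \<longleftrightarrow> (\<forall>m\<in>carrier M. (\<lambda>n. \<phi> m n) \<in> k_hom k N L) \<and> (\<forall>n\<in>carrier N. (\<lambda>m. \<phi> m n) \<in> k_hom k M L)"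

lemma bilinearI:
 assumes "\<And>m. m \<in> carrier M \<Longrightarrow> (\<lambda>n. \<phi> m n) \<in> k_hom k N L"
  "\<And>n. n \<in> carrier N \<Longrightarrow> (\<lambda>m. \<phi> m n) \<in> k_hom k M L"
 shows "bilinear k M N L \<phi>"
 using assms by (auto simp: bilinear_def)

context
 fixes k :: "'k ring" and M :: "('k, 'm) module" and N :: "('k, 'n) module"
 assumes M: "module k M" and N: "module k N"
begin

interpretation M: module k M by (rule M)
interpretation N: module k N by (rule N)
interpretation F: module k "free_module k (carrier M \<times> carrier N)"
 by (rule module_free_module) (rule M.R.is_cring)

lemma basis_pair: "\<lbrakk>m \<in> carrier M; n \<in> carrier N\<rbrakk> \<Longrightarrow> basis k (m, n) \<in> carrier (free_module k (carrier M \<times> carrier N))"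
 by (rule basis_in_free) (auto simp: M.R.is_cring)

lemma tensor_rels_sub: "tensor_rels k M N \<subseteq> carrier (free_module k (carrier M \<times> carrier N))"
 unfolding tensor_rels_def Let_def by (auto simp: basis_pair)

lemma module_tensor: "module k (tensor k M N)"
 unfolding tensor_def by (rule module_presented[OF M.R.is_cring tensor_rels_sub])

lemma pure_tensor_closed: "\<lbrakk>m \<in> carrier M; n \<in> carrier N\<rbrakk> \<Longrightarrow> pure_tensor k M N m n \<in> carrier (tensor k M N)"
 unfolding tensor_def pure_tensor_def by (rule presented_gen_closed[OF M.R.is_cring tensor_rels_sub]) simp

lemma pure_tensor_bilinear: "bilinear k M N (tensor k M N) (pure_tensor k M N)"
proof -
 let ?F = "free_module k (carrier M \<times> carrier N)"
 let ?c = "\<lambda>x. generated_submodule k ?F (tensor_rels k M N) +>\<^bsub>?F\<^esub> x"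
 have c: "?c \<in> k_hom k ?F (tensor k M N)"
  unfolding tensor_def presented_def
  by (rule submodule_pair.coset_k_hom[OF presented_pair[OF M.R.is_cring tensor_rels_sub]])
 note rel = presented_gen_rel[OF M.R.is_cring tensor_rels_sub]
 note pd = pure_tensor_def presented_gen_def
 show ?thesis
 proof (intro bilinearI k_homI)
  fix m n assume m: "m \<in> carrier M" and n: "n \<in> carrier N"
  then show "pure_tensor k M N m n \<in> carrier (tensor k M N)" by (rule pure_tensor_closed)
  then show "pure_tensor k M N m n \<in> carrier (tensor k M N)" .
  { fix n' assume n': "n' \<in> carrier N"
   have "?c (basis k (m, n \<oplus>\<^bsub>N\<^esub> n')) = ?c (basis k (m, n) \<oplus>\<^bsub>?F\<^esub> basis k (m, n'))"
    by (rule rel) (use m n n' in \<open>auto simp: basis_pair tensor_rels_def Let_def\<close>)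
   then show "pure_tensor k M N m (n \<oplus>\<^bsub>N\<^esub> n') = pure_tensor k M N m n \<oplus>\<^bsub>tensor k M N\<^esub> pure_tensor k M N m n'"
    using m n n' by (simp add: pd k_hom_add[OF c] basis_pair) }
  { fix m' assume m': "m' \<in> carrier M"
   have "?c (basis k (m \<oplus>\<^bsub>M\<^esub> m', n)) = ?c (basis k (m, n) \<oplus>\<^bsub>?F\<^esub> basis k (m', n))"
    by (rule rel) (use m n m' in \<open>auto simp: basis_pair tensor_rels_def Let_def\<close>)
   then show "pure_tensor k M N (m \<oplus>\<^bsub>M\<^esub> m') n = pure_tensor k M N m n \<oplus>\<^bsub>tensor k M N\<^esub> pure_tensor k M N m' n"
    using m n m' by (simp add: pd k_hom_add[OF c] basis_pair) }
  { fix r assume r: "r \<in> carrier k"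
   have "?c (basis k (m, r \<odot>\<^bsub>N\<^esub> n)) = ?c (r \<odot>\<^bsub>?F\<^esub> basis k (m, n))"
    by (rule rel) (use m n r in \<open>auto simp: basis_pair tensor_rels_def Let_def\<close>)
   then show "pure_tensor k M N m (r \<odot>\<^bsub>N\<^esub> n) = r \<odot>\<^bsub>tensor k M N\<^esub> pure_tensor k M N m n"
    using m n r by (simp add: pd k_hom_smult[OF c] basis_pair)
   have "?c (basis k (r \<odot>\<^bsub>M\<^esub> m, n)) = ?c (r \<odot>\<^bsub>?F\<^esub> basis k (m, n))"
    by (rule rel) (use m n r in \<open>auto simp: basis_pair tensor_rels_def Let_def\<close>)
   then show "pure_tensor k M N (r \<odot>\<^bsub>M\<^esub> m) n = r \<odot>\<^bsub>tensor k M N\<^esub> pure_tensor k M N m n"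
    using m n r by (simp add: pd k_hom_smult[OF c] basis_pair) }
 qed
qed

lemma tensor_hom_eq:
 assumes "module k L" "f \<in> k_hom k (tensor k M N) L" "g \<in> k_hom k (tensor k M N) L"
  "\<And>m n. \<lbrakk>m \<in> carrier M; n \<in> carrier N\<rbrakk> \<Longrightarrow> f (pure_tensor k M N m n) = g (pure_tensor k M N m n)"
  "t \<in> carrier (tensor k M N)"
 shows "f t = g t"
 by (rule presented_hom_eq[OF M.R.is_cring tensor_rels_sub assms(1) assms(2,3)[unfolded tensor_def] _ assms(5)[unfolded tensor_def]])
   (use assms(4) in \<open>auto simp: pure_tensor_def\<close>)

context
 fixes L :: "('k, 'x, 'z) module_scheme" and \<phi>
 assumes L: "module k L" and phi: "bilinear k M N L \<phi>"
begin

interpretation L: module k L by (rule L)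

lemma bilinear_rels: "x \<in> tensor_rels k M N \<Longrightarrow> lin_ext k L (\<lambda>(m, n). \<phi> m n) x = \<zero>\<^bsub>L\<^esub>"
proof -
 have p1: "(\<lambda>n. \<phi> m n) \<in> k_hom k N L" if "m \<in> carrier M" for m using phi that by (auto simp: bilinear_def)
 have p2: "(\<lambda>m. \<phi> m n) \<in> k_hom k M L" if "n \<in> carrier N" for n using phi that by (auto simp: bilinear_def)
 have cl: "\<phi> m n \<in> carrier L" if "m \<in> carrier M" "n \<in> carrier N" for m n
  using k_hom_closed[OF p1] that by blast
 have E: "lin_ext k L (\<lambda>(m, n). \<phi> m n) \<in> k_hom k (free_module k (carrier M \<times> carrier N)) L"
  by (rule lin_ext_k_hom[OF L]) (use cl in auto)
 have B: "lin_ext k L (\<lambda>(m, n). \<phi> m n) (basis k (m, n)) = \<phi> m n" if "m \<in> carrier M" "n \<in> carrier N" for m n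
  using lin_ext_basis[OF L, of "carrier M \<times> carrier N" "\<lambda>(m, n). \<phi> m n" "(m, n)"] cl that by auto
 note mi = k_hom_minus[OF F.module_axioms L E] k_hom_add[OF E] k_hom_smult[OF E]
 have z: "\<And>a. a \<in> carrier L \<Longrightarrow> a \<ominus>\<^bsub>L\<^esub> a = \<zero>\<^bsub>L\<^esub>" by (simp add: a_minus_def L.M.r_neg)
 show "x \<in> tensor_rels k M N \<Longrightarrow> ?thesis"
  unfolding tensor_rels_def Let_def
  by (auto simp: mi basis_pair B cl z k_hom_add[OF p1] k_hom_add[OF p2] k_hom_smult[OF p1] k_hom_smult[OF p2])
qed

lemma tensor_lift_k_hom: "lin_lift k L (\<lambda>(m, n). \<phi> m n) \<in> k_hom k (tensor k M N) L"
 unfolding tensor_def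
 by (rule lin_lift_k_hom[OF M.R.is_cring tensor_rels_sub L _ bilinear_rels])
   (use phi in \<open>auto simp: bilinear_def k_hom_def\<close>)

lemma tensor_lift_pure:
 assumes "m \<in> carrier M" "n \<in> carrier N"
 shows "lin_lift k L (\<lambda>(m, n). \<phi> m n) (pure_tensor k M N m n) = \<phi> m n"
 unfolding pure_tensor_def
 by (subst lin_lift_gen[OF M.R.is_cring tensor_rels_sub L _ bilinear_rels])
   (use phi assms in \<open>auto simp: bilinear_def k_hom_def\<close>)

end

lemma tensor_lift_param:
 assumes L: "module k L" and V: "module k V" and phi: "\<And>v. v \<in> carrier V \<Longrightarrow> bilinear k M N L (\<phi> v)"
  and lin: "\<And>m n. \<lbrakk>m \<in> carrier M; n \<in> carrier N\<rbrakk> \<Longrightarrow> (\<lambda>v. \<phi> v m n) \<in> k_hom k V L"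
  and t: "t \<in> carrier (tensor k M N)"
 shows "(\<lambda>v. lin_lift k L (\<lambda>(m, n). \<phi> v m n) t) \<in> k_hom k V L"
proof (rule k_homI)
 interpret V: module k V by fact
 interpret L: module k L by fact
 note H = tensor_lift_k_hom[OF L phi] and G = tensor_lift_pure[OF L phi]
 fix v assume v: "v \<in> carrier V"
 show "lin_lift k L (\<lambda>(m, n). \<phi> v m n) t \<in> carrier L" by (rule k_hom_closed[OF H[OF v] t])
 { fix w assume w: "w \<in> carrier V"
  show "lin_lift k L (\<lambda>(m, n). \<phi> (v \<oplus>\<^bsub>V\<^esub> w) m n) t =
    lin_lift k L (\<lambda>(m, n). \<phi> v m n) t \<oplus>\<^bsub>L\<^esub> lin_lift k L (\<lambda>(m, n). \<phi> w m n) t"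
   by (rule tensor_hom_eq[OF L H k_hom_plus[OF L H H] _ t])
     (use v w in \<open>auto simp: G k_hom_add[OF lin]\<close>) }
 { fix c assume c: "c \<in> carrier k"
  show "lin_lift k L (\<lambda>(m, n). \<phi> (c \<odot>\<^bsub>V\<^esub> v) m n) t = c \<odot>\<^bsub>L\<^esub> lin_lift k L (\<lambda>(m, n). \<phi> v m n) t"
   by (rule tensor_hom_eq[OF L H k_hom_scale[OF L H] _ t])
     (use v c in \<open>auto simp: G k_hom_smult[OF lin]\<close>) }
qed

end

section \<open>Multilinear functions of lists and tensor powers\<close>

text \<open>
 A slot of a list is written as the middle of \<open>l1 @ x # l2\<close> instead of \<open>l[i := x]\<close>, since cochains are
 defined by recursion over lists; one function covers the tensor powers of all degrees.
\<close>

definition multilinear where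
 "multilinear k C N f \<longleftrightarrow> (\<forall>l\<in>lists (carrier C). f l \<in> carrier N) \<and>
   (\<forall>l1\<in>lists (carrier C). \<forall>l2\<in>lists (carrier C). (\<lambda>x. f (l1 @ x # l2)) \<in> k_hom k C N)"

lemma multilinearI:
 assumes "\<And>l. l \<in> lists (carrier C) \<Longrightarrow> f l \<in> carrier N"
  "\<And>l1 l2. \<lbrakk>l1 \<in> lists (carrier C); l2 \<in> lists (carrier C)\<rbrakk> \<Longrightarrow> (\<lambda>x. f (l1 @ x # l2)) \<in> k_hom k C N"
 shows "multilinear k C N f"
 using assms unfolding multilinear_def by blast

lemma multilinear_closed: "\<lbrakk>multilinear k C N f; l \<in> lists (carrier C)\<rbrakk> \<Longrightarrow> f l \<in> carrier N"
 unfolding multilinear_def by blast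

lemma multilinear_slot:
 "\<lbrakk>multilinear k C N f; l1 \<in> lists (carrier C); l2 \<in> lists (carrier C)\<rbrakk> \<Longrightarrow> (\<lambda>x. f (l1 @ x # l2)) \<in> k_hom k C N"
 unfolding multilinear_def by blast

lemma multilinear_hd:
 "\<lbrakk>multilinear k C N f; l \<in> lists (carrier C)\<rbrakk> \<Longrightarrow> (\<lambda>x. f (x # l)) \<in> k_hom k C N"
 using multilinear_slot[of k C N f "[]" l] by simp

lemma multilinear_Cons:
 assumes "multilinear k C N f" "x \<in> carrier C"
 shows "multilinear k C N (\<lambda>l. f (x # l))"
proof (rule multilinearI)
 show "f (x # l) \<in> carrier N" if "l \<in> lists (carrier C)" for l
  using multilinear_closed[OF assms(1)] that assms(2) by simp
 show "(\<lambda>y. f (x # l1 @ y # l2)) \<in> k_hom k C N" if "l1 \<in> lists (carrier C)" "l2 \<in> lists (carrier C)" for l1 l2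
  using multilinear_slot[OF assms(1), of "x # l1" l2] that assms(2) by simp
qed

lemma power_gens_lists: "l \<in> power_gens C n \<longleftrightarrow> l \<in> lists (carrier C) \<and> length l = n"
 by (auto simp: power_gens_def)

lemma power_gens_update:
 assumes "l \<in> power_gens C n" "i < n"
 obtains l1 l2 where "l1 \<in> lists (carrier C)" "l2 \<in> lists (carrier C)" "length l1 + length l2 + 1 = n"
  "\<And>x. l[i := x] = l1 @ x # l2" "length l1 = i"
proof
 show "l[i := x] = take i l @ x # drop (Suc i) l" for x
  using assms by (intro upd_conv_take_nth_drop) (simp add: power_gens_def)
 show "take i l \<in> lists (carrier C)" "drop (Suc i) l \<in> lists (carrier C)"
  using assms set_take_subset[of i l] set_drop_subset[of "Suc i" l] by (auto simp: power_gens_def subset_eq)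
 show "length (take i l) + length (drop (Suc i) l) + 1 = n" "length (take i l) = i"
  using assms by (auto simp: power_gens_def)
qed

definition pure_in where
 "pure_in k C n l = (if length l = n then pure_list k C l else \<zero>\<^bsub>tensor_power k C n\<^esub>)"

context
 fixes k :: "'k ring" and C :: "('k, 'c) module"
 assumes C: "module k C"
begin

interpretation C: module k C by (rule C)

lemma power_rels_sub: "power_rels k C n \<subseteq> carrier (free_module k (power_gens C n))"
proof -
 interpret F: module k "free_module k (power_gens C n)"
  by (rule module_free_module) (rule C.R.is_cring)
 have b: "basis k l \<in> carrier (free_module k (power_gens C n))" if "l \<in> power_gens C n" for l
  using basis_in_free[OF C.R.is_cring that] .
 have u: "l[i := x] \<in> power_gens C n" if "l \<in> power_gens C n" "x \<in> carrier C" for l i x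
  using that set_update_subset_insert[of l i x] by (auto simp: power_gens_def)
 show ?thesis unfolding power_rels_def Let_def by (auto intro!: F.M.minus_closed b u)
qed

lemma module_tensor_power: "module k (tensor_power k C n)"
 unfolding tensor_power_def by (rule module_presented[OF C.R.is_cring power_rels_sub])

lemma pure_list_closed: "l \<in> power_gens C n \<Longrightarrow> pure_list k C l \<in> carrier (tensor_power k C n)"
 using presented_gen_closed[OF C.R.is_cring power_rels_sub, of l n]
 by (auto simp: tensor_power_def pure_list_def power_gens_def)

lemma pure_in_multilinear: "multilinear k C (tensor_power k C n) (pure_in k C n)"
proof (rule multilinearI)
 interpret T: module k "tensor_power k C n" by (rule module_tensor_power)
 show "pure_in k C n l \<in> carrier (tensor_power k C n)" if "l \<in> lists (carrier C)" for l
  using that pure_list_closed[of l n] by (auto simp: pure_in_def power_gens_lists)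
 fix l1 l2 assume l: "l1 \<in> lists (carrier C)" "l2 \<in> lists (carrier C)"
 let ?F = "free_module k (power_gens C n)"
 let ?c = "\<lambda>x. generated_submodule k ?F (power_rels k C n) +>\<^bsub>?F\<^esub> x"
 have c: "?c \<in> k_hom k ?F (tensor_power k C n)"
  unfolding tensor_power_def presented_def
  by (rule submodule_pair.coset_k_hom[OF presented_pair[OF C.R.is_cring power_rels_sub]])
 note rel = presented_gen_rel[OF C.R.is_cring power_rels_sub]
 interpret F: module k ?F by (rule module_free_module) (rule C.R.is_cring)
 show "(\<lambda>x. pure_in k C n (l1 @ x # l2)) \<in> k_hom k C (tensor_power k C n)"
 proof (cases "length l1 + length l2 + 1 = n")
  case False
  then have "(\<lambda>x. pure_in k C n (l1 @ x # l2)) = (\<lambda>x. \<zero>\<^bsub>tensor_power k C n\<^esub>)"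
   by (auto simp: pure_in_def)
  then show ?thesis using k_hom_const_zero[OF module_tensor_power] by simp
 next
  case True
  have g: "l1 @ x # l2 \<in> power_gens C n" if "x \<in> carrier C" for x
   using that l True by (auto simp: power_gens_lists)
  have b: "basis k (l1 @ x # l2) \<in> carrier ?F" if "x \<in> carrier C" for x
   using basis_in_free[OF C.R.is_cring g[OF that]] .
  have P: "pure_in k C n (l1 @ x # l2) = ?c (basis k (l1 @ x # l2))" for x
   using True by (auto simp: pure_in_def pure_list_def presented_gen_def)
  have upd: "(l1 @ \<zero>\<^bsub>C\<^esub> # l2)[length l1 := x] = l1 @ x # l2" for x by simp
  have r1: "basis k (l1 @ (x \<oplus>\<^bsub>C\<^esub> y) # l2) \<ominus>\<^bsub>?F\<^esub> (basis k (l1 @ x # l2) \<oplus>\<^bsub>?F\<^esub> basis k (l1 @ y # l2)) \<in> power_rels k C n"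
   if "x \<in> carrier C" "y \<in> carrier C" for x y
   unfolding power_rels_def Let_def
   apply (rule UnI1)
   apply (rule CollectI)
   apply (rule exI[of _ "l1 @ \<zero>\<^bsub>C\<^esub> # l2"], rule exI[of _ "length l1"], rule exI[of _ x], rule exI[of _ y])
   using that True g[of "\<zero>\<^bsub>C\<^esub>"] by simp
  have r2: "basis k (l1 @ (r \<odot>\<^bsub>C\<^esub> x) # l2) \<ominus>\<^bsub>?F\<^esub> (r \<odot>\<^bsub>?F\<^esub> basis k (l1 @ x # l2)) \<in> power_rels k C n"
   if "x \<in> carrier C" "r \<in> carrier k" for x r
   unfolding power_rels_def Let_def
   apply (rule UnI2)
   apply (rule CollectI)
   apply (rule exI[of _ r], rule exI[of _ "l1 @ \<zero>\<^bsub>C\<^esub> # l2"], rule exI[of _ "length l1"], rule exI[of _ x])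
   using that True g[of "\<zero>\<^bsub>C\<^esub>"] by simp
  show ?thesis
  proof (rule k_homI)
   fix x assume x: "x \<in> carrier C"
   show "pure_in k C n (l1 @ x # l2) \<in> carrier (tensor_power k C n)"
    unfolding P by (rule k_hom_closed[OF c b[OF x]])
   { fix y assume y: "y \<in> carrier C"
    have "?c (basis k (l1 @ (x \<oplus>\<^bsub>C\<^esub> y) # l2)) = ?c (basis k (l1 @ x # l2) \<oplus>\<^bsub>?F\<^esub> basis k (l1 @ y # l2))"
     by (rule rel) (use x y r1 b in auto)
    then show "pure_in k C n (l1 @ (x \<oplus>\<^bsub>C\<^esub> y) # l2) =
      pure_in k C n (l1 @ x # l2) \<oplus>\<^bsub>tensor_power k C n\<^esub> pure_in k C n (l1 @ y # l2)"
     unfolding P using k_hom_add[OF c b[OF x] b[OF y]] by simp }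
   { fix r assume r: "r \<in> carrier k"
    have "?c (basis k (l1 @ (r \<odot>\<^bsub>C\<^esub> x) # l2)) = ?c (r \<odot>\<^bsub>?F\<^esub> basis k (l1 @ x # l2))"
     by (rule rel) (use x r r2 b in auto)
    then show "pure_in k C n (l1 @ (r \<odot>\<^bsub>C\<^esub> x) # l2) = r \<odot>\<^bsub>tensor_power k C n\<^esub> pure_in k C n (l1 @ x # l2)"
     unfolding P using k_hom_smult[OF c r b[OF x]] by simp }
  qed
 qed
qed

lemma tensor_power_hom_eq:
 assumes "module k L" "f \<in> k_hom k (tensor_power k C n) L" "g \<in> k_hom k (tensor_power k C n) L"
  "\<And>l. l \<in> power_gens C n \<Longrightarrow> f (pure_list k C l) = g (pure_list k C l)"
  "t \<in> carrier (tensor_power k C n)"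
 shows "f t = g t"
 by (rule presented_hom_eq[OF C.R.is_cring power_rels_sub assms(1) assms(2,3)[unfolded tensor_power_def] _ assms(5)[unfolded tensor_power_def]])
   (use assms(4) in \<open>auto simp: pure_list_def power_gens_def\<close>)

context
 fixes L :: "('k, 'x, 'z) module_scheme" and \<phi>
 assumes L: "module k L" and phi: "multilinear k C L \<phi>"
begin

interpretation L: module k L by (rule L)

lemma multilinear_rels:
 assumes "x \<in> power_rels k C n"
 shows "lin_ext k L \<phi> x = \<zero>\<^bsub>L\<^esub>"
proof -
 let ?F = "free_module k (power_gens C n)"
 interpret F: module k ?F by (rule module_free_module) (rule C.R.is_cring)
 have cl: "\<phi> l \<in> carrier L" if "l \<in> power_gens C n" for l
  using multilinear_closed[OF phi] that by (auto simp: power_gens_lists)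
 have E: "lin_ext k L \<phi> \<in> k_hom k ?F L" by (rule lin_ext_k_hom[OF L]) (use cl in auto)
 have b: "basis k l \<in> carrier ?F" if "l \<in> power_gens C n" for l
  using basis_in_free[OF C.R.is_cring that] .
 have B: "lin_ext k L \<phi> (basis k l) = \<phi> l" if "l \<in> power_gens C n" for l
  using lin_ext_basis[OF L, of "power_gens C n" \<phi>] cl that by auto
 note mi = k_hom_minus[OF F.module_axioms L E] k_hom_add[OF E] k_hom_smult[OF E]
 have z: "\<And>a. a \<in> carrier L \<Longrightarrow> a \<ominus>\<^bsub>L\<^esub> a = \<zero>\<^bsub>L\<^esub>" by (simp add: a_minus_def L.M.r_neg)
 from assms consider
  (a) l i u v where "x = basis k (l[i := u \<oplus>\<^bsub>C\<^esub> v]) \<ominus>\<^bsub>?F\<^esub> (basis k (l[i := u]) \<oplus>\<^bsub>?F\<^esub> basis k (l[i := v]))"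
     "l \<in> power_gens C n" "i < n" "u \<in> carrier C" "v \<in> carrier C"
  | (b) c l i u where "x = basis k (l[i := c \<odot>\<^bsub>C\<^esub> u]) \<ominus>\<^bsub>?F\<^esub> (c \<odot>\<^bsub>?F\<^esub> basis k (l[i := u]))"
     "c \<in> carrier k" "l \<in> power_gens C n" "i < n" "u \<in> carrier C"
  unfolding power_rels_def Let_def by blast
 then show ?thesis
 proof cases
  case a
  from a obtain l1 l2 where l: "l1 \<in> lists (carrier C)" "l2 \<in> lists (carrier C)" "length l1 + length l2 + 1 = n"
   "\<And>x. l[i := x] = l1 @ x # l2" by (rule_tac power_gens_update) auto
  have g: "l1 @ x # l2 \<in> power_gens C n" if "x \<in> carrier C" for x
   using that l by (auto simp: power_gens_lists)
  note sl = multilinear_slot[OF phi l(1,2)]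
  show ?thesis using a g by (simp add: l(4) mi b B cl z k_hom_add[OF sl])
 next
  case b': b
  from b' obtain l1 l2 where l: "l1 \<in> lists (carrier C)" "l2 \<in> lists (carrier C)" "length l1 + length l2 + 1 = n"
   "\<And>x. l[i := x] = l1 @ x # l2" by (rule_tac power_gens_update) auto
  have g: "l1 @ x # l2 \<in> power_gens C n" if "x \<in> carrier C" for x
   using that l by (auto simp: power_gens_lists)
  note sl = multilinear_slot[OF phi l(1,2)]
  show ?thesis using b' g by (simp add: l(4) mi b B cl z k_hom_smult[OF sl])
 qed
qed

lemma power_lift_k_hom: "lin_lift k L \<phi> \<in> k_hom k (tensor_power k C n) L"
 unfolding tensor_power_def
 by (rule lin_lift_k_hom[OF C.R.is_cring power_rels_sub L _ multilinear_rels])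
   (use multilinear_closed[OF phi] in \<open>auto simp: power_gens_lists\<close>)

lemma power_lift_pure:
 assumes "l \<in> lists (carrier C)"
 shows "lin_lift k L \<phi> (pure_list k C l) = \<phi> l"
 unfolding pure_list_def
 by (rule lin_lift_gen[OF C.R.is_cring power_rels_sub L _ multilinear_rels])
   (use multilinear_closed[OF phi] assms in \<open>auto simp: power_gens_lists\<close>)

end

lemma power_lift_cong:
 assumes "module k L" "\<And>l. l \<in> power_gens C n \<Longrightarrow> \<phi> l = \<psi> l" "multilinear k C L \<phi>"
  "t \<in> carrier (tensor_power k C n)"
 shows "lin_lift k L \<phi> t = lin_lift k L \<psi> t"
 by (rule lin_lift_cong[OF C.R.is_cring power_rels_sub assms(1) assms(2) _ assms(4)[unfolded tensor_power_def]])
   (use multilinear_closed[OF assms(3)] in \<open>auto simp: power_gens_lists\<close>)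

lemma power_lift_cong_k_hom:
 assumes "module k L" "\<And>l. l \<in> power_gens C n \<Longrightarrow> \<phi> l = \<psi> l" "multilinear k C L \<psi>"
 shows "lin_lift k L \<phi> \<in> k_hom k (tensor_power k C n) L"
  and "l \<in> power_gens C n \<Longrightarrow> lin_lift k L \<phi> (pure_list k C l) = \<psi> l"
proof -
 have eq: "lin_lift k L \<phi> t = lin_lift k L \<psi> t" if "t \<in> carrier (tensor_power k C n)" for t
  using power_lift_cong[OF assms(1) assms(2)[symmetric] assms(3) that] by simp
 show "lin_lift k L \<phi> \<in> k_hom k (tensor_power k C n) L"
  by (rule k_hom_cong[OF power_lift_k_hom[OF assms(1,3)] module_tensor_power]) (simp add: eq)
 show "lin_lift k L \<phi> (pure_list k C l) = \<psi> l" if "l \<in> power_gens C n"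
  using eq[OF pure_list_closed[OF that]] power_lift_pure[OF assms(1,3), of l] that by (simp add: power_gens_lists)
qed

end

section \<open>Bimodules as left modules\<close>

lemma bilinear_k_hom_left: "\<lbrakk>bilinear k M N L \<phi>; m \<in> carrier M\<rbrakk> \<Longrightarrow> (\<lambda>n. \<phi> m n) \<in> k_hom k N L"
 and bilinear_k_hom_right: "\<lbrakk>bilinear k M N L \<phi>; n \<in> carrier N\<rbrakk> \<Longrightarrow> (\<lambda>m. \<phi> m n) \<in> k_hom k M L"
 by (auto simp: bilinear_def)

lemma bilinear_closed: "\<lbrakk>bilinear k M N L \<phi>; m \<in> carrier M; n \<in> carrier N\<rbrakk> \<Longrightarrow> \<phi> m n \<in> carrier L"
 by (auto simp: bilinear_def k_hom_def)

lemma bilinear_compose: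
 "\<lbrakk>bilinear k M N L \<phi>; f \<in> k_hom k L L'\<rbrakk> \<Longrightarrow> bilinear k M N L' (\<lambda>m n. f (\<phi> m n))"
 by (rule bilinearI; rule k_hom_compose[where g = f])
  (simp_all add: bilinear_k_hom_left bilinear_k_hom_right)

lemma k_algebra_mult_bilinear:
 assumes "k_algebra k A" shows "bilinear k A A A (mult A)"
proof -
 interpret A: k_algebra k A by fact
 show ?thesis
  by (intro bilinearI k_homI) (simp_all add: A.A.r_distr A.A.l_distr A.smult_mult_left[symmetric] A.smult_mult_right[symmetric])
qed

lemma opposite_simps [simp]:
 "carrier (opposite B) = carrier B" "zero (opposite B) = zero B" "add (opposite B) = add B"
 "smult (opposite B) = smult B" "one (opposite B) = one B" "x \<otimes>\<^bsub>opposite B\<^esub> y = y \<otimes>\<^bsub>B\<^esub> x"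
 by (simp_all add: opposite_def)

lemma module_opposite: "module k B \<Longrightarrow> module k (opposite B)"
 by (erule module_transfer) simp_all

lemma k_hom_opposite [simp]: "k_hom k (opposite B) N = k_hom k B N" "k_hom k N (opposite B) = k_hom k N B"
 by (auto simp: k_hom_def)

lemma bilinear_opposite: "bilinear k A (opposite B) N \<phi> = bilinear k A B N \<phi>"
 by (simp add: bilinear_def)

lemma k_hom_transfer_left:
 assumes "carrier N' = carrier N" "add N' = add N" "smult N' = smult N"
 shows "k_hom k N' L = k_hom k N L"
 using assms by (auto simp: k_hom_def)

lemma k_hom_transfer_right:
 assumes "carrier N' = carrier N" "add N' = add N" "smult N' = smult N"
 shows "k_hom k L N' = k_hom k L N"
 using assms by (auto simp: k_hom_def)

lemma bimod_as_left_simps [simp]: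
 "carrier (bimod_as_left k N) = carrier N" "zero (bimod_as_left k N) = zero N" "add (bimod_as_left k N) = add N"
 "smult (bimod_as_left k N) = smult N"
 by (simp_all add: bimod_as_left_def)

lemma bimod_as_left_k_hom [simp]:
 "k_hom k (bimod_as_left k N) L = k_hom k N L" "k_hom k L (bimod_as_left k N) = k_hom k L N"
 by (auto simp: k_hom_def)

locale two_algebras = A: k_algebra k A + B: k_algebra k B
 for k :: "'k ring" and A :: "('k, 'a) module" and B :: "('k, 'b) module"
begin

abbreviation "T \<equiv> tensor k A (opposite B)"
abbreviation "R \<equiv> tensor_algebra k A (opposite B)"
abbreviation "pt \<equiv> pure_tensor k A (opposite B)"

lemma mA: "module k A" and mB: "module k B" and mBo: "module k (opposite B)"
 by (auto intro: A.module_axioms B.module_axioms module_opposite)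

lemma mT: "module k T" by (rule module_tensor[OF mA mBo])

lemma R_simps [simp]: "carrier R = carrier T" "zero R = zero T" "add R = add T" "smult R = smult T"
 "one R = pt \<one>\<^bsub>A\<^esub> \<one>\<^bsub>B\<^esub>"
 by (simp_all add: tensor_algebra_def)

lemma R_k_hom [simp]: "k_hom k R L = k_hom k T L" "k_hom k L R = k_hom k L T"
 by (auto simp: k_hom_def)

lemma pt_closed: "\<lbrakk>a \<in> carrier A; b \<in> carrier B\<rbrakk> \<Longrightarrow> pt a b \<in> carrier T"
 using pure_tensor_closed[OF mA mBo] by simp

lemma pt_left: "a \<in> carrier A \<Longrightarrow> (\<lambda>b. pt a b) \<in> k_hom k B T"
 and pt_right: "b \<in> carrier B \<Longrightarrow> (\<lambda>a. pt a b) \<in> k_hom k A T"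
 using pure_tensor_bilinear[OF mA mBo] by (auto simp: bilinear_def)

lemma T_hom_eq:
 assumes "module k L" "f \<in> k_hom k T L" "g \<in> k_hom k T L"
  "\<And>a b. \<lbrakk>a \<in> carrier A; b \<in> carrier B\<rbrakk> \<Longrightarrow> f (pt a b) = g (pt a b)"
  "t \<in> carrier T"
 shows "f t = g t"
 using tensor_hom_eq[OF mA mBo assms(1-3) _ assms(5)] assms(4) by simp

lemma T_lift:
 assumes "module k L" "bilinear k A B L \<phi>"
 shows "lin_lift k L (\<lambda>(a, b). \<phi> a b) \<in> k_hom k T L"
  and "\<lbrakk>a \<in> carrier A; b \<in> carrier B\<rbrakk> \<Longrightarrow> lin_lift k L (\<lambda>(a, b). \<phi> a b) (pt a b) = \<phi> a b"
 using tensor_lift_k_hom[OF mA mBo assms(1), of \<phi>] tensor_lift_pure[OF mA mBo assms(1), of \<phi> a b] assms(2)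
 by (simp_all add: bilinear_opposite)

lemma T_lift_param:
 assumes "module k L" "module k V" "\<And>v. v \<in> carrier V \<Longrightarrow> bilinear k A B L (\<phi> v)"
  "\<And>a b. \<lbrakk>a \<in> carrier A; b \<in> carrier B\<rbrakk> \<Longrightarrow> (\<lambda>v. \<phi> v a b) \<in> k_hom k V L" "t \<in> carrier T"
 shows "(\<lambda>v. lin_lift k L (\<lambda>(a, b). \<phi> v a b) t) \<in> k_hom k V L"
 by (rule tensor_lift_param[OF mA mBo assms(1,2) _ _ assms(5)])
   (use assms(3,4) in \<open>auto simp: bilinear_opposite\<close>)

lemma mult_inner:
 assumes "a \<in> carrier A" "b \<in> carrier B"
 shows "bilinear k A B T (\<lambda>a' b'. pt (a \<otimes>\<^bsub>A\<^esub> a') (b \<otimes>\<^bsub>opposite B\<^esub> b'))"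
proof (rule bilinearI)
 note mb = k_algebra_mult_bilinear[OF A.k_algebra_axioms] k_algebra_mult_bilinear[OF B.k_algebra_axioms]
 show "(\<lambda>b'. pt (a \<otimes>\<^bsub>A\<^esub> a') (b \<otimes>\<^bsub>opposite B\<^esub> b')) \<in> k_hom k B T" if "a' \<in> carrier A" for a'
  using k_hom_compose[OF bilinear_k_hom_right[OF mb(2) assms(2)] pt_left[of "a \<otimes>\<^bsub>A\<^esub> a'"]] assms that by simp
 show "(\<lambda>a'. pt (a \<otimes>\<^bsub>A\<^esub> a') (b \<otimes>\<^bsub>opposite B\<^esub> b')) \<in> k_hom k A T" if "b' \<in> carrier B" for b'
  using k_hom_compose[OF bilinear_k_hom_left[OF mb(1) assms(1)] pt_right[of "b' \<otimes>\<^bsub>B\<^esub> b"]] assms that by simp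
qed

lemma mult_outer:
 assumes "t \<in> carrier T"
 shows "bilinear k A B T (\<lambda>a b. lin_lift k T (\<lambda>(a', b'). pt (a \<otimes>\<^bsub>A\<^esub> a') (b \<otimes>\<^bsub>opposite B\<^esub> b')) t)"
proof (rule bilinearI)
 note mb = k_algebra_mult_bilinear[OF A.k_algebra_axioms] k_algebra_mult_bilinear[OF B.k_algebra_axioms]
 show "(\<lambda>b. lin_lift k T (\<lambda>(a', b'). pt (a \<otimes>\<^bsub>A\<^esub> a') (b \<otimes>\<^bsub>opposite B\<^esub> b')) t) \<in> k_hom k B T" if "a \<in> carrier A" for a
 proof (rule T_lift_param[OF mT mB mult_inner _ assms])
  show "(\<lambda>b. pt (a \<otimes>\<^bsub>A\<^esub> a') (b \<otimes>\<^bsub>opposite B\<^esub> b')) \<in> k_hom k B T" if "a' \<in> carrier A" "b' \<in> carrier B" for a' b'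
   using k_hom_compose[OF bilinear_k_hom_left[OF mb(2) that(2)] pt_left[of "a \<otimes>\<^bsub>A\<^esub> a'"]] that \<open>a \<in> carrier A\<close> by simp
 qed (use that in auto)
 show "(\<lambda>a. lin_lift k T (\<lambda>(a', b'). pt (a \<otimes>\<^bsub>A\<^esub> a') (b \<otimes>\<^bsub>opposite B\<^esub> b')) t) \<in> k_hom k A T" if "b \<in> carrier B" for b
 proof (rule T_lift_param[OF mT mA mult_inner _ assms])
  show "(\<lambda>a. pt (a \<otimes>\<^bsub>A\<^esub> a') (b \<otimes>\<^bsub>opposite B\<^esub> b')) \<in> k_hom k A T" if "a' \<in> carrier A" "b' \<in> carrier B" for a' b'
   using k_hom_compose[OF bilinear_k_hom_right[OF mb(1) that(1)] pt_right[of "b' \<otimes>\<^bsub>B\<^esub> b"]] that \<open>b \<in> carrier B\<close> by simp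
 qed (use that in auto)
qed

lemma R_mult_left: "t \<in> carrier T \<Longrightarrow> (\<lambda>s. s \<otimes>\<^bsub>R\<^esub> t) \<in> k_hom k T T"
 using T_lift(1)[OF mT mult_outer] by (simp add: tensor_algebra_def)

lemma R_mult_pt_left:
 assumes "a \<in> carrier A" "b \<in> carrier B" "t \<in> carrier T"
 shows "pt a b \<otimes>\<^bsub>R\<^esub> t = lin_lift k T (\<lambda>(a', b'). pt (a \<otimes>\<^bsub>A\<^esub> a') (b \<otimes>\<^bsub>opposite B\<^esub> b')) t"
 using T_lift(2)[OF mT mult_outer[OF assms(3)] assms(1,2)] by (simp add: tensor_algebra_def)

lemma R_mult_pt:
 assumes "a \<in> carrier A" "b \<in> carrier B" "a' \<in> carrier A" "b' \<in> carrier B"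
 shows "pt a b \<otimes>\<^bsub>R\<^esub> pt a' b' = pt (a \<otimes>\<^bsub>A\<^esub> a') (b' \<otimes>\<^bsub>B\<^esub> b)"
 using R_mult_pt_left[OF assms(1,2) pt_closed[OF assms(3,4)]] T_lift(2)[OF mT mult_inner[OF assms(1,2)] assms(3,4)]
 by simp

lemma R_mult_pt_k_hom:
 assumes "a \<in> carrier A" "b \<in> carrier B"
 shows "(\<lambda>t. pt a b \<otimes>\<^bsub>R\<^esub> t) \<in> k_hom k T T"
 by (rule k_hom_cong[OF T_lift(1)[OF mT mult_inner[OF assms]] mT]) (rule R_mult_pt_left[OF assms])

end

lemma bimodule_lact_k_hom: "\<lbrakk>bimodule k A B N; a \<in> carrier A\<rbrakk> \<Longrightarrow> lact N a \<in> k_hom k N N"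
proof -
 assume "bimodule k A B N" and a: "a \<in> carrier A"
 then interpret bimodule k A B N by simp
 show ?thesis
 proof (rule k_homI)
  fix c x assume c: "c \<in> carrier k" and x: "x \<in> carrier N"
  have "lact N a (c \<odot>\<^bsub>N\<^esub> x) = lact N a (lact N (c \<odot>\<^bsub>A\<^esub> \<one>\<^bsub>A\<^esub>) x)"
   using c x by (simp add: lact_smult lact_one)
  also have "\<dots> = lact N (a \<otimes>\<^bsub>A\<^esub> (c \<odot>\<^bsub>A\<^esub> \<one>\<^bsub>A\<^esub>)) x" using a c x by (simp add: lact_mult)
  also have "a \<otimes>\<^bsub>A\<^esub> (c \<odot>\<^bsub>A\<^esub> \<one>\<^bsub>A\<^esub>) = c \<odot>\<^bsub>A\<^esub> a"
   using smult_mult_right[of c a "\<one>\<^bsub>A\<^esub>"] a c by simp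
  finally show "lact N a (c \<odot>\<^bsub>N\<^esub> x) = c \<odot>\<^bsub>N\<^esub> lact N a x" using a c x by (simp add: lact_smult)
 qed (simp_all add: a lact_closed lact_add_right)
qed

lemma left_module_lact_k_hom: "\<lbrakk>left_module k A N; a \<in> carrier A\<rbrakk> \<Longrightarrow> lact N a \<in> k_hom k N N"
proof -
 assume "left_module k A N" and a: "a \<in> carrier A"
 then interpret left_module k A N by simp
 show ?thesis
 proof (rule k_homI)
  fix c x assume c: "c \<in> carrier k" and x: "x \<in> carrier N"
  have "lact N a (c \<odot>\<^bsub>N\<^esub> x) = lact N a (lact N (c \<odot>\<^bsub>A\<^esub> \<one>\<^bsub>A\<^esub>) x)"
   using c x by (simp add: lact_smult lact_one)
  also have "\<dots> = lact N (a \<otimes>\<^bsub>A\<^esub> (c \<odot>\<^bsub>A\<^esub> \<one>\<^bsub>A\<^esub>)) x" using a c x by (simp add: lact_mult)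
  also have "a \<otimes>\<^bsub>A\<^esub> (c \<odot>\<^bsub>A\<^esub> \<one>\<^bsub>A\<^esub>) = c \<odot>\<^bsub>A\<^esub> a"
   using smult_mult_right[of c a "\<one>\<^bsub>A\<^esub>"] a c by simp
  finally show "lact N a (c \<odot>\<^bsub>N\<^esub> x) = c \<odot>\<^bsub>N\<^esub> lact N a x" using a c x by (simp add: lact_smult)
 qed (simp_all add: a lact_closed lact_add_right)
qed

lemma left_module_lact_bilinear:
 assumes "left_module k A N" shows "bilinear k A N N (lact N)"
proof -
 interpret left_module k A N by fact
 show ?thesis
  by (rule bilinearI, rule left_module_lact_k_hom[OF assms], assumption)
   (rule k_homI, simp_all add: lact_closed lact_add_left lact_smult)
qed

lemma bimodule_left: "bimodule k A B N \<Longrightarrow> left_module k A N"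
 by (simp add: bimodule_def)

lemma bimodule_module: "bimodule k A B N \<Longrightarrow> module k N"
 by (simp add: bimodule_def left_module_def)

lemma bimodule_ract_bilinear:
 assumes "bimodule k A B N" shows "bilinear k N B N (ract N)"
proof -
 interpret bimodule k A B N by fact
 show ?thesis
 proof (intro bilinearI k_homI)
  fix c x b assume c: "c \<in> carrier k" and x: "x \<in> carrier N" and b: "b \<in> carrier B"
  have "ract N (c \<odot>\<^bsub>N\<^esub> x) b = ract N (ract N x (c \<odot>\<^bsub>B\<^esub> \<one>\<^bsub>B\<^esub>)) b"
   using c x by (simp add: ract_smult ract_one)
  also have "\<dots> = ract N x ((c \<odot>\<^bsub>B\<^esub> \<one>\<^bsub>B\<^esub>) \<otimes>\<^bsub>B\<^esub> b)" using b c x by (simp add: ract_mult)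
  also have "(c \<odot>\<^bsub>B\<^esub> \<one>\<^bsub>B\<^esub>) \<otimes>\<^bsub>B\<^esub> b = c \<odot>\<^bsub>B\<^esub> b"
   using B.smult_mult_left[of c "\<one>\<^bsub>B\<^esub>" b] b c by simp
  finally show "ract N (c \<odot>\<^bsub>N\<^esub> x) b = c \<odot>\<^bsub>N\<^esub> ract N x b" using b c x by (simp add: ract_smult)
 qed (simp_all add: ract_closed ract_add_left ract_add_right ract_smult)
qed

lemma bimodule_lact_bilinear: "bimodule k A B N \<Longrightarrow> bilinear k A N N (lact N)"
 by (intro left_module_lact_bilinear bimodule_left)

definition bimod_hom where
 "bimod_hom k A B N N' = {f \<in> k_hom k N N'. (\<forall>a\<in>carrier A. \<forall>x\<in>carrier N. f (lact N a x) = lact N' a (f x)) \<and>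
   (\<forall>b\<in>carrier B. \<forall>x\<in>carrier N. f (ract N x b) = ract N' (f x) b)}"

context two_algebras
begin

context
 fixes N :: "('k, 'a, 'b, 'x) bimod"
 assumes N: "bimodule k A B N"
begin

interpretation N: bimodule k A B N by (rule N)

lemma mN: "module k N" by (rule bimodule_module[OF N])

lemma twosided_bilinear:
 assumes x: "x \<in> carrier N" shows "bilinear k A B N (\<lambda>a b. lact N a (ract N x b))"
 using k_hom_compose[OF bilinear_k_hom_left[OF bimodule_ract_bilinear[OF N]] bilinear_k_hom_left[OF bimodule_lact_bilinear[OF N]]]
  bilinear_k_hom_right[OF bimodule_lact_bilinear[OF N]] x
 by (intro bilinearI) (auto simp: N.ract_closed)

lemma as_left_lact_pt:
 "\<lbrakk>x \<in> carrier N; a \<in> carrier A; b \<in> carrier B\<rbrakk> \<Longrightarrow> lact (bimod_as_left k N) (pt a b) x = lact N a (ract N x b)"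
 unfolding bimod_as_left_def by (simp add: T_lift(2)[OF mN twosided_bilinear])

lemma as_left_lact_k_hom1: "x \<in> carrier N \<Longrightarrow> (\<lambda>t. lact (bimod_as_left k N) t x) \<in> k_hom k T N"
 unfolding bimod_as_left_def using T_lift(1)[OF mN twosided_bilinear] by simp

lemma as_left_lact_k_hom2:
 assumes t: "t \<in> carrier T" shows "(\<lambda>x. lact (bimod_as_left k N) t x) \<in> k_hom k N N"
 unfolding bimod_as_left_def lmod.simps
proof (rule T_lift_param[OF mN mN twosided_bilinear _ t])
 show "(\<lambda>x. lact N a (ract N x b)) \<in> k_hom k N N" if "a \<in> carrier A" "b \<in> carrier B" for a b
  by (rule k_hom_compose[OF bilinear_k_hom_right[OF bimodule_ract_bilinear[OF N]] bilinear_k_hom_left[OF bimodule_lact_bilinear[OF N]]])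
   (use that in auto)
qed

lemma as_left_closed: "\<lbrakk>t \<in> carrier T; x \<in> carrier N\<rbrakk> \<Longrightarrow> lact (bimod_as_left k N) t x \<in> carrier N"
 using k_hom_closed[OF as_left_lact_k_hom1] by blast

lemma as_left_mult_pt:
 assumes "a \<in> carrier A" "b \<in> carrier B" "s \<in> carrier T" "x \<in> carrier N"
 shows "lact (bimod_as_left k N) (pt a b \<otimes>\<^bsub>R\<^esub> s) x = lact (bimod_as_left k N) (pt a b) (lact (bimod_as_left k N) s x)"
proof (rule T_hom_eq[OF mN k_hom_compose[OF R_mult_pt_k_hom[OF assms(1,2)] as_left_lact_k_hom1[OF assms(4)]]
  k_hom_compose[OF as_left_lact_k_hom1[OF assms(4)] as_left_lact_k_hom2[OF pt_closed[OF assms(1,2)]]] _ assms(3)])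
 fix a' b' assume *: "a' \<in> carrier A" "b' \<in> carrier B"
 then show "lact (bimod_as_left k N) (pt a b \<otimes>\<^bsub>R\<^esub> pt a' b') x = lact (bimod_as_left k N) (pt a b) (lact (bimod_as_left k N) (pt a' b') x)"
  using assms by (simp add: R_mult_pt as_left_lact_pt N.lact_mult N.ract_mult N.lact_ract N.lact_closed N.ract_closed)
qed

lemma as_left_left_module:
 assumes R: "k_algebra k R"
 shows "left_module k R (bimod_as_left k N)"
proof (intro left_module.intro left_module_axioms.intro R)
 show mN': "module k (bimod_as_left k N)" by (rule module_transfer[OF mN]) simp_all
 show "lact (bimod_as_left k N) \<one>\<^bsub>R\<^esub> x = x" if "x \<in> carrier (bimod_as_left k N)" for x
  using that by (simp add: as_left_lact_pt N.lact_one N.ract_one)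
 fix r x assume r: "r \<in> carrier R" and x: "x \<in> carrier (bimod_as_left k N)"
 then have r': "r \<in> carrier T" and x': "x \<in> carrier N" by simp_all
 note h1 = as_left_lact_k_hom1[OF x'] and h2 = as_left_lact_k_hom2[OF r']
 show "lact (bimod_as_left k N) r x \<in> carrier (bimod_as_left k N)"
  using as_left_closed[OF r' x'] by simp
 show "lact (bimod_as_left k N) (c \<odot>\<^bsub>R\<^esub> r) x = c \<odot>\<^bsub>bimod_as_left k N\<^esub> lact (bimod_as_left k N) r x"
  if "c \<in> carrier k" for c using k_hom_smult[OF h1 that r'] by simp
 show "lact (bimod_as_left k N) r (x \<oplus>\<^bsub>bimod_as_left k N\<^esub> y) =
   lact (bimod_as_left k N) r x \<oplus>\<^bsub>bimod_as_left k N\<^esub> lact (bimod_as_left k N) r y"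
  if "y \<in> carrier (bimod_as_left k N)" for y using k_hom_add[OF h2 x'] that by simp
 fix s assume s: "s \<in> carrier R"
 then have s': "s \<in> carrier T" by simp
 show "lact (bimod_as_left k N) (r \<oplus>\<^bsub>R\<^esub> s) x =
   lact (bimod_as_left k N) r x \<oplus>\<^bsub>bimod_as_left k N\<^esub> lact (bimod_as_left k N) s x"
  using k_hom_add[OF h1 r' s'] by simp
 show "lact (bimod_as_left k N) (r \<otimes>\<^bsub>R\<^esub> s) x = lact (bimod_as_left k N) r (lact (bimod_as_left k N) s x)"
  by (rule T_hom_eq[OF mN k_hom_compose[OF R_mult_left[OF s'] h1] as_left_lact_k_hom1[OF as_left_closed[OF s' x']] _ r'])
   (use as_left_mult_pt s' x' in auto)
qed

end

lemma lmod_hom_as_left: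
 fixes N :: "('k, 'a, 'b, 'x) bimod" and N' :: "('k, 'a, 'b, 'y) bimod"
 assumes N: "bimodule k A B N" and N': "bimodule k A B N'"
 shows "lmod_hom k R (bimod_as_left k N) (bimod_as_left k N') = bimod_hom k A B N N'"
proof (intro subset_antisym subsetI)
 interpret N: bimodule k A B N by fact
 interpret N': bimodule k A B N' by fact
 fix f assume f: "f \<in> lmod_hom k R (bimod_as_left k N) (bimod_as_left k N')"
 then have fk: "f \<in> k_hom k N N'" by (auto simp: lmod_hom_def)
 have eq: "f (lact (bimod_as_left k N) (pt a b) x) = lact (bimod_as_left k N') (pt a b) (f x)"
  if "a \<in> carrier A" "b \<in> carrier B" "x \<in> carrier N" for a b x
  using f that pt_closed by (auto simp: lmod_hom_def)
 note cl = k_hom_closed[OF fk]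
 show "f \<in> bimod_hom k A B N N'"
  unfolding bimod_hom_def using fk eq[of _ "\<one>\<^bsub>B\<^esub>"] eq[of "\<one>\<^bsub>A\<^esub>"]
  by (auto simp: as_left_lact_pt[OF N] as_left_lact_pt[OF N'] N.ract_one N.lact_one N'.ract_one N'.lact_one
    cl N'.ract_closed N.ract_closed)
next
 interpret N: bimodule k A B N by fact
 interpret N': bimodule k A B N' by fact
 fix f assume f: "f \<in> bimod_hom k A B N N'"
 then have fk: "f \<in> k_hom k N N'" by (auto simp: bimod_hom_def)
 note cl = k_hom_closed[OF fk]
 have "f (lact (bimod_as_left k N) t x) = lact (bimod_as_left k N') t (f x)" if t: "t \<in> carrier T" and x: "x \<in> carrier N" for t x
  by (rule T_hom_eq[OF mN[OF N'] k_hom_compose[OF as_left_lact_k_hom1[OF N x] fk] as_left_lact_k_hom1[OF N' cl[OF x]] _ t])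
   (use f x in \<open>auto simp: as_left_lact_pt[OF N] as_left_lact_pt[OF N'] bimod_hom_def cl N.ract_closed\<close>)
 then show "f \<in> lmod_hom k R (bimod_as_left k N) (bimod_as_left k N')"
  using fk by (simp add: lmod_hom_def)
qed

text \<open>
 The inverse of \<open>bimod_as_left\<close>: the two actions are those of \<open>a \<otimes> 1\<close> and \<open>1 \<otimes> b\<close>.
\<close>

definition bim_of :: "('k, ('a \<times> 'b \<Rightarrow> 'k) set, 'p) lmod \<Rightarrow> ('k, 'a, 'b, 'p) bimod" where
 "bim_of P = \<lparr>carrier = carrier P, mult = mult P, one = one P, zero = zero P, add = add P, smult = smult P,
   lact = (\<lambda>a x. lact P (pt a \<one>\<^bsub>B\<^esub>) x), ract = (\<lambda>x b. lact P (pt \<one>\<^bsub>A\<^esub> b) x)\<rparr>"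

lemma bim_of_simps [simp]: "carrier (bim_of P) = carrier P" "zero (bim_of P) = zero P" "add (bim_of P) = add P"
 "smult (bim_of P) = smult P" "lact (bim_of P) a x = lact P (pt a \<one>\<^bsub>B\<^esub>) x" "ract (bim_of P) x b = lact P (pt \<one>\<^bsub>A\<^esub> b) x"
 by (simp_all add: bim_of_def)

lemma bimodule_bim_of:
 assumes P: "left_module k R P" shows "bimodule k A B (bim_of P)"
proof -
 interpret P: left_module k R P by fact
 have sm: "lact P (pt a b) (lact P (pt a' b') x) = lact P (pt (a \<otimes>\<^bsub>A\<^esub> a') (b' \<otimes>\<^bsub>B\<^esub> b)) x"
  if "a \<in> carrier A" "b \<in> carrier B" "a' \<in> carrier A" "b' \<in> carrier B" "x \<in> carrier P" for a b a' b' x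
  using P.lact_mult[of "pt a b" "pt a' b'" x] that by (simp add: R_mult_pt pt_closed)
 have b1: "(\<lambda>t. lact P t x) \<in> k_hom k T P" if "x \<in> carrier P" for x
  using bilinear_k_hom_right[OF left_module_lact_bilinear[OF P] that] by simp
 have b2: "lact P t \<in> k_hom k P P" if "t \<in> carrier T" for t
  using bilinear_k_hom_left[OF left_module_lact_bilinear[OF P], of t] that by simp
 note lef = k_hom_compose[OF pt_right[of "\<one>\<^bsub>B\<^esub>"] b1] and rig = k_hom_compose[OF pt_left[of "\<one>\<^bsub>A\<^esub>"] b1]
 show ?thesis
 proof (intro bimodule.intro left_module.intro left_module_axioms.intro bimodule_axioms.intro A.k_algebra_axioms B.k_algebra_axioms)
  show "module k (bim_of P)" by (rule module_transfer[OF P.N.module_axioms]) simp_all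
 qed (simp_all add: sm k_hom_add[OF lef] k_hom_add[OF rig] k_hom_smult[OF lef] k_hom_smult[OF rig]
   k_hom_add[OF b2] pt_closed k_hom_closed[OF b2] P.lact_one[simplified])
qed

lemma lact_bim_of:
 assumes P: "left_module k R P" and t: "t \<in> carrier R" and x: "x \<in> carrier P"
 shows "lact (bimod_as_left k (bim_of P)) t x = lact P t x"
proof -
 interpret P: left_module k R P by fact
 have t': "t \<in> carrier T" using t by simp
 have x': "x \<in> carrier (bim_of P)" using x by simp
 have b1: "(\<lambda>t. lact P t x) \<in> k_hom k T P"
  using bilinear_k_hom_right[OF left_module_lact_bilinear[OF P] x] by simp
 have [simp]: "k_hom k T (bim_of P) = k_hom k T P" by (rule k_hom_transfer_right) simp_all
 show ?thesis
 proof (rule T_hom_eq[OF P.N.module_axioms _ b1 _ t'])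
  show "(\<lambda>t. lact (bimod_as_left k (bim_of P)) t x) \<in> k_hom k T P"
   using as_left_lact_k_hom1[OF bimodule_bim_of[OF P] x'] by simp
  fix a b assume ab: "a \<in> carrier A" "b \<in> carrier B"
  then show "lact (bimod_as_left k (bim_of P)) (pt a b) x = lact P (pt a b) x"
   using P.lact_mult[of "pt a \<one>\<^bsub>B\<^esub>" "pt \<one>\<^bsub>A\<^esub> b" x] x
   by (simp add: as_left_lact_pt[OF bimodule_bim_of[OF P] x'] pt_closed R_mult_pt)
 qed
qed

end

section \<open>Hochschild cochains\<close>

context abelian_group
begin

lemma add_minus_add: "\<lbrakk>a \<in> carrier G; b \<in> carrier G; c \<in> carrier G; d \<in> carrier G\<rbrakk> \<Longrightarrow>
  a \<oplus> b \<ominus> (c \<oplus> d) = (a \<ominus> c) \<oplus> (b \<ominus> d)"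
 by algebra

lemma minus_minus_cancel: "\<lbrakk>a \<in> carrier G; b \<in> carrier G; c \<in> carrier G\<rbrakk> \<Longrightarrow> a \<ominus> b \<ominus> (c \<ominus> b) = a \<ominus> c"
 by algebra

lemma eq_minusI: "\<lbrakk>x \<oplus> y = z; x \<in> carrier G; y \<in> carrier G\<rbrakk> \<Longrightarrow> x = z \<ominus> y"
 by (auto simp: a_minus_def a_assoc r_neg)

lemma triple_minus_zero: "\<lbrakk>p \<in> carrier G; q \<in> carrier G; r \<in> carrier G\<rbrakk> \<Longrightarrow> p \<ominus> q \<ominus> (p \<ominus> r \<ominus> (q \<ominus> r)) = \<zero>"
 by algebra

end

declare in_lists_conv_set [simp del] in_listsD [rule del] in_listsI [rule del]

text \<open>
 The Hochschild differential without its first term: \<open>hD f e l\<close> for \<open>l = [e\<^sub>1, \<dots>, e\<^sub>n]\<close> is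
 \<open>f [ee\<^sub>1, e\<^sub>2, \<dots>] - f [e, e\<^sub>1e\<^sub>2, \<dots>] + \<dots> \<plusminus> f [e, e\<^sub>1, \<dots>] e\<^sub>n\<close>. Absorbing the leading letter \<open>e\<close> into the cochain
 turns the alternating sum into a recursion over the list without signs.
\<close>

fun hD :: "('k, 'c) module \<Rightarrow> ('k, 'l, 'c, 'x) bimod \<Rightarrow> ('c list \<Rightarrow> 'x) \<Rightarrow> 'c \<Rightarrow> 'c list \<Rightarrow> 'x" where
 "hD C N f e [] = ract N (f []) e"
| "hD C N f e (e' # l) = f ((e \<otimes>\<^bsub>C\<^esub> e') # l) \<ominus>\<^bsub>N\<^esub> hD C N (\<lambda>m. f (e # m)) e' l"

fun hdel :: "('k, 'c) module \<Rightarrow> ('k, 'c, 'c, 'x) bimod \<Rightarrow> ('c list \<Rightarrow> 'x) \<Rightarrow> 'c list \<Rightarrow> 'x" where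
 "hdel C N f [] = \<zero>\<^bsub>N\<^esub>"
| "hdel C N f (e # l) = lact N e (f l) \<ominus>\<^bsub>N\<^esub> hD C N f e l"

definition trunc :: "('k, 'c) module \<Rightarrow> ('k, 'x, 'z) module_scheme \<Rightarrow> nat \<Rightarrow> ('c list \<Rightarrow> 'x) \<Rightarrow> 'c list \<Rightarrow> 'x" where
 "trunc C N n f = (\<lambda>l. if l \<in> power_gens C n then f l else \<zero>\<^bsub>N\<^esub>)"

text \<open>
 All degrees share one type of functions; a cochain of degree \<open>n\<close> vanishes off the lists of length \<open>n\<close>
 over \<open>C\<close>, so that equality of cochains is equality of functions.
\<close>

definition coch :: "'k ring \<Rightarrow> ('k, 'c) module \<Rightarrow> ('k, 'x, 'z) module_scheme \<Rightarrow> nat \<Rightarrow> ('k, 'c list \<Rightarrow> 'x) module" where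
 "coch k C N n = \<lparr>carrier = {f. multilinear k C N f \<and> (\<forall>l. l \<notin> power_gens C n \<longrightarrow> f l = \<zero>\<^bsub>N\<^esub>)},
   mult = undefined, one = undefined, zero = (\<lambda>l. \<zero>\<^bsub>N\<^esub>), add = (\<lambda>f g l. f l \<oplus>\<^bsub>N\<^esub> g l),
   smult = (\<lambda>c f l. c \<odot>\<^bsub>N\<^esub> f l)\<rparr>"

definition coch_d where
 "coch_d C N n f = trunc C N (Suc n) (hdel C N f)"

lemma coch_simps [simp]: "zero (coch k C N n) = (\<lambda>l. \<zero>\<^bsub>N\<^esub>)" "add (coch k C N n) = (\<lambda>f g l. f l \<oplus>\<^bsub>N\<^esub> g l)"
 "smult (coch k C N n) = (\<lambda>c f l. c \<odot>\<^bsub>N\<^esub> f l)"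
 by (simp_all add: coch_def)

lemma coch_carrier: "f \<in> carrier (coch k C N n) \<longleftrightarrow> multilinear k C N f \<and> (\<forall>l. l \<notin> power_gens C n \<longrightarrow> f l = \<zero>\<^bsub>N\<^esub>)"
 by (simp add: coch_def)

lemma coch_multilinear: "f \<in> carrier (coch k C N n) \<Longrightarrow> multilinear k C N f"
 by (simp add: coch_carrier)

lemma multilinear_const_zero: "module k N \<Longrightarrow> multilinear k C N (\<lambda>l. \<zero>\<^bsub>N\<^esub>)"
proof -
 assume N: "module k N"
 then interpret N: module k N .
 show ?thesis by (rule multilinearI) (simp_all add: k_hom_const_zero N)
qed

lemma multilinear_plus:
 assumes "module k N" "multilinear k C N f" "multilinear k C N g"
 shows "multilinear k C N (\<lambda>l. f l \<oplus>\<^bsub>N\<^esub> g l)"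
proof -
 interpret N: module k N by fact
 show ?thesis using assms
  by (intro multilinearI k_hom_plus) (auto simp: multilinear_closed multilinear_slot)
qed

lemma multilinear_smult:
 assumes "module k N" "multilinear k C N f" "c \<in> carrier k"
 shows "multilinear k C N (\<lambda>l. c \<odot>\<^bsub>N\<^esub> f l)"
proof -
 interpret N: module k N by fact
 show ?thesis using assms
  by (intro multilinearI k_hom_scale) (auto simp: multilinear_closed multilinear_slot)
qed

lemma multilinear_comp:
 assumes "multilinear k C N f" "g \<in> k_hom k N N'"
 shows "multilinear k C N' (\<lambda>l. g (f l))"
 by (rule multilinearI) (use assms k_hom_compose[OF multilinear_slot[OF assms(1)] assms(2)] in
   \<open>auto simp: multilinear_closed k_hom_closed\<close>)

lemma multilinear_trunc:
 assumes "module k C" "module k N" "multilinear k C N f"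
 shows "multilinear k C N (trunc C N n f)"
proof (rule multilinearI)
 interpret N: module k N by fact
 interpret C: module k C by fact
 show "trunc C N n f l \<in> carrier N" if "l \<in> lists (carrier C)" for l
  using that multilinear_closed[OF assms(3)] by (simp add: trunc_def)
 fix l1 l2 assume l: "l1 \<in> lists (carrier C)" "l2 \<in> lists (carrier C)"
 show "(\<lambda>x. trunc C N n f (l1 @ x # l2)) \<in> k_hom k C N"
 proof (cases "length l1 + length l2 + 1 = n")
  case True
  show ?thesis
   by (rule k_hom_cong[OF multilinear_slot[OF assms(3) l] assms(1)])
    (use True l in \<open>auto simp: trunc_def power_gens_lists\<close>)
 next
  case False
  show ?thesis
   by (rule k_hom_cong[OF k_hom_const_zero[OF assms(2)] assms(1)])
    (use False in \<open>auto simp: trunc_def power_gens_lists\<close>)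
 qed
qed

lemma trunc_coch:
 "\<lbrakk>module k C; module k N; multilinear k C N f\<rbrakk> \<Longrightarrow> trunc C N n f \<in> carrier (coch k C N n)"
 by (simp add: coch_carrier multilinear_trunc) (simp add: trunc_def)

lemma coch_closed: "\<lbrakk>f \<in> carrier (coch k C N n); module k N\<rbrakk> \<Longrightarrow> f l \<in> carrier N"
proof -
 assume f: "f \<in> carrier (coch k C N n)" and "module k N"
 then interpret N: module k N by simp
 show ?thesis using f multilinear_closed[of k C N f l]
  by (cases "l \<in> power_gens C n") (auto simp: coch_carrier power_gens_lists)
qed

lemma coch_eqI:
 assumes "f \<in> carrier (coch k C N n)" "g \<in> carrier (coch k C N n)" "\<And>l. l \<in> power_gens C n \<Longrightarrow> f l = g l"
 shows "f = g"
 using assms by (force simp: coch_carrier)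

lemma module_coch:
 assumes N: "module k N" shows "module k (coch k C N n)"
 by (rule module_pointwise[OF N, where I = UNIV])
  (auto simp: fun_eq_iff coch_closed[OF _ N] coch_carrier multilinear_plus multilinear_smult multilinear_const_zero N
   module.smult_r_null[OF N] abelian_groupE(5)[OF module.axioms(2)[OF N]] abelian_groupE(2)[OF module.axioms(2)[OF N]])

lemma hD_cong:
 assumes "\<And>m. \<lbrakk>m \<in> lists (carrier C); length m = length l\<rbrakk> \<Longrightarrow> f m = g m"
  "ring C" "e \<in> carrier C" "l \<in> lists (carrier C)"
 shows "hD C N f e l = hD C N g e l"
 using assms(1,3,4)
proof (induct l arbitrary: f g e)
 case Nil
 then show ?case by simp
next
 case (Cons e' l)
 interpret C: ring C by fact
 have "hD C N (\<lambda>m. f (e # m)) e' l = hD C N (\<lambda>m. g (e # m)) e' l"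
  by (rule Cons(1)) (use Cons(2-) in auto)
 then show ?case using Cons(2)[of "(e \<otimes>\<^bsub>C\<^esub> e') # l"] Cons(3,4) by simp
qed

locale hoch = N: bimodule k C C N
 for k :: "'k ring" and C :: "('k, 'c) module" and N :: "('k, 'c, 'c, 'x) bimod" (structure)
begin

abbreviation "Cs \<equiv> lists (carrier C)"

lemma mC: "module k C" and mN: "module k N"
 by (rule N.module_axioms, rule N.N.module_axioms)

lemma bN: "bimodule k C C N" by (rule N.bimodule_axioms)

lemma ringC: "ring C" by (rule N.A.ring_axioms)

lemma mult_k_hom: "a \<in> carrier C \<Longrightarrow> (\<lambda>x. a \<otimes>\<^bsub>C\<^esub> x) \<in> k_hom k C C" "a \<in> carrier C \<Longrightarrow> (\<lambda>x. x \<otimes>\<^bsub>C\<^esub> a) \<in> k_hom k C C"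
 using k_algebra_mult_bilinear[OF N.k_algebra_axioms] by (auto simp: bilinear_def)

lemma lact_k_hom: "a \<in> carrier C \<Longrightarrow> lact N a \<in> k_hom k N N" "x \<in> carrier N \<Longrightarrow> (\<lambda>a. lact N a x) \<in> k_hom k C N"
 using bimodule_lact_bilinear[OF bN] by (auto simp: bilinear_def)

lemma ract_k_hom: "a \<in> carrier C \<Longrightarrow> (\<lambda>x. ract N x a) \<in> k_hom k N N" "x \<in> carrier N \<Longrightarrow> (\<lambda>a. ract N x a) \<in> k_hom k C N"
 using bimodule_ract_bilinear[OF bN] by (auto simp: bilinear_def)

lemma hD_closed:
 "\<lbrakk>\<And>m. m \<in> Cs \<Longrightarrow> f m \<in> carrier N; e \<in> carrier C; l \<in> Cs\<rbrakk> \<Longrightarrow> hD C N f e l \<in> carrier N"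
 by (induct l arbitrary: f e) (auto simp: N.ract_closed intro!: N.N.minus_closed)

lemma hdel_closed:
 "\<lbrakk>\<And>m. m \<in> Cs \<Longrightarrow> f m \<in> carrier N; l \<in> Cs\<rbrakk> \<Longrightarrow> hdel C N f l \<in> carrier N"
 by (cases l) (auto simp: hD_closed N.lact_closed intro!: N.N.minus_closed)

lemma hD_param:
 assumes "\<And>l. l \<in> Cs \<Longrightarrow> (\<lambda>v. f v l) \<in> k_hom k V N" "e \<in> carrier C" "l \<in> Cs"
 shows "(\<lambda>v. hD C N (f v) e l) \<in> k_hom k V N"
 using assms
proof (induct l arbitrary: f e)
 case Nil
 then show ?case using k_hom_compose[OF Nil(1)[of "[]"] ract_k_hom(1)[OF Nil(2)]] by simp
next
 case (Cons e' l)
 have "(\<lambda>v. hD C N (\<lambda>m. f v (e # m)) e' l) \<in> k_hom k V N"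
  by (rule Cons(1)) (use Cons(2-) in auto)
 then show ?case using Cons by (auto intro!: k_hom_sub mN)
qed

lemma hD_linear:
 assumes "multilinear k C N f" "l \<in> Cs"
 shows "(\<lambda>e. hD C N f e l) \<in> k_hom k C N"
proof (cases l)
 case Nil
 then show ?thesis using ract_k_hom(2) multilinear_closed[OF assms(1)] by simp
next
 case (Cons e' l')
 have "(\<lambda>e. f ((e \<otimes>\<^bsub>C\<^esub> e') # l')) \<in> k_hom k C N"
  using k_hom_compose[OF mult_k_hom(2) multilinear_hd[OF assms(1)], of e' l'] assms(2) Cons by simp
 moreover have "(\<lambda>e. hD C N (\<lambda>m. f (e # m)) e' l') \<in> k_hom k C N"
  by (rule hD_param) (use assms(2) Cons multilinear_hd[OF assms(1)] in auto)
 ultimately show ?thesis using Cons by (auto intro!: k_hom_sub mN)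
qed

lemma hD_slot:
 assumes "multilinear k C N f" "l1 \<in> Cs" "l2 \<in> Cs" "e \<in> carrier C"
 shows "(\<lambda>x. hD C N f e (l1 @ x # l2)) \<in> k_hom k C N"
 using assms
proof (induct l1 arbitrary: f e)
 case Nil
 have "(\<lambda>x. f ((e \<otimes>\<^bsub>C\<^esub> x) # l2)) \<in> k_hom k C N"
  using k_hom_compose[OF mult_k_hom(1) multilinear_hd[OF Nil(1)], of e l2] Nil by simp
 then show ?case using hD_linear[OF multilinear_Cons[OF Nil(1,4)] Nil(3)] by (auto intro!: k_hom_sub mN)
next
 case (Cons e' l1)
 have "(\<lambda>x. f ((e \<otimes>\<^bsub>C\<^esub> e') # l1 @ x # l2)) \<in> k_hom k C N"
  using multilinear_slot[OF Cons(2), of "(e \<otimes>\<^bsub>C\<^esub> e') # l1" l2] Cons N.A.m_closed by auto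
 then show ?case using Cons(1)[OF multilinear_Cons[OF Cons(2,5)]] Cons by (auto intro!: k_hom_sub mN)
qed

lemma hdel_multilinear:
 assumes f: "multilinear k C N f" shows "multilinear k C N (hdel C N f)"
proof (rule multilinearI)
 show "hdel C N f l \<in> carrier N" if "l \<in> Cs" for l using that multilinear_closed[OF f] by (intro hdel_closed)
 fix l1 l2 assume l: "l1 \<in> Cs" "l2 \<in> Cs"
 show "(\<lambda>x. hdel C N f (l1 @ x # l2)) \<in> k_hom k C N"
 proof (cases l1)
  case Nil
  then show ?thesis using l multilinear_closed[OF f]
   by (auto intro!: k_hom_sub mN lact_k_hom hD_linear f)
 next
  case (Cons e l1')
  then show ?thesis using l k_hom_compose[OF multilinear_slot[OF f] lact_k_hom(1)]
   by (auto intro!: k_hom_sub mN hD_slot f)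
 qed
qed

lemma hD_plus:
 assumes "\<And>m. m \<in> Cs \<Longrightarrow> f m \<in> carrier N" "\<And>m. m \<in> Cs \<Longrightarrow> g m \<in> carrier N" "e \<in> carrier C" "l \<in> Cs"
 shows "hD C N (\<lambda>m. f m \<oplus> g m) e l = hD C N f e l \<oplus> hD C N g e l"
 using assms
proof (induct l arbitrary: f g e)
 case Nil
 then show ?case by (simp add: N.ract_add_left)
next
 case (Cons e' l)
 have IH: "hD C N (\<lambda>m. f (e # m) \<oplus> g (e # m)) e' l = hD C N (\<lambda>m. f (e # m)) e' l \<oplus> hD C N (\<lambda>m. g (e # m)) e' l"
  by (rule Cons(1)) (use Cons(2-) in auto)
 have "f ((e \<otimes>\<^bsub>C\<^esub> e') # l) \<in> carrier N" "g ((e \<otimes>\<^bsub>C\<^esub> e') # l) \<in> carrier N"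
  using Cons(2-) by auto
 moreover have "hD C N (\<lambda>m. f (e # m)) e' l \<in> carrier N" "hD C N (\<lambda>m. g (e # m)) e' l \<in> carrier N"
  using Cons(2-) by (auto intro!: hD_closed)
 ultimately show ?case by (simp add: IH N.N.add_minus_add)
qed

lemma hD_nat:
 assumes "bimodule k C C N'" "g \<in> k_hom k N N'" "\<And>x e. \<lbrakk>x \<in> carrier N; e \<in> carrier C\<rbrakk> \<Longrightarrow> g (ract N x e) = ract N' (g x) e"
  and "\<And>m. m \<in> Cs \<Longrightarrow> f m \<in> carrier N" "e \<in> carrier C" "l \<in> Cs"
 shows "g (hD C N f e l) = hD C N' (\<lambda>m. g (f m)) e l"
 using assms(4-6)
proof (induct l arbitrary: f e)
 case Nil
 then show ?case using assms(3) by simp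
next
 case (Cons e' l)
 have IH: "g (hD C N (\<lambda>m. f (e # m)) e' l) = hD C N' (\<lambda>m. g (f (e # m))) e' l"
  by (rule Cons(1)) (use Cons(2-) in auto)
 have "hD C N (\<lambda>m. f (e # m)) e' l \<in> carrier N" using Cons(2-) by (auto intro!: hD_closed)
 moreover have "f ((e \<otimes>\<^bsub>C\<^esub> e') # l) \<in> carrier N" using Cons(2-) by auto
 ultimately show ?case using IH k_hom_minus[OF mN bimodule_module[OF assms(1)] assms(2)] by simp
qed

lemma hD_zero: "\<lbrakk>e \<in> carrier C; l \<in> Cs\<rbrakk> \<Longrightarrow> hD C N (\<lambda>m. \<zero>) e l = \<zero>"
 using k_hom_zero[OF mN mN ract_k_hom(1)]
 by (induct l arbitrary: e) (auto simp: N.N.minus_zero_right)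

lemma hD_minus:
 assumes "\<And>m. m \<in> Cs \<Longrightarrow> f m \<in> carrier N" "\<And>m. m \<in> Cs \<Longrightarrow> g m \<in> carrier N" "e \<in> carrier C" "l \<in> Cs"
 shows "hD C N (\<lambda>m. f m \<ominus> g m) e l = hD C N f e l \<ominus> hD C N g e l"
proof -
 have "hD C N (\<lambda>m. (f m \<ominus> g m) \<oplus> g m) e l = hD C N f e l"
 proof (rule hD_cong[OF _ ringC assms(3,4)])
  fix m assume "m \<in> Cs"
  then have "f m \<in> carrier N" "g m \<in> carrier N" using assms by auto
  then show "f m \<ominus> g m \<oplus> g m = f m" by (simp add: a_minus_def N.N.a_assoc N.N.l_neg)
 qed
 moreover have "hD C N (\<lambda>m. (f m \<ominus> g m) \<oplus> g m) e l = hD C N (\<lambda>m. f m \<ominus> g m) e l \<oplus> hD C N g e l"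
  by (rule hD_plus) (use assms in auto)
 moreover have "hD C N (\<lambda>m. f m \<ominus> g m) e l \<in> carrier N" "hD C N g e l \<in> carrier N"
  using assms by (auto intro!: hD_closed)
 ultimately show ?thesis by (intro N.N.eq_minusI) auto
qed

text \<open>
 The identity \<open>d d = 0\<close> with all terms removed in which a letter acts from the left; for those,
 the bimodule axioms suffice.
\<close>

lemma hD_hD:
 assumes "\<And>m. m \<in> Cs \<Longrightarrow> f m \<in> carrier N" "e \<in> carrier C" "e' \<in> carrier C" "l \<in> Cs"
 shows "hD C N (\<lambda>m. hD C N f e m) e' l = hD C N f (e \<otimes>\<^bsub>C\<^esub> e') l"
 using assms
proof (induct l arbitrary: f e e')
 case Nil
 then show ?case by (simp add: N.ract_mult)
next
 case (Cons e'' l)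
 have e: "e \<in> carrier C" "e' \<in> carrier C" "e'' \<in> carrier C" "l \<in> Cs" using Cons(2-) by auto
 have IH: "hD C N (\<lambda>m. hD C N (\<lambda>m. f (e # m)) e' m) e'' l = hD C N (\<lambda>m. f (e # m)) (e' \<otimes>\<^bsub>C\<^esub> e'') l"
  by (rule Cons(1)) (use Cons(2-) in auto)
 let ?a = "f ((e \<otimes>\<^bsub>C\<^esub> (e' \<otimes>\<^bsub>C\<^esub> e'')) # l)"
 let ?b = "hD C N (\<lambda>m. f (e # m)) (e' \<otimes>\<^bsub>C\<^esub> e'') l"
 let ?c = "hD C N (\<lambda>m. f ((e \<otimes>\<^bsub>C\<^esub> e') # m)) e'' l"
 have f: "f m \<in> carrier N" if "m \<in> Cs" for m using Cons(2) that .
 have cl: "?a \<in> carrier N" by (rule f) (use e in simp)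
 have clb: "?b \<in> carrier N" by (rule hD_closed, rule f) (use e in simp_all)
 have clc: "?c \<in> carrier N" by (rule hD_closed, rule f) (use e in simp_all)
 have h: "hD C N (\<lambda>m. f (e # m)) e' m \<in> carrier N" if "m \<in> Cs" for m
  by (rule hD_closed, rule f) (use e that in simp_all)
 have "hD C N (\<lambda>m. f ((e \<otimes>\<^bsub>C\<^esub> e') # m) \<ominus> hD C N (\<lambda>m. f (e # m)) e' m) e'' l = ?c \<ominus> ?b"
  by (subst hD_minus) (use e f h IH in simp_all)
 then have "hD C N (\<lambda>m. hD C N f e m) e' (e'' # l) = (?a \<ominus> ?b) \<ominus> (?c \<ominus> ?b)" by simp
 also have "\<dots> = ?a \<ominus> ?c" using cl clb clc by (rule N.N.minus_minus_cancel)
 also have "\<dots> = hD C N f (e \<otimes>\<^bsub>C\<^esub> e') (e'' # l)" using e by (simp add: N.A.m_assoc)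
 finally show ?case .
qed

lemma hdel_hdel:
 assumes f: "\<And>m. m \<in> Cs \<Longrightarrow> f m \<in> carrier N" and l: "l \<in> Cs"
 shows "hdel C N (hdel C N f) l = \<zero>"
proof (cases l)
 case Nil
 then show ?thesis by simp
next
 case (Cons e l')
 have e: "e \<in> carrier C" and l': "l' \<in> Cs" using l Cons by auto
 show ?thesis
 proof (cases l')
  case Nil
  then show ?thesis using Cons e k_hom_zero[OF mN mN lact_k_hom(1)[OF e]] k_hom_zero[OF mN mN ract_k_hom(1)[OF e]]
   by (simp add: a_minus_def N.N.r_neg)
 next
  case c2: (Cons e' l'')
  have e': "e' \<in> carrier C" and l'': "l'' \<in> Cs" using l' c2 by auto
  let ?p = "lact N (e \<otimes>\<^bsub>C\<^esub> e') (f l'')"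
  let ?q = "lact N e (hD C N f e' l'')"
  let ?r = "hD C N f (e \<otimes>\<^bsub>C\<^esub> e') l''"
  have cl: "?p \<in> carrier N" "?q \<in> carrier N" "?r \<in> carrier N"
   using e e' l'' f by (auto intro!: hD_closed N.lact_closed)
  have h: "hD C N f e' l'' \<in> carrier N" using e' l'' f by (auto intro!: hD_closed)
  have 1: "lact N e (lact N e' (f l'') \<ominus> hD C N f e' l'') = ?p \<ominus> ?q"
   using e e' l'' f h by (simp add: k_hom_minus[OF mN mN lact_k_hom(1)[OF e]] N.lact_closed N.lact_mult)
  have 2: "hD C N (\<lambda>m. lact N e (f m)) e' l'' = ?q"
   by (rule hD_nat[OF bN lact_k_hom(1)[OF e], symmetric]) (use e e' l'' f N.lact_ract in auto)
  have 3: "hD C N (\<lambda>m. lact N e (f m) \<ominus> hD C N f e m) e' l'' = ?q \<ominus> ?r"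
   using e e' l'' f by (subst hD_minus) (auto simp: 2 hD_hD intro!: hD_closed N.lact_closed)
  have "hdel C N (hdel C N f) l = (?p \<ominus> ?q) \<ominus> ((?p \<ominus> ?r) \<ominus> (?q \<ominus> ?r))"
   using Cons c2 1 3 by simp
  also have "\<dots> = \<zero>" using cl by (rule N.N.triple_minus_zero)
  finally show ?thesis .
 qed
qed

lemma hdel_coch_off:
 assumes "f \<in> carrier (coch k C N n)" "l \<in> Cs" "length l \<noteq> Suc n"
 shows "hdel C N f l = \<zero>"
proof (cases l)
 case (Cons e l')
 have z: "f m = \<zero>" if "length m = length l'" for m
  using assms that Cons by (auto simp: coch_carrier power_gens_lists)
 have e: "e \<in> carrier C" "l' \<in> Cs" using assms Cons by auto
 have "hD C N f e l' = hD C N (\<lambda>m. \<zero>) e l'"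
  by (rule hD_cong[OF _ ringC]) (use e z in auto)
 then show ?thesis using Cons e z[of l'] hD_zero[OF e] k_hom_zero[OF mN mN lact_k_hom(1)[OF e(1)]]
  by (simp add: N.N.minus_zero_right)
qed simp

lemma hdel_eq_coch_d:
 "\<lbrakk>f \<in> carrier (coch k C N n); l \<in> Cs\<rbrakk> \<Longrightarrow> hdel C N f l = coch_d C N n f l"
 by (simp add: coch_d_def trunc_def power_gens_lists hdel_coch_off)

lemma hdel_cong:
 assumes "\<And>m. \<lbrakk>m \<in> Cs; Suc (length m) = length l\<rbrakk> \<Longrightarrow> f m = g m" "l \<in> Cs"
 shows "hdel C N f l = hdel C N g l"
proof (cases l)
 case (Cons e l')
 have "hD C N f e l' = hD C N g e l'"
  by (rule hD_cong[OF _ ringC], rule assms(1)) (use assms(2) Cons in simp_all)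
 moreover have "f l' = g l'" by (rule assms(1)) (use assms(2) Cons in simp_all)
 ultimately show ?thesis using Cons by simp
qed simp

lemma hdel_param:
 assumes "\<And>l. l \<in> Cs \<Longrightarrow> (\<lambda>v. f v l) \<in> k_hom k V N" "l \<in> Cs"
 shows "(\<lambda>v. hdel C N (f v) l) \<in> k_hom k V N"
proof (cases l)
 case Nil
 then show ?thesis using k_hom_const_zero[OF mN] by simp
next
 case (Cons e l')
 have e: "e \<in> carrier C" "l' \<in> Cs" using assms(2) Cons by simp_all
 show ?thesis unfolding Cons hdel.simps
  by (rule k_hom_sub[OF mN k_hom_compose[OF assms(1)[OF e(2)] lact_k_hom(1)[OF e(1)]] hD_param[OF assms(1) e]])
qed

lemma coch_eval_k_hom: "(\<lambda>f. f l) \<in> k_hom k (coch k C N n) N"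
 by (rule k_homI) (auto simp: coch_closed[OF _ mN])

lemma coch_d_k_hom: "coch_d C N n \<in> k_hom k (coch k C N n) (coch k C N (Suc n))"
proof (rule k_homI)
 have h: "(\<lambda>f. hdel C N f l) \<in> k_hom k (coch k C N n) N" if "l \<in> Cs" for l
  by (rule hdel_param[OF coch_eval_k_hom that])
 fix f assume f: "f \<in> carrier (coch k C N n)"
 show "coch_d C N n f \<in> carrier (coch k C N (Suc n))"
  unfolding coch_d_def by (intro trunc_coch mC mN hdel_multilinear coch_multilinear[OF f])
 show "coch_d C N n (f \<oplus>\<^bsub>coch k C N n\<^esub> g) = coch_d C N n f \<oplus>\<^bsub>coch k C N (Suc n)\<^esub> coch_d C N n g"
  if "g \<in> carrier (coch k C N n)" for g
  using k_hom_add[OF h f that] by (auto simp: coch_d_def trunc_def power_gens_lists)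
 show "coch_d C N n (c \<odot>\<^bsub>coch k C N n\<^esub> f) = c \<odot>\<^bsub>coch k C N (Suc n)\<^esub> coch_d C N n f"
  if "c \<in> carrier k" for c
  using k_hom_smult[OF h that f] that by (auto simp: coch_d_def trunc_def power_gens_lists)
qed

lemma coch_d_d:
 assumes "f \<in> carrier (coch k C N n)"
 shows "coch_d C N (Suc n) (coch_d C N n f) = \<zero>\<^bsub>coch k C N (Suc (Suc n))\<^esub>"
proof -
 have "hdel C N (coch_d C N n f) l = \<zero>" if "l \<in> Cs" for l
  using hdel_hdel[of f l] hdel_cong[of l "coch_d C N n f" "hdel C N f"] that
   multilinear_closed[OF coch_multilinear[OF assms]] hdel_eq_coch_d[OF assms] by simp
 then show ?thesis by (auto simp: coch_d_def[of C N "Suc n"] trunc_def power_gens_lists)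
qed

end

section \<open>The bar resolution\<close>

text \<open>
 The alternating sum of \<open>f\<close> over the contractions of adjacent letters, by the same kind of recursion as
 for \<open>hD\<close>; the bar differential is the case \<open>f = pure_list k C\<close> (see \<open>alt_finsum\<close>).
\<close>

fun alt :: "('k, 'c) module \<Rightarrow> ('k, 'x, 'z) module_scheme \<Rightarrow> ('c list \<Rightarrow> 'x) \<Rightarrow> 'c list \<Rightarrow> 'x" where
 "alt C N f [] = \<zero>\<^bsub>N\<^esub>"
| "alt C N f [x] = \<zero>\<^bsub>N\<^esub>"
| "alt C N f (x # y # l) = f ((x \<otimes>\<^bsub>C\<^esub> y) # l) \<ominus>\<^bsub>N\<^esub> alt C N (\<lambda>m. f (x # m)) (y # l)"

lemma contract_Cons: "contract C (x # l) (Suc j) = x # contract C l j"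
 by (simp add: contract_def)

lemma contract_0: "contract C (x # y # l) 0 = (x \<otimes>\<^bsub>C\<^esub> y) # l"
 by (simp add: contract_def numeral_2_eq_2)

lemma alg_mult_k_hom:
 assumes "k_algebra k C" "a \<in> carrier C"
 shows "(\<lambda>x. a \<otimes>\<^bsub>C\<^esub> x) \<in> k_hom k C C" "(\<lambda>x. x \<otimes>\<^bsub>C\<^esub> a) \<in> k_hom k C C"
 using k_algebra_mult_bilinear[OF assms(1)] assms(2) by (auto simp: bilinear_def)

context
 fixes k :: "'k ring" and C :: "('k, 'c) module" and N :: "('k, 'x, 'z) module_scheme" (structure)
 assumes C: "k_algebra k C" and N: "module k N"
begin

interpretation C: k_algebra k C by (rule C)
interpretation N: module k N by (rule N)

lemma alt_closed:
 assumes "\<And>m. m \<in> lists (carrier C) \<Longrightarrow> f m \<in> carrier N" "l \<in> lists (carrier C)"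
 shows "alt C N f l \<in> carrier N"
 using assms
proof (induct l arbitrary: f rule: induct_list012)
 case (3 x y l)
 have "alt C N (\<lambda>m. f (x # m)) (y # l) \<in> carrier N" by (rule 3(2), rule 3(3)) (use 3(4) in simp_all)
 moreover have "f ((x \<otimes>\<^bsub>C\<^esub> y) # l) \<in> carrier N" by (rule 3(3)) (use 3(4) in simp)
 ultimately show ?case by simp
qed simp_all

lemma alt_param:
 assumes "\<And>l. l \<in> lists (carrier C) \<Longrightarrow> (\<lambda>v. f v l) \<in> k_hom k V N" "l \<in> lists (carrier C)"
 shows "(\<lambda>v. alt C N (f v) l) \<in> k_hom k V N"
 using assms
proof (induct l arbitrary: f rule: induct_list012)
 case (3 x y l)
 have "(\<lambda>v. alt C N (\<lambda>m. f v (x # m)) (y # l)) \<in> k_hom k V N" by (rule 3(2), rule 3(3)) (use 3(4) in simp_all)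
 moreover have "(\<lambda>v. f v ((x \<otimes>\<^bsub>C\<^esub> y) # l)) \<in> k_hom k V N" by (rule 3(3)) (use 3(4) in simp)
 ultimately show ?case by (simp add: k_hom_sub N)
qed (simp_all add: k_hom_const_zero N)

lemma alt_hd:
 assumes "multilinear k C N f" "l \<in> lists (carrier C)"
 shows "(\<lambda>x. alt C N f (x # l)) \<in> k_hom k C N"
proof (cases l)
 case (Cons y l')
 have y: "y \<in> carrier C" "l' \<in> lists (carrier C)" using assms(2) Cons by simp_all
 show ?thesis unfolding Cons alt.simps
  by (rule k_hom_sub[OF N k_hom_compose[OF alg_mult_k_hom(2)[OF C y(1)] multilinear_hd[OF assms(1) y(2)]]
     alt_param[OF multilinear_hd[OF assms(1)]]]) (use assms(2) Cons in simp_all)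
qed (simp add: k_hom_const_zero N)

lemma alt_slot:
 assumes "multilinear k C N f" "l1 \<in> lists (carrier C)" "l2 \<in> lists (carrier C)"
 shows "(\<lambda>x. alt C N f (l1 @ x # l2)) \<in> k_hom k C N"
 using assms
proof (induct l1 arbitrary: f)
 case Nil
 then show ?case using alt_hd by simp
next
 case (Cons a l1)
 have a: "a \<in> carrier C" "l1 \<in> lists (carrier C)" using Cons(3) by simp_all
 have IH: "(\<lambda>x. alt C N (\<lambda>m. f (a # m)) (l1 @ x # l2)) \<in> k_hom k C N"
  by (rule Cons(1)[OF multilinear_Cons[OF Cons(2) a(1)] a(2) Cons(4)])
 show ?case
 proof (cases l1)
  case Nil
  have "(\<lambda>x. f ((a \<otimes>\<^bsub>C\<^esub> x) # l2)) \<in> k_hom k C N"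
   by (rule k_hom_compose[OF alg_mult_k_hom(1)[OF C a(1)] multilinear_hd[OF Cons(2,4)]])
  then show ?thesis using IH unfolding Nil by (simp add: k_hom_sub N)
 next
  case c: (Cons b l1')
  have "(\<lambda>x. f (((a \<otimes>\<^bsub>C\<^esub> b) # l1') @ x # l2)) \<in> k_hom k C N"
   by (rule multilinear_slot[OF Cons(2)]) (use a c Cons(4) in simp_all)
  then show ?thesis using IH unfolding c by (simp add: k_hom_sub N)
 qed
qed

lemma alt_multilinear: "multilinear k C N f \<Longrightarrow> multilinear k C N (alt C N f)"
 by (rule multilinearI) (simp_all add: alt_slot alt_closed multilinear_closed)

lemma alt_cong:
 assumes "\<And>m. \<lbrakk>m \<in> lists (carrier C); Suc (length m) = length l\<rbrakk> \<Longrightarrow> f m = g m" "l \<in> lists (carrier C)"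
 shows "alt C N f l = alt C N g l"
 using assms
proof (induct l arbitrary: f g rule: induct_list012)
 case (3 x y l)
 have "alt C N (\<lambda>m. f (x # m)) (y # l) = alt C N (\<lambda>m. g (x # m)) (y # l)"
  by (rule 3(2), rule 3(3)) (use 3(4) in simp_all)
 moreover have "f ((x \<otimes>\<^bsub>C\<^esub> y) # l) = g ((x \<otimes>\<^bsub>C\<^esub> y) # l)" by (rule 3(3)) (use 3(4) in simp_all)
 ultimately show ?case by simp
qed simp_all

lemma alt_finsum:
 assumes "\<And>m. m \<in> lists (carrier C) \<Longrightarrow> f m \<in> carrier N" "l \<in> lists (carrier C)" "length l = n + 2"
 shows "alt C N f l = (\<Oplus> j\<in>{0..n}. ((\<ominus>\<^bsub>k\<^esub> \<one>\<^bsub>k\<^esub>) [^]\<^bsub>k\<^esub> j) \<odot> f (contract C l j))"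
 using assms
proof (induct n arbitrary: l f)
 case 0
 then obtain x y where l: "l = [x, y]" by (auto simp: length_Suc_conv numeral_2_eq_2)
 have "f [x \<otimes>\<^bsub>C\<^esub> y] \<in> carrier N" by (rule 0(1)) (use 0(2) l in simp)
 then show ?case by (simp add: l contract_0 N.M.minus_zero_right)
next
 case (Suc n)
 then obtain x l0 where l0: "l = x # l0" "length l0 = n + 2" by (auto simp: length_Suc_conv numeral_2_eq_2)
 then obtain y l' where l': "l0 = y # l'" by (auto simp: length_Suc_conv numeral_2_eq_2)
 have mem: "x \<in> carrier C" "y \<in> carrier C" "l' \<in> lists (carrier C)" "l0 \<in> lists (carrier C)"
  using Suc(3) l0 l' by simp_all
 have fx: "f (x # m) \<in> carrier N" if "m \<in> lists (carrier C)" for m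
  by (rule Suc(2)) (use that mem in simp)
 have con: "contract C l0 j \<in> lists (carrier C)" if "j \<le> n" for j
 proof -
  have "l0 ! j \<in> carrier C" "l0 ! (j + 1) \<in> carrier C"
   using mem(4) that l0(2) nth_mem[of j l0] nth_mem[of "j+1" l0] by (auto simp: in_lists_conv_set)
  then show ?thesis using mem(4) set_take_subset[of j l0] set_drop_subset[of "j+2" l0]
   by (auto simp: contract_def in_lists_conv_set)
 qed
 let ?s = "\<lambda>j. (\<ominus>\<^bsub>k\<^esub> \<one>\<^bsub>k\<^esub>) [^]\<^bsub>k\<^esub> (j::nat)"
 let ?g = "\<lambda>j. ?s j \<odot> f (contract C l j)"
 have s: "?s j \<in> carrier k" for j by simp
 have IH: "alt C N (\<lambda>m. f (x # m)) l0 = (\<Oplus> j\<in>{..n}. ?s j \<odot> f (x # contract C l0 j))"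
  using Suc(1)[of "\<lambda>m. f (x # m)" l0] fx mem(4) l0(2) by (simp add: atLeast0AtMost)
 have f0: "f ((x \<otimes>\<^bsub>C\<^esub> y) # l') \<in> carrier N" by (rule Suc(2)) (use mem in simp)
 have gS: "?g (Suc j) = (\<ominus>\<^bsub>k\<^esub> \<one>\<^bsub>k\<^esub>) \<odot> (?s j \<odot> f (x # contract C l0 j))" if "j \<le> n" for j
  using fx[OF con[OF that]] by (simp add: l0(1) contract_Cons N.smult_assoc1[symmetric] C.R.m_comm)
 have g0: "?g 0 = f ((x \<otimes>\<^bsub>C\<^esub> y) # l')" using f0 by (simp add: l0(1) l' contract_0)
 have gc: "?g \<in> {..Suc n} \<rightarrow> carrier N"
 proof
  fix j assume "j \<in> {..Suc n}"
  then show "?g j \<in> carrier N"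
   using f0 g0 gS fx con by (cases j) simp_all
 qed
 have "(\<Oplus> j\<in>{0..Suc n}. ?g j) = (\<Oplus> j\<in>{..n}. ?g (Suc j)) \<oplus> ?g 0"
  unfolding atLeast0AtMost by (rule N.M.finsum_Suc2[OF gc])
 also have "(\<Oplus> j\<in>{..n}. ?g (Suc j)) = (\<Oplus> j\<in>{..n}. (\<ominus>\<^bsub>k\<^esub> \<one>\<^bsub>k\<^esub>) \<odot> (?s j \<odot> f (x # contract C l0 j)))"
  by (rule N.M.finsum_cong') (use gS fx con in auto)
 also have "\<dots> = (\<ominus>\<^bsub>k\<^esub> \<one>\<^bsub>k\<^esub>) \<odot> (\<Oplus> j\<in>{..n}. ?s j \<odot> f (x # contract C l0 j))"
  by (rule N.finsum_smult_ldistr[symmetric]) (use fx con in auto)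
 also have "\<dots> = \<ominus> alt C N (\<lambda>m. f (x # m)) l0"
  unfolding IH[symmetric] using alt_closed[OF fx mem(4)] by (simp add: N.smult_l_minus)
 finally have fin: "(\<Oplus> j\<in>{0..Suc n}. ?g j) = \<ominus> alt C N (\<lambda>m. f (x # m)) l0 \<oplus> ?g 0" .
 have ac: "alt C N (\<lambda>m. f (x # m)) l0 \<in> carrier N" by (rule alt_closed[OF fx mem(4)])
 have "alt C N f l = f ((x \<otimes>\<^bsub>C\<^esub> y) # l') \<ominus> alt C N (\<lambda>m. f (x # m)) l0" by (simp add: l0(1) l')
 then show ?case unfolding fin g0 using ac f0 by (simp add: a_minus_def N.M.a_comm)
qed

end

lemma alt_nat:
 fixes k :: "'k ring"
 assumes "k_algebra k C" "module k N" "module k N'" "g \<in> k_hom k N N'"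
  "\<And>m. m \<in> lists (carrier C) \<Longrightarrow> f m \<in> carrier N" "l \<in> lists (carrier C)"
 shows "g (alt C N f l) = alt C N' (\<lambda>m. g (f m)) l"
 using assms(5,6)
proof (induct l arbitrary: f rule: induct_list012)
 case (3 x y l)
 interpret C: k_algebra k C by fact
 have c: "f (x # m) \<in> carrier N" if "m \<in> lists (carrier C)" for m
  by (rule 3(3)) (use 3(4) that in simp)
 have "g (alt C N (\<lambda>m. f (x # m)) (y # l)) = alt C N' (\<lambda>m. g (f (x # m))) (y # l)"
  by (rule 3(2), rule c) (use 3(4) in simp_all)
 moreover have "f ((x \<otimes>\<^bsub>C\<^esub> y) # l) \<in> carrier N" by (rule 3(3)) (use 3(4) in simp_all)
 moreover have "alt C N (\<lambda>m. f (x # m)) (y # l) \<in> carrier N"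
  by (rule alt_closed[OF assms(1,2)], rule c) (use 3(4) in simp_all)
 ultimately show ?case by (simp add: k_hom_minus[OF assms(2,3,4)])
qed (simp_all add: k_hom_zero[OF assms(2-4)])

lemma list_ends:
 assumes "length l = n + 2" "l \<in> lists S"
 obtains x m z where "l = x # m @ [z]" "length m = n" "x \<in> S" "m \<in> lists S" "z \<in> S"
proof -
 obtain x l' where l: "l = x # l'" "length l' = Suc n" using assms(1) by (cases l) auto
 then obtain m z where "l' = m @ [z]" by (cases l' rule: rev_cases) auto
 then show ?thesis using that[of x m z] l assms by auto
qed

lemma slot_last_cases:
 assumes "l2 \<in> lists S"
 obtains "l2 = []" | m z where "l2 = m @ [z]" "m \<in> lists S" "z \<in> S"
 using assms by (cases l2 rule: rev_cases) auto

definition scale_hd where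
 "scale_hd C N f c l = (case l of [] \<Rightarrow> \<zero>\<^bsub>N\<^esub> | x # l' \<Rightarrow> f ((c \<otimes>\<^bsub>C\<^esub> x) # l'))"

definition scale_last where
 "scale_last C N f c l = (if l = [] then \<zero>\<^bsub>N\<^esub> else f (butlast l @ [last l \<otimes>\<^bsub>C\<^esub> c]))"

lemma scale_simps [simp]: "scale_hd C N f c (x # l) = f ((c \<otimes>\<^bsub>C\<^esub> x) # l)"
 "scale_last C N f c (l @ [x]) = f (l @ [x \<otimes>\<^bsub>C\<^esub> c])"
 "scale_last C N f c (y # l @ [x]) = f (y # l @ [x \<otimes>\<^bsub>C\<^esub> c])"
 "scale_last C N f c [x] = f [x \<otimes>\<^bsub>C\<^esub> c]"
 by (simp_all add: scale_hd_def scale_last_def butlast_append)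

lemma scale_hd_multilinear:
 fixes k :: "'k ring"
 assumes C: "k_algebra k C" and N: "module k N" and f: "multilinear k C N f" and c: "c \<in> carrier C"
 shows "multilinear k C N (scale_hd C N f c)"
proof (rule multilinearI)
 interpret C: k_algebra k C by fact
 interpret N: module k N by fact
 show "scale_hd C N f c l \<in> carrier N" if "l \<in> lists (carrier C)" for l
  using that c multilinear_closed[OF f] by (cases l) (simp_all add: scale_hd_def)
 fix l1 l2 assume l: "l1 \<in> lists (carrier C)" "l2 \<in> lists (carrier C)"
 show "(\<lambda>x. scale_hd C N f c (l1 @ x # l2)) \<in> k_hom k C N"
 proof (cases l1)
  case Nil
  then show ?thesis using k_hom_compose[OF alg_mult_k_hom(1)[OF C c] multilinear_hd[OF f l(2)]] by simp
 next
  case (Cons a l1')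
  then show ?thesis using multilinear_slot[OF f, of "(c \<otimes>\<^bsub>C\<^esub> a) # l1'" l2] l c by simp
 qed
qed

lemma scale_last_multilinear:
 fixes k :: "'k ring"
 assumes C: "k_algebra k C" and N: "module k N" and f: "multilinear k C N f" and c: "c \<in> carrier C"
 shows "multilinear k C N (scale_last C N f c)"
proof (rule multilinearI)
 interpret C: k_algebra k C by fact
 interpret N: module k N by fact
 show "scale_last C N f c l \<in> carrier N" if "l \<in> lists (carrier C)" for l
  using that c multilinear_closed[OF f] by (cases l rule: rev_cases) (simp_all add: scale_last_def)
 fix l1 l2 assume l: "l1 \<in> lists (carrier C)" "l2 \<in> lists (carrier C)"
 from l(2) show "(\<lambda>x. scale_last C N f c (l1 @ x # l2)) \<in> k_hom k C N"
 proof (cases rule: slot_last_cases)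
  case 1
  then show ?thesis using k_hom_compose[OF alg_mult_k_hom(2)[OF C c] multilinear_slot[OF f l(1), of "[]"]] by simp
 next
  case (2 m z)
  have eq: "l1 @ x # l2 = (l1 @ x # m) @ [z]" for x using 2 by simp
  show ?thesis unfolding eq scale_simps
   using multilinear_slot[OF f l(1), of "m @ [z \<otimes>\<^bsub>C\<^esub> c]"] l c 2 by simp
 qed
qed

locale bar = C: k_algebra k C for k :: "'k ring" and C :: "('k, 'c) module"
begin

abbreviation "Tp n \<equiv> tensor_power k C n"
abbreviation "Bn n \<equiv> bar_bimod k C n"

lemma kC: "k_algebra k C" by (rule C.k_algebra_axioms)
lemma mC: "module k C" by (rule C.module_axioms)
lemma mTp: "module k (Tp n)" by (rule module_tensor_power[OF mC])

lemma bar_simps [simp]: "carrier (Bn n) = carrier (Tp (n + 2))" "zero (Bn n) = zero (Tp (n + 2))"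
 "add (Bn n) = add (Tp (n + 2))" "smult (Bn n) = smult (Tp (n + 2))"
 by (simp_all add: bar_bimod_def Let_def)

lemma bar_k_hom [simp]: "k_hom k (Bn n) L = k_hom k (Tp (n + 2)) L" "k_hom k L (Bn n) = k_hom k L (Tp (n + 2))"
 by (rule k_hom_transfer_left k_hom_transfer_right; simp)+

lemma bar_lact:
 assumes c: "c \<in> carrier C"
 shows "lact (Bn n) c \<in> k_hom k (Tp (n + 2)) (Tp (n + 2))"
  and "\<lbrakk>x \<in> carrier C; l \<in> lists (carrier C); length l = Suc n\<rbrakk> \<Longrightarrow>
   lact (Bn n) c (pure_list k C (x # l)) = pure_list k C ((c \<otimes>\<^bsub>C\<^esub> x) # l)"
proof -
 have eq: "pure_list k C (l[0 := c \<otimes>\<^bsub>C\<^esub> l ! 0]) = scale_hd C (Tp (n + 2)) (pure_in k C (n + 2)) c l"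
  if "l \<in> power_gens C (n + 2)" for l
  using that by (cases l) (auto simp: power_gens_lists pure_in_def)
 note ml = scale_hd_multilinear[OF kC mTp pure_in_multilinear[OF mC] c]
 note P = power_lift_cong_k_hom[OF mC mTp eq ml]
 show "lact (Bn n) c \<in> k_hom k (Tp (n + 2)) (Tp (n + 2))"
  using P(1) by (simp add: bar_bimod_def Let_def)
 show "lact (Bn n) c (pure_list k C (x # l)) = pure_list k C ((c \<otimes>\<^bsub>C\<^esub> x) # l)"
  if "x \<in> carrier C" "l \<in> lists (carrier C)" "length l = Suc n"
  using P(2)[where l = "x # l"] that by (simp add: bar_bimod_def Let_def power_gens_lists pure_in_def)
qed

lemma bar_ract:
 assumes c: "c \<in> carrier C"
 shows "(\<lambda>t. ract (Bn n) t c) \<in> k_hom k (Tp (n + 2)) (Tp (n + 2))"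
  and "\<lbrakk>z \<in> carrier C; l \<in> lists (carrier C); length l = Suc n\<rbrakk> \<Longrightarrow>
   ract (Bn n) (pure_list k C (l @ [z])) c = pure_list k C (l @ [z \<otimes>\<^bsub>C\<^esub> c])"
proof -
 have eq: "pure_list k C (l[n + 1 := l ! (n + 1) \<otimes>\<^bsub>C\<^esub> c]) = scale_last C (Tp (n + 2)) (pure_in k C (n + 2)) c l"
  if "l \<in> power_gens C (n + 2)" for l
 proof -
  from that have "length l = n + 2" "l \<in> lists (carrier C)" by (simp_all add: power_gens_lists)
  then obtain x m z where "l = x # m @ [z]" "length m = n" by (rule list_ends)
  then show ?thesis by (simp add: pure_in_def nth_append list_update_append)
 qed
 note ml = scale_last_multilinear[OF kC mTp pure_in_multilinear[OF mC] c]
 note P = power_lift_cong_k_hom[OF mC mTp eq ml]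
 show "(\<lambda>t. ract (Bn n) t c) \<in> k_hom k (Tp (n + 2)) (Tp (n + 2))"
  using P(1) by (simp add: bar_bimod_def Let_def)
 show "ract (Bn n) (pure_list k C (l @ [z])) c = pure_list k C (l @ [z \<otimes>\<^bsub>C\<^esub> c])"
  if "z \<in> carrier C" "l \<in> lists (carrier C)" "length l = Suc n"
  using P(2)[where l = "l @ [z]"] that by (simp add: bar_bimod_def Let_def power_gens_lists pure_in_def)
qed

lemma bar_lact_ends:
 assumes "c \<in> carrier C" "x \<in> carrier C" "m \<in> lists (carrier C)" "length m = n" "z \<in> carrier C"
 shows "lact (Bn n) c (pure_list k C (x # m @ [z])) = pure_list k C ((c \<otimes>\<^bsub>C\<^esub> x) # m @ [z])"
  and "ract (Bn n) (pure_list k C (x # m @ [z])) c = pure_list k C (x # m @ [z \<otimes>\<^bsub>C\<^esub> c])"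
 using bar_lact(2)[of c x "m @ [z]" n] bar_ract(2)[of c z "x # m" n] assms by simp_all

lemma bar_hom_eq:
 assumes "module k L" "f \<in> k_hom k (Tp (n + 2)) L" "g \<in> k_hom k (Tp (n + 2)) L"
  "\<And>x m z. \<lbrakk>x \<in> carrier C; m \<in> lists (carrier C); length m = n; z \<in> carrier C\<rbrakk> \<Longrightarrow>
    f (pure_list k C (x # m @ [z])) = g (pure_list k C (x # m @ [z]))"
  "t \<in> carrier (Tp (n + 2))"
 shows "f t = g t"
proof (rule tensor_power_hom_eq[OF mC assms(1-3) _ assms(5)])
 fix l assume "l \<in> power_gens C (n + 2)"
 then have "length l = n + 2" "l \<in> lists (carrier C)" by (simp_all add: power_gens_lists)
 then obtain x m z where "l = x # m @ [z]" "length m = n" "x \<in> carrier C" "m \<in> lists (carrier C)" "z \<in> carrier C"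
  by (rule list_ends)
 then show "f (pure_list k C l) = g (pure_list k C l)" using assms(4) by simp
qed

lemma pure_ends_hd:
 "\<lbrakk>m \<in> lists (carrier C); length m = n; z \<in> carrier C\<rbrakk> \<Longrightarrow> (\<lambda>x. pure_list k C (x # m @ [z])) \<in> k_hom k C (Tp (n + 2))"
 using multilinear_slot[OF pure_in_multilinear[OF mC], of "[]" "m @ [z]" "n + 2"] by (simp add: pure_in_def)

lemma pure_ends_last:
 "\<lbrakk>m \<in> lists (carrier C); length m = n; x \<in> carrier C\<rbrakk> \<Longrightarrow> (\<lambda>z. pure_list k C (x # m @ [z])) \<in> k_hom k C (Tp (n + 2))"
 using multilinear_slot[OF pure_in_multilinear[OF mC], of "x # m" "[]" "n + 2"] by (simp add: pure_in_def)

lemma pure_ends_closed: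
 "\<lbrakk>x \<in> carrier C; m \<in> lists (carrier C); length m = n; z \<in> carrier C\<rbrakk> \<Longrightarrow> pure_list k C (x # m @ [z]) \<in> carrier (Tp (n + 2))"
 using k_hom_closed[OF pure_ends_hd] by blast

lemma bimodule_bar: "bimodule k C C (Bn n)"
proof (intro bimodule.intro left_module.intro left_module_axioms.intro bimodule_axioms.intro kC; (unfold bar_simps)?)
 note L = bar_lact(1)[of _ n] and Rr = bar_ract(1)[of _ n]
 note LP = bar_lact_ends(1)[of _ _ _ n] and RP = bar_lact_ends(2)[of _ _ _ n]
 let ?T = "Tp (n + 2)"
 show "module k (Bn n)" by (rule module_transfer[OF mTp]) simp_all
 fix r assume r: "r \<in> carrier C"
 show "lact (Bn n) r t \<in> carrier ?T" if "t \<in> carrier ?T" for t by (rule k_hom_closed[OF L[OF r] that])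
 show "ract (Bn n) t r \<in> carrier ?T" if "t \<in> carrier ?T" for t by (rule k_hom_closed[OF Rr[OF r] that])
 show "lact (Bn n) r (t \<oplus>\<^bsub>?T\<^esub> u) = lact (Bn n) r t \<oplus>\<^bsub>?T\<^esub> lact (Bn n) r u"
  if "t \<in> carrier ?T" "u \<in> carrier ?T" for t u by (rule k_hom_add[OF L[OF r] that])
 show "ract (Bn n) (t \<oplus>\<^bsub>?T\<^esub> u) r = ract (Bn n) t r \<oplus>\<^bsub>?T\<^esub> ract (Bn n) u r"
  if "t \<in> carrier ?T" "u \<in> carrier ?T" for t u by (rule k_hom_add[OF Rr[OF r] that])
 show "lact (Bn n) (c \<odot>\<^bsub>C\<^esub> r) t = c \<odot>\<^bsub>?T\<^esub> lact (Bn n) r t"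
  if c: "c \<in> carrier k" and t: "t \<in> carrier ?T" for c t
  by (rule bar_hom_eq[OF mTp L k_hom_scale[OF mTp L[OF r] c] _ t])
   (use r c in \<open>simp_all add: LP C.smult_mult_left[symmetric] k_hom_smult[OF pure_ends_hd]\<close>)
 show "ract (Bn n) t (c \<odot>\<^bsub>C\<^esub> r) = c \<odot>\<^bsub>?T\<^esub> ract (Bn n) t r"
  if c: "c \<in> carrier k" and t: "t \<in> carrier ?T" for c t
  by (rule bar_hom_eq[OF mTp Rr k_hom_scale[OF mTp Rr[OF r] c] _ t])
   (use r c in \<open>simp_all add: RP C.smult_mult_right[symmetric] k_hom_smult[OF pure_ends_last]\<close>)
 fix s assume s: "s \<in> carrier C"
 fix t assume t: "t \<in> carrier ?T"
 show "lact (Bn n) (r \<oplus>\<^bsub>C\<^esub> s) t = lact (Bn n) r t \<oplus>\<^bsub>?T\<^esub> lact (Bn n) s t"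
  by (rule bar_hom_eq[OF mTp L k_hom_plus[OF mTp L[OF r] L[OF s]] _ t])
   (use r s in \<open>simp_all add: LP C.A.l_distr k_hom_add[OF pure_ends_hd]\<close>)
 show "ract (Bn n) t (r \<oplus>\<^bsub>C\<^esub> s) = ract (Bn n) t r \<oplus>\<^bsub>?T\<^esub> ract (Bn n) t s"
  by (rule bar_hom_eq[OF mTp Rr k_hom_plus[OF mTp Rr[OF r] Rr[OF s]] _ t])
   (use r s in \<open>simp_all add: RP C.A.r_distr k_hom_add[OF pure_ends_last]\<close>)
 show "lact (Bn n) (r \<otimes>\<^bsub>C\<^esub> s) t = lact (Bn n) r (lact (Bn n) s t)"
  by (rule bar_hom_eq[OF mTp L k_hom_compose[OF L[OF s] L[OF r]] _ t])
   (use r s in \<open>simp_all add: LP C.A.m_assoc\<close>)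
 show "ract (Bn n) t (r \<otimes>\<^bsub>C\<^esub> s) = ract (Bn n) (ract (Bn n) t r) s"
  by (rule bar_hom_eq[OF mTp Rr k_hom_compose[OF Rr[OF r] Rr[OF s]] _ t])
   (use r s in \<open>simp_all add: RP C.A.m_assoc\<close>)
next
 note L = bar_lact(1)[of _ n] and Rr = bar_ract(1)[of _ n]
 note LP = bar_lact_ends(1)[of _ _ _ n] and RP = bar_lact_ends(2)[of _ _ _ n]
 let ?T = "Tp (n + 2)"
 fix t assume t: "t \<in> carrier ?T"
 show "lact (Bn n) \<one>\<^bsub>C\<^esub> t = t"
  by (rule bar_hom_eq[OF mTp L k_hom_id _ t]) (simp_all add: LP)
 show "ract (Bn n) t \<one>\<^bsub>C\<^esub> = t"
  by (rule bar_hom_eq[OF mTp Rr k_hom_id _ t]) (simp_all add: RP)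
 fix r s assume r: "r \<in> carrier C" and s: "s \<in> carrier C"
 show "lact (Bn n) r (ract (Bn n) t s) = ract (Bn n) (lact (Bn n) r t) s"
  by (rule bar_hom_eq[OF mTp k_hom_compose[OF Rr[OF s] L[OF r]] k_hom_compose[OF L[OF r] Rr[OF s]] _ t])
   (use r s in \<open>simp add: LP RP\<close>)
qed

lemma bar_diff_props:
 shows "bar_diff k C n \<in> k_hom k (Tp (n + 2)) (Tp (n + 1))"
  and "l \<in> power_gens C (n + 2) \<Longrightarrow> bar_diff k C n (pure_list k C l) = alt C (Tp (n + 1)) (pure_in k C (n + 1)) l"
proof -
 note ml = pure_in_multilinear[OF mC, of "n + 1"]
 interpret T: module k "Tp (n + 1)" by (rule mTp)
 have eq: "(\<Oplus>\<^bsub>Tp (n + 1)\<^esub> j\<in>{0..n}. ((\<ominus>\<^bsub>k\<^esub> \<one>\<^bsub>k\<^esub>) [^]\<^bsub>k\<^esub> j) \<odot>\<^bsub>Tp (n + 1)\<^esub> pure_list k C (contract C l j))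
   = alt C (Tp (n + 1)) (pure_in k C (n + 1)) l" if l: "l \<in> power_gens C (n + 2)" for l
 proof -
  have len: "length (contract C l j) = n + 1" if "j \<in> {0..n}" for j
   using that l by (auto simp: contract_def power_gens_lists)
  have con: "contract C l j \<in> lists (carrier C)" if "j \<in> {0..n}" for j
  proof -
   have "l ! j \<in> carrier C" "l ! (j + 1) \<in> carrier C"
    using l that nth_mem[of j l] nth_mem[of "j+1" l] by (auto simp: power_gens_def)
   then show ?thesis using l set_take_subset[of j l] set_drop_subset[of "j+2" l]
    by (auto simp: contract_def in_lists_conv_set power_gens_def)
  qed
  have sum: "alt C (Tp (n + 1)) (pure_in k C (n + 1)) l =
    (\<Oplus>\<^bsub>Tp (n + 1)\<^esub> j\<in>{0..n}. ((\<ominus>\<^bsub>k\<^esub> \<one>\<^bsub>k\<^esub>) [^]\<^bsub>k\<^esub> j) \<odot>\<^bsub>Tp (n + 1)\<^esub> pure_in k C (n + 1) (contract C l j))"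
   by (rule alt_finsum[OF kC mTp multilinear_closed[OF ml]]) (use l in \<open>simp_all add: power_gens_lists\<close>)
  show ?thesis unfolding sum
  proof (rule T.M.finsum_cong'[OF refl])
   show "(\<lambda>j. ((\<ominus>\<^bsub>k\<^esub> \<one>\<^bsub>k\<^esub>) [^]\<^bsub>k\<^esub> j) \<odot>\<^bsub>Tp (n + 1)\<^esub> pure_in k C (n + 1) (contract C l j)) \<in> {0..n} \<rightarrow> carrier (Tp (n + 1))"
    by (intro Pi_I T.smult_closed multilinear_closed[OF ml] con) simp_all
  qed (simp add: pure_in_def len)
 qed
 note P = power_lift_cong_k_hom[OF mC mTp eq alt_multilinear[OF kC mTp ml]]
 show "bar_diff k C n \<in> k_hom k (Tp (n + 2)) (Tp (n + 1))" unfolding bar_diff_def by (rule P(1))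
 show "bar_diff k C n (pure_list k C l) = alt C (Tp (n + 1)) (pure_in k C (n + 1)) l" if "l \<in> power_gens C (n + 2)"
  unfolding bar_diff_def by (rule P(2)[OF _ that])
qed

end

section \<open>Cohomology of complexes of modules\<close>

definition cyc :: "(nat \<Rightarrow> ('k, 'x) module) \<Rightarrow> (nat \<Rightarrow> 'x \<Rightarrow> 'x) \<Rightarrow> nat \<Rightarrow> ('k, 'x) module" where
 "cyc K \<delta> n = (K n)\<lparr>carrier := {x \<in> carrier (K n). \<delta> n x = \<zero>\<^bsub>K (Suc n)\<^esub>}\<rparr>"

definition bdry :: "(nat \<Rightarrow> ('k, 'x) module) \<Rightarrow> (nat \<Rightarrow> 'x \<Rightarrow> 'x) \<Rightarrow> nat \<Rightarrow> 'x set" where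
 "bdry K \<delta> n = (case n of 0 \<Rightarrow> {\<zero>\<^bsub>K 0\<^esub>} | Suc m \<Rightarrow> \<delta> m ` carrier (K m))"

definition cls :: "(nat \<Rightarrow> ('k, 'x) module) \<Rightarrow> (nat \<Rightarrow> 'x \<Rightarrow> 'x) \<Rightarrow> nat \<Rightarrow> 'x \<Rightarrow> 'x set" where
 "cls K \<delta> n x = bdry K \<delta> n +>\<^bsub>K n\<^esub> x"

lemma cyc_simps [simp]: "zero (cyc K \<delta> n) = zero (K n)" "add (cyc K \<delta> n) = add (K n)" "smult (cyc K \<delta> n) = smult (K n)"
 by (simp_all add: cyc_def)

lemma cyc_carrier: "x \<in> carrier (cyc K \<delta> n) \<longleftrightarrow> x \<in> carrier (K n) \<and> \<delta> n x = \<zero>\<^bsub>K (Suc n)\<^esub>"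
 by (simp add: cyc_def)

lemma cohomology_eq: "cohomology K \<delta> n = quot_module (cyc K \<delta> n) (bdry K \<delta> n)"
 by (simp add: cohomology_def cyc_def bdry_def)

locale cx =
 fixes k :: "'k ring" and K :: "nat \<Rightarrow> ('k, 'x) module" and \<delta> :: "nat \<Rightarrow> 'x \<Rightarrow> 'x"
 assumes mod: "module k (K n)"
  and d_hom: "\<delta> n \<in> k_hom k (K n) (K (Suc n))"
  and d_d: "x \<in> carrier (K n) \<Longrightarrow> \<delta> (Suc n) (\<delta> n x) = \<zero>\<^bsub>K (Suc (Suc n))\<^esub>"
begin

abbreviation "Zc \<equiv> cyc K \<delta>"
abbreviation "Bd \<equiv> bdry K \<delta>"
abbreviation "Hc \<equiv> cohomology K \<delta>"
abbreviation "cl \<equiv> cls K \<delta>"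

lemma cyc_submodule: "submodule (carrier (Zc n)) k (K n)"
 using kernel_submodule[OF mod mod d_hom] by (simp add: cyc_def)

lemma mod_cyc: "module k (Zc n)"
 using submodule.submodule_is_module[OF cyc_submodule mod] by (simp add: cyc_def)

lemma cyc_sub: "x \<in> carrier (Zc n) \<Longrightarrow> x \<in> carrier (K n)"
 by (simp add: cyc_carrier)

lemma cyc_minus:
 assumes "x \<in> carrier (Zc n)" "y \<in> carrier (Zc n)"
 shows "x \<ominus>\<^bsub>Zc n\<^esub> y = x \<ominus>\<^bsub>K n\<^esub> y"
proof -
 interpret Z: module k "Zc n" by (rule mod_cyc)
 interpret K: module k "K n" by (rule mod)
 have "(\<ominus>\<^bsub>Zc n\<^esub> y) \<oplus>\<^bsub>K n\<^esub> y = \<zero>\<^bsub>K n\<^esub>" using Z.M.l_neg[OF assms(2)] by simp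
 then have "\<ominus>\<^bsub>K n\<^esub> y = \<ominus>\<^bsub>Zc n\<^esub> y"
  using K.M.minus_equality cyc_sub assms(2) Z.M.a_inv_closed[OF assms(2)] by blast
 then show ?thesis by (simp add: a_minus_def)
qed

lemma bdry_submodule: "submodule (Bd n) k (Zc n)"
proof (cases n)
 case 0
 interpret Z: module k "Zc n" by (rule mod_cyc)
 show ?thesis unfolding bdry_def 0 nat.case
  by (rule module.submoduleI[OF mod_cyc]) (use 0 Z.M.zero_closed Z.M.a_inv_zero Z.M.l_zero[OF Z.M.zero_closed] Z.smult_r_null in auto)
next
 case (Suc m)
 interpret Z: module k "Zc n" by (rule mod_cyc)
 interpret Km: module k "K m" by (rule mod)
 interpret Kn: module k "K n" by (rule mod)
 note h = d_hom[of m]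
 show ?thesis
 proof (rule module.submoduleI[OF mod_cyc])
  show sub: "Bd n \<subseteq> carrier (Zc n)"
   using k_hom_closed[OF h] d_d[of _ m] by (auto simp: bdry_def Suc cyc_carrier)
  show "\<zero>\<^bsub>Zc n\<^esub> \<in> Bd n"
   using k_hom_zero[OF mod mod h] Km.M.zero_closed by (auto simp: bdry_def Suc image_iff intro!: bexI[of _ "\<zero>\<^bsub>K m\<^esub>"])
  show "\<ominus>\<^bsub>Zc n\<^esub> a \<in> Bd n" if a: "a \<in> Bd n" for a
  proof -
   obtain y where y: "y \<in> carrier (K m)" "a = \<delta> m y" using a by (auto simp: bdry_def Suc)
   have ac: "a \<in> carrier (Zc n)" using a sub by blast
   have "\<ominus>\<^bsub>Zc n\<^esub> a = \<ominus>\<^bsub>K n\<^esub> a"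
    using cyc_minus[OF Z.M.zero_closed ac] ac Z.M.a_inv_closed[OF ac] cyc_sub
    by (simp add: a_minus_def)
   also have "\<dots> = \<delta> m (\<ominus>\<^bsub>K m\<^esub> y)" using k_hom_a_inv[OF mod mod h y(1)] y(2) Suc by simp
   finally show ?thesis using y by (auto simp: bdry_def Suc)
  qed
  show "a \<oplus>\<^bsub>Zc n\<^esub> b \<in> Bd n" if "a \<in> Bd n" "b \<in> Bd n" for a b
   using that k_hom_add[OF h, symmetric] by (auto simp: bdry_def Suc)
  show "c \<odot>\<^bsub>Zc n\<^esub> a \<in> Bd n" if "c \<in> carrier k" "a \<in> Bd n" for c a
   using that k_hom_smult[OF h, symmetric] by (auto simp: bdry_def Suc)
 qed
qed

lemma pair: "submodule_pair k (Zc n) (Bd n)"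
 by (intro submodule_pair.intro mod_cyc bdry_submodule)

lemma mod_H: "module k (Hc n)"
 unfolding cohomology_eq by (rule submodule_pair.module_quot[OF pair])

lemma cls_alt: "Bd n +>\<^bsub>Zc n\<^esub> x = cl n x"
 by (simp add: cls_def a_r_coset_def r_coset_def)

lemma H_carrier: "carrier (Hc n) = cl n ` carrier (Zc n)"
 unfolding cohomology_eq submodule_pair.carrier_quot[OF pair] cls_alt ..

lemma H_zero: "zero (Hc n) = cl n \<zero>\<^bsub>K n\<^esub>"
 unfolding cohomology_eq submodule_pair.zero_quot[OF pair] cls_alt by simp

lemma H_add: "\<lbrakk>x \<in> carrier (Zc n); y \<in> carrier (Zc n)\<rbrakk> \<Longrightarrow>
  cl n x \<oplus>\<^bsub>Hc n\<^esub> cl n y = cl n (x \<oplus>\<^bsub>K n\<^esub> y)"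
 using submodule_pair.add_quot[OF pair, of x n y] by (simp add: cls_alt cohomology_eq)

lemma H_smult: "\<lbrakk>c \<in> carrier k; x \<in> carrier (Zc n)\<rbrakk> \<Longrightarrow>
  c \<odot>\<^bsub>Hc n\<^esub> cl n x = cl n (c \<odot>\<^bsub>K n\<^esub> x)"
 using submodule_pair.smult_quot[OF pair, of c x n] by (simp add: cls_alt cohomology_eq)

lemma cls_eq_iff: "\<lbrakk>x \<in> carrier (Zc n); y \<in> carrier (Zc n)\<rbrakk> \<Longrightarrow>
  cl n x = cl n y \<longleftrightarrow> x \<ominus>\<^bsub>K n\<^esub> y \<in> Bd n"
 using submodule_pair.coset_eq_iff[OF pair, of x n y] by (simp add: cls_alt cyc_minus)

lemma cls_zero_iff: "x \<in> carrier (Zc n) \<Longrightarrow> cl n x = zero (Hc n) \<longleftrightarrow> x \<in> Bd n"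
proof -
 assume x: "x \<in> carrier (Zc n)"
 interpret Z: module k "Zc n" by (rule mod_cyc)
 interpret K: module k "K n" by (rule mod)
 show ?thesis using cls_eq_iff[OF x, of "\<zero>\<^bsub>K n\<^esub>"] Z.M.zero_closed cyc_sub[OF x]
  by (simp add: H_zero K.M.minus_zero_right)
qed

lemma bdry_cyc: "x \<in> Bd n \<Longrightarrow> x \<in> carrier (Zc n)"
 using submodule_pair.H_sub[OF pair] by blast

lemma bdry_zero: "\<zero>\<^bsub>K n\<^esub> \<in> Bd n"
 using submodule_pair.zero_in[OF pair] by simp

lemma bdry_uminus: "x \<in> Bd n \<Longrightarrow> \<ominus>\<^bsub>K n\<^esub> x \<in> Bd n"
proof -
 assume x: "x \<in> Bd n"
 interpret Z: module k "Zc n" by (rule mod_cyc)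
 interpret K: module k "K n" by (rule mod)
 have "\<ominus>\<^bsub>Zc n\<^esub> x \<in> Bd n" using Z.submoduleE(3)[OF bdry_submodule x] .
 then show ?thesis using cyc_minus[OF Z.M.zero_closed bdry_cyc[OF x]] bdry_cyc[OF x]
   Z.M.a_inv_closed[OF bdry_cyc[OF x]] cyc_sub by (simp add: a_minus_def)
qed

end

text \<open>
 The choice of a representative is harmless once \<open>f\<close> maps boundaries to boundaries.
\<close>

definition induced where
 "induced K \<delta> n L \<epsilon> m f T = cls L \<epsilon> m (f (SOME x. x \<in> carrier (cyc K \<delta> n) \<and> cls K \<delta> n x = T))"

lemma induced:
 assumes K: "cx k K \<delta>" and L: "cx k L \<epsilon>" and f: "f \<in> k_hom k (cyc K \<delta> n) (cyc L \<epsilon> m)"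
  and b: "\<And>x. x \<in> bdry K \<delta> n \<Longrightarrow> f x \<in> bdry L \<epsilon> m"
 shows "induced K \<delta> n L \<epsilon> m f \<in> k_hom k (cohomology K \<delta> n) (cohomology L \<epsilon> m)"
  and "x \<in> carrier (cyc K \<delta> n) \<Longrightarrow> induced K \<delta> n L \<epsilon> m f (cls K \<delta> n x) = cls L \<epsilon> m (f x)"
proof -
 interpret K: cx k K \<delta> by fact
 interpret L: cx k L \<epsilon> by fact
 interpret ZK: module k "cyc K \<delta> n" by (rule K.mod_cyc)
 interpret ZL: module k "cyc L \<epsilon> m" by (rule L.mod_cyc)
 show *: "induced K \<delta> n L \<epsilon> m f (cls K \<delta> n x) = cls L \<epsilon> m (f x)" if x: "x \<in> carrier (cyc K \<delta> n)" for x
 proof -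
  define y where "y = (SOME y. y \<in> carrier (cyc K \<delta> n) \<and> cls K \<delta> n y = cls K \<delta> n x)"
  have y: "y \<in> carrier (cyc K \<delta> n)" "cls K \<delta> n y = cls K \<delta> n x"
   using someI[of "\<lambda>y. y \<in> carrier (cyc K \<delta> n) \<and> cls K \<delta> n y = cls K \<delta> n x" x] x by (auto simp: y_def)
  then have "y \<ominus>\<^bsub>cyc K \<delta> n\<^esub> x \<in> bdry K \<delta> n" using K.cls_eq_iff x by (simp add: K.cyc_minus)
  then have "f y \<ominus>\<^bsub>cyc L \<epsilon> m\<^esub> f x \<in> bdry L \<epsilon> m"
   using b k_hom_minus[OF K.mod_cyc L.mod_cyc f y(1) x] by metis
  then have "cls L \<epsilon> m (f y) = cls L \<epsilon> m (f x)"
   using k_hom_closed[OF f] x y(1) by (simp add: L.cls_eq_iff L.cyc_minus)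
  then show ?thesis by (simp add: induced_def y_def)
 qed
 have mem: "f x \<in> carrier (cyc L \<epsilon> m)" if "x \<in> carrier (cyc K \<delta> n)" for x using k_hom_closed[OF f that] .
 show "induced K \<delta> n L \<epsilon> m f \<in> k_hom k (cohomology K \<delta> n) (cohomology L \<epsilon> m)"
 proof (rule k_homI; (unfold K.H_carrier)?; (elim imageE)?)
  show "induced K \<delta> n L \<epsilon> m f T \<in> carrier (cohomology L \<epsilon> m)" if "T = cls K \<delta> n x" "x \<in> carrier (cyc K \<delta> n)" for T x
   using * mem that by (auto simp: L.H_carrier)
  show "induced K \<delta> n L \<epsilon> m f (T \<oplus>\<^bsub>cohomology K \<delta> n\<^esub> S) =
    induced K \<delta> n L \<epsilon> m f T \<oplus>\<^bsub>cohomology L \<epsilon> m\<^esub> induced K \<delta> n L \<epsilon> m f S"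
   if t: "T = cls K \<delta> n x" "x \<in> carrier (cyc K \<delta> n)" "S = cls K \<delta> n y" "y \<in> carrier (cyc K \<delta> n)" for T S x y
  proof -
   have "x \<oplus>\<^bsub>K n\<^esub> y \<in> carrier (cyc K \<delta> n)" using ZK.M.a_closed[OF t(2,4)] by simp
   then show ?thesis using k_hom_add[OF f t(2,4)] t
    by (simp add: * mem K.H_add L.H_add)
  qed
  show "induced K \<delta> n L \<epsilon> m f (c \<odot>\<^bsub>cohomology K \<delta> n\<^esub> T) = c \<odot>\<^bsub>cohomology L \<epsilon> m\<^esub> induced K \<delta> n L \<epsilon> m f T"
   if c: "c \<in> carrier k" and t: "T = cls K \<delta> n x" "x \<in> carrier (cyc K \<delta> n)" for c T x
  proof -
   have "c \<odot>\<^bsub>K n\<^esub> x \<in> carrier (cyc K \<delta> n)" using ZK.smult_closed[OF c t(2)] by simp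
   then show ?thesis using k_hom_smult[OF f c t(2)] t c
    by (simp add: * mem K.H_smult L.H_smult)
  qed
 qed
qed

locale chain_map = K: cx k K \<delta> + L: cx k L \<epsilon> for k :: "'k ring" and K :: "nat \<Rightarrow> ('k, 'x) module" and \<delta>
  and L :: "nat \<Rightarrow> ('k, 'y) module" and \<epsilon> +
 fixes f :: "nat \<Rightarrow> 'x \<Rightarrow> 'y"
 assumes f_hom: "f n \<in> k_hom k (K n) (L n)"
  and f_comm: "x \<in> carrier (K n) \<Longrightarrow> f (Suc n) (\<delta> n x) = \<epsilon> n (f n x)"
begin

abbreviation "Ind n \<equiv> induced K \<delta> n L \<epsilon> n (f n)"

lemma f_cyc: "f n \<in> k_hom k (K.Zc n) (L.Zc n)"
proof (rule k_homI)
 fix x assume x: "x \<in> carrier (K.Zc n)"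
 then have xk: "x \<in> carrier (K n)" "\<delta> n x = \<zero>\<^bsub>K (Suc n)\<^esub>" by (auto simp: cyc_carrier)
 show "f n x \<in> carrier (L.Zc n)"
  using k_hom_closed[OF f_hom xk(1)] f_comm[OF xk(1)] xk(2) k_hom_zero[OF K.mod L.mod f_hom]
  by (simp add: cyc_carrier)
 show "f n (x \<oplus>\<^bsub>K.Zc n\<^esub> y) = f n x \<oplus>\<^bsub>L.Zc n\<^esub> f n y" if "y \<in> carrier (K.Zc n)" for y
  using k_hom_add[OF f_hom xk(1)] that by (simp add: cyc_carrier)
 show "f n (c \<odot>\<^bsub>K.Zc n\<^esub> x) = c \<odot>\<^bsub>L.Zc n\<^esub> f n x" if "c \<in> carrier k" for c
  using k_hom_smult[OF f_hom that xk(1)] by simp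
qed

lemma f_bdry: "x \<in> K.Bd n \<Longrightarrow> f n x \<in> L.Bd n"
 using f_comm k_hom_closed[OF f_hom] k_hom_zero[OF K.mod L.mod f_hom]
 by (auto simp: bdry_def split: nat.splits)

lemma ind:
 "Ind n \<in> k_hom k (K.Hc n) (L.Hc n)"
 "x \<in> carrier (K.Zc n) \<Longrightarrow> Ind n (K.cl n x) = L.cl n (f n x)"
 using induced[OF K.cx_axioms L.cx_axioms f_cyc, of n] f_bdry by blast+

text \<open>
 Bijectivity is reduced to two lifting problems for cocycles, each up to boundaries.
\<close>

lemma quasi_iso_bij:
 assumes surj: "\<And>z. z \<in> carrier (L.Zc n) \<Longrightarrow> \<exists>x\<in>carrier (K.Zc n). z \<ominus>\<^bsub>L n\<^esub> f n x \<in> L.Bd n"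
  and inj: "\<And>x. \<lbrakk>x \<in> carrier (K.Zc n); f n x \<in> L.Bd n\<rbrakk> \<Longrightarrow> x \<in> K.Bd n"
 shows "bij_betw (Ind n) (carrier (K.Hc n)) (carrier (L.Hc n))"
proof -
 note h = ind(1)[where n = n] and e = ind(2)[where n = n]
 interpret HK: module k "K.Hc n" by (rule K.mod_H)
 interpret ZK: module k "K.Zc n" by (rule K.mod_cyc)
 have "inj_on (Ind n) (carrier (K.Hc n))"
 proof (rule inj_onI)
  fix S T assume S: "S \<in> carrier (K.Hc n)" and T: "T \<in> carrier (K.Hc n)"
   and eq: "Ind n S = Ind n T"
  obtain x y where x: "x \<in> carrier (K.Zc n)" "S = K.cl n x" and y: "y \<in> carrier (K.Zc n)" "T = K.cl n y"
   using S T by (auto simp: K.H_carrier)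
  have "f n x \<ominus>\<^bsub>L.Zc n\<^esub> f n y \<in> L.Bd n"
   using eq x y k_hom_closed[OF f_cyc] by (simp add: e L.cls_eq_iff L.cyc_minus)
  then have "f n (x \<ominus>\<^bsub>K.Zc n\<^esub> y) \<in> L.Bd n"
   using k_hom_minus[OF K.mod_cyc L.mod_cyc f_cyc x(1) y(1)] by simp
  then have "x \<ominus>\<^bsub>K.Zc n\<^esub> y \<in> K.Bd n" using inj ZK.M.minus_closed[OF x(1) y(1)] by blast
  then show "S = T" using x y by (simp add: K.cls_eq_iff K.cyc_minus)
 qed
 moreover have "Ind n ` carrier (K.Hc n) = carrier (L.Hc n)"
 proof (intro subset_antisym subsetI)
  show "T \<in> carrier (L.Hc n)" if "T \<in> Ind n ` carrier (K.Hc n)" for T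
   using that k_hom_closed[OF h] by blast
  fix T assume "T \<in> carrier (L.Hc n)"
  then obtain z where z: "z \<in> carrier (L.Zc n)" "T = L.cl n z" by (auto simp: L.H_carrier)
  from surj[OF z(1)] obtain x where x: "x \<in> carrier (K.Zc n)" "z \<ominus>\<^bsub>L n\<^esub> f n x \<in> L.Bd n" by blast
  have "L.cl n z = L.cl n (f n x)" using L.cls_eq_iff[OF z(1) k_hom_closed[OF f_cyc x(1)]] x(2) by simp
  then show "T \<in> Ind n ` carrier (K.Hc n)"
   using x(1) z(2) e[OF x(1)] by (auto simp: K.H_carrier image_iff)
 qed
 ultimately show ?thesis by (simp add: bij_betw_def)
qed

lemma iso_bij:
 assumes bij: "\<And>n. bij_betw (f n) (carrier (K n)) (carrier (L n))"
 shows "bij_betw (Ind n) (carrier (K.Hc n)) (carrier (L.Hc n))"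
proof (rule quasi_iso_bij)
 have inj: "x = y" if "x \<in> carrier (K n)" "y \<in> carrier (K n)" "f n x = f n y" for x y n
  using bij[of n] that by (auto simp: bij_betw_def inj_on_def)
 have surj: "\<exists>x\<in>carrier (K n). f n x = y" if "y \<in> carrier (L n)" for y n
 proof -
  have "y \<in> f n ` carrier (K n)" using bij[of n] that by (simp add: bij_betw_def)
  then show ?thesis by blast
 qed
 have z: "f n \<zero>\<^bsub>K n\<^esub> = \<zero>\<^bsub>L n\<^esub>" for n by (rule k_hom_zero[OF K.mod L.mod f_hom])
 have zc: "\<zero>\<^bsub>K n\<^esub> \<in> carrier (K n)" for n
 proof -
  interpret module k "K n" by (rule K.mod)
  show ?thesis by simp
 qed
 show "\<exists>x\<in>carrier (K.Zc n). y \<ominus>\<^bsub>L n\<^esub> f n x \<in> L.Bd n" if y: "y \<in> carrier (L.Zc n)" for y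
 proof -
  interpret Ln: module k "L n" by (rule L.mod)
  obtain x where x: "x \<in> carrier (K n)" "f n x = y" using surj y L.cyc_sub by blast
  have "f (Suc n) (\<delta> n x) = f (Suc n) \<zero>\<^bsub>K (Suc n)\<^esub>" using f_comm[OF x(1)] x(2) y z by (simp add: cyc_carrier)
  then have "\<delta> n x = \<zero>\<^bsub>K (Suc n)\<^esub>" using inj k_hom_closed[OF K.d_hom x(1)] zc by blast
  then have "x \<in> carrier (K.Zc n)" using x by (simp add: cyc_carrier)
  moreover have "y \<ominus>\<^bsub>L n\<^esub> f n x = \<zero>\<^bsub>L n\<^esub>" using x L.cyc_sub[OF y] by (simp add: a_minus_def Ln.M.r_neg)
  ultimately show ?thesis using L.bdry_zero by force
 qed
 show "x \<in> K.Bd n" if x: "x \<in> carrier (K.Zc n)" "f n x \<in> L.Bd n" for x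
 proof (cases n)
  case 0
  then show ?thesis using x inj[of x 0 "\<zero>\<^bsub>K 0\<^esub>"] z[of 0] zc[of 0] K.cyc_sub[OF x(1)] by (simp add: bdry_def)
 next
  case (Suc m)
  then obtain b where b: "b \<in> carrier (L m)" "f n x = \<epsilon> m b" using x by (auto simp: bdry_def)
  obtain a where a: "a \<in> carrier (K m)" "f m a = b" using surj b by blast
  have "f n x = f n (\<delta> m a)" using f_comm[OF a(1)] a b Suc by simp
  then have "x = \<delta> m a" using inj K.cyc_sub[OF x(1)] k_hom_closed[OF K.d_hom a(1)] Suc by blast
  then show ?thesis using a Suc by (simp add: bdry_def)
 qed
qed

end

section \<open>Long exact sequences\<close>

text \<open>
 The maps are conjugated by the isomorphisms. Those for \<open>U\<close> point the other way because relative Ext is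
 mapped to cochains, while cochains are mapped to Hochschild cohomology.
\<close>

lemma has_long_exact_sequence_transfer:
 fixes k :: "'k ring"
 assumes les: "has_long_exact_sequence k U V W"
  and mU: "\<And>n. module k (U n)" "\<And>n. module k (U' n)" and mV: "\<And>n. module k (V n)" "\<And>n. module k (V' n)"
  and mW: "\<And>n. module k (W n)" "\<And>n. module k (W' n)"
  and u: "\<And>n. u n \<in> k_hom k (U' n) (U n)" "\<And>n. bij_betw (u n) (carrier (U' n)) (carrier (U n))"
  and v: "\<And>n. v n \<in> k_hom k (V n) (V' n)" "\<And>n. bij_betw (v n) (carrier (V n)) (carrier (V' n))"
  and w: "\<And>n. w n \<in> k_hom k (W n) (W' n)" "\<And>n. bij_betw (w n) (carrier (W n)) (carrier (W' n))"
 shows "has_long_exact_sequence k U' V' W'"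
proof -
 have inv: "\<exists>f'. \<forall>n. f' n \<in> k_hom k (Q n) (P n) \<and> (\<forall>x\<in>carrier (P n). f' n (f n x) = x) \<and> (\<forall>y\<in>carrier (Q n). f n (f' n y) = y)"
  if f: "\<And>n. f n \<in> k_hom k (P n) (Q n)" and b: "\<And>n. bij_betw (f n) (carrier (P n)) (carrier (Q n))"
   and m: "\<And>n. module k (P n)" "\<And>n. module k (Q n)"
  for f :: "nat \<Rightarrow> 'p \<Rightarrow> 'q" and P :: "nat \<Rightarrow> ('k, 'p) module" and Q :: "nat \<Rightarrow> ('k, 'q) module"
 proof (intro exI allI)
  fix n
  interpret P: module k "P n" by (rule m)
  interpret Q: module k "Q n" by (rule m)
  let ?g = "inv_into (carrier (P n)) (f n)"
  have i: "inj_on (f n) (carrier (P n))" and s: "f n ` carrier (P n) = carrier (Q n)"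
   using b[of n] by (auto simp: bij_betw_def)
  have gf: "?g (f n x) = x" if "x \<in> carrier (P n)" for x using inv_into_f_f[OF i that] .
  have fg: "f n (?g y) = y" if "y \<in> carrier (Q n)" for y using f_inv_into_f[of y "f n" "carrier (P n)"] that s by simp
  have gc: "?g y \<in> carrier (P n)" if "y \<in> carrier (Q n)" for y using inv_into_into[of y "f n" "carrier (P n)"] that s by simp
  have "?g \<in> k_hom k (Q n) (P n)"
  proof (rule k_homI)
   fix x assume x: "x \<in> carrier (Q n)"
   then show "?g x \<in> carrier (P n)" by (rule gc)
   show "?g (x \<oplus>\<^bsub>Q n\<^esub> y) = ?g x \<oplus>\<^bsub>P n\<^esub> ?g y" if y: "y \<in> carrier (Q n)" for y
    using gf[of "?g x \<oplus>\<^bsub>P n\<^esub> ?g y"] k_hom_add[OF f gc[OF x] gc[OF y]] fg x y gc by simp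
   show "?g (c \<odot>\<^bsub>Q n\<^esub> x) = c \<odot>\<^bsub>P n\<^esub> ?g x" if c: "c \<in> carrier k" for c
    using gf[of "c \<odot>\<^bsub>P n\<^esub> ?g x"] k_hom_smult[OF f c gc[OF x]] fg x c gc by simp
  qed
  then show "?g \<in> k_hom k (Q n) (P n) \<and> (\<forall>x\<in>carrier (P n). ?g (f n x) = x) \<and> (\<forall>y\<in>carrier (Q n). f n (?g y) = y)"
   using gf fg by blast
 qed
 obtain u' where u': "\<And>n. u' n \<in> k_hom k (U n) (U' n)" "\<And>n x. x \<in> carrier (U' n) \<Longrightarrow> u' n (u n x) = x"
   "\<And>n x. x \<in> carrier (U n) \<Longrightarrow> u n (u' n x) = x"
  using inv[of u U' U, OF u mU(2,1)] by metis
 obtain v' where v': "\<And>n. v' n \<in> k_hom k (V' n) (V n)" "\<And>n x. x \<in> carrier (V n) \<Longrightarrow> v' n (v n x) = x"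
   "\<And>n x. x \<in> carrier (V' n) \<Longrightarrow> v n (v' n x) = x"
  using inv[of v V V', OF v mV] by metis
 obtain w' where w': "\<And>n. w' n \<in> k_hom k (W' n) (W n)" "\<And>n x. x \<in> carrier (W n) \<Longrightarrow> w' n (w n x) = x"
   "\<And>n x. x \<in> carrier (W' n) \<Longrightarrow> w n (w' n x) = x"
  using inv[of w W W', OF w mW] by metis
 from les obtain \<alpha> \<beta> \<gamma> where
  h: "\<And>n. \<alpha> n \<in> k_hom k (U n) (V n)" "\<And>n. \<beta> n \<in> k_hom k (V n) (W n)" "\<And>n. \<gamma> n \<in> k_hom k (W n) (U (Suc n))"
  and inj: "inj_on (\<alpha> 0) (carrier (U 0))"
  and ex: "\<And>n. exact_at (U n) (\<alpha> n) (V n) (\<beta> n) (W n)" "\<And>n. exact_at (V n) (\<beta> n) (W n) (\<gamma> n) (U (Suc n))"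
   "\<And>n. exact_at (W n) (\<gamma> n) (U (Suc n)) (\<alpha> (Suc n)) (V (Suc n))"
  unfolding has_long_exact_sequence_def by blast
 have exact: "exact_at P' (\<lambda>x. q (f (p' x))) Q' (\<lambda>x. r (g (q' x))) R'"
  if e: "exact_at P f Q g R" and hf: "f \<in> k_hom k P Q" "g \<in> k_hom k Q R" and mm: "module k R" "module k R'"
  and p: "p \<in> k_hom k P P'" "p' \<in> k_hom k P' P" "\<And>x. x \<in> carrier P \<Longrightarrow> p' (p x) = x"
  and q: "q \<in> k_hom k Q Q'" "q' \<in> k_hom k Q' Q" "\<And>x. x \<in> carrier Q \<Longrightarrow> q' (q x) = x" "\<And>x. x \<in> carrier Q' \<Longrightarrow> q (q' x) = x"
  and r: "r \<in> k_hom k R R'" "r' \<in> k_hom k R' R" "\<And>x. x \<in> carrier R \<Longrightarrow> r' (r x) = x"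
  for P :: "('k, 'p) module" and P' :: "('k, 'p') module" and Q :: "('k, 'q) module" and Q' :: "('k, 'q') module"
   and R :: "('k, 'r) module" and R' :: "('k, 'r') module" and f g p p' q q' r r'
  unfolding exact_at_def
 proof (intro subset_antisym subsetI)
  fix y assume "y \<in> (\<lambda>x. q (f (p' x))) ` carrier P'"
  then obtain x where x: "x \<in> carrier P'" "y = q (f (p' x))" by blast
  have fx: "f (p' x) \<in> carrier Q" "p' x \<in> carrier P" using k_hom_closed[OF p(2) x(1)] k_hom_closed[OF hf(1)] by auto
  have "g (f (p' x)) = \<zero>\<^bsub>R\<^esub>" using e fx unfolding exact_at_def by blast
  then show "y \<in> {y \<in> carrier Q'. r (g (q' y)) = \<zero>\<^bsub>R'\<^esub>}"
   using x(2) fx k_hom_closed[OF q(1)] q(3) k_hom_zero[OF mm r(1)] by simp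
 next
  fix y assume "y \<in> {y \<in> carrier Q'. r (g (q' y)) = \<zero>\<^bsub>R'\<^esub>}"
  then have y: "y \<in> carrier Q'" "r (g (q' y)) = \<zero>\<^bsub>R'\<^esub>" by auto
  have qy: "q' y \<in> carrier Q" by (rule k_hom_closed[OF q(2) y(1)])
  have "g (q' y) = r' (r (g (q' y)))" using r(3)[OF k_hom_closed[OF hf(2) qy]] by simp
  then have "g (q' y) = \<zero>\<^bsub>R\<^esub>" using y(2) k_hom_zero[OF mm(2,1) r(2)] by simp
  then obtain x where x: "x \<in> carrier P" "q' y = f x" using e qy unfolding exact_at_def by blast
  have "y = q (f (p' (p x)))" using x p(3) q(4)[OF y(1)] by simp
  then show "y \<in> (\<lambda>x. q (f (p' x))) ` carrier P'" using k_hom_closed[OF p(1) x(1)] by blast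
 qed
 show ?thesis
  unfolding has_long_exact_sequence_def
 proof (intro exI conjI allI)
  fix n
  show "(\<lambda>x. v n (\<alpha> n (u n x))) \<in> k_hom k (U' n) (V' n)"
   by (rule k_hom_compose[OF k_hom_compose[OF u(1) h(1)] v(1)])
  show "(\<lambda>x. w n (\<beta> n (v' n x))) \<in> k_hom k (V' n) (W' n)"
   by (rule k_hom_compose[OF k_hom_compose[OF v'(1) h(2)] w(1)])
  show "(\<lambda>x. u' (Suc n) (\<gamma> n (w' n x))) \<in> k_hom k (W' n) (U' (Suc n))"
   by (rule k_hom_compose[OF k_hom_compose[OF w'(1) h(3)] u'(1)])
  show "exact_at (U' n) (\<lambda>x. v n (\<alpha> n (u n x))) (V' n) (\<lambda>x. w n (\<beta> n (v' n x))) (W' n)"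
   by (rule exact[OF ex(1) h(1,2) mW u'(1) u(1) u'(3) v(1) v'(1) v'(2,3) w(1) w'(1,2)])
  show "exact_at (V' n) (\<lambda>x. w n (\<beta> n (v' n x))) (W' n) (\<lambda>x. u' (Suc n) (\<gamma> n (w' n x))) (U' (Suc n))"
   by (rule exact[OF ex(2) h(2,3) mU v(1) v'(1) v'(2) w(1) w'(1) w'(2,3) u'(1) u(1) u'(3)])
  show "exact_at (W' n) (\<lambda>x. u' (Suc n) (\<gamma> n (w' n x))) (U' (Suc n)) (\<lambda>x. v (Suc n) (\<alpha> (Suc n) (u (Suc n) x))) (V' (Suc n))"
   by (rule exact[OF ex(3) h(3,1) mV w(1) w'(1) w'(2) u'(1) u(1) u'(3,2) v(1) v'(1,2)])
 next
  show "inj_on (\<lambda>x. v 0 (\<alpha> 0 (u 0 x))) (carrier (U' 0))"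
  proof (rule inj_onI)
   fix x y assume x: "x \<in> carrier (U' 0)" and y: "y \<in> carrier (U' 0)" and eq: "v 0 (\<alpha> 0 (u 0 x)) = v 0 (\<alpha> 0 (u 0 y))"
   have uc: "u 0 x \<in> carrier (U 0)" "u 0 y \<in> carrier (U 0)" using k_hom_closed[OF u(1)] x y by auto
   have "\<alpha> 0 (u 0 x) = \<alpha> 0 (u 0 y)"
    using arg_cong[OF eq, of "v' 0"] v'(2)[OF k_hom_closed[OF h(1) uc(1)]] v'(2)[OF k_hom_closed[OF h(1) uc(2)]] by simp
   then have "u 0 x = u 0 y" using inj uc by (auto simp: inj_on_def)
   then show "x = y" using u'(2) x y by metis
  qed
 qed
qed

locale split_ses = U: cx k U dU + V: cx k V dV + W: cx k W dW
 for k :: "'k ring" and U :: "nat \<Rightarrow> ('k, 'u) module" and dU and V :: "nat \<Rightarrow> ('k, 'v) module" and dV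
  and W :: "nat \<Rightarrow> ('k, 'w) module" and dW +
 fixes i :: "nat \<Rightarrow> 'u \<Rightarrow> 'v" and p :: "nat \<Rightarrow> 'v \<Rightarrow> 'w" and s :: "nat \<Rightarrow> 'w \<Rightarrow> 'v" and r :: "nat \<Rightarrow> 'v \<Rightarrow> 'u"
 assumes i_hom: "i n \<in> k_hom k (U n) (V n)" and p_hom: "p n \<in> k_hom k (V n) (W n)"
  and s_hom: "s n \<in> k_hom k (W n) (V n)" and r_hom: "r n \<in> k_hom k (V n) (U n)"
  and i_comm: "x \<in> carrier (U n) \<Longrightarrow> i (Suc n) (dU n x) = dV n (i n x)"
  and p_comm: "y \<in> carrier (V n) \<Longrightarrow> p (Suc n) (dV n y) = dW n (p n y)"
  and r_i: "x \<in> carrier (U n) \<Longrightarrow> r n (i n x) = x"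
  and p_s: "z \<in> carrier (W n) \<Longrightarrow> p n (s n z) = z"
  and i_r: "y \<in> carrier (V n) \<Longrightarrow> i n (r n y) \<oplus>\<^bsub>V n\<^esub> s n (p n y) = y"
begin

interpretation I: chain_map k U dU V dV i
 by unfold_locales (rule i_hom, rule i_comm)

interpretation P: chain_map k V dV W dW p
 by unfold_locales (rule p_hom, rule p_comm)

lemma V_ab: "abelian_group (V n)" and U_ab: "abelian_group (U n)" and W_ab: "abelian_group (W n)"
 using V.mod U.mod W.mod by (simp_all add: module_def)

lemma i_cl: "x \<in> carrier (U n) \<Longrightarrow> i n x \<in> carrier (V n)" and p_cl: "y \<in> carrier (V n) \<Longrightarrow> p n y \<in> carrier (W n)"
 and s_cl: "z \<in> carrier (W n) \<Longrightarrow> s n z \<in> carrier (V n)" and r_cl: "y \<in> carrier (V n) \<Longrightarrow> r n y \<in> carrier (U n)"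
 by (rule k_hom_closed[OF i_hom] k_hom_closed[OF p_hom] k_hom_closed[OF s_hom] k_hom_closed[OF r_hom]; assumption)+

lemma dV_cl: "y \<in> carrier (V n) \<Longrightarrow> dV n y \<in> carrier (V (Suc n))" and dU_cl: "x \<in> carrier (U n) \<Longrightarrow> dU n x \<in> carrier (U (Suc n))"
 by (rule k_hom_closed[OF V.d_hom] k_hom_closed[OF U.d_hom]; assumption)+

lemma p_i: assumes x: "x \<in> carrier (U n)" shows "p n (i n x) = \<zero>\<^bsub>W n\<^esub>"
proof -
 interpret V: abelian_group "V n" by (rule V_ab)
 have "i n x \<oplus>\<^bsub>V n\<^esub> s n (p n (i n x)) = i n x" using i_r[OF i_cl[OF x]] r_i[OF x] by simp
 then have "s n (p n (i n x)) = \<zero>\<^bsub>V n\<^esub>"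
  using V.add.l_cancel_one'[of "i n x" "s n (p n (i n x))"] i_cl[OF x] s_cl[OF p_cl[OF i_cl[OF x]]] by metis
 then have "p n (i n x) = p n \<zero>\<^bsub>V n\<^esub>" using p_s[OF p_cl[OF i_cl[OF x]]] by simp
 then show ?thesis using k_hom_zero[OF V.mod W.mod p_hom] by simp
qed

lemma i_r_kernel: "\<lbrakk>y \<in> carrier (V n); p n y = \<zero>\<^bsub>W n\<^esub>\<rbrakk> \<Longrightarrow> i n (r n y) = y"
proof -
 assume y: "y \<in> carrier (V n)" "p n y = \<zero>\<^bsub>W n\<^esub>"
 interpret V: abelian_group "V n" by (rule V_ab)
 show ?thesis using i_r[OF y(1)] y k_hom_zero[OF W.mod V.mod s_hom] i_cl[OF r_cl[OF y(1)]] by simp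
qed

lemma s_p: "y \<in> carrier (V n) \<Longrightarrow> s n (p n y) = y \<ominus>\<^bsub>V n\<^esub> i n (r n y)"
proof -
 assume y: "y \<in> carrier (V n)"
 interpret V: abelian_group "V n" by (rule V_ab)
 show ?thesis by (rule V.eq_minusI) (use y i_r[OF y] in \<open>simp_all add: i_cl r_cl s_cl p_cl V.a_comm\<close>)
qed

lemma i_inj: "\<lbrakk>x \<in> carrier (U n); y \<in> carrier (U n); i n x = i n y\<rbrakk> \<Longrightarrow> x = y"
 using r_i by metis

text \<open>
 The section \<open>s\<close> need not commute with the differentials; by exactness, \<open>dV (s z)\<close> comes from \<open>U\<close> for a
 cocycle \<open>z\<close>, and \<open>r\<close> recovers its preimage. This represents the connecting homomorphism.
\<close>

definition "conn n z = r (Suc n) (dV n (s n z))"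

lemma conn_raw: "conn n \<in> k_hom k (W n) (U (Suc n))"
 unfolding conn_def by (rule k_hom_compose[OF k_hom_compose[OF s_hom V.d_hom] r_hom])

lemma i_conn: "z \<in> carrier (W.Zc n) \<Longrightarrow> i (Suc n) (conn n z) = dV n (s n z)"
proof -
 assume z: "z \<in> carrier (W.Zc n)"
 then have zW: "z \<in> carrier (W n)" "dW n z = \<zero>\<^bsub>W (Suc n)\<^esub>" by (auto simp: cyc_carrier)
 show ?thesis unfolding conn_def
  by (rule i_r_kernel) (use zW p_comm[OF s_cl[OF zW(1)]] in \<open>simp_all add: dV_cl s_cl p_s\<close>)
qed

lemma conn_hom: "conn n \<in> k_hom k (W.Zc n) (U.Zc (Suc n))"
proof (rule k_homI)
 fix z assume z: "z \<in> carrier (W.Zc n)"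
 then have zW: "z \<in> carrier (W n)" by (auto simp: cyc_carrier)
 have c: "conn n z \<in> carrier (U (Suc n))" by (rule k_hom_closed[OF conn_raw zW])
 have "i (Suc (Suc n)) (dU (Suc n) (conn n z)) = dV (Suc n) (dV n (s n z))"
  using i_comm[OF c] i_conn[OF z] by simp
 also have "\<dots> = i (Suc (Suc n)) \<zero>\<^bsub>U (Suc (Suc n))\<^esub>"
  using V.d_d[OF s_cl[OF zW]] k_hom_zero[OF U.mod V.mod i_hom] by simp
 finally have "dU (Suc n) (conn n z) = \<zero>\<^bsub>U (Suc (Suc n))\<^esub>"
  using i_inj dU_cl[OF c] abelian_group.axioms(1)[OF U_ab] abelian_monoid.zero_closed by blast
 then show "conn n z \<in> carrier (U.Zc (Suc n))" using c by (simp add: cyc_carrier)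
 show "conn n (z \<oplus>\<^bsub>W.Zc n\<^esub> y) = conn n z \<oplus>\<^bsub>U.Zc (Suc n)\<^esub> conn n y" if "y \<in> carrier (W.Zc n)" for y
  using k_hom_add[OF conn_raw zW W.cyc_sub[OF that]] by simp
 show "conn n (c \<odot>\<^bsub>W.Zc n\<^esub> z) = c \<odot>\<^bsub>U.Zc (Suc n)\<^esub> conn n z" if "c \<in> carrier k" for c
  using k_hom_smult[OF conn_raw that zW] by simp
qed

lemma conn_p:
 assumes y: "y \<in> carrier (V n)"
 shows "conn n (p n y) = r (Suc n) (dV n y) \<ominus>\<^bsub>U (Suc n)\<^esub> dU n (r n y)"
proof -
 have "dV n (s n (p n y)) = dV n y \<ominus>\<^bsub>V (Suc n)\<^esub> i (Suc n) (dU n (r n y))"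
  using k_hom_minus[OF V.mod V.mod V.d_hom y i_cl[OF r_cl[OF y]]] s_p[OF y] i_comm[OF r_cl[OF y]] by simp
 then show ?thesis unfolding conn_def
  using k_hom_minus[OF V.mod U.mod r_hom dV_cl[OF y] i_cl[OF dU_cl[OF r_cl[OF y]]]] r_i[OF dU_cl[OF r_cl[OF y]]] by simp
qed

lemma bdry_Suc: "x \<in> carrier (U n) \<Longrightarrow> dU n x \<in> U.Bd (Suc n)"
 by (simp add: bdry_def)

lemma conn_bdry: "z \<in> W.Bd n \<Longrightarrow> conn n z \<in> U.Bd (Suc n)"
proof (cases n)
 case 0
 assume "z \<in> W.Bd n"
 then have "conn n z = \<zero>\<^bsub>U (Suc n)\<^esub>" using k_hom_zero[OF W.mod U.mod conn_raw] 0 by (simp add: bdry_def)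
 then show ?thesis using U.bdry_zero by simp
next
 case (Suc m)
 assume "z \<in> W.Bd n"
 then obtain w where w: "w \<in> carrier (W m)" "z = dW m w" by (auto simp: bdry_def Suc)
 let ?y = "dV m (s m w)"
 have y: "?y \<in> carrier (V n)" "p n ?y = z"
  using w p_comm[OF s_cl[OF w(1)]] by (simp_all add: Suc dV_cl s_cl p_s)
 interpret U: abelian_group "U (Suc n)" by (rule U_ab)
 have "dV n ?y = \<zero>\<^bsub>V (Suc n)\<^esub>" using V.d_d[OF s_cl[OF w(1)]] Suc by simp
 then have "conn n z = \<ominus>\<^bsub>U (Suc n)\<^esub> dU n (r n ?y)"
  using conn_p[OF y(1)] y k_hom_zero[OF V.mod U.mod r_hom] dU_cl[OF r_cl[OF y(1)]] by (simp add: a_minus_def)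
 then show ?thesis using U.bdry_uminus[OF bdry_Suc[OF r_cl[OF y(1)]]] by simp
qed

lemma conn_ind:
 "induced W dW n U dU (Suc n) (conn n) \<in> k_hom k (W.Hc n) (U.Hc (Suc n))"
 "z \<in> carrier (W.Zc n) \<Longrightarrow> induced W dW n U dU (Suc n) (conn n) (W.cl n z) = U.cl (Suc n) (conn n z)"
 using induced[OF W.cx_axioms U.cx_axioms conn_hom, of n] conn_bdry by blast+

lemma long_exact_sequence:
 "has_long_exact_sequence k (U.Hc) (V.Hc) (W.Hc)"
proof -
 let ?a = "\<lambda>n. induced U dU n V dV n (i n)"
 let ?b = "\<lambda>n. induced V dV n W dW n (p n)"
 let ?g = "\<lambda>n. induced W dW n U dU (Suc n) (conn n)"
 note ae = I.ind(2) and be = P.ind(2) and ge = conn_ind(2)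
 have icyc: "i n x \<in> carrier (V.Zc n)" if "x \<in> carrier (U.Zc n)" for n x using k_hom_closed[OF I.f_cyc that] .
 have pcyc: "p n x \<in> carrier (W.Zc n)" if "x \<in> carrier (V.Zc n)" for n x using k_hom_closed[OF P.f_cyc that] .
 have ccyc: "conn n x \<in> carrier (U.Zc (Suc n))" if "x \<in> carrier (W.Zc n)" for n x using k_hom_closed[OF conn_hom that] .
 have i_cyc_rev: "u \<in> carrier (U.Zc n)" if u: "u \<in> carrier (U n)" and c: "i n u \<in> carrier (V.Zc n)" for u n
 proof -
  interpret U: abelian_group "U (Suc n)" by (rule U_ab)
  have "i (Suc n) (dU n u) = i (Suc n) \<zero>\<^bsub>U (Suc n)\<^esub>" using i_comm[OF u] c k_hom_zero[OF U.mod V.mod i_hom] by (simp add: cyc_carrier)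
  then have "dU n u = \<zero>\<^bsub>U (Suc n)\<^esub>" using i_inj dU_cl[OF u] by blast
  then show ?thesis using u by (simp add: cyc_carrier)
 qed
 show ?thesis unfolding has_long_exact_sequence_def
 proof (intro exI conjI allI)
  fix n
  show "?a n \<in> k_hom k (U.Hc n) (V.Hc n)" by (rule I.ind(1))
  show "?b n \<in> k_hom k (V.Hc n) (W.Hc n)" by (rule P.ind(1))
  show "?g n \<in> k_hom k (W.Hc n) (U.Hc (Suc n))" by (rule conn_ind(1))
  interpret Vn: abelian_group "V n" by (rule V_ab)
  interpret VS: abelian_group "V (Suc n)" by (rule V_ab)
  interpret US: abelian_group "U (Suc n)" by (rule U_ab)
  interpret Wn: abelian_group "W n" by (rule W_ab)
  interpret ZV: module k "V.Zc n" by (rule V.mod_cyc)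
  show "exact_at (U.Hc n) (?a n) (V.Hc n) (?b n) (W.Hc n)"
   unfolding exact_at_def
  proof (intro subset_antisym subsetI)
   fix T assume "T \<in> ?a n ` carrier (U.Hc n)"
   then obtain x where x: "x \<in> carrier (U.Zc n)" "T = V.cl n (i n x)" by (auto simp: U.H_carrier ae)
   have "?b n T = W.cl n \<zero>\<^bsub>W n\<^esub>" using x be[OF icyc[OF x(1)]] p_i[OF U.cyc_sub[OF x(1)]] by simp
   then show "T \<in> {T \<in> carrier (V.Hc n). ?b n T = \<zero>\<^bsub>W.Hc n\<^esub>}"
    using x icyc[OF x(1)] by (simp add: V.H_carrier W.H_zero)
  next
   fix T assume "T \<in> {T \<in> carrier (V.Hc n). ?b n T = \<zero>\<^bsub>W.Hc n\<^esub>}"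
   then obtain v where v: "v \<in> carrier (V.Zc n)" "T = V.cl n v" "?b n T = \<zero>\<^bsub>W.Hc n\<^esub>" by (auto simp: V.H_carrier)
   have pv: "p n v \<in> W.Bd n" using v be[OF v(1)] W.cls_zero_iff[OF pcyc[OF v(1)]] by simp
   have vV: "v \<in> carrier (V n)" by (rule V.cyc_sub[OF v(1)])
   have "\<exists>b\<in>V.Bd n. p n b = p n v"
   proof (cases n)
    case 0
    then have "p n \<zero>\<^bsub>V n\<^esub> = p n v" using pv k_hom_zero[OF V.mod W.mod p_hom] by (simp add: bdry_def)
    then show ?thesis using V.bdry_zero by blast
   next
    case (Suc m)
    then obtain w where w: "w \<in> carrier (W m)" "p n v = dW m w" using pv by (auto simp: bdry_def)
    have "p n (dV m (s m w)) = p n v" using p_comm[OF s_cl[OF w(1)]] w p_s Suc by simp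
    then show ?thesis using s_cl[OF w(1)] Suc by (auto simp: bdry_def)
   qed
   then obtain b where b: "b \<in> V.Bd n" "p n b = p n v" by blast
   have bc: "b \<in> carrier (V.Zc n)" by (rule V.bdry_cyc[OF b(1)])
   let ?d = "v \<ominus>\<^bsub>V n\<^esub> b"
   have dc: "?d \<in> carrier (V.Zc n)" using ZV.M.minus_closed[OF v(1) bc] V.cyc_minus[OF v(1) bc] by simp
   have "p n ?d = \<zero>\<^bsub>W n\<^esub>"
    using k_hom_minus[OF V.mod W.mod p_hom vV V.cyc_sub[OF bc]] b(2) p_cl[OF vV] by (simp add: a_minus_def Wn.r_neg)
   then have id: "i n (r n ?d) = ?d" by (rule i_r_kernel[OF V.cyc_sub[OF dc]])
   have rc: "r n ?d \<in> carrier (U.Zc n)" by (rule i_cyc_rev) (use id dc r_cl[OF V.cyc_sub[OF dc]] in simp_all)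
   have "v \<ominus>\<^bsub>V n\<^esub> ?d = b" using vV V.cyc_sub[OF bc]
    by (simp add: a_minus_def Vn.minus_add Vn.a_assoc[symmetric] Vn.r_neg)
   then have "V.cl n v = V.cl n (i n (r n ?d))" unfolding id using V.cls_eq_iff[OF v(1) dc] b(1) by simp
   then show "T \<in> ?a n ` carrier (U.Hc n)"
    unfolding U.H_carrier v(2) using ae[OF rc] rc by auto
  qed
  show "exact_at (V.Hc n) (?b n) (W.Hc n) (?g n) (U.Hc (Suc n))"
   unfolding exact_at_def
  proof (intro subset_antisym subsetI)
   fix T assume "T \<in> ?b n ` carrier (V.Hc n)"
   then obtain v where v: "v \<in> carrier (V.Zc n)" "T = W.cl n (p n v)" by (auto simp: V.H_carrier be)
   have vV: "v \<in> carrier (V n)" "dV n v = \<zero>\<^bsub>V (Suc n)\<^esub>" using v by (auto simp: cyc_carrier)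
   have "conn n (p n v) = \<ominus>\<^bsub>U (Suc n)\<^esub> dU n (r n v)"
    using conn_p[OF vV(1)] vV k_hom_zero[OF V.mod U.mod r_hom] dU_cl[OF r_cl[OF vV(1)]] by (simp add: a_minus_def)
   then have "conn n (p n v) \<in> U.Bd (Suc n)" using U.bdry_uminus[OF bdry_Suc[OF r_cl[OF vV(1)]]] by simp
   then have "?g n T = \<zero>\<^bsub>U.Hc (Suc n)\<^esub>"
    using v ge[OF pcyc[OF v(1)]] U.cls_zero_iff[OF ccyc[OF pcyc[OF v(1)]]] by simp
   then show "T \<in> {T \<in> carrier (W.Hc n). ?g n T = \<zero>\<^bsub>U.Hc (Suc n)\<^esub>}"
    using v pcyc[OF v(1)] by (simp add: W.H_carrier)
  next
   fix T assume "T \<in> {T \<in> carrier (W.Hc n). ?g n T = \<zero>\<^bsub>U.Hc (Suc n)\<^esub>}"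
   then obtain z where z: "z \<in> carrier (W.Zc n)" "T = W.cl n z" "?g n T = \<zero>\<^bsub>U.Hc (Suc n)\<^esub>" by (auto simp: W.H_carrier)
   have "conn n z \<in> U.Bd (Suc n)" using z ge[OF z(1)] U.cls_zero_iff[OF ccyc[OF z(1)]] by simp
   then obtain u where u: "u \<in> carrier (U n)" "conn n z = dU n u" by (auto simp: bdry_def)
   have zW: "z \<in> carrier (W n)" by (rule W.cyc_sub[OF z(1)])
   let ?v = "s n z \<ominus>\<^bsub>V n\<^esub> i n u"
   have "dV n ?v = dV n (s n z) \<ominus>\<^bsub>V (Suc n)\<^esub> i (Suc n) (dU n u)"
    using k_hom_minus[OF V.mod V.mod V.d_hom s_cl[OF zW] i_cl[OF u(1)]] i_comm[OF u(1)] by simp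
   also have "\<dots> = \<zero>\<^bsub>V (Suc n)\<^esub>" using i_conn[OF z(1)] u(2) dV_cl[OF s_cl[OF zW]] by (simp add: a_minus_def VS.r_neg)
   finally have vc: "?v \<in> carrier (V.Zc n)" using s_cl[OF zW] i_cl[OF u(1)] by (simp add: cyc_carrier)
   have "p n ?v = z" using k_hom_minus[OF V.mod W.mod p_hom s_cl[OF zW] i_cl[OF u(1)]] p_s[OF zW] p_i[OF u(1)] zW
    by (simp add: Wn.minus_zero_right)
   then show "T \<in> ?b n ` carrier (V.Hc n)"
    unfolding V.H_carrier z(2) using be[OF vc] vc by (metis image_eqI)
  qed
  show "exact_at (W.Hc n) (?g n) (U.Hc (Suc n)) (?a (Suc n)) (V.Hc (Suc n))"
   unfolding exact_at_def
  proof (intro subset_antisym subsetI)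
   fix T assume "T \<in> ?g n ` carrier (W.Hc n)"
   then obtain z where z: "z \<in> carrier (W.Zc n)" "T = U.cl (Suc n) (conn n z)" by (auto simp: W.H_carrier ge)
   have "i (Suc n) (conn n z) \<in> V.Bd (Suc n)"
    using i_conn[OF z(1)] s_cl[OF W.cyc_sub[OF z(1)]] by (simp add: bdry_def)
   then have "?a (Suc n) T = \<zero>\<^bsub>V.Hc (Suc n)\<^esub>"
    using z ae[OF ccyc[OF z(1)]] V.cls_zero_iff[OF icyc[OF ccyc[OF z(1)]]] by simp
   then show "T \<in> {T \<in> carrier (U.Hc (Suc n)). ?a (Suc n) T = \<zero>\<^bsub>V.Hc (Suc n)\<^esub>}"
    using z ccyc[OF z(1)] by (simp add: U.H_carrier)
  next
   fix T assume "T \<in> {T \<in> carrier (U.Hc (Suc n)). ?a (Suc n) T = \<zero>\<^bsub>V.Hc (Suc n)\<^esub>}"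
   then obtain u where u: "u \<in> carrier (U.Zc (Suc n))" "T = U.cl (Suc n) u" "?a (Suc n) T = \<zero>\<^bsub>V.Hc (Suc n)\<^esub>" by (auto simp: U.H_carrier)
   have "i (Suc n) u \<in> V.Bd (Suc n)" using u ae[OF u(1)] V.cls_zero_iff[OF icyc[OF u(1)]] by simp
   then obtain v where v: "v \<in> carrier (V n)" "i (Suc n) u = dV n v" by (auto simp: bdry_def)
   have uU: "u \<in> carrier (U (Suc n))" by (rule U.cyc_sub[OF u(1)])
   have "dW n (p n v) = \<zero>\<^bsub>W (Suc n)\<^esub>" using p_comm[OF v(1)] v(2) p_i[OF uU] by simp
   then have pc: "p n v \<in> carrier (W.Zc n)" using p_cl[OF v(1)] by (simp add: cyc_carrier)
   have "conn n (p n v) = u \<ominus>\<^bsub>U (Suc n)\<^esub> dU n (r n v)" using conn_p[OF v(1)] v(2)[symmetric] r_i[OF uU] by simp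
   then have "u \<ominus>\<^bsub>U (Suc n)\<^esub> conn n (p n v) = dU n (r n v)" using uU dU_cl[OF r_cl[OF v(1)]]
    by (simp add: a_minus_def US.minus_add US.a_assoc[symmetric] US.r_neg)
   then have "U.cl (Suc n) u = U.cl (Suc n) (conn n (p n v))"
    using U.cls_eq_iff[OF u(1) ccyc[OF pc]] bdry_Suc[OF r_cl[OF v(1)]] by simp
   then show "T \<in> ?g n ` carrier (W.Hc n)"
    unfolding W.H_carrier u(2) using ge[OF pc] pc by (metis image_eqI)
  qed
 next
  show "inj_on (?a 0) (carrier (U.Hc 0))"
  proof (rule inj_onI)
   fix S T assume S: "S \<in> carrier (U.Hc 0)" and T: "T \<in> carrier (U.Hc 0)" and eq: "?a 0 S = ?a 0 T"
   then obtain x y where x: "x \<in> carrier (U.Zc 0)" "S = U.cl 0 x" and y: "y \<in> carrier (U.Zc 0)" "T = U.cl 0 y"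
    by (auto simp: U.H_carrier)
   interpret V0: abelian_group "V 0" by (rule V_ab)
   have xy: "x \<in> carrier (U 0)" "y \<in> carrier (U 0)" using x y U.cyc_sub by auto
   have "i 0 x \<ominus>\<^bsub>V 0\<^esub> i 0 y \<in> V.Bd 0" using eq x y ae V.cls_eq_iff[OF icyc icyc] by simp
   then have "i 0 x \<ominus>\<^bsub>V 0\<^esub> i 0 y = \<zero>\<^bsub>V 0\<^esub>" by (simp add: bdry_def)
   then have "i 0 x = i 0 y" using i_cl[OF xy(1)] i_cl[OF xy(2)]
    by (metis V0.add.inv_equality V0.add.inv_inv V0.a_inv_closed a_minus_def)
   then show "S = T" using i_inj[OF xy] x y by simp
  qed
 qed
qed

end

section \<open>Hochschild cohomology by cochains\<close>

lemma hom_module_simps [simp]: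
 "carrier (hom_module k R M N) = lmod_hom k R M N \<inter> extensional (carrier M)"
 "zero (hom_module k R M N) = (\<lambda>x\<in>carrier M. \<zero>\<^bsub>N\<^esub>)"
 "add (hom_module k R M N) = (\<lambda>f g. \<lambda>x\<in>carrier M. f x \<oplus>\<^bsub>N\<^esub> g x)"
 "smult (hom_module k R M N) = (\<lambda>c f. \<lambda>x\<in>carrier M. c \<odot>\<^bsub>N\<^esub> f x)"
 by (simp_all add: hom_module_def)

lemma lmod_homD:
 assumes "f \<in> lmod_hom k R M N"
 shows "f \<in> k_hom k M N" "\<lbrakk>r \<in> carrier R; x \<in> carrier M\<rbrakk> \<Longrightarrow> f (lact M r x) = lact N r (f x)"
 using assms by (auto simp: lmod_hom_def)

lemma lmod_homI:
 assumes "f \<in> k_hom k M N" "\<And>r x. \<lbrakk>r \<in> carrier R; x \<in> carrier M\<rbrakk> \<Longrightarrow> f (lact M r x) = lact N r (f x)"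
 shows "f \<in> lmod_hom k R M N"
 using assms by (auto simp: lmod_hom_def)

lemma lmod_hom_cong:
 assumes "f \<in> lmod_hom k R M N" "module k M" "\<And>r x. \<lbrakk>r \<in> carrier R; x \<in> carrier M\<rbrakk> \<Longrightarrow> lact M r x \<in> carrier M"
  "\<And>x. x \<in> carrier M \<Longrightarrow> g x = f x"
 shows "g \<in> lmod_hom k R M N"
 by (rule lmod_homI, rule k_hom_cong[OF lmod_homD(1)[OF assms(1)] assms(2,4)])
  (use assms(3,4) lmod_homD(2)[OF assms(1)] in auto)

lemma module_hom_module:
 fixes M :: "('k, 'r, 'x) lmod" and N :: "('k, 'r, 'y) lmod"
 assumes M: "module k M" and N: "module k N"
  and lM: "\<And>r x. \<lbrakk>r \<in> carrier R; x \<in> carrier M\<rbrakk> \<Longrightarrow> lact M r x \<in> carrier M"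
  and lN: "\<And>r. r \<in> carrier R \<Longrightarrow> lact N r \<in> k_hom k N N"
 shows "module k (hom_module k R M N)"
proof -
 interpret M: module k M by fact
 interpret N: module k N by fact
 let ?H = "hom_module k R M N"
 have Hk: "f \<in> k_hom k M N" if "f \<in> carrier ?H" for f using that by (simp add: lmod_homD(1)[of f k R M N])
 have Hl: "f (lact M r x) = lact N r (f x)" if "f \<in> carrier ?H" "r \<in> carrier R" "x \<in> carrier M" for f r x
  using that lmod_homD(2)[of f k R M N r x] by simp
 have cl: "f x \<in> carrier N" if "f \<in> carrier ?H" "x \<in> carrier M" for f x
  using k_hom_closed[OF Hk] that by blast
 have res: "(\<lambda>x\<in>carrier M. f x) \<in> carrier ?H" if "f \<in> lmod_hom k R M N" for f
  using lmod_hom_cong[OF that M lM, of "restrict f (carrier M)"] by simp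
 have ex: "f = g" if "f \<in> carrier ?H" "g \<in> carrier ?H" "\<And>x. x \<in> carrier M \<Longrightarrow> f x = g x" for f g
  by (rule extensionalityI[of _ "carrier M"]) (use that in auto)
 have addc: "f \<oplus>\<^bsub>?H\<^esub> g \<in> carrier ?H" if f: "f \<in> carrier ?H" and g: "g \<in> carrier ?H" for f g
 proof -
  have "(\<lambda>x. f x \<oplus>\<^bsub>N\<^esub> g x) \<in> lmod_hom k R M N"
   by (rule lmod_homI, rule k_hom_plus[OF N]) (simp_all add: Hk[OF f] Hk[OF g] Hl[OF f] Hl[OF g] k_hom_add[OF lN] cl[OF f] cl[OF g])
  then show ?thesis using res[of "\<lambda>x. f x \<oplus>\<^bsub>N\<^esub> g x"] by simp
 qed
 have smc: "c \<odot>\<^bsub>?H\<^esub> f \<in> carrier ?H" if f: "f \<in> carrier ?H" and c: "c \<in> carrier k" for c f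
 proof -
  have "(\<lambda>x. c \<odot>\<^bsub>N\<^esub> f x) \<in> lmod_hom k R M N"
   by (rule lmod_homI, rule k_hom_scale[OF N _ c]) (simp_all add: Hk[OF f] Hl[OF f] k_hom_smult[OF lN] c cl[OF f])
  then show ?thesis using res[of "\<lambda>x. c \<odot>\<^bsub>N\<^esub> f x"] by simp
 qed
 have zc: "\<zero>\<^bsub>?H\<^esub> \<in> carrier ?H"
 proof -
  have "(\<lambda>x. \<zero>\<^bsub>N\<^esub>) \<in> lmod_hom k R M N"
   by (rule lmod_homI, rule k_hom_const_zero[OF N]) (simp add: k_hom_zero[OF N N lN])
  then show ?thesis using res[of "\<lambda>x. \<zero>\<^bsub>N\<^esub>"] by simp
 qed
 show ?thesis
  by (rule module_pointwise[OF N, where I = "carrier M"]) (use addc smc zc cl ex in simp_all)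
qed

text \<open>
 The complex axioms for the Hom complex are inherited from the cochains, in place of a computation
 of \<open>b' b' = 0\<close>.
\<close>

lemma chain_iso_transport:
 fixes k :: "'k ring" and L :: "nat \<Rightarrow> ('k, 'y) module"
 assumes K: "cx k K \<delta>" and L: "\<And>n. module k (L n)" and f: "\<And>n. f n \<in> k_hom k (K n) (L n)"
  and bij: "\<And>n. bij_betw (f n) (carrier (K n)) (carrier (L n))"
  and comm: "\<And>n x. x \<in> carrier (K n) \<Longrightarrow> f (Suc n) (\<delta> n x) = \<epsilon> n (f n x)"
 shows "chain_map k K \<delta> L \<epsilon> f"
proof -
 interpret K: cx k K \<delta> by fact
 have surj: "\<exists>x\<in>carrier (K n). f n x = y" if "y \<in> carrier (L n)" for y n
 proof -
  have "y \<in> f n ` carrier (K n)" using bij[of n] that by (simp add: bij_betw_def)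
  then show ?thesis by blast
 qed
 have eps: "\<epsilon> n (f n x) = f (Suc n) (\<delta> n x)" if "x \<in> carrier (K n)" for n x
  using comm[OF that] by (rule sym)
 have Lcx: "cx k L \<epsilon>"
 proof (rule cx.intro)
  show "module k (L n)" for n by (rule L)
  show "\<epsilon> n \<in> k_hom k (L n) (L (Suc n))" for n
  proof (rule k_homI)
   interpret Kn: module k "K n" by (rule K.mod)
   fix y assume "y \<in> carrier (L n)"
   then obtain x where x: "x \<in> carrier (K n)" "f n x = y" using surj by blast
   note dx = k_hom_closed[OF K.d_hom x(1)]
   show "\<epsilon> n y \<in> carrier (L (Suc n))" unfolding x(2)[symmetric] eps[OF x(1)] by (rule k_hom_closed[OF f dx])
   show "\<epsilon> n (y \<oplus>\<^bsub>L n\<^esub> z) = \<epsilon> n y \<oplus>\<^bsub>L (Suc n)\<^esub> \<epsilon> n z" if z: "z \<in> carrier (L n)" for z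
   proof -
    obtain w where w: "w \<in> carrier (K n)" "f n w = z" using surj[OF z] by blast
    note dw = k_hom_closed[OF K.d_hom w(1)]
    show ?thesis
     unfolding x(2)[symmetric] w(2)[symmetric] k_hom_add[OF f x(1) w(1), symmetric]
      eps[OF x(1)] eps[OF w(1)] eps[OF Kn.M.a_closed[OF x(1) w(1)]] k_hom_add[OF K.d_hom x(1) w(1)]
     by (rule k_hom_add[OF f dx dw])
   qed
   show "\<epsilon> n (c \<odot>\<^bsub>L n\<^esub> y) = c \<odot>\<^bsub>L (Suc n)\<^esub> \<epsilon> n y" if c: "c \<in> carrier k" for c
    unfolding x(2)[symmetric] k_hom_smult[OF f c x(1), symmetric] eps[OF x(1)] eps[OF Kn.smult_closed[OF c x(1)]]
      k_hom_smult[OF K.d_hom c x(1)]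
    by (rule k_hom_smult[OF f c dx])
  qed
  show "\<epsilon> (Suc n) (\<epsilon> n y) = \<zero>\<^bsub>L (Suc (Suc n))\<^esub>" if "y \<in> carrier (L n)" for n y
  proof -
   obtain x where x: "x \<in> carrier (K n)" "f n x = y" using surj \<open>y \<in> carrier (L n)\<close> by blast
   show ?thesis
    unfolding x(2)[symmetric] eps[OF x(1)] eps[OF k_hom_closed[OF K.d_hom x(1)]] K.d_d[OF x(1)]
    by (rule k_hom_zero[OF K.mod L f])
  qed
 qed
 show ?thesis by (intro chain_map.intro K Lcx chain_map_axioms.intro f comm)
qed

lemma bimod_hom_cong:
 assumes "f \<in> bimod_hom k A B N N'" "bimodule k A B N" "\<And>x. x \<in> carrier N \<Longrightarrow> g x = f x"
 shows "g \<in> bimod_hom k A B N N'"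
proof -
 interpret bimodule k A B N by fact
 show ?thesis using assms(1,3) k_hom_cong[of f k N N' g] assms(3)
  by (auto simp: bimod_hom_def lact_closed ract_closed N.module_axioms)
qed

text \<open>
 The bimodule map \<open>x\<^sub>0 \<otimes> \<dots> \<otimes> x\<^sub>n\<^sub>+\<^sub>1 \<mapsto> x\<^sub>0 g(x\<^sub>1, \<dots>, x\<^sub>n) x\<^sub>n\<^sub>+\<^sub>1\<close> belonging to the cochain \<open>g\<close>; the bar
 resolution in degree \<open>n\<close> is free on the inner factors. The value on short lists is arbitrary.
\<close>

definition twist :: "('k, 'c, 'c, 'x) bimod \<Rightarrow> ('c list \<Rightarrow> 'x) \<Rightarrow> 'c list \<Rightarrow> 'x" where
 "twist N g l = (if length l < 2 then \<zero>\<^bsub>N\<^esub> else lact N (hd l) (ract N (g (butlast (tl l))) (last l)))"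

lemma twist_ends: "twist N g (x # m @ [z]) = lact N x (ract N (g m) z)"
 by (simp add: twist_def)

context hoch
begin

lemma multilinear_twist:
 assumes g: "multilinear k C N g" shows "multilinear k C N (twist N g)"
proof (rule multilinearI)
 show "twist N g l \<in> carrier N" if "l \<in> Cs" for l
 proof (cases "length l < 2")
  case False
  then have "length l = (length l - 2) + 2" by simp
  from list_ends[OF this that] obtain x m z where "l = x # m @ [z]" "x \<in> carrier C" "m \<in> Cs" "z \<in> carrier C" by metis
  then show ?thesis using multilinear_closed[OF g] by (simp add: twist_ends N.lact_closed N.ract_closed)
 qed (simp add: twist_def)
 fix l1 l2 assume l: "l1 \<in> Cs" "l2 \<in> Cs"
 note gc = multilinear_closed[OF g]
 from l(2) show "(\<lambda>x. twist N g (l1 @ x # l2)) \<in> k_hom k C N"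
 proof (cases rule: slot_last_cases)
  case 1
  show ?thesis
  proof (cases l1)
   case Nil
   then show ?thesis using 1 k_hom_const_zero[OF mN] by (simp add: twist_def)
  next
   case (Cons a l1')
   then have a: "a \<in> carrier C" "l1' \<in> Cs" using l by simp_all
   show ?thesis using k_hom_compose[OF ract_k_hom(2)[OF gc[OF a(2)]] lact_k_hom(1)[OF a(1)]]
    by (simp add: Cons 1 twist_ends)
  qed
 next
  case (2 m z)
  show ?thesis
  proof (cases l1)
   case Nil
   then show ?thesis using lact_k_hom(2)[OF N.ract_closed[OF gc[OF 2(2)] 2(3)]] by (simp add: 2 twist_ends)
  next
   case (Cons a l1')
   then have a: "a \<in> carrier C" "l1' \<in> Cs" using l by simp_all
   have eq: "l1 @ x # l2 = a # (l1' @ x # m) @ [z]" for x using Cons 2 by simp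
   show ?thesis unfolding eq twist_ends
    by (rule k_hom_compose[OF k_hom_compose[OF multilinear_slot[OF g a(2) 2(2)] ract_k_hom(1)[OF 2(3)]] lact_k_hom(1)[OF a(1)]])
  qed
 qed
qed

lemma kC: "k_algebra k C" by (rule N.k_algebra_axioms)

lemma alt_ract:
 assumes "\<And>m. m \<in> Cs \<Longrightarrow> g m \<in> carrier N" "e \<in> carrier C" "m \<in> Cs" "z \<in> carrier C"
 shows "alt C N (\<lambda>l. if l = [] then \<zero> else ract N (g (butlast l)) (last l)) (e # m @ [z]) = ract N (hD C N g e m) z"
 using assms
proof (induct m arbitrary: g e)
 case Nil
 then show ?case using Nil(1)[of "[]"] by (simp add: N.N.minus_zero_right N.ract_closed N.ract_mult)
next
 case (Cons e' m)
 have c: "e' \<in> carrier C" "m \<in> Cs" using Cons(4) by simp_all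
 have ge: "g (e # l) \<in> carrier N" if "l \<in> Cs" for l by (rule Cons(2)) (use that Cons(3) in simp)
 have gc: "g ((e \<otimes>\<^bsub>C\<^esub> e') # m) \<in> carrier N" by (rule Cons(2)) (use c Cons(3) in simp)
 have IH: "alt C N (\<lambda>l. if l = [] then \<zero> else ract N (g (e # butlast l)) (last l)) (e' # m @ [z])
   = ract N (hD C N (\<lambda>l. g (e # l)) e' m) z"
  by (rule Cons(1)[OF ge c Cons(5)])
 have "alt C N (\<lambda>l. ract N (g (butlast (e # l))) (last (e # l))) (e' # m @ [z]) =
   alt C N (\<lambda>l. if l = [] then \<zero> else ract N (g (e # butlast l)) (last l)) (e' # m @ [z])"
  by (rule alt_cong[OF kC mN]) (use c Cons(5) in auto)
 then show ?case using IH gc hD_closed[OF ge c] Cons(5)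
  by (simp add: k_hom_minus[OF mN mN ract_k_hom(1)] butlast_append)
qed

text \<open>
 In the alternating sum the outermost contractions let the first and last inner letter act on the value,
 and the others contract inner letters: this is exactly the Hochschild coboundary.
\<close>

lemma alt_twist:
 assumes g: "\<And>m. m \<in> Cs \<Longrightarrow> g m \<in> carrier N" and x: "x \<in> carrier C" and m: "m \<in> Cs" "m \<noteq> []" and z: "z \<in> carrier C"
 shows "alt C N (twist N g) (x # m @ [z]) = lact N x (ract N (hdel C N g m) z)"
proof -
 obtain e m' where em: "m = e # m'" using m(2) by (cases m) auto
 have e: "e \<in> carrier C" "m' \<in> Cs" using m em by simp_all
 let ?G = "\<lambda>l. if l = [] then \<zero> else ract N (g (butlast l)) (last l)"
 have Gc: "?G l \<in> carrier N" if "l \<in> Cs" for l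
  using that g by (cases l rule: rev_cases) (simp_all add: N.ract_closed)
 have "alt C N (\<lambda>l. twist N g (x # l)) (e # m' @ [z]) = alt C N (\<lambda>l. lact N x (?G l)) (e # m' @ [z])"
  by (rule alt_cong[OF kC mN]) (use e z in \<open>auto simp: twist_def\<close>)
 also have "\<dots> = lact N x (alt C N ?G (e # m' @ [z]))"
  by (rule alt_nat[OF kC mN mN lact_k_hom(1)[OF x] Gc, symmetric]) (use e z in simp_all)
 also have "\<dots> = lact N x (ract N (hD C N g e m') z)" by (rule arg_cong[where f = "lact N x"], rule alt_ract[OF g e z])
 finally have 1: "alt C N (\<lambda>l. twist N g (x # l)) (e # m' @ [z]) = lact N x (ract N (hD C N g e m') z)" .
 have "alt C N (twist N g) (x # m @ [z]) = lact N (x \<otimes>\<^bsub>C\<^esub> e) (ract N (g m') z) \<ominus> lact N x (ract N (hD C N g e m') z)"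
  using 1 twist_ends[of N g "x \<otimes>\<^bsub>C\<^esub> e" m' z] by (simp add: em)
 also have "\<dots> = lact N x (ract N (lact N e (g m') \<ominus> hD C N g e m') z)"
  using e x z g[OF e(2)] hD_closed[OF g e]
  by (simp add: k_hom_minus[OF mN mN ract_k_hom(1)] k_hom_minus[OF mN mN lact_k_hom(1)] N.lact_closed N.ract_closed N.lact_mult N.lact_ract)
 finally show ?thesis by (simp add: em)
qed

interpretation bar: bar k C by (rule bar.intro) (rule kC)
interpretation ta: two_algebras k C C by (rule two_algebras.intro) (rule kC)+

definition "Psi n g = (\<lambda>t\<in>carrier (bar_bimod k C n). lin_lift k N (twist N g) t)"

lemma lift_twist:
 assumes g: "multilinear k C N g"
 shows "lin_lift k N (twist N g) \<in> k_hom k (tensor_power k C (n + 2)) N"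
  and "\<lbrakk>x \<in> carrier C; m \<in> Cs; z \<in> carrier C\<rbrakk> \<Longrightarrow>
   lin_lift k N (twist N g) (pure_list k C (x # m @ [z])) = lact N x (ract N (g m) z)"
proof -
 show "lin_lift k N (twist N g) \<in> k_hom k (tensor_power k C (n + 2)) N"
  by (rule power_lift_k_hom[OF mC mN multilinear_twist[OF g]])
 show "lin_lift k N (twist N g) (pure_list k C (x # m @ [z])) = lact N x (ract N (g m) z)"
  if "x \<in> carrier C" "m \<in> Cs" "z \<in> carrier C"
  using power_lift_pure[OF mC mN multilinear_twist[OF g], of "x # m @ [z]"] that by (simp add: twist_ends)
qed

abbreviation "hoch_hom n \<equiv> hom_module k (tensor_algebra k C (opposite C)) (bimod_as_left k (bar_bimod k C n)) (bimod_as_left k N)"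
abbreviation "hoch_d n f \<equiv> compose (carrier (bimod_as_left k (bar_bimod k C (Suc n)))) f (bar_diff k C (Suc n))"

lemma hoch_hom_carrier: "carrier (hoch_hom n) = bimod_hom k C C (bar_bimod k C n) N \<inter> extensional (carrier (tensor_power k C (n + 2)))"
 using ta.lmod_hom_as_left[OF bar.bimodule_bar[of n] bN] by simp

lemma module_hoch_hom: "module k (hoch_hom n)"
proof (rule module_hom_module)
 show "module k (bimod_as_left k (bar_bimod k C n))" by (rule module_transfer[OF bar.mTp[of "n + 2"]]) simp_all
 show "module k (bimod_as_left k N)" by (rule module_transfer[OF mN]) simp_all
 show "lact (bimod_as_left k (bar_bimod k C n)) r x \<in> carrier (bimod_as_left k (bar_bimod k C n))"
  if "r \<in> carrier (tensor_algebra k C (opposite C))" "x \<in> carrier (bimod_as_left k (bar_bimod k C n))" for r x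
  using ta.as_left_closed[OF bar.bimodule_bar[of n]] that by simp
 show "lact (bimod_as_left k N) r \<in> k_hom k (bimod_as_left k N) (bimod_as_left k N)"
  if "r \<in> carrier (tensor_algebra k C (opposite C))" for r
  using ta.as_left_lact_k_hom2[OF bN] that by simp
qed

lemma Psi_hom:
 assumes g: "multilinear k C N g" shows "Psi n g \<in> carrier (hoch_hom n)"
proof -
 note L = lift_twist[OF g] and gc = multilinear_closed[OF g]
 note cl = k_hom_closed[OF L(1)]
 have "lin_lift k N (twist N g) \<in> bimod_hom k C C (bar_bimod k C n) N"
  unfolding bimod_hom_def
 proof (intro CollectI conjI ballI)
  show "lin_lift k N (twist N g) \<in> k_hom k (bar_bimod k C n) N" using L(1) by simp
  fix a t assume a: "a \<in> carrier C" and "t \<in> carrier (bar_bimod k C n)"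
  then have t: "t \<in> carrier (tensor_power k C (n + 2))" by simp
  show "lin_lift k N (twist N g) (lact (bar_bimod k C n) a t) = lact N a (lin_lift k N (twist N g) t)"
   by (rule bar.bar_hom_eq[OF mN k_hom_compose[OF bar.bar_lact(1)[OF a] L(1)] k_hom_compose[OF L(1) lact_k_hom(1)[OF a]] _ t])
    (use a gc in \<open>simp add: bar.bar_lact_ends L(2) N.lact_mult N.ract_closed\<close>)
  show "lin_lift k N (twist N g) (ract (bar_bimod k C n) t a) = ract N (lin_lift k N (twist N g) t) a"
   by (rule bar.bar_hom_eq[OF mN k_hom_compose[OF bar.bar_ract(1)[OF a] L(1)] k_hom_compose[OF L(1) ract_k_hom(1)[OF a]] _ t])
    (use a gc in \<open>simp add: bar.bar_lact_ends L(2) N.ract_mult N.ract_closed N.lact_ract\<close>)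
 qed
 then have "Psi n g \<in> bimod_hom k C C (bar_bimod k C n) N"
  by (rule bimod_hom_cong[OF _ bar.bimodule_bar]) (simp add: Psi_def)
 then show ?thesis unfolding hoch_hom_carrier by (simp add: Psi_def)
qed

lemma Psi_pure:
 assumes g: "multilinear k C N g" and "x \<in> carrier C" "m \<in> Cs" "length m = n" "z \<in> carrier C"
 shows "Psi n g (pure_list k C (x # m @ [z])) = lact N x (ract N (g m) z)"
 using lift_twist(2)[OF g, of x m z] assms bar.pure_ends_closed[of x m n z] by (simp add: Psi_def)

lemma hoch_hom_eqI:
 assumes "F \<in> carrier (hoch_hom n)" "G \<in> carrier (hoch_hom n)"
  "\<And>x m z. \<lbrakk>x \<in> carrier C; m \<in> Cs; length m = n; z \<in> carrier C\<rbrakk> \<Longrightarrow> F (pure_list k C (x # m @ [z])) = G (pure_list k C (x # m @ [z]))"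
 shows "F = G"
proof (rule extensionalityI[of _ "carrier (tensor_power k C (n + 2))"])
 show "F \<in> extensional (carrier (tensor_power k C (n + 2)))" "G \<in> extensional (carrier (tensor_power k C (n + 2)))"
  using assms(1,2) by simp_all
 have h: "F \<in> k_hom k (tensor_power k C (n + 2)) N" "G \<in> k_hom k (tensor_power k C (n + 2)) N"
  using assms(1,2) unfolding hoch_hom_carrier by (simp_all add: bimod_hom_def)
 show "F t = G t" if "t \<in> carrier (tensor_power k C (n + 2))" for t
  by (rule bar.bar_hom_eq[OF mN h assms(3) that])
qed

lemma Psi_k_hom: "Psi n \<in> k_hom k (coch k C N n) (hoch_hom n)"
proof (rule k_homI)
 interpret H: module k "hoch_hom n" by (rule module_hoch_hom)
 interpret Q: module k "coch k C N n" by (rule module_coch[OF mN])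
 fix f assume f: "f \<in> carrier (coch k C N n)"
 note mf = coch_multilinear[OF f]
 show "Psi n f \<in> carrier (hoch_hom n)" by (rule Psi_hom[OF mf])
 show "Psi n (f \<oplus>\<^bsub>coch k C N n\<^esub> g) = Psi n f \<oplus>\<^bsub>hoch_hom n\<^esub> Psi n g" if g: "g \<in> carrier (coch k C N n)" for g
 proof (rule hoch_hom_eqI)
  note mg = coch_multilinear[OF g] and mfg = coch_multilinear[OF Q.M.a_closed[OF f g]]
  show "Psi n (f \<oplus>\<^bsub>coch k C N n\<^esub> g) \<in> carrier (hoch_hom n)" by (rule Psi_hom[OF mfg])
  show "Psi n f \<oplus>\<^bsub>hoch_hom n\<^esub> Psi n g \<in> carrier (hoch_hom n)" by (rule H.M.a_closed[OF Psi_hom[OF mf] Psi_hom[OF mg]])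
  fix x m z assume *: "x \<in> carrier C" "m \<in> Cs" "length m = n" "z \<in> carrier C"
  have c: "f m \<in> carrier N" "g m \<in> carrier N" using multilinear_closed[OF mf *(2)] multilinear_closed[OF mg *(2)] by auto
  show "Psi n (f \<oplus>\<^bsub>coch k C N n\<^esub> g) (pure_list k C (x # m @ [z])) = (Psi n f \<oplus>\<^bsub>hoch_hom n\<^esub> Psi n g) (pure_list k C (x # m @ [z]))"
   using Psi_pure[OF mfg *] Psi_pure[OF mf *] Psi_pure[OF mg *] bar.pure_ends_closed[OF *] c *
   by (simp add: N.ract_add_left N.lact_add_right N.ract_closed)
 qed
 show "Psi n (c \<odot>\<^bsub>coch k C N n\<^esub> f) = c \<odot>\<^bsub>hoch_hom n\<^esub> Psi n f" if c: "c \<in> carrier k" for c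
 proof (rule hoch_hom_eqI)
  note mcf = coch_multilinear[OF Q.smult_closed[OF c f]]
  show "Psi n (c \<odot>\<^bsub>coch k C N n\<^esub> f) \<in> carrier (hoch_hom n)" by (rule Psi_hom[OF mcf])
  show "c \<odot>\<^bsub>hoch_hom n\<^esub> Psi n f \<in> carrier (hoch_hom n)" by (rule H.smult_closed[OF c Psi_hom[OF mf]])
  fix x m z assume *: "x \<in> carrier C" "m \<in> Cs" "length m = n" "z \<in> carrier C"
  have fc: "f m \<in> carrier N" using multilinear_closed[OF mf *(2)] .
  show "Psi n (c \<odot>\<^bsub>coch k C N n\<^esub> f) (pure_list k C (x # m @ [z])) = (c \<odot>\<^bsub>hoch_hom n\<^esub> Psi n f) (pure_list k C (x # m @ [z]))"
   using Psi_pure[OF mcf *] Psi_pure[OF mf *] bar.pure_ends_closed[OF *] fc * c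
   by (simp add: k_hom_smult[OF ract_k_hom(1)] k_hom_smult[OF lact_k_hom(1)] N.ract_closed)
 qed
qed

text \<open>
 The inverse evaluates a homomorphism at \<open>1 \<otimes> x\<^sub>1 \<otimes> \<dots> \<otimes> x\<^sub>n \<otimes> 1\<close>.
\<close>

lemma Psi_bij: "bij_betw (Psi n) (carrier (coch k C N n)) (carrier (hoch_hom n))"
proof (rule bij_betw_imageI)
 have one: "\<one>\<^bsub>C\<^esub> \<in> carrier C" by simp
 have ev: "Psi n g (pure_list k C (\<one>\<^bsub>C\<^esub> # l @ [\<one>\<^bsub>C\<^esub>])) = g l" if g: "g \<in> carrier (coch k C N n)" and l: "l \<in> power_gens C n" for g l
 proof -
  have l': "l \<in> Cs" "length l = n" using l by (simp_all add: power_gens_lists)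
  show ?thesis using Psi_pure[OF coch_multilinear[OF g] one l' one] coch_closed[OF g mN, of l]
   by (simp add: N.ract_one N.lact_one)
 qed
 show "inj_on (Psi n) (carrier (coch k C N n))"
  by (rule inj_onI, rule coch_eqI, assumption, assumption) (metis ev)
 show "Psi n ` carrier (coch k C N n) = carrier (hoch_hom n)"
 proof (intro subset_antisym subsetI)
  show "F \<in> carrier (hoch_hom n)" if "F \<in> Psi n ` carrier (coch k C N n)" for F
   using that Psi_hom coch_multilinear by blast
  fix F assume F: "F \<in> carrier (hoch_hom n)"
  have Fb: "F \<in> bimod_hom k C C (bar_bimod k C n) N" using F unfolding hoch_hom_carrier by blast
  have Fk: "F \<in> k_hom k (tensor_power k C (n + 2)) N" using Fb by (simp add: bimod_hom_def)
  define g0 where "g0 l = F (pure_in k C (n + 2) (\<one>\<^bsub>C\<^esub> # l @ [\<one>\<^bsub>C\<^esub>]))" for l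
  have g0m: "multilinear k C N g0"
  proof (rule multilinearI)
   show "g0 l \<in> carrier N" if "l \<in> Cs" for l
    unfolding g0_def by (rule k_hom_closed[OF Fk multilinear_closed[OF pure_in_multilinear[OF mC]]]) (use that in simp)
   fix l1 l2 assume l: "l1 \<in> Cs" "l2 \<in> Cs"
   have "(\<lambda>x. F (pure_in k C (n + 2) ((\<one>\<^bsub>C\<^esub> # l1) @ x # (l2 @ [\<one>\<^bsub>C\<^esub>])))) \<in> k_hom k C N"
    by (rule k_hom_compose[OF multilinear_slot[OF pure_in_multilinear[OF mC]] Fk]) (use l in simp_all)
   then show "(\<lambda>x. g0 (l1 @ x # l2)) \<in> k_hom k C N" by (simp add: g0_def)
  qed
  define g where "g = trunc C N n g0"
  have gc: "g \<in> carrier (coch k C N n)" unfolding g_def by (rule trunc_coch[OF mC mN g0m])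
  note gm = coch_multilinear[OF gc]
  have "Psi n g = F"
  proof (rule hoch_hom_eqI[OF Psi_hom[OF gm] F])
   fix x m z assume *: "x \<in> carrier C" "m \<in> Cs" "length m = n" "z \<in> carrier C"
   let ?p = "pure_list k C (\<one>\<^bsub>C\<^esub> # m @ [\<one>\<^bsub>C\<^esub>])"
   have pc: "?p \<in> carrier (tensor_power k C (n + 2))" by (rule bar.pure_ends_closed) (use * in simp_all)
   have gm': "g m = F ?p" using * by (simp add: g_def trunc_def power_gens_lists g0_def pure_in_def)
   have "lact N x (ract N (F ?p) z) = F (lact (bar_bimod k C n) x (ract (bar_bimod k C n) ?p z))"
    using Fb pc * k_hom_closed[OF bar.bar_ract(1)[OF *(4)] pc] by (simp add: bimod_hom_def)
   also have "\<dots> = F (pure_list k C (x # m @ [z]))"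
    using * by (simp add: bar.bar_lact_ends)
   finally show "Psi n g (pure_list k C (x # m @ [z])) = F (pure_list k C (x # m @ [z]))"
    using Psi_pure[OF gm *] gm' by simp
  qed
  then show "F \<in> Psi n ` carrier (coch k C N n)" using gc by blast
 qed
qed

lemma Psi_comm:
 assumes g: "g \<in> carrier (coch k C N n)"
 shows "Psi (Suc n) (coch_d C N n g) = hoch_d n (Psi n g)"
proof (rule extensionalityI[of _ "carrier (tensor_power k C (Suc n + 2))"])
 note gm = coch_multilinear[OF g]
 have dg: "coch_d C N n g \<in> carrier (coch k C N (Suc n))" by (rule k_hom_closed[OF coch_d_k_hom g])
 note dgm = coch_multilinear[OF dg]
 show "Psi (Suc n) (coch_d C N n g) \<in> extensional (carrier (tensor_power k C (Suc n + 2)))" by (simp add: Psi_def)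
 show "hoch_d n (Psi n g) \<in> extensional (carrier (tensor_power k C (Suc n + 2)))" by (simp add: compose_def)
 fix t assume t: "t \<in> carrier (tensor_power k C (Suc n + 2))"
 have d: "bar_diff k C (Suc n) \<in> k_hom k (tensor_power k C (Suc n + 2)) (tensor_power k C (n + 2))"
  using bar.bar_diff_props(1)[of "Suc n"] by simp
 have "hoch_d n (Psi n g) t = lin_lift k N (twist N g) (bar_diff k C (Suc n) t)"
  using k_hom_closed[OF d t] t by (simp add: compose_def Psi_def)
 also have "\<dots> = lin_lift k N (twist N (coch_d C N n g)) t"
 proof (rule bar.bar_hom_eq[OF mN k_hom_compose[OF d lift_twist(1)[OF gm]] lift_twist(1)[OF dgm] _ t])
  fix x m z assume *: "x \<in> carrier C" "m \<in> Cs" "length m = Suc n" "z \<in> carrier C"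
  let ?l = "x # m @ [z]"
  have lC: "?l \<in> Cs" using * by simp
  have "lin_lift k N (twist N g) (bar_diff k C (Suc n) (pure_list k C ?l))
    = lin_lift k N (twist N g) (alt C (tensor_power k C (n + 2)) (pure_in k C (n + 2)) ?l)"
   using bar.bar_diff_props(2)[of ?l "Suc n"] * by (simp add: power_gens_lists)
  also have "\<dots> = alt C N (\<lambda>l. lin_lift k N (twist N g) (pure_in k C (n + 2) l)) ?l"
   by (rule alt_nat[OF kC bar.mTp mN lift_twist(1)[OF gm] multilinear_closed[OF pure_in_multilinear[OF mC]] lC])
  also have "\<dots> = alt C N (twist N g) ?l"
  proof (rule alt_cong[OF kC mN _ lC])
   fix l assume l: "l \<in> Cs" "Suc (length l) = length ?l"
   then have "pure_in k C (n + 2) l = pure_list k C l" using * by (simp add: pure_in_def)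
   then show "lin_lift k N (twist N g) (pure_in k C (n + 2) l) = twist N g l"
    using power_lift_pure[OF mC mN multilinear_twist[OF gm] l(1)] by simp
  qed
  also have "\<dots> = lact N x (ract N (hdel C N g m) z)"
   by (rule alt_twist[OF multilinear_closed[OF gm]]) (use * in auto)
  also have "\<dots> = lin_lift k N (twist N (coch_d C N n g)) (pure_list k C ?l)"
   using lift_twist(2)[OF dgm *(1,2,4)] hdel_eq_coch_d[OF g *(2)] by simp
  finally show "lin_lift k N (twist N g) (bar_diff k C (Suc n) (pure_list k C ?l)) = lin_lift k N (twist N (coch_d C N n g)) (pure_list k C ?l)" .
 qed
 finally show "Psi (Suc n) (coch_d C N n g) t = hoch_d n (Psi n g) t" using t by (simp add: Psi_def)
qed

lemma coch_cx: "cx k (coch k C N) (coch_d C N)"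
 by (intro cx.intro module_coch mN coch_d_k_hom coch_d_d)

lemma Psi_chain: "chain_map k (coch k C N) (coch_d C N) hoch_hom hoch_d Psi"
 by (rule chain_iso_transport; (rule coch_cx module_hoch_hom Psi_k_hom Psi_bij | erule Psi_comm))

lemma hochschild_eq: "hochschild k C N = cohomology hoch_hom hoch_d"
 unfolding hochschild_def hom_cohomology_def ..

lemma module_hochschild: "module k (hochschild k C N n)"
proof -
 interpret chain_map k "coch k C N" "coch_d C N" hoch_hom hoch_d Psi by (rule Psi_chain)
 show ?thesis unfolding hochschild_eq by (rule L.mod_H)
qed

lemma hochschild_iso:
 "induced (coch k C N) (coch_d C N) n hoch_hom hoch_d n (Psi n) \<in> k_hom k (cohomology (coch k C N) (coch_d C N) n) (hochschild k C N n)"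
 "bij_betw (induced (coch k C N) (coch_d C N) n hoch_hom hoch_d n (Psi n))
   (carrier (cohomology (coch k C N) (coch_d C N) n)) (carrier (hochschild k C N n))"
proof -
 interpret chain_map k "coch k C N" "coch_d C N" hoch_hom hoch_d Psi by (rule Psi_chain)
 show "induced (coch k C N) (coch_d C N) n hoch_hom hoch_d n (Psi n) \<in> k_hom k (cohomology (coch k C N) (coch_d C N) n) (hochschild k C N n)"
  unfolding hochschild_eq by (rule ind(1))
 show "bij_betw (induced (coch k C N) (coch_d C N) n hoch_hom hoch_d n (Psi n))
   (carrier (cohomology (coch k C N) (coch_d C N) n)) (carrier (hochschild k C N n))"
  unfolding hochschild_eq by (rule iso_bij[OF Psi_bij])
qed

end

section \<open>Restriction to a corner\<close>

context abelian_group
begin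

lemma minus_swap: "\<lbrakk>a \<in> carrier G; b \<in> carrier G; c \<in> carrier G; d \<in> carrier G\<rbrakk> \<Longrightarrow>
  a \<ominus> b \<ominus> (c \<ominus> d) = a \<ominus> c \<ominus> (b \<ominus> d)"
 by (simp add: a_minus_def minus_add a_ac)

lemma corner_step:
 assumes ih: "R \<ominus> T = F3 \<ominus> F2 \<oplus> V"
  and cl: "P \<in> carrier G" "Sa \<in> carrier G" "Q \<in> carrier G" "R \<in> carrier G" "T \<in> carrier G" "F1 \<in> carrier G"
   "F2 \<in> carrier G" "F3 \<in> carrier G" "V \<in> carrier G"
 shows "(P \<ominus> Sa \<ominus> (Q \<ominus> R)) \<ominus> (F1 \<ominus> (F2 \<ominus> V) \<ominus> (Sa \<ominus> T)) = F3 \<ominus> F1 \<oplus> (P \<ominus> Q)"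
proof -
 have swap: "a \<ominus> b \<ominus> (c \<ominus> d) = a \<ominus> c \<ominus> (b \<ominus> d)"
  if "a \<in> carrier G" "b \<in> carrier G" "c \<in> carrier G" "d \<in> carrier G" for a b c d
  using that by (rule minus_swap)
 have cancel: "a \<ominus> b \<ominus> (a \<ominus> c) = \<ominus> (b \<ominus> c)" if "a \<in> carrier G" "b \<in> carrier G" "c \<in> carrier G" for a b c
  using that by algebra
 have "(P \<ominus> Sa \<ominus> (Q \<ominus> R)) \<ominus> (F1 \<ominus> (F2 \<ominus> V) \<ominus> (Sa \<ominus> T)) = (P \<ominus> Q \<ominus> (F1 \<ominus> (F2 \<ominus> V))) \<ominus> (Sa \<ominus> R \<ominus> (Sa \<ominus> T))"
  using cl by (simp add: swap[of P Sa Q R] swap[of "P \<ominus> Q" "Sa \<ominus> R" "F1 \<ominus> (F2 \<ominus> V)" "Sa \<ominus> T"])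
 also have "Sa \<ominus> R \<ominus> (Sa \<ominus> T) = \<ominus> (F3 \<ominus> F2 \<oplus> V)" using cl by (simp add: cancel ih)
 also have "P \<ominus> Q \<ominus> (F1 \<ominus> (F2 \<ominus> V)) \<ominus> \<ominus> (F3 \<ominus> F2 \<oplus> V) = ((F3 \<ominus> (F2 \<ominus> V)) \<ominus> (F1 \<ominus> (F2 \<ominus> V))) \<oplus> (P \<ominus> Q)"
  using cl by (simp add: a_minus_def minus_add a_ac)
 also have "F3 \<ominus> (F2 \<ominus> V) \<ominus> (F1 \<ominus> (F2 \<ominus> V)) = F3 \<ominus> F1" using cl by (simp add: minus_minus_cancel)
 finally show ?thesis .
qed

lemma corner_total:
 assumes d: "b \<ominus> s = F3 \<ominus> F1 \<oplus> W"
  and cl: "a \<in> carrier G" "b \<in> carrier G" "c \<in> carrier G" "s \<in> carrier G" "F1 \<in> carrier G" "F3 \<in> carrier G" "W \<in> carrier G"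
 shows "(a \<ominus> b) \<oplus> (c \<ominus> (F1 \<ominus> W) \<ominus> (a \<ominus> s)) = c \<ominus> F3"
proof -
 have "b = (b \<ominus> s) \<oplus> s" using cl by algebra
 then have b: "b = (F3 \<ominus> F1 \<oplus> W) \<oplus> s" using d by simp
 show ?thesis unfolding b using cl by algebra
qed

lemma minus_eq_zeroD: "\<lbrakk>a \<ominus> b = \<zero>; a \<in> carrier G; b \<in> carrier G\<rbrakk> \<Longrightarrow> a = b"
proof -
 assume ab: "a \<ominus> b = \<zero>" and cl: "a \<in> carrier G" "b \<in> carrier G"
 have "a = (a \<ominus> b) \<oplus> b" using cl by algebra
 then show ?thesis using ab cl by simp
qed

end

lemma hD_morph:
 fixes k :: "'k ring"
 assumes N: "bimodule k C C N" and N': "module k N'" and C': "k_algebra k C'"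
  and g: "g \<in> k_hom k N N'"
  and ph: "\<And>x. x \<in> carrier C' \<Longrightarrow> \<phi> x \<in> carrier C" "\<And>x y. \<lbrakk>x \<in> carrier C'; y \<in> carrier C'\<rbrakk> \<Longrightarrow> \<phi> (x \<otimes>\<^bsub>C'\<^esub> y) = \<phi> x \<otimes>\<^bsub>C\<^esub> \<phi> y"
  and gr: "\<And>x e. \<lbrakk>x \<in> carrier N; e \<in> carrier C'\<rbrakk> \<Longrightarrow> g (ract N x (\<phi> e)) = ract N' (g x) e"
  and f: "\<And>m. m \<in> lists (carrier C) \<Longrightarrow> f m \<in> carrier N" and e: "e \<in> carrier C'" and l: "l \<in> lists (carrier C')"
 shows "g (hD C N f (\<phi> e) (map \<phi> l)) = hD C' N' (\<lambda>m. g (f (map \<phi> m))) e l"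
 using f e l
proof (induct l arbitrary: f e)
 case Nil
 then show ?case using gr[OF Nil(1)[of "[]"] Nil(2)] by simp
next
 case (Cons e' l)
 interpret N: hoch k C N by (rule hoch.intro[OF N])
 interpret C': k_algebra k C' by (rule C')
 have c: "e' \<in> carrier C'" "l \<in> lists (carrier C')" using Cons(4) by simp_all
 have ml: "map \<phi> m \<in> lists (carrier C)" if "m \<in> lists (carrier C')" for m
  using that by (induct m) (simp_all add: ph)
 have fe: "f (\<phi> e # m) \<in> carrier N" if "m \<in> lists (carrier C)" for m
  by (rule Cons(2)) (use that Cons(3) ph in simp)
 have IH: "g (hD C N (\<lambda>m. f (\<phi> e # m)) (\<phi> e') (map \<phi> l)) = hD C' N' (\<lambda>m. g (f (\<phi> e # map \<phi> m))) e' l"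
  by (rule Cons(1)[OF fe c])
 have f1: "f ((\<phi> e \<otimes>\<^bsub>C\<^esub> \<phi> e') # map \<phi> l) \<in> carrier N"
  by (rule Cons(2)) (use c Cons(3) ph ml in simp)
 have h: "hD C N (\<lambda>m. f (\<phi> e # m)) (\<phi> e') (map \<phi> l) \<in> carrier N"
  by (rule N.hD_closed[OF fe ph(1)[OF c(1)] ml[OF c(2)]])
 show ?case using IH ph(2)[OF Cons(3) c(1)] by (simp add: k_hom_minus[OF N.mN N' g f1 h])
qed

text \<open>
 The alternating sum of \<open>f [e\<^sub>1, \<dots>, e\<^sub>i, u, q e\<^sub>i\<^sub>+\<^sub>1, \<dots>, q e\<^sub>n]\<close> over all positions \<open>i\<close> at which \<open>u\<close> can be inserted.
\<close>

fun corner_htpy :: "('k, 'x, 'z) module_scheme \<Rightarrow> 'c \<Rightarrow> ('c \<Rightarrow> 'c) \<Rightarrow> ('c list \<Rightarrow> 'x) \<Rightarrow> 'c list \<Rightarrow> 'x" where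
 "corner_htpy N u q f [] = f [u]"
| "corner_htpy N u q f (e # l) = f (u # q e # map q l) \<ominus>\<^bsub>N\<^esub> corner_htpy N u q (\<lambda>m. f (e # m)) l"

text \<open>
 The situation of \<open>A \<subseteq> E\<close> with unit \<open>u = \<iota> 1\<close> for the triangular algebra: \<open>e u\<close> is the diagonal entry of
 \<open>e\<close> in \<open>A\<close>, and only this entry acts on the right of \<open>Z\<close>.
\<close>

locale corner = Z: hoch k E Z + A: k_algebra k A
 for k :: "'k ring" and E :: "('k, 'e) module" and Z :: "('k, 'e, 'e, 'x) bimod" (structure) and A :: "('k, 'a) module" +
 fixes \<iota> :: "'a \<Rightarrow> 'e" and p :: "'e \<Rightarrow> 'a"
 assumes iota_hom: "\<iota> \<in> k_hom k A E" and iota_mult: "\<lbrakk>a \<in> carrier A; b \<in> carrier A\<rbrakk> \<Longrightarrow> \<iota> (a \<otimes>\<^bsub>A\<^esub> b) = \<iota> a \<otimes>\<^bsub>E\<^esub> \<iota> b"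
  and p_hom: "p \<in> k_hom k E A" and p_mult: "\<lbrakk>x \<in> carrier E; y \<in> carrier E\<rbrakk> \<Longrightarrow> p (x \<otimes>\<^bsub>E\<^esub> y) = p x \<otimes>\<^bsub>A\<^esub> p y"
  and p_iota: "a \<in> carrier A \<Longrightarrow> p (\<iota> a) = a"
  and mult_unit: "x \<in> carrier E \<Longrightarrow> x \<otimes>\<^bsub>E\<^esub> \<iota> \<one>\<^bsub>A\<^esub> = \<iota> (p x)"
  and ract_p: "\<lbrakk>z \<in> carrier Z; x \<in> carrier E\<rbrakk> \<Longrightarrow> ract Z z x = ract Z z (\<iota> (p x))"
begin

abbreviation "u \<equiv> \<iota> \<one>\<^bsub>A\<^esub>"
abbreviation "q \<equiv> \<lambda>x. \<iota> (p x)"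
abbreviation "Es \<equiv> lists (carrier E)"
abbreviation "As \<equiv> lists (carrier A)"
abbreviation "hS \<equiv> corner_htpy Z u q"

lemma io: "a \<in> carrier A \<Longrightarrow> \<iota> a \<in> carrier E" and pc: "x \<in> carrier E \<Longrightarrow> p x \<in> carrier A"
 by (rule k_hom_closed[OF iota_hom] k_hom_closed[OF p_hom]; assumption)+

lemma uc: "u \<in> carrier E" by (simp add: io)

lemma qc: "x \<in> carrier E \<Longrightarrow> q x \<in> carrier E" by (simp add: io pc)

lemma q_hom: "q \<in> k_hom k E E" by (rule k_hom_compose[OF p_hom iota_hom])

lemma q_mult: "\<lbrakk>x \<in> carrier E; y \<in> carrier E\<rbrakk> \<Longrightarrow> q (x \<otimes>\<^bsub>E\<^esub> y) = q x \<otimes>\<^bsub>E\<^esub> q y"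
 by (simp add: p_mult iota_mult pc)

lemma u_q: "x \<in> carrier E \<Longrightarrow> u \<otimes>\<^bsub>E\<^esub> q x = q x"
 using iota_mult[of "\<one>\<^bsub>A\<^esub>" "p x"] by (simp add: pc)

lemma x_u: "x \<in> carrier E \<Longrightarrow> x \<otimes>\<^bsub>E\<^esub> u = q x" by (rule mult_unit)

lemma ract_u: "z \<in> carrier Z \<Longrightarrow> ract Z z u = z"
 using ract_p[of z "\<one>\<^bsub>E\<^esub>"] mult_unit[of "\<one>\<^bsub>E\<^esub>"] uc by (simp add: Z.N.ract_one)

lemma map_q: "l \<in> Es \<Longrightarrow> map q l \<in> Es" by (induct l) (simp_all add: qc)
lemma map_p: "l \<in> Es \<Longrightarrow> map p l \<in> As" by (induct l) (simp_all add: pc)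
lemma map_iota: "l \<in> As \<Longrightarrow> map \<iota> l \<in> Es" by (induct l) (simp_all add: io)

lemma hS_closed: "\<lbrakk>\<And>m. m \<in> Es \<Longrightarrow> f m \<in> carrier Z; l \<in> Es\<rbrakk> \<Longrightarrow> hS f l \<in> carrier Z"
proof (induct l arbitrary: f)
 case Nil
 show ?case using Nil(1)[of "[u]"] uc by simp
next
 case (Cons e l)
 have c: "e \<in> carrier E" "l \<in> Es" using Cons(3) by simp_all
 have "hS (\<lambda>m. f (e # m)) l \<in> carrier Z" by (rule Cons(1), rule Cons(2)) (use c in simp_all)
 moreover have "f (u # q e # map q l) \<in> carrier Z" by (rule Cons(2)) (use c uc qc map_q in simp)
 ultimately show ?case by simp
qed

lemma hS_param:
 assumes "\<And>l. l \<in> Es \<Longrightarrow> (\<lambda>v. f v l) \<in> k_hom k V Z" "l \<in> Es"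
 shows "(\<lambda>v. hS (f v) l) \<in> k_hom k V Z"
 using assms
proof (induct l arbitrary: f)
 case Nil
 show ?case using Nil(1)[of "[u]"] uc by simp
next
 case (Cons e l)
 have c: "e \<in> carrier E" "l \<in> Es" using Cons(3) by simp_all
 have "(\<lambda>v. hS (\<lambda>m. f v (e # m)) l) \<in> k_hom k V Z" by (rule Cons(1), rule Cons(2)) (use c in simp_all)
 moreover have "(\<lambda>v. f v (u # q e # map q l)) \<in> k_hom k V Z" by (rule Cons(2)) (use c uc qc map_q in simp)
 ultimately show ?case by (simp add: k_hom_sub Z.mN)
qed

lemma hS_slot:
 assumes "multilinear k E Z f" "l1 \<in> Es" "l2 \<in> Es"
 shows "(\<lambda>x. hS f (l1 @ x # l2)) \<in> k_hom k E Z"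
 using assms
proof (induct l1 arbitrary: f)
 case Nil
 have "(\<lambda>x. f ([u] @ q x # map q l2)) \<in> k_hom k E Z"
  by (rule k_hom_compose[OF q_hom multilinear_slot[OF Nil(1)]]) (use uc map_q Nil(3) in simp_all)
 moreover have "(\<lambda>x. hS (\<lambda>m. f (x # m)) l2) \<in> k_hom k E Z"
  by (rule hS_param[OF multilinear_hd[OF Nil(1)] Nil(3)])
 ultimately show ?case by (simp add: k_hom_sub Z.mN)
next
 case (Cons a l1)
 have c: "a \<in> carrier E" "l1 \<in> Es" using Cons(3) by simp_all
 have "(\<lambda>x. f ((u # q a # map q l1) @ q x # map q l2)) \<in> k_hom k E Z"
  by (rule k_hom_compose[OF q_hom multilinear_slot[OF Cons(2)]]) (use uc map_q Cons(4) c qc in simp_all)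
 moreover have "(\<lambda>x. hS (\<lambda>m. f (a # m)) (l1 @ x # l2)) \<in> k_hom k E Z"
  by (rule Cons(1)[OF multilinear_Cons[OF Cons(2) c(1)] c(2) Cons(4)])
 ultimately show ?case by (simp add: k_hom_sub Z.mN)
qed

lemma hS_multilinear: "multilinear k E Z f \<Longrightarrow> multilinear k E Z (hS f)"
 by (rule multilinearI) (simp_all add: hS_slot hS_closed multilinear_closed)

lemma hS_cong: "\<lbrakk>\<And>m. m \<in> Es \<Longrightarrow> f m = g m; l \<in> Es\<rbrakk> \<Longrightarrow> hS f l = hS g l"
proof (induct l arbitrary: f g)
 case Nil
 then show ?case using uc by simp
next
 case (Cons e l)
 have c: "e \<in> carrier E" "l \<in> Es" using Cons(3) by simp_all
 have "hS (\<lambda>m. f (e # m)) l = hS (\<lambda>m. g (e # m)) l" by (rule Cons(1), rule Cons(2)) (use c in simp_all)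
 moreover have "f (u # q e # map q l) = g (u # q e # map q l)" by (rule Cons(2)) (use c uc qc map_q in simp)
 ultimately show ?case by simp
qed

lemma hS_minus:
 assumes "\<And>m. m \<in> Es \<Longrightarrow> f m \<in> carrier Z" "\<And>m. m \<in> Es \<Longrightarrow> g m \<in> carrier Z" "l \<in> Es"
 shows "hS (\<lambda>m. f m \<ominus> g m) l = hS f l \<ominus> hS g l"
 using assms
proof (induct l arbitrary: f g)
 case Nil
 then show ?case by simp
next
 case (Cons e l)
 have c: "e \<in> carrier E" "l \<in> Es" using Cons(4) by simp_all
 have fe: "f (e # m) \<in> carrier Z" if "m \<in> Es" for m by (rule Cons(2)) (use c that in simp)
 have ge: "g (e # m) \<in> carrier Z" if "m \<in> Es" for m by (rule Cons(3)) (use c that in simp)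
 have IH: "hS (\<lambda>m. f (e # m) \<ominus> g (e # m)) l = hS (\<lambda>m. f (e # m)) l \<ominus> hS (\<lambda>m. g (e # m)) l"
  by (rule Cons(1)[OF fe ge c(2)])
 have l: "u # q e # map q l \<in> Es" using c uc qc map_q by simp
 show ?case using IH Z.N.N.minus_swap[OF Cons(2)[OF l] Cons(3)[OF l] hS_closed[OF fe c(2)] hS_closed[OF ge c(2)]] by simp
qed

lemma hS_lact:
 assumes "\<And>m. m \<in> Es \<Longrightarrow> f m \<in> carrier Z" "x \<in> carrier E" "l \<in> Es"
 shows "hS (\<lambda>m. lact Z x (f m)) l = lact Z x (hS f l)"
 using assms
proof (induct l arbitrary: f)
 case Nil
 then show ?case by simp
next
 case (Cons e l)
 have c: "e \<in> carrier E" "l \<in> Es" using Cons(4) by simp_all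
 have fe: "f (e # m) \<in> carrier Z" if "m \<in> Es" for m by (rule Cons(2)) (use c that in simp)
 have IH: "hS (\<lambda>m. lact Z x (f (e # m))) l = lact Z x (hS (\<lambda>m. f (e # m)) l)"
  by (rule Cons(1)[OF fe Cons(3) c(2)])
 have l: "u # q e # map q l \<in> Es" using c uc qc map_q by simp
 show ?case using IH by (simp add: k_hom_minus[OF Z.mN Z.mN Z.lact_k_hom(1)[OF Cons(3)] Cons(2)[OF l] hS_closed[OF fe c(2)]])
qed

lemma hD_q:
 assumes "\<And>m. m \<in> Es \<Longrightarrow> f m \<in> carrier Z" "e \<in> carrier E" "l \<in> Es"
 shows "hD E Z (\<lambda>m. f (map q m)) e l = hD E Z f (q e) (map q l)"
 by (rule hD_morph[OF Z.bN Z.mN Z.kC k_hom_id qc q_mult _ assms, symmetric]) (simp_all add: ract_p[symmetric])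

text \<open>
 All interior terms cancel because \<open>e u = q e\<close> and \<open>q\<close> is multiplicative. The three remaining terms are
 from inserting \<open>u\<close> at the far right, where \<open>u\<close> acts trivially on \<open>Z\<close>, and at the far left.
\<close>

lemma hD_hS:
 assumes "\<And>m. m \<in> Es \<Longrightarrow> f m \<in> carrier Z" "e \<in> carrier E" "l \<in> Es"
 shows "hD E Z (hS f) e l \<ominus> hS (hD E Z f e) l =
   f (e # l) \<ominus> f (q e # map q l) \<oplus> hD E Z (\<lambda>m. f (u # m)) (q e) (map q l)"
 using assms
proof (induct l arbitrary: f e)
 case Nil
 have c: "f [e] \<in> carrier Z" "f [q e] \<in> carrier Z" "f [u] \<in> carrier Z"
  by (rule Nil(1), use Nil(2) qc uc in simp)+
 have "ract Z (f [u]) (q e) = ract Z (f [u]) e" using ract_p[OF c(3) Nil(2)] by simp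
 moreover have rc: "ract Z (f [u]) e \<in> carrier Z" using c Nil(2) by (simp add: Z.N.ract_closed)
 moreover have sw: "a \<ominus> (b \<ominus> d) = d \<ominus> b \<oplus> a"
  if "a \<in> carrier Z" "b \<in> carrier Z" "d \<in> carrier Z" for a b d
  using that by (simp add: a_minus_def Z.N.N.minus_add Z.N.N.a_ac)
 ultimately show ?case using Nil(2) sw[OF rc c(2,1)] by (simp add: x_u ract_u c)
next
 case (Cons e' l)
 note f = Cons(2) and e = Cons(3)
 have c: "e' \<in> carrier E" "l \<in> Es" using Cons(4) by simp_all
 note ql = map_q[OF c(2)]
 have fx: "f (x # m) \<in> carrier Z" if "m \<in> Es" "x \<in> carrier E" for m x by (rule f) (use that in simp)
 have fxy: "f (x # y # m) \<in> carrier Z" if "m \<in> Es" "x \<in> carrier E" "y \<in> carrier E" for m x y by (rule f) (use that in simp)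
 have ee: "e \<otimes>\<^bsub>E\<^esub> e' \<in> carrier E" using e c by simp
 let ?P = "f (u # q (e \<otimes>\<^bsub>E\<^esub> e') # map q l)" and ?Sa = "hS (\<lambda>m. f ((e \<otimes>\<^bsub>E\<^esub> e') # m)) l"
 let ?Q = "hD E Z (\<lambda>m. f (u # q e # m)) (q e') (map q l)" and ?R = "hD E Z (hS (\<lambda>m. f (e # m))) e' l"
 let ?T = "hS (hD E Z (\<lambda>m. f (e # m)) e') l" and ?F1 = "f (q e # q e' # map q l)"
 let ?F2 = "f (e # q e' # map q l)" and ?F3 = "f (e # e' # l)" and ?V = "hD E Z (\<lambda>m. f (e # u # m)) (q e') (map q l)"
 have IH: "?R \<ominus> ?T = ?F3 \<ominus> ?F2 \<oplus> ?V"
  by (rule Cons(1)[OF fx c]) (use e in simp_all)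
 have Pc: "?P \<in> carrier Z" by (rule fxy[OF ql uc qc[OF ee]])
 have Sac: "?Sa \<in> carrier Z" by (rule hS_closed[OF fx[OF _ ee] c(2)])
 have Qc: "?Q \<in> carrier Z" by (rule Z.hD_closed[OF fxy[OF _ uc qc[OF e]] qc[OF c(1)] ql])
 have hSe: "hS (\<lambda>m. f (e # m)) m \<in> carrier Z" if "m \<in> Es" for m by (rule hS_closed[OF fx[OF _ e] that])
 have Rc: "?R \<in> carrier Z" by (rule Z.hD_closed[OF hSe c])
 have hDe: "hD E Z (\<lambda>m. f (e # m)) e' m \<in> carrier Z" if "m \<in> Es" for m by (rule Z.hD_closed[OF fx[OF _ e] c(1) that])
 have Tc: "?T \<in> carrier Z" by (rule hS_closed[OF hDe c(2)])
 have Vc: "?V \<in> carrier Z" by (rule Z.hD_closed[OF fxy[OF _ e uc] qc[OF c(1)] ql])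
 have 1: "hD E Z (hS f) e (e' # l) = ?P \<ominus> ?Sa \<ominus> (?Q \<ominus> ?R)"
 proof -
  have "hD E Z (\<lambda>m. hS f (e # m)) e' l = hD E Z (\<lambda>m. f (u # q e # map q m)) e' l \<ominus> ?R"
   unfolding corner_htpy.simps(2)
   by (rule Z.hD_minus[OF _ hSe c]) (rule fxy[OF map_q uc qc[OF e]])
  also have "hD E Z (\<lambda>m. f (u # q e # map q m)) e' l = ?Q"
   by (rule hD_q[where f = "\<lambda>m. f (u # q e # m)", OF fxy[OF _ uc qc[OF e]] c])
  finally show ?thesis by simp
 qed
 have 2: "hS (hD E Z f e) (e' # l) = ?F1 \<ominus> (?F2 \<ominus> ?V) \<ominus> (?Sa \<ominus> ?T)"
 proof -
  have "hS (\<lambda>m. hD E Z f e (e' # m)) l = ?Sa \<ominus> ?T"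
   unfolding hD.simps(2) by (rule hS_minus[OF fx[OF _ ee] hDe c(2)])
  moreover have "hD E Z f e (u # q e' # map q l) = ?F1 \<ominus> (?F2 \<ominus> ?V)"
   by (simp add: x_u[OF e] u_q[OF c(1)])
  ultimately show ?thesis by simp
 qed
 have 3: "hD E Z (\<lambda>m. f (u # m)) (q e) (map q (e' # l)) = ?P \<ominus> ?Q"
  by (simp add: q_mult[OF e c(1), symmetric])
 show ?case unfolding 1 2 3
  using Z.N.N.corner_step[OF IH Pc Sac Qc Rc Tc fxy[OF ql qc[OF e] qc[OF c(1)]] fxy[OF ql e qc[OF c(1)]] fxy[OF c(2) e c(1)] Vc]
  by simp
qed

text \<open>
 Hence the composite of restriction to the corner and inflation along \<open>p\<close> is homotopic to the identity.
\<close>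

lemma corner_homotopy:
 assumes f: "\<And>m. m \<in> Es \<Longrightarrow> f m \<in> carrier Z" and l: "l \<in> Es"
 shows "hdel E Z (hS f) l \<oplus> hS (hdel E Z f) l = lact Z u (f (map q l)) \<ominus> f l"
proof (cases l)
 case Nil
 have "f [] \<in> carrier Z" by (rule f) simp
 then show ?thesis using Nil uc by (simp add: ract_u Z.N.lact_closed)
next
 case (Cons e l')
 have e: "e \<in> carrier E" and l': "l' \<in> Es" using l Cons by simp_all
 note ql = map_q[OF l']
 have fx: "f (x # m) \<in> carrier Z" if "m \<in> Es" "x \<in> carrier E" for m x by (rule f) (use that in simp)
 let ?a = "lact Z e (hS f l')" and ?b = "hD E Z (hS f) e l'" and ?c = "lact Z u (f (q e # map q l'))"
 let ?F1 = "f (q e # map q l')" and ?W = "hD E Z (\<lambda>m. f (u # m)) (q e) (map q l')" and ?s = "hS (hD E Z f e) l'"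
 have hSc: "hS f m \<in> carrier Z" if "m \<in> Es" for m by (rule hS_closed[OF f that])
 have hDc: "hD E Z f e m \<in> carrier Z" if "m \<in> Es" for m by (rule Z.hD_closed[OF f e that])
 have F1: "?F1 \<in> carrier Z" by (rule fx[OF ql qc[OF e]])
 have ac: "?a \<in> carrier Z" by (rule Z.N.lact_closed[OF e hSc[OF l']])
 have bc: "?b \<in> carrier Z" by (rule Z.hD_closed[OF hSc e l'])
 have cc: "?c \<in> carrier Z" by (rule Z.N.lact_closed[OF uc F1])
 have sc: "?s \<in> carrier Z" by (rule hS_closed[OF hDc l'])
 have Wc: "?W \<in> carrier Z" by (rule Z.hD_closed[OF fx[OF _ uc] qc[OF e] ql])
 have la: "hS (\<lambda>m. lact Z e (f m)) l' = ?a" by (rule hS_lact[OF f e l'])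
 have 1: "hS (\<lambda>m. hdel E Z f (e # m)) l' = ?a \<ominus> ?s"
  unfolding hdel.simps(2) la[symmetric]
  by (rule hS_minus[OF Z.N.lact_closed[OF e f] hDc l'])
 have 2: "hdel E Z f (u # q e # map q l') = ?c \<ominus> (?F1 \<ominus> ?W)"
  by (simp add: u_q[OF e])
 show ?thesis
  using Z.N.N.corner_total[OF hD_hS[OF f e l'] ac bc cc sc F1 fx[OF l' e] Wc] 1 2 by (simp add: Cons)
qed

definition "ZA = restrict_bimod {lact Z u z | z. z \<in> carrier Z} \<iota> \<iota> Z"

lemma ZA_simps [simp]: "carrier ZA = {lact Z u z | z. z \<in> carrier Z}" "zero ZA = zero Z" "add ZA = add Z"
 "smult ZA = smult Z" "lact ZA = (\<lambda>a. lact Z (\<iota> a))" "ract ZA = (\<lambda>x b. ract Z x (\<iota> b))"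
 by (simp_all add: ZA_def restrict_bimod_def)

lemma ZA_iff: "z \<in> carrier ZA \<longleftrightarrow> z \<in> carrier Z \<and> lact Z u z = z"
proof -
 have uu: "u \<otimes>\<^bsub>E\<^esub> u = u" using u_q[of "\<one>\<^bsub>E\<^esub>"] mult_unit[of "\<one>\<^bsub>E\<^esub>"] uc by simp
 have "lact Z u (lact Z u z) = lact Z u z" if "z \<in> carrier Z" for z
  using Z.N.lact_mult[OF uc uc that] uu by simp
 then show ?thesis using Z.N.lact_closed[OF uc] by force
qed

lemma iota_u: "a \<in> carrier A \<Longrightarrow> \<iota> a \<otimes>\<^bsub>E\<^esub> u = \<iota> a" "a \<in> carrier A \<Longrightarrow> u \<otimes>\<^bsub>E\<^esub> \<iota> a = \<iota> a"
 using mult_unit[OF io] iota_mult[of "\<one>\<^bsub>A\<^esub>" a] by (simp_all add: p_iota)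

lemma bimodule_ZA: "bimodule k A A ZA"
proof -
 have sm: "submodule (carrier ZA) k Z"
 proof (rule Z.N.N.submoduleI)
  show "carrier ZA \<subseteq> carrier Z" using ZA_iff by blast
  note lu = Z.lact_k_hom(1)[OF uc]
  show "\<zero> \<in> carrier ZA" unfolding ZA_iff using k_hom_zero[OF Z.mN Z.mN lu] by simp
  show "\<ominus> a \<in> carrier ZA" if "a \<in> carrier ZA" for a
   using that unfolding ZA_iff using k_hom_a_inv[OF Z.mN Z.mN lu] by simp
  show "a \<oplus> b \<in> carrier ZA" if "a \<in> carrier ZA" "b \<in> carrier ZA" for a b
   using that unfolding ZA_iff using k_hom_add[OF lu] by simp
  show "c \<odot> b \<in> carrier ZA" if "c \<in> carrier k" "b \<in> carrier ZA" for c b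
   using that unfolding ZA_iff using k_hom_smult[OF lu] by simp
 qed
 have mZA: "module k ZA"
  by (rule module_transfer[OF submodule.submodule_is_module[OF sm Z.mN]]) simp_all
 have lc: "lact Z (\<iota> a) z \<in> carrier ZA" if "a \<in> carrier A" "z \<in> carrier ZA" for a z
  using that unfolding ZA_iff using Z.N.lact_mult[OF uc io] iota_u by (simp add: Z.N.lact_closed io)
 have rc: "ract Z z (\<iota> a) \<in> carrier ZA" if "a \<in> carrier A" "z \<in> carrier ZA" for a z
  using that unfolding ZA_iff using Z.N.lact_ract[OF uc _ io] by (simp add: Z.N.ract_closed io)
 have zc: "z \<in> carrier Z" if "z \<in> carrier ZA" for z using that unfolding ZA_iff by simp
 have u1: "lact Z u z = z" if "z \<in> carrier ZA" for z using that unfolding ZA_iff by simp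
 show ?thesis
 proof (intro bimodule.intro left_module.intro left_module_axioms.intro bimodule_axioms.intro A.k_algebra_axioms mZA;
   (unfold ZA_simps(2-6))?)
  show "lact Z (\<iota> a) z \<in> carrier ZA" if "a \<in> carrier A" "z \<in> carrier ZA" for a z by (rule lc[OF that])
  show "ract Z z (\<iota> a) \<in> carrier ZA" if "z \<in> carrier ZA" "a \<in> carrier A" for a z by (rule rc[OF that(2,1)])
 qed (auto simp del: ZA_simps(1) simp: zc u1 io ract_u k_hom_add[OF iota_hom] k_hom_smult[OF iota_hom] iota_mult
  Z.N.lact_add_left Z.N.lact_add_right Z.N.lact_mult Z.N.lact_smult Z.N.ract_add_left Z.N.ract_add_right Z.N.ract_mult
  Z.N.ract_smult Z.N.lact_ract)
qed

abbreviation "CE \<equiv> coch k E Z"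
abbreviation "dE \<equiv> coch_d E Z"
abbreviation "CA \<equiv> coch k A ZA"
abbreviation "dA \<equiv> coch_d A ZA"

interpretation ZA: hoch k A ZA by (rule hoch.intro[OF bimodule_ZA])

lemma u_hom: "lact Z u \<in> k_hom k Z ZA"
proof -
 have "lact Z u z \<in> carrier ZA" if "z \<in> carrier Z" for z using that by auto
 then show ?thesis
  using Z.lact_k_hom(1)[OF uc] by (auto simp: k_hom_def simp del: ZA_simps(1))
qed

lemma incl_hom: "(\<lambda>x. x) \<in> k_hom k ZA Z"
 by (rule k_homI) (use ZA_iff in \<open>simp_all del: ZA_simps(1)\<close>)

definition "restr n f = trunc A ZA n (\<lambda>l. lact Z u (f (map \<iota> l)))"
definition "infl n g = trunc E Z n (\<lambda>l. g (map p l))"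

lemma restr_multilinear:
 assumes f: "multilinear k E Z f" shows "multilinear k A ZA (\<lambda>l. lact Z u (f (map \<iota> l)))"
proof (rule multilinear_comp[OF multilinearI u_hom])
 show "f (map \<iota> l) \<in> carrier Z" if "l \<in> As" for l by (rule multilinear_closed[OF f map_iota[OF that]])
 show "(\<lambda>x. f (map \<iota> (l1 @ x # l2))) \<in> k_hom k A Z" if "l1 \<in> As" "l2 \<in> As" for l1 l2
  using k_hom_compose[OF iota_hom multilinear_slot[OF f map_iota[OF that(1)] map_iota[OF that(2)]]] by simp
qed

lemma infl_multilinear:
 assumes g: "multilinear k A ZA g" shows "multilinear k E Z (\<lambda>l. g (map p l))"
proof (rule multilinear_comp[OF multilinearI incl_hom])
 show "g (map p l) \<in> carrier ZA" if "l \<in> Es" for l by (rule multilinear_closed[OF g map_p[OF that]])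
 show "(\<lambda>x. g (map p (l1 @ x # l2))) \<in> k_hom k E ZA" if "l1 \<in> Es" "l2 \<in> Es" for l1 l2
  using k_hom_compose[OF p_hom multilinear_slot[OF g map_p[OF that(1)] map_p[OF that(2)]]] by simp
qed

lemma restr_hdel:
 assumes f: "\<And>m. m \<in> Es \<Longrightarrow> f m \<in> carrier Z" and l: "l \<in> As"
 shows "lact Z u (hdel E Z f (map \<iota> l)) = hdel A ZA (\<lambda>l. lact Z u (f (map \<iota> l))) l"
proof (cases l)
 case Nil
 then show ?thesis using k_hom_zero[OF Z.mN ZA.mN u_hom] by simp
next
 case (Cons a l')
 have a: "a \<in> carrier A" "l' \<in> As" using l Cons by simp_all
 have 1: "lact Z u (hD E Z f (\<iota> a) (map \<iota> l')) = hD A ZA (\<lambda>m. lact Z u (f (map \<iota> m))) a l'"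
  by (rule hD_morph[OF Z.bN ZA.mN A.k_algebra_axioms u_hom io iota_mult _ f a])
   (simp_all add: Z.N.lact_ract uc io)
 have fc: "f (map \<iota> l') \<in> carrier Z" by (rule f[OF map_iota[OF a(2)]])
 have 2: "lact Z u (lact Z (\<iota> a) (f (map \<iota> l'))) = lact Z (\<iota> a) (lact Z u (f (map \<iota> l')))"
  using Z.N.lact_mult[OF uc io[OF a(1)] fc] Z.N.lact_mult[OF io[OF a(1)] uc fc] iota_u[OF a(1)] by simp
 show ?thesis
  using k_hom_minus[OF Z.mN ZA.mN u_hom Z.N.lact_closed[OF io[OF a(1)] fc] Z.hD_closed[OF f io[OF a(1)] map_iota[OF a(2)]]]
  by (simp add: Cons 1 2 del: ZA_simps(1))
qed

lemma infl_hdel: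
 assumes g: "\<And>m. m \<in> As \<Longrightarrow> g m \<in> carrier ZA" and l: "l \<in> Es"
 shows "hdel A ZA g (map p l) = hdel E Z (\<lambda>l. g (map p l)) l"
proof (cases l)
 case Nil
 then show ?thesis by simp
next
 case (Cons e l')
 have e: "e \<in> carrier E" "l' \<in> Es" using l Cons by simp_all
 have 1: "hD A ZA g (p e) (map p l') = hD E Z (\<lambda>m. g (map p m)) e l'"
  by (rule hD_morph[OF bimodule_ZA Z.mN Z.kC incl_hom pc p_mult _ g e])
   (use ract_p ZA_iff in \<open>simp_all del: ZA_simps(1)\<close>)
 have gc: "g (map p l') \<in> carrier ZA" by (rule g[OF map_p[OF e(2)]])
 then have gu: "g (map p l') \<in> carrier Z" "lact Z u (g (map p l')) = g (map p l')" unfolding ZA_iff by simp_all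
 have 2: "lact Z (\<iota> (p e)) (g (map p l')) = lact Z e (g (map p l'))"
  using Z.N.lact_mult[OF e(1) uc gu(1)] gu(2) mult_unit[OF e(1)] by simp
 have lc: "lact Z (\<iota> (p e)) (g (map p l')) \<in> carrier ZA" using ZA.N.lact_closed[OF pc[OF e(1)] gc] by simp
 have hc: "hD A ZA g (p e) (map p l') \<in> carrier ZA" by (rule ZA.hD_closed[OF g pc[OF e(1)] map_p[OF e(2)]])
 have "lact Z (\<iota> (p e)) (g (map p l')) \<ominus>\<^bsub>ZA\<^esub> hD A ZA g (p e) (map p l')
   = lact Z (\<iota> (p e)) (g (map p l')) \<ominus> hD A ZA g (p e) (map p l')"
  by (rule k_hom_minus[OF ZA.mN Z.mN incl_hom lc hc])
 then show ?thesis by (simp add: Cons 1 2)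
qed

lemma map_gens: "l \<in> power_gens A n \<Longrightarrow> map \<iota> l \<in> power_gens E n" "l' \<in> power_gens E n \<Longrightarrow> map p l' \<in> power_gens A n"
 by (simp_all add: power_gens_lists map_iota map_p)

lemma restr_chain: "chain_map k (CE) (dE) (CA) (dA) restr"
proof (intro chain_map.intro chain_map_axioms.intro Z.coch_cx ZA.coch_cx)
 note lu = Z.lact_k_hom(1)[OF uc]
 show "restr n \<in> k_hom k (CE n) (CA n)" for n
 proof (rule k_homI)
  fix f assume f: "f \<in> carrier (CE n)"
  show "restr n f \<in> carrier (CA n)" unfolding restr_def
   by (rule trunc_coch[OF ZA.mC ZA.mN restr_multilinear[OF coch_multilinear[OF f]]])
  note fc = coch_closed[OF f Z.mN]
  show "restr n (f \<oplus>\<^bsub>CE n\<^esub> g) = restr n f \<oplus>\<^bsub>CA n\<^esub> restr n g" if g: "g \<in> carrier (CE n)" for g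
   using fc coch_closed[OF g Z.mN] by (auto simp: restr_def trunc_def k_hom_add[OF lu])
  show "restr n (c \<odot>\<^bsub>CE n\<^esub> f) = c \<odot>\<^bsub>CA n\<^esub> restr n f" if c: "c \<in> carrier k" for c
   using fc c by (auto simp: restr_def trunc_def k_hom_smult[OF lu])
 qed
 show "restr (Suc n) (dE n f) = dA n (restr n f)" if f: "f \<in> carrier (CE n)" for f n
 proof
  fix l
  show "restr (Suc n) (dE n f) l = dA n (restr n f) l"
  proof (cases "l \<in> power_gens A (Suc n)")
   case True
   then have l: "l \<in> As" "length l = Suc n" by (simp_all add: power_gens_lists)
   have "restr (Suc n) (dE n f) l = lact Z u (hdel E Z f (map \<iota> l))"
    using True map_gens(1)[OF True] by (simp add: restr_def coch_d_def trunc_def)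
   also have "\<dots> = hdel A ZA (\<lambda>l. lact Z u (f (map \<iota> l))) l"
    by (rule restr_hdel[OF multilinear_closed[OF coch_multilinear[OF f]] l(1)])
   also have "\<dots> = hdel A ZA (restr n f) l"
    by (rule ZA.hdel_cong[OF _ l(1)]) (use l in \<open>simp add: restr_def trunc_def power_gens_lists\<close>)
   finally show ?thesis using True by (simp add: coch_d_def trunc_def)
  qed (simp add: restr_def coch_d_def trunc_def)
 qed
qed

lemma infl_coch: "g \<in> carrier (CA n) \<Longrightarrow> infl n g \<in> carrier (CE n)"
 unfolding infl_def by (rule trunc_coch[OF Z.mC Z.mN infl_multilinear[OF coch_multilinear]])

lemma infl_comm:
 assumes g: "g \<in> carrier (CA n)"
 shows "infl (Suc n) (dA n g) = dE n (infl n g)"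
proof
 fix l
 show "infl (Suc n) (dA n g) l = dE n (infl n g) l"
 proof (cases "l \<in> power_gens E (Suc n)")
  case True
  then have l: "l \<in> Es" "length l = Suc n" by (simp_all add: power_gens_lists)
  have "infl (Suc n) (dA n g) l = hdel A ZA g (map p l)"
   using True map_gens(2)[OF True] by (simp add: infl_def coch_d_def trunc_def)
  also have "\<dots> = hdel E Z (\<lambda>l. g (map p l)) l"
   by (rule infl_hdel[OF multilinear_closed[OF coch_multilinear[OF g]] l(1)])
  also have "\<dots> = hdel E Z (infl n g) l"
   by (rule Z.hdel_cong[OF _ l(1)]) (use l in \<open>simp add: infl_def trunc_def power_gens_lists\<close>)
  finally show ?thesis using True by (simp add: coch_d_def trunc_def)
 qed (simp add: infl_def coch_d_def trunc_def)
qed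

lemma restr_infl:
 assumes g: "g \<in> carrier (CA n)" shows "restr n (infl n g) = g"
proof
 fix l
 show "restr n (infl n g) l = g l"
 proof (cases "l \<in> power_gens A n")
  case True
  then have "l \<in> As" by (simp add: power_gens_lists)
  then have "map p (map \<iota> l) = l" by (induct l) (simp_all add: p_iota)
  moreover have "lact Z u (g l) = g l" using coch_closed[OF g ZA.mN, of l] unfolding ZA_iff by simp
  ultimately show ?thesis using True map_gens(1)[OF True] by (simp add: restr_def infl_def trunc_def)
 next
  case False
  then show ?thesis using g by (simp add: restr_def trunc_def coch_carrier)
 qed
qed

lemma infl_restr:
 assumes f: "f \<in> carrier (cyc (CE) (dE) n)"
 shows "infl n (restr n f) \<ominus>\<^bsub>CE n\<^esub> f \<in> bdry (CE) (dE) n"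
proof -
 interpret cE: cx k "CE" "dE" by (rule Z.coch_cx)
 interpret Q: module k "CE n" by (rule cE.mod)
 have fc: "f \<in> carrier (CE n)" and df: "dE n f = (\<lambda>l. \<zero>)" using f by (simp_all add: cyc_carrier)
 note fcl = multilinear_closed[OF coch_multilinear[OF fc]]
 have rc: "restr n f \<in> carrier (CA n)" by (rule k_hom_closed[OF chain_map.f_hom[OF restr_chain] fc])
 note ic = infl_coch[OF rc]
 have ir: "infl n (restr n f) l = lact Z u (f (map q l))" if l: "l \<in> power_gens E n" for l
  using l map_gens(2)[OF l] by (simp add: infl_def restr_def trunc_def comp_def)
 have S0: "hS (hdel E Z f) l = \<zero>" if l: "l \<in> Es" for l
 proof -
  have "hS (hdel E Z f) l = hS (\<lambda>m. \<zero> \<ominus> \<zero>) l"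
   by (rule hS_cong[OF _ l]) (simp add: Z.hdel_eq_coch_d[OF fc] df Z.N.N.minus_zero_right)
  also have "\<dots> = hS (\<lambda>m. \<zero>) l \<ominus> hS (\<lambda>m. \<zero>) l" by (rule hS_minus[OF _ _ l]) simp_all
  also have "\<dots> = \<zero>" using hS_closed[of "\<lambda>m. \<zero>" l] l by (simp add: a_minus_def Z.N.N.r_neg)
  finally show ?thesis .
 qed
 have main: "lact Z u (f (map q l)) \<ominus> f l = hdel E Z (hS f) l" if l: "l \<in> Es" for l
 proof -
  have h: "hdel E Z (hS f) l \<oplus> hS (hdel E Z f) l = lact Z u (f (map q l)) \<ominus> f l"
   by (rule corner_homotopy[OF fcl l])
  have "hdel E Z (hS f) l \<in> carrier Z" by (rule Z.hdel_closed[OF hS_closed[OF fcl] l])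
  then show ?thesis using h S0[OF l] by simp
 qed
 show ?thesis
 proof (cases n)
  case 0
  have "infl n (restr n f) = f"
  proof (rule coch_eqI[OF ic fc])
   fix l assume l: "l \<in> power_gens E n"
   then have "l = []" using 0 by (simp add: power_gens_def)
   have c: "f l \<in> carrier Z" "f (map q l) \<in> carrier Z" using l fcl map_q by (simp_all add: power_gens_lists)
   show "infl n (restr n f) l = f l" unfolding ir[OF l]
    by (rule Z.N.N.minus_eq_zeroD) (use main[of l] \<open>l = []\<close> c Z.N.lact_closed[OF uc c(2)] in simp_all)
  qed
  then have "infl n (restr n f) \<ominus>\<^bsub>CE n\<^esub> f = \<zero>\<^bsub>CE n\<^esub>" using Q.M.r_neg[OF fc] by (simp add: a_minus_def)
  then show ?thesis using cE.bdry_zero by simp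
 next
  case (Suc m)
  let ?h = "trunc E Z m (hS f)"
  have hc: "?h \<in> carrier (CE m)" by (rule trunc_coch[OF Z.mC Z.mN hS_multilinear[OF coch_multilinear[OF fc]]])
  have dh: "dE m ?h \<in> carrier (CE n)" using k_hom_closed[OF Z.coch_d_k_hom hc] Suc by simp
  have "infl n (restr n f) = dE m ?h \<oplus>\<^bsub>CE n\<^esub> f"
  proof (rule coch_eqI[OF ic Q.M.a_closed[OF dh fc]])
   fix l assume l: "l \<in> power_gens E n"
   then have l': "l \<in> Es" "length l = Suc m" using Suc by (simp_all add: power_gens_lists)
   have "hdel E Z (hS f) l = hdel E Z ?h l"
    by (rule Z.hdel_cong[OF _ l'(1)]) (use l' in \<open>simp add: trunc_def power_gens_lists\<close>)
   then have e: "lact Z u (f (map q l)) \<ominus> f l = dE m ?h l" using main[OF l'(1)] Z.hdel_eq_coch_d[OF hc l'(1)] by simp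
   have c: "f l \<in> carrier Z" "lact Z u (f (map q l)) \<in> carrier Z" using l' fcl map_q Z.N.lact_closed[OF uc] by simp_all
   show "infl n (restr n f) l = (dE m ?h \<oplus>\<^bsub>CE n\<^esub> f) l"
    unfolding ir[OF l] using e[symmetric] c by (simp add: a_minus_def Z.N.N.a_assoc Z.N.N.l_neg)
  qed
  then have "infl n (restr n f) \<ominus>\<^bsub>CE n\<^esub> f = dE m ?h"
   using dh fc by (simp add: a_minus_def Q.M.a_assoc Q.M.r_neg del: coch_simps)
  then show ?thesis using hc Suc by (simp add: bdry_def)
 qed
qed

lemma corner_iso:
 "induced (CE) (dE) n (CA) (dA) n (restr n) \<in>
   k_hom k (cohomology (CE) (dE) n) (cohomology (CA) (dA) n)"
 "bij_betw (induced (CE) (dE) n (CA) (dA) n (restr n))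
   (carrier (cohomology (CE) (dE) n)) (carrier (cohomology (CA) (dA) n))"
proof -
 interpret R: chain_map k "CE" "dE" "CA" "dA" restr by (rule restr_chain)
 show "induced (CE) (dE) n (CA) (dA) n (restr n) \<in>
   k_hom k (cohomology (CE) (dE) n) (cohomology (CA) (dA) n)"
  by (rule R.ind(1))
 interpret QE: module k "CE n" by (rule R.K.mod)
 interpret QA: module k "CA n" by (rule R.L.mod)
 have infl0: "infl (Suc n) (\<lambda>l. \<zero>) = (\<lambda>l. \<zero>)" for n by (simp add: infl_def trunc_def)
 show "bij_betw (induced (CE) (dE) n (CA) (dA) n (restr n))
   (carrier (cohomology (CE) (dE) n)) (carrier (cohomology (CA) (dA) n))"
 proof (rule R.quasi_iso_bij)
  fix g assume g: "g \<in> carrier (cyc (CA) (dA) n)"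
  then have gc: "g \<in> carrier (CA n)" and dg: "dA n g = (\<lambda>l. \<zero>)" by (simp_all add: cyc_carrier)
  have "infl n g \<in> carrier (cyc (CE) (dE) n)"
   using infl_coch[OF gc] infl_comm[OF gc] dg infl0 by (simp add: cyc_carrier)
  moreover have "g \<ominus>\<^bsub>CA n\<^esub> restr n (infl n g) \<in> bdry (CA) (dA) n"
   unfolding restr_infl[OF gc] using QA.M.r_neg[OF gc] R.L.bdry_zero by (simp add: a_minus_def)
  ultimately show "\<exists>x\<in>carrier (cyc (CE) (dE) n). g \<ominus>\<^bsub>CA n\<^esub> restr n x \<in> bdry (CA) (dA) n"
   by blast
 next
  fix f assume f: "f \<in> carrier (cyc (CE) (dE) n)" and b: "restr n f \<in> bdry (CA) (dA) n"
  have fc: "f \<in> carrier (CE n)" by (rule R.K.cyc_sub[OF f])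
  have ib: "infl n (restr n f) \<in> bdry (CE) (dE) n"
  proof (cases n)
   case 0
   then show ?thesis using b by (simp add: bdry_def infl_def trunc_def)
  next
   case (Suc m)
   then obtain g where g: "g \<in> carrier (CA m)" "restr n f = dA m g" using b by (auto simp: bdry_def)
   then show ?thesis using infl_comm[OF g(1)] infl_coch[OF g(1)] Suc by (simp add: bdry_def)
  qed
  have ic: "infl n (restr n f) \<in> carrier (cyc (CE) (dE) n)" by (rule R.K.bdry_cyc[OF ib])
  have "cls (CE) (dE) n f = cls (CE) (dE) n (infl n (restr n f))"
   using R.K.cls_eq_iff[OF ic f] infl_restr[OF f] by simp
  then show "f \<in> bdry (CE) (dE) n"
   using R.K.cls_zero_iff[OF f] R.K.cls_zero_iff[OF ic] ib by simp
 qed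
qed

end

section \<open>Relatively projective modules\<close>

lemma truncate_simps [simp]: "carrier (module.truncate P) = carrier P" "zero (module.truncate P) = zero P"
 "add (module.truncate P) = add P" "smult (module.truncate P) = smult P"
 by (simp_all add: module.truncate_def)

lemma module_truncate: "module k P \<Longrightarrow> module k (module.truncate P)"
 by (erule module_transfer) simp_all

lemma k_hom_truncate [simp]: "k_hom k (module.truncate P) N = k_hom k P N"
 by (auto simp: k_hom_def)

lemma bilinear_truncate [simp]: "bilinear k R (module.truncate P) N \<phi> = bilinear k R P N \<phi>"
 by (simp add: bilinear_def)

abbreviation "ext_tensor k R P \<equiv> tensor k R (module.truncate P)"
abbreviation "ext_pure k R P \<equiv> pure_tensor k R (module.truncate P)"

definition ext_lact where
 "ext_lact k R P r = lin_lift k (ext_tensor k R P) (\<lambda>(r', x). ext_pure k R P (r \<otimes>\<^bsub>R\<^esub> r') x)"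

definition extension_module :: "'k ring \<Rightarrow> ('k, 'r) module \<Rightarrow> ('k, 'r, 'p) lmod \<Rightarrow> ('k, 'r, ('r \<times> 'p \<Rightarrow> 'k) set) lmod" where
 "extension_module k R P = \<lparr>carrier = carrier (ext_tensor k R P), mult = mult (ext_tensor k R P), one = one (ext_tensor k R P),
   zero = zero (ext_tensor k R P), add = add (ext_tensor k R P), smult = smult (ext_tensor k R P), lact = ext_lact k R P\<rparr>"

lemma extension_module_simps [simp]:
 "carrier (extension_module k R P) = carrier (ext_tensor k R P)" "zero (extension_module k R P) = zero (ext_tensor k R P)"
 "add (extension_module k R P) = add (ext_tensor k R P)" "smult (extension_module k R P) = smult (ext_tensor k R P)"
 "lact (extension_module k R P) = ext_lact k R P"
 by (simp_all add: extension_module_def)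

text \<open>
 An \<open>R\<close>-linear section of the multiplication map \<open>R \<otimes> P \<rightarrow> P\<close>.
\<close>

definition rel_section :: "'k ring \<Rightarrow> ('k, 'r) module \<Rightarrow> ('k, 'r, 'p) lmod \<Rightarrow> ('p \<Rightarrow> ('r \<times> 'p \<Rightarrow> 'k) set) \<Rightarrow> bool" where
 "rel_section k R P h \<longleftrightarrow> left_module k R P \<and> h \<in> k_hom k P (ext_tensor k R P) \<and>
   (\<forall>r\<in>carrier R. \<forall>x\<in>carrier P. h (lact P r x) = ext_lact k R P r (h x)) \<and>
   (\<forall>x\<in>carrier P. lin_lift k P (\<lambda>(r, y). lact P r y) (h x) = x)"

context
 fixes k :: "'k ring" and R :: "('k, 'r) module" and P :: "('k, 'r, 'p) lmod"
 assumes P: "left_module k R P"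
begin

interpretation P: left_module k R P by (rule P)

lemma ext_mR: "module k R" by (rule P.module_axioms)
lemma ext_mP: "module k P" by (rule P.N.module_axioms)
lemma ext_mP': "module k (module.truncate P)" by (rule module_truncate[OF ext_mP])
lemma ext_mT: "module k (ext_tensor k R P)" by (rule module_tensor[OF ext_mR ext_mP'])

lemma ext_hom_eq:
 assumes "module k L" "f \<in> k_hom k (ext_tensor k R P) L" "g \<in> k_hom k (ext_tensor k R P) L"
  "\<And>r x. \<lbrakk>r \<in> carrier R; x \<in> carrier P\<rbrakk> \<Longrightarrow> f (ext_pure k R P r x) = g (ext_pure k R P r x)"
  "t \<in> carrier (ext_tensor k R P)"
 shows "f t = g t"
 using tensor_hom_eq[OF ext_mR ext_mP' assms(1-3) _ assms(5)] assms(4) by simp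

lemma ext_lift:
 assumes "module k L" "bilinear k R P L \<phi>"
 shows "lin_lift k L (\<lambda>(r, x). \<phi> r x) \<in> k_hom k (ext_tensor k R P) L"
  and "\<lbrakk>r \<in> carrier R; x \<in> carrier P\<rbrakk> \<Longrightarrow> lin_lift k L (\<lambda>(r, x). \<phi> r x) (ext_pure k R P r x) = \<phi> r x"
 using tensor_lift_k_hom[OF ext_mR ext_mP' assms(1), of \<phi>] tensor_lift_pure[OF ext_mR ext_mP' assms(1), of \<phi> r x] assms(2)
 by simp_all

lemma ext_pure_bilinear: "bilinear k R P (ext_tensor k R P) (ext_pure k R P)"
 using pure_tensor_bilinear[OF ext_mR ext_mP'] by simp

lemma ext_pure_closed: "\<lbrakk>r \<in> carrier R; x \<in> carrier P\<rbrakk> \<Longrightarrow> ext_pure k R P r x \<in> carrier (ext_tensor k R P)"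
 using bilinear_closed[OF ext_pure_bilinear] .

lemma left_mult_bilinear:
 assumes \<phi>: "bilinear k R P L \<phi>" and r: "r \<in> carrier R"
 shows "bilinear k R P L (\<lambda>r' x. \<phi> (r \<otimes>\<^bsub>R\<^esub> r') x)"
proof (rule bilinearI)
 show "(\<lambda>x. \<phi> (r \<otimes>\<^bsub>R\<^esub> r') x) \<in> k_hom k P L" if "r' \<in> carrier R" for r'
  by (rule bilinear_k_hom_left[OF \<phi>]) (use r that in simp)
 show "(\<lambda>r'. \<phi> (r \<otimes>\<^bsub>R\<^esub> r') x) \<in> k_hom k R L" if "x \<in> carrier P" for x
  by (rule k_hom_compose[OF alg_mult_k_hom(1)[OF P.k_algebra_axioms r] bilinear_k_hom_right[OF \<phi> that]])
qed

lemma ext_lact_props: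
 assumes r: "r \<in> carrier R"
 shows "ext_lact k R P r \<in> k_hom k (ext_tensor k R P) (ext_tensor k R P)"
  "\<lbrakk>r' \<in> carrier R; x \<in> carrier P\<rbrakk> \<Longrightarrow> ext_lact k R P r (ext_pure k R P r' x) = ext_pure k R P (r \<otimes>\<^bsub>R\<^esub> r') x"
 unfolding ext_lact_def
 using ext_lift[OF ext_mT left_mult_bilinear[OF ext_pure_bilinear r]] by auto

lemma left_module_extension: "left_module k R (extension_module k R P)"
proof (intro left_module.intro left_module_axioms.intro P.k_algebra_axioms; (unfold extension_module_simps)?)
 note L = ext_lact_props
 let ?T = "ext_tensor k R P"
 show "module k (extension_module k R P)" by (rule module_transfer[OF ext_mT]) simp_all
 fix r assume r: "r \<in> carrier R"
 fix t assume t: "t \<in> carrier ?T"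
 show "ext_lact k R P r t \<in> carrier ?T" by (rule k_hom_closed[OF L(1)[OF r] t])
 show "ext_lact k R P r (t \<oplus>\<^bsub>?T\<^esub> s) = ext_lact k R P r t \<oplus>\<^bsub>?T\<^esub> ext_lact k R P r s" if s: "s \<in> carrier ?T" for s
  by (rule k_hom_add[OF L(1)[OF r] t s])
 show "ext_lact k R P (c \<odot>\<^bsub>R\<^esub> r) t = c \<odot>\<^bsub>?T\<^esub> ext_lact k R P r t" if c: "c \<in> carrier k" for c
  by (rule ext_hom_eq[OF ext_mT L(1) k_hom_scale[OF ext_mT L(1)[OF r] c] _ t])
   (use r c in \<open>simp_all add: L(2) P.smult_mult_left[symmetric] k_hom_smult[OF bilinear_k_hom_right[OF ext_pure_bilinear]]\<close>)
 fix s assume s: "s \<in> carrier R"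
 show "ext_lact k R P (r \<oplus>\<^bsub>R\<^esub> s) t = ext_lact k R P r t \<oplus>\<^bsub>?T\<^esub> ext_lact k R P s t"
  by (rule ext_hom_eq[OF ext_mT L(1) k_hom_plus[OF ext_mT L(1)[OF r] L(1)[OF s]] _ t])
   (use r s in \<open>simp_all add: L(2) P.A.l_distr k_hom_add[OF bilinear_k_hom_right[OF ext_pure_bilinear]]\<close>)
 show "ext_lact k R P (r \<otimes>\<^bsub>R\<^esub> s) t = ext_lact k R P r (ext_lact k R P s t)"
  by (rule ext_hom_eq[OF ext_mT L(1) k_hom_compose[OF L(1)[OF s] L(1)[OF r]] _ t])
   (use r s in \<open>simp_all add: L(2) P.A.m_assoc\<close>)
next
 fix t assume t: "t \<in> carrier (ext_tensor k R P)"
 show "ext_lact k R P \<one>\<^bsub>R\<^esub> t = t"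
  by (rule ext_hom_eq[OF ext_mT ext_lact_props(1) k_hom_id _ t]) (simp_all add: ext_lact_props(2))
qed

text \<open>
 The map \<open>x \<mapsto> 1 \<otimes> x\<close> splits \<open>R \<otimes> P \<rightarrow> P\<close> over \<open>k\<close>, so relative projectivity lifts the identity of \<open>P\<close>
 to \<open>R \<otimes> P\<close>.
\<close>

lemma rel_projective_section:
 assumes rp: "rel_projective k R P"
 shows "\<exists>h. rel_section k R P h"
proof -
 let ?M = "extension_module k R P" and ?g = "lin_lift k P (\<lambda>(r, y). lact P r y)"
 note L = ext_lift[OF ext_mP left_module_lact_bilinear[OF P]]
 have [simp]: "k_hom k ?M P = k_hom k (ext_tensor k R P) P" "k_hom k P ?M = k_hom k P (ext_tensor k R P)"
  by (rule k_hom_transfer_left k_hom_transfer_right; simp)+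
 have g: "?g \<in> lmod_hom k R ?M P"
 proof (rule lmod_homI)
  show "?g \<in> k_hom k ?M P" using L(1) by simp
  fix r t assume r: "r \<in> carrier R" and "t \<in> carrier ?M"
  then have t: "t \<in> carrier (ext_tensor k R P)" by simp
  show "?g (lact ?M r t) = lact P r (?g t)"
   unfolding extension_module_simps
   by (rule ext_hom_eq[OF ext_mP k_hom_compose[OF ext_lact_props(1)[OF r] L(1)]
      k_hom_compose[OF L(1) left_module_lact_k_hom[OF P r]] _ t])
    (use r in \<open>simp add: ext_lact_props(2) L(2) P.lact_mult\<close>)
 qed
 have s: "(\<lambda>x. ext_pure k R P \<one>\<^bsub>R\<^esub> x) \<in> k_hom k P ?M"
  using bilinear_k_hom_left[OF ext_pure_bilinear, of "\<one>\<^bsub>R\<^esub>"] by simp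
 have gs: "?g (ext_pure k R P \<one>\<^bsub>R\<^esub> x) = x" if "x \<in> carrier P" for x
  using L(2)[of "\<one>\<^bsub>R\<^esub>" x] that by (simp add: P.lact_one)
 have onto: "?g ` carrier ?M = carrier P"
 proof (intro subset_antisym subsetI)
  show "y \<in> carrier P" if "y \<in> ?g ` carrier ?M" for y using that k_hom_closed[OF L(1)] by auto
  show "y \<in> ?g ` carrier ?M" if y: "y \<in> carrier P" for y
   using gs[OF y] ext_pure_closed[of "\<one>\<^bsub>R\<^esub>" y] y by (metis P.A.one_closed extension_module_simps(1) image_eqI)
 qed
 (* ?g is the multiplication map and x |-> 1 (x) x its k-linear section *)
 have epi: "?g \<in> k_split_epis k R ?M P"
  unfolding k_split_epis_def using g onto s gs by blast
 have idh: "(\<lambda>x. x) \<in> lmod_hom k R P P" by (rule lmod_homI) (simp_all add: k_hom_id)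
 obtain h where h: "h \<in> lmod_hom k R P ?M" "\<forall>x\<in>carrier P. ?g (h x) = x"
  using rp left_module_extension P epi idh unfolding rel_projective_def by blast
 then show ?thesis unfolding rel_section_def using P lmod_homD[OF h(1)] by auto
qed

end

text \<open>
 If \<open>h x = \<Sum> r\<^sub>i \<otimes> x\<^sub>i\<close>, this is \<open>\<Sum> \<phi>(r\<^sub>i, x\<^sub>i)\<close>; by the section property \<open>\<phi> r y = f (r y)\<close> gives back \<open>f\<close>.
\<close>

definition avg where
 "avg k h N \<phi> x = lin_lift k N (\<lambda>(r, y). \<phi> r y) (h x)"

context
 fixes k :: "'k ring" and R :: "('k, 'r) module" and P :: "('k, 'r, 'p) lmod" and h
 assumes h: "rel_section k R P h"
begin

lemma sec_left: "left_module k R P" and sec_hom: "h \<in> k_hom k P (ext_tensor k R P)"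
 using h by (auto simp: rel_section_def)

lemma sec_lact: "\<lbrakk>r \<in> carrier R; x \<in> carrier P\<rbrakk> \<Longrightarrow> h (lact P r x) = ext_lact k R P r (h x)"
 and sec_id: "x \<in> carrier P \<Longrightarrow> lin_lift k P (\<lambda>(r, y). lact P r y) (h x) = x"
 using h by (auto simp: rel_section_def)

lemma sec_closed: "x \<in> carrier P \<Longrightarrow> h x \<in> carrier (ext_tensor k R P)"
 by (rule k_hom_closed[OF sec_hom])

lemma avg_k_hom: "\<lbrakk>module k N; bilinear k R P N \<phi>\<rbrakk> \<Longrightarrow> avg k h N \<phi> \<in> k_hom k P N"
 unfolding avg_def by (rule k_hom_compose[OF sec_hom ext_lift(1)[OF sec_left]])

lemma avg_eqI:
 assumes "module k N" "f \<in> k_hom k (ext_tensor k R P) N" "bilinear k R P N \<psi>"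
  "\<And>r y. \<lbrakk>r \<in> carrier R; y \<in> carrier P\<rbrakk> \<Longrightarrow> f (ext_pure k R P r y) = \<psi> r y" "x \<in> carrier P"
 shows "f (h x) = avg k h N \<psi> x"
 unfolding avg_def
 by (rule ext_hom_eq[OF sec_left assms(1,2) ext_lift(1)[OF sec_left assms(1,3)] _ sec_closed[OF assms(5)]])
  (simp add: assms(4) ext_lift(2)[OF sec_left assms(1,3)])

lemma avg_cong:
 assumes "module k N" "bilinear k R P N \<phi>" "bilinear k R P N \<psi>"
  "\<And>r y. \<lbrakk>r \<in> carrier R; y \<in> carrier P\<rbrakk> \<Longrightarrow> \<phi> r y = \<psi> r y" "x \<in> carrier P"
 shows "avg k h N \<phi> x = avg k h N \<psi> x"
 using avg_eqI[OF assms(1) ext_lift(1)[OF sec_left assms(1,2)] assms(3) _ assms(5)] assms(4)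
 by (simp add: avg_def ext_lift(2)[OF sec_left assms(1,2)])

lemma avg_nat:
 assumes "module k N" "module k N'" "g \<in> k_hom k N N'" "bilinear k R P N \<phi>" "x \<in> carrier P"
 shows "g (avg k h N \<phi> x) = avg k h N' (\<lambda>r y. g (\<phi> r y)) x"
 using avg_eqI[OF assms(2) k_hom_compose[OF ext_lift(1)[OF sec_left assms(1,4)] assms(3)] bilinear_compose[OF assms(4,3)] _ assms(5)]
 by (simp add: avg_def ext_lift(2)[OF sec_left assms(1,4)])

lemma avg_lact:
 assumes "module k N" "bilinear k R P N \<phi>" "r \<in> carrier R" "x \<in> carrier P"
 shows "avg k h N \<phi> (lact P r x) = avg k h N (\<lambda>r' y. \<phi> (r \<otimes>\<^bsub>R\<^esub> r') y) x"
proof -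
 interpret P: left_module k R P by (rule sec_left)
 show ?thesis
  using avg_eqI[OF assms(1) k_hom_compose[OF ext_lact_props(1)[OF sec_left assms(3)] ext_lift(1)[OF sec_left assms(1,2)]]
    left_mult_bilinear[OF sec_left assms(2,3)] _ assms(4)] assms(3,4)
  by (simp add: avg_def sec_lact ext_lact_props(2)[OF sec_left] ext_lift(2)[OF sec_left assms(1,2)])
qed

lemma avg_lact_hom:
 assumes "module k N" "\<phi> \<in> k_hom k P N" "x \<in> carrier P"
 shows "avg k h N (\<lambda>r y. \<phi> (lact P r y)) x = \<phi> x"
proof -
 note b = left_module_lact_bilinear[OF sec_left]
 note L = ext_lift[OF sec_left ext_mP[OF sec_left] b]
 show ?thesis
  using avg_eqI[OF assms(1) k_hom_compose[OF L(1) assms(2)] bilinear_compose[OF b assms(2)] _ assms(3)]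
  by (simp add: L(2) sec_id assms(3))
qed

lemma avg_param:
 assumes "module k N" "module k V" "\<And>v. v \<in> carrier V \<Longrightarrow> bilinear k R P N (\<phi> v)"
  "\<And>r y. \<lbrakk>r \<in> carrier R; y \<in> carrier P\<rbrakk> \<Longrightarrow> (\<lambda>v. \<phi> v r y) \<in> k_hom k V N" "x \<in> carrier P"
 shows "(\<lambda>v. avg k h N (\<phi> v) x) \<in> k_hom k V N"
 unfolding avg_def
 by (rule tensor_lift_param[OF ext_mR[OF sec_left] ext_mP'[OF sec_left] assms(1,2) _ _ sec_closed[OF assms(5)]])
  (use assms(3,4) in simp_all)

end

context two_algebras
begin

text \<open>
 \<open>lam\<close> averages maps which are already right \<open>B\<close>-linear, so that only the letter in \<open>A\<close> is left to be
 filled in. \<open>tav\<close> turns a \<open>k\<close>-linear map into a bimodule homomorphism and fixes those which are one.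
\<close>

definition E_bilinear where
 "E_bilinear P Y \<phi> \<longleftrightarrow> bilinear k A P Y \<phi> \<and>
  (\<forall>e\<in>carrier A. \<forall>x\<in>carrier P. \<forall>b\<in>carrier B. \<phi> e (ract P x b) = ract Y (\<phi> e x) b)"

definition right_hom where
 "right_hom P Y = {f \<in> k_hom k P Y. \<forall>x\<in>carrier P. \<forall>b\<in>carrier B. f (ract P x b) = ract Y (f x) b}"

lemma right_homI: "\<lbrakk>f \<in> k_hom k P Y; \<And>x b. \<lbrakk>x \<in> carrier P; b \<in> carrier B\<rbrakk> \<Longrightarrow> f (ract P x b) = ract Y (f x) b\<rbrakk> \<Longrightarrow> f \<in> right_hom P Y"
 and right_homD: "f \<in> right_hom P Y \<Longrightarrow> f \<in> k_hom k P Y" "\<lbrakk>f \<in> right_hom P Y; x \<in> carrier P; b \<in> carrier B\<rbrakk> \<Longrightarrow> f (ract P x b) = ract Y (f x) b"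
 by (auto simp: right_hom_def)

lemma bimod_homI: "\<lbrakk>f \<in> right_hom P Y; \<And>a x. \<lbrakk>a \<in> carrier A; x \<in> carrier P\<rbrakk> \<Longrightarrow> f (lact P a x) = lact Y a (f x)\<rbrakk> \<Longrightarrow> f \<in> bimod_hom k A B P Y"
 and bimod_homD: "f \<in> bimod_hom k A B P Y \<Longrightarrow> f \<in> right_hom P Y"
  "\<lbrakk>f \<in> bimod_hom k A B P Y; a \<in> carrier A; x \<in> carrier P\<rbrakk> \<Longrightarrow> f (lact P a x) = lact Y a (f x)"
 by (auto simp: right_hom_def bimod_hom_def)

lemmas bimod_homK = right_homD(1)[OF bimod_homD(1)]

lemma E_bilinearI:
 assumes "\<And>e. e \<in> carrier A \<Longrightarrow> \<phi> e \<in> right_hom P Y" "\<And>x. x \<in> carrier P \<Longrightarrow> (\<lambda>e. \<phi> e x) \<in> k_hom k A Y"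
 shows "E_bilinear P Y \<phi>"
 using assms by (auto simp: E_bilinear_def right_hom_def bilinear_def)

lemma E_bilinearD:
 assumes "E_bilinear P Y \<phi>"
 shows "e \<in> carrier A \<Longrightarrow> \<phi> e \<in> right_hom P Y" "x \<in> carrier P \<Longrightarrow> (\<lambda>e. \<phi> e x) \<in> k_hom k A Y"
 using assms by (auto simp: E_bilinear_def right_hom_def bilinear_def)

definition lam_ext where
 "lam_ext Y \<phi> r y = lin_lift k Y (\<lambda>(e, b). ract Y (\<phi> e y) b) r"

definition lam where
 "lam h Y \<phi> = avg k h Y (lam_ext Y \<phi>)"

definition tav where
 "tav h Y \<phi> = avg k h Y (\<lambda>r y. lact (bimod_as_left k Y) r (\<phi> y))"

context
 fixes P :: "('k, ('a \<times> 'b \<Rightarrow> 'k) set, 'p) lmod" and h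
 assumes h: "rel_section k R P h"
begin

lemma lP: "left_module k R P" by (rule sec_left[OF h])

abbreviation "Pb \<equiv> bim_of P"

lemma bPb: "bimodule k A B Pb" by (rule bimodule_bim_of[OF lP])

lemma Pb_k_hom [simp]: "k_hom k Pb N = k_hom k P N" "k_hom k N Pb = k_hom k N P"
 by (rule k_hom_transfer_left k_hom_transfer_right; simp)+

context
 fixes Y :: "('k, 'a, 'b, 'y) bimod" (structure)
 assumes Y: "bimodule k A B Y"
begin

interpretation Y: bimodule k A B Y by (rule Y)

lemma mY: "module k Y" by (rule bimodule_module[OF Y])

lemma lam_inner:
 assumes \<phi>: "E_bilinear Pb Y \<phi>" and y: "y \<in> carrier P"
 shows "bilinear k A B Y (\<lambda>e b. ract Y (\<phi> e y) b)"
proof (rule bilinearI)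
 have y': "y \<in> carrier Pb" using y by simp
 note r = bimodule_ract_bilinear[OF Y]
 have c: "\<phi> e y \<in> carrier Y" if "e \<in> carrier A" for e by (rule k_hom_closed[OF E_bilinearD(2)[OF \<phi> y'] that])
 show "(\<lambda>b. ract Y (\<phi> e y) b) \<in> k_hom k B Y" if "e \<in> carrier A" for e by (rule bilinear_k_hom_left[OF r c[OF that]])
 show "(\<lambda>e. ract Y (\<phi> e y) b) \<in> k_hom k A Y" if "b \<in> carrier B" for b
  by (rule k_hom_compose[OF E_bilinearD(2)[OF \<phi> y'] bilinear_k_hom_right[OF r that]])
qed

lemma lam_bilinear:
 assumes \<phi>: "E_bilinear Pb Y \<phi>"
 shows "bilinear k R P Y (lam_ext Y \<phi>)"
  and "\<lbrakk>e \<in> carrier A; b \<in> carrier B; y \<in> carrier P\<rbrakk> \<Longrightarrow> lam_ext Y \<phi> (pt e b) y = ract Y (\<phi> e y) b"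
proof -
 show "bilinear k R P Y (lam_ext Y \<phi>)"
 proof (rule bilinearI)
  show "(\<lambda>r. lam_ext Y \<phi> r y) \<in> k_hom k R Y" if "y \<in> carrier P" for y
   unfolding lam_ext_def using T_lift(1)[OF mY lam_inner[OF \<phi> that]] by simp
  show "(\<lambda>y. lam_ext Y \<phi> r y) \<in> k_hom k P Y" if "r \<in> carrier R" for r
   unfolding lam_ext_def
  proof (rule T_lift_param[OF mY ext_mP[OF lP] lam_inner[OF \<phi>]])
   show "(\<lambda>y. ract Y (\<phi> e y) b) \<in> k_hom k P Y" if e: "e \<in> carrier A" and b: "b \<in> carrier B" for e b
    using k_hom_compose[OF right_homD(1)[OF E_bilinearD(1)[OF \<phi> e]] bilinear_k_hom_right[OF bimodule_ract_bilinear[OF Y] b]] by simp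
   show "r \<in> carrier T" using that by simp
  qed
 qed
 show "lam_ext Y \<phi> (pt e b) y = ract Y (\<phi> e y) b" if "e \<in> carrier A" "b \<in> carrier B" "y \<in> carrier P"
  unfolding lam_ext_def using T_lift(2)[OF mY lam_inner[OF \<phi> that(3)] that(1,2)] .
qed

lemma R_bilinear_eq:
 assumes N: "module k N" and f: "bilinear k R P N f" and g: "bilinear k R P N g"
  and eq: "\<And>e b y. \<lbrakk>e \<in> carrier A; b \<in> carrier B; y \<in> carrier P\<rbrakk> \<Longrightarrow> f (pt e b) y = g (pt e b) y"
  and r: "r \<in> carrier R" and y: "y \<in> carrier P"
 shows "f r y = g r y"
proof -
 have "(\<lambda>r. f r y) \<in> k_hom k T N" "(\<lambda>r. g r y) \<in> k_hom k T N"
  using bilinear_k_hom_right[OF f y] bilinear_k_hom_right[OF g y] by simp_all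
 from T_hom_eq[OF N this] eq r y show ?thesis by simp
qed

lemma lam_eqI:
 assumes N: "bilinear k R P Y f" and \<phi>: "E_bilinear Pb Y \<phi>"
  and eq: "\<And>e b y. \<lbrakk>e \<in> carrier A; b \<in> carrier B; y \<in> carrier P\<rbrakk> \<Longrightarrow> f (pt e b) y = ract Y (\<phi> e y) b" and x: "x \<in> carrier P"
 shows "avg k h Y f x = lam h Y \<phi> x"
 unfolding lam_def
 by (rule avg_cong[OF h mY N lam_bilinear(1)[OF \<phi>] R_bilinear_eq[OF mY N lam_bilinear(1)[OF \<phi>]] x])
  (use eq lam_bilinear(2)[OF \<phi>] in simp_all)

lemma lam_cong:
 assumes \<phi>: "E_bilinear Pb Y \<phi>" and \<psi>: "E_bilinear Pb Y \<psi>"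
  and eq: "\<And>e y. \<lbrakk>e \<in> carrier A; y \<in> carrier P\<rbrakk> \<Longrightarrow> \<phi> e y = \<psi> e y" and x: "x \<in> carrier P"
 shows "lam h Y \<phi> x = lam h Y \<psi> x"
 unfolding lam_def[of h Y \<phi>] by (rule lam_eqI[OF lam_bilinear(1)[OF \<phi>] \<psi> _ x]) (simp add: lam_bilinear(2)[OF \<phi>] eq)

lemma lam_right_hom:
 assumes \<phi>: "E_bilinear Pb Y \<phi>" shows "lam h Y \<phi> \<in> right_hom Pb Y"
proof (rule right_homI)
 show "lam h Y \<phi> \<in> k_hom k Pb Y" unfolding lam_def Pb_k_hom by (rule avg_k_hom[OF h mY lam_bilinear(1)[OF \<phi>]])
 fix x b assume "x \<in> carrier Pb" and b: "b \<in> carrier B"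
 then have x: "x \<in> carrier P" by simp
 have one: "\<one>\<^bsub>A\<^esub> \<in> carrier A" by simp
 have pb: "pt \<one>\<^bsub>A\<^esub> b \<in> carrier R" using pt_closed[OF one b] by simp
 note rb = bilinear_k_hom_right[OF bimodule_ract_bilinear[OF Y] b]
 have c: "\<phi> e y \<in> carrier Y" if "e \<in> carrier A" "y \<in> carrier P" for e y
  using k_hom_closed[OF E_bilinearD(2)[OF \<phi>, of y] that(1)] that(2) by simp
 have "lam h Y \<phi> (ract Pb x b) = avg k h Y (\<lambda>r y. lam_ext Y \<phi> (pt \<one>\<^bsub>A\<^esub> b \<otimes>\<^bsub>R\<^esub> r) y) x"
  unfolding lam_def bim_of_simps by (rule avg_lact[OF h mY lam_bilinear(1)[OF \<phi>] pb x])
 also have "\<dots> = avg k h Y (\<lambda>r y. ract Y (lam_ext Y \<phi> r y) b) x"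
  by (rule avg_cong[OF h mY left_mult_bilinear[OF lP lam_bilinear(1)[OF \<phi>] pb] bilinear_compose[OF lam_bilinear(1)[OF \<phi>] rb]
    R_bilinear_eq[OF mY left_mult_bilinear[OF lP lam_bilinear(1)[OF \<phi>] pb] bilinear_compose[OF lam_bilinear(1)[OF \<phi>] rb]] x])
   (use b in \<open>simp_all add: R_mult_pt lam_bilinear(2)[OF \<phi>] c Y.ract_mult\<close>)
 also have "\<dots> = ract Y (lam h Y \<phi> x) b"
  unfolding lam_def by (rule avg_nat[OF h mY mY rb lam_bilinear(1)[OF \<phi>] x, symmetric])
 finally show "lam h Y \<phi> (ract Pb x b) = ract Y (lam h Y \<phi> x) b" .
qed

lemma E_bilinear_mult:
 assumes \<phi>: "E_bilinear Pb Y \<phi>" and e: "e \<in> carrier A" shows "E_bilinear Pb Y (\<lambda>e'. \<phi> (e \<otimes>\<^bsub>A\<^esub> e'))"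
 by (rule E_bilinearI[OF E_bilinearD(1)[OF \<phi>] k_hom_compose[OF alg_mult_k_hom(1)[OF A.k_algebra_axioms e] E_bilinearD(2)[OF \<phi>]]])
  (use e in simp_all)

lemma lam_lact:
 assumes \<phi>: "E_bilinear Pb Y \<phi>" and e: "e \<in> carrier A" and x: "x \<in> carrier P"
 shows "lam h Y \<phi> (lact Pb e x) = lam h Y (\<lambda>e'. \<phi> (e \<otimes>\<^bsub>A\<^esub> e')) x"
proof -
 have pe: "pt e \<one>\<^bsub>B\<^esub> \<in> carrier R" using pt_closed[OF e, of "\<one>\<^bsub>B\<^esub>"] by simp
 have "lam h Y \<phi> (lact Pb e x) = avg k h Y (\<lambda>r y. lam_ext Y \<phi> (pt e \<one>\<^bsub>B\<^esub> \<otimes>\<^bsub>R\<^esub> r) y) x"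
  unfolding lam_def bim_of_simps by (rule avg_lact[OF h mY lam_bilinear(1)[OF \<phi>] pe x])
 also have "\<dots> = lam h Y (\<lambda>e'. \<phi> (e \<otimes>\<^bsub>A\<^esub> e')) x"
  by (rule lam_eqI[OF left_mult_bilinear[OF lP lam_bilinear(1)[OF \<phi>] pe] E_bilinear_mult[OF \<phi> e] _ x])
   (use e in \<open>simp add: R_mult_pt lam_bilinear(2)[OF \<phi>]\<close>)
 finally show ?thesis .
qed

lemma lam_id:
 assumes \<phi>: "\<phi> \<in> right_hom Pb Y" and x: "x \<in> carrier P"
 shows "E_bilinear Pb Y (\<lambda>e y. \<phi> (lact Pb e y))" "lam h Y (\<lambda>e y. \<phi> (lact Pb e y)) x = \<phi> x"
proof -
 interpret Pb: bimodule k A B Pb by (rule bPb)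
 have \<phi>k: "\<phi> \<in> k_hom k P Y" using right_homD(1)[OF \<phi>] by simp
 note lb = bimodule_lact_bilinear[OF bPb]
 show E: "E_bilinear Pb Y (\<lambda>e y. \<phi> (lact Pb e y))"
 proof (rule E_bilinearI)
  show "(\<lambda>y. \<phi> (lact Pb e y)) \<in> right_hom Pb Y" if e: "e \<in> carrier A" for e
  proof (rule right_homI)
   show "(\<lambda>y. \<phi> (lact Pb e y)) \<in> k_hom k Pb Y"
    by (rule k_hom_compose[OF bilinear_k_hom_left[OF lb e] right_homD(1)[OF \<phi>]])
   show "\<phi> (lact Pb e (ract Pb y b)) = ract Y (\<phi> (lact Pb e y)) b" if "y \<in> carrier Pb" "b \<in> carrier B" for y b
    unfolding Pb.lact_ract[OF e that] by (rule right_homD(2)[OF \<phi> Pb.lact_closed[OF e that(1)] that(2)])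
  qed
  show "(\<lambda>e. \<phi> (lact Pb e y)) \<in> k_hom k A Y" if "y \<in> carrier Pb" for y
   by (rule k_hom_compose[OF bilinear_k_hom_right[OF lb that] right_homD(1)[OF \<phi>]])
 qed
 have "avg k h Y (\<lambda>r y. \<phi> (lact P r y)) x = lam h Y (\<lambda>e y. \<phi> (lact Pb e y)) x"
 proof (rule lam_eqI[OF bilinear_compose[OF left_module_lact_bilinear[OF lP] \<phi>k] E _ x])
  fix e b y assume eb: "e \<in> carrier A" "b \<in> carrier B" and "y \<in> carrier P"
  then have y: "y \<in> carrier Pb" by simp
  have "lact P (pt e b) y = lact (bimod_as_left k Pb) (pt e b) y" using lact_bim_of[OF lP, of "pt e b" y] pt_closed[OF eb] y by simp
  also have "\<dots> = ract Pb (lact Pb e y) b" using as_left_lact_pt[OF bPb y eb] Pb.lact_ract[OF eb(1) y eb(2)] by (rule trans)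
  finally show "\<phi> (lact P (pt e b) y) = ract Y (\<phi> (lact Pb e y)) b"
   using right_homD(2)[OF \<phi> Pb.lact_closed[OF eb(1) y] eb(2)] by (simp del: bim_of_simps)
 qed
 then show "lam h Y (\<lambda>e y. \<phi> (lact Pb e y)) x = \<phi> x" using avg_lact_hom[OF h mY \<phi>k x] by simp
qed

lemma lam_param:
 assumes V: "module k V" and \<phi>: "\<And>v. v \<in> carrier V \<Longrightarrow> E_bilinear Pb Y (\<phi> v)"
  and lin: "\<And>e y. \<lbrakk>e \<in> carrier A; y \<in> carrier P\<rbrakk> \<Longrightarrow> (\<lambda>v. \<phi> v e y) \<in> k_hom k V Y" and x: "x \<in> carrier P"
 shows "(\<lambda>v. lam h Y (\<phi> v) x) \<in> k_hom k V Y"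
 unfolding lam_def
proof (rule avg_param[OF h mY V lam_bilinear(1)[OF \<phi>] _ x])
 show "(\<lambda>v. lam_ext Y (\<phi> v) r y) \<in> k_hom k V Y" if "r \<in> carrier R" "y \<in> carrier P" for r y
  unfolding lam_ext_def
 proof (rule T_lift_param[OF mY V lam_inner[OF \<phi> that(2)]])
  show "r \<in> carrier T" using that by simp
  show "(\<lambda>v. ract Y (\<phi> v e y) b) \<in> k_hom k V Y" if "e \<in> carrier A" "b \<in> carrier B" for e b
   by (rule k_hom_compose[OF lin[OF that(1) \<open>y \<in> carrier P\<close>] bilinear_k_hom_right[OF bimodule_ract_bilinear[OF Y] that(2)]])
 qed
qed

lemma E_bilinear_minus:
 assumes \<phi>: "E_bilinear Pb Y \<phi>" and \<psi>: "E_bilinear Pb Y \<psi>"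
 shows "E_bilinear Pb Y (\<lambda>e y. \<phi> e y \<ominus> \<psi> e y)"
proof (rule E_bilinearI)
 show "(\<lambda>y. \<phi> e y \<ominus> \<psi> e y) \<in> right_hom Pb Y" if e: "e \<in> carrier A" for e
 proof (rule right_homI)
  note p = E_bilinearD(1)[OF \<phi> e] and q = E_bilinearD(1)[OF \<psi> e]
  show "(\<lambda>y. \<phi> e y \<ominus> \<psi> e y) \<in> k_hom k Pb Y" by (rule k_hom_sub[OF mY right_homD(1)[OF p] right_homD(1)[OF q]])
  fix y b assume y: "y \<in> carrier Pb" and b: "b \<in> carrier B"
  show "\<phi> e (ract Pb y b) \<ominus> \<psi> e (ract Pb y b) = ract Y (\<phi> e y \<ominus> \<psi> e y) b"
   unfolding right_homD(2)[OF p y b] right_homD(2)[OF q y b]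
   by (rule k_hom_minus[OF mY mY bilinear_k_hom_right[OF bimodule_ract_bilinear[OF Y] b]
    k_hom_closed[OF right_homD(1)[OF p] y] k_hom_closed[OF right_homD(1)[OF q] y], symmetric])
 qed
 show "(\<lambda>e. \<phi> e y \<ominus> \<psi> e y) \<in> k_hom k A Y" if y: "y \<in> carrier Pb" for y
  by (rule k_hom_sub[OF mY E_bilinearD(2)[OF \<phi> y] E_bilinearD(2)[OF \<psi> y]])
qed

lemma lam_minus:
 assumes \<phi>: "E_bilinear Pb Y \<phi>" and \<psi>: "E_bilinear Pb Y \<psi>" and x: "x \<in> carrier P"
 shows "lam h Y (\<lambda>e y. \<phi> e y \<ominus> \<psi> e y) x = lam h Y \<phi> x \<ominus> lam h Y \<psi> x"
proof -
 let ?L = "\<lambda>\<phi>. lin_lift k Y (\<lambda>(r, y). lam_ext Y \<phi> r y)"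
 have mT: "module k (ext_tensor k R P)" by (rule ext_mT[OF lP])
 note b1 = ext_lift[OF lP mY lam_bilinear(1)[OF \<phi>]] and b2 = ext_lift[OF lP mY lam_bilinear(1)[OF \<psi>]]
 note d = E_bilinear_minus[OF \<phi> \<psi>]
 have bl: "bilinear k R P Y (\<lambda>r y. lam_ext Y \<phi> r y \<ominus> lam_ext Y \<psi> r y)"
  using lam_bilinear(1)[OF \<phi>] lam_bilinear(1)[OF \<psi>] unfolding bilinear_def by (auto intro!: k_hom_sub mY)
 have "?L \<phi> (h x) \<ominus> ?L \<psi> (h x) = avg k h Y (\<lambda>r y. lam_ext Y \<phi> r y \<ominus> lam_ext Y \<psi> r y) x"
  by (rule avg_eqI[OF h mY k_hom_sub[OF mY b1(1) b2(1)] bl _ x]) (simp add: b1(2) b2(2))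
 also have "\<dots> = lam h Y (\<lambda>e y. \<phi> e y \<ominus> \<psi> e y) x"
 proof (rule lam_eqI[OF bl d _ x])
  fix e b y assume e: "e \<in> carrier A" and b: "b \<in> carrier B" and y: "y \<in> carrier P"
  have c: "\<phi> e y \<in> carrier Y" "\<psi> e y \<in> carrier Y"
   using k_hom_closed[OF E_bilinearD(2)[OF \<phi>, of y] e] k_hom_closed[OF E_bilinearD(2)[OF \<psi>, of y] e] y by simp_all
  show "lam_ext Y \<phi> (pt e b) y \<ominus> lam_ext Y \<psi> (pt e b) y = ract Y (\<phi> e y \<ominus> \<psi> e y) b"
   unfolding lam_bilinear(2)[OF \<phi> e b y] lam_bilinear(2)[OF \<psi> e b y]
   by (rule k_hom_minus[OF mY mY bilinear_k_hom_right[OF bimodule_ract_bilinear[OF Y] b] c, symmetric])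
 qed
 finally show ?thesis by (simp add: lam_def avg_def)
qed

lemma lam_zero: assumes x: "x \<in> carrier P" shows "lam h Y (\<lambda>e y. \<zero>) x = \<zero>"
proof -
 have z: "\<zero> \<ominus> \<zero> = \<zero>" by (simp add: Y.N.M.minus_zero_right)
 have E: "E_bilinear Pb Y (\<lambda>e y. \<zero>)"
  by (intro E_bilinearI right_homI k_hom_const_zero mY)
   (simp add: k_hom_zero[OF mY mY bilinear_k_hom_right[OF bimodule_ract_bilinear[OF Y]]])
 have "lam h Y (\<lambda>e y. \<zero>) x \<in> carrier Y" using k_hom_closed[OF right_homD(1)[OF lam_right_hom[OF E]]] x by simp
 then show ?thesis using lam_minus[OF E E x] unfolding z by (simp add: a_minus_def Y.N.M.r_neg)
qed

lemma E_bilinear_lact: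
 assumes \<phi>: "\<phi> \<in> right_hom Pb Y" shows "E_bilinear Pb Y (\<lambda>e y. lact Y e (\<phi> y))"
proof (rule E_bilinearI)
 note lb = bimodule_lact_bilinear[OF Y]
 have c: "\<phi> y \<in> carrier Y" if "y \<in> carrier Pb" for y by (rule k_hom_closed[OF right_homD(1)[OF \<phi>] that])
 show "(\<lambda>y. lact Y e (\<phi> y)) \<in> right_hom Pb Y" if e: "e \<in> carrier A" for e
 proof (rule right_homI)
  show "(\<lambda>y. lact Y e (\<phi> y)) \<in> k_hom k Pb Y" by (rule k_hom_compose[OF right_homD(1)[OF \<phi>] bilinear_k_hom_left[OF lb e]])
  show "lact Y e (\<phi> (ract Pb y b)) = ract Y (lact Y e (\<phi> y)) b" if "y \<in> carrier Pb" "b \<in> carrier B" for y b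
   unfolding right_homD(2)[OF \<phi> that] by (rule Y.lact_ract[OF e c[OF that(1)] that(2)])
 qed
 show "(\<lambda>e. lact Y e (\<phi> y)) \<in> k_hom k A Y" if "y \<in> carrier Pb" for y by (rule bilinear_k_hom_right[OF lb c[OF that]])
qed

lemma tav_bilinear:
 assumes \<phi>: "\<phi> \<in> k_hom k P Y" shows "bilinear k R P Y (\<lambda>r y. lact (bimod_as_left k Y) r (\<phi> y))"
proof (rule bilinearI)
 show "(\<lambda>y. lact (bimod_as_left k Y) r (\<phi> y)) \<in> k_hom k P Y" if "r \<in> carrier R" for r
  using k_hom_compose[OF \<phi> as_left_lact_k_hom2[OF Y]] that by simp
 show "(\<lambda>r. lact (bimod_as_left k Y) r (\<phi> y)) \<in> k_hom k R Y" if "y \<in> carrier P" for y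
  using as_left_lact_k_hom1[OF Y k_hom_closed[OF \<phi> that]] by simp
qed

lemma tav_bimod_hom:
 assumes \<phi>: "\<phi> \<in> k_hom k P Y" shows "tav h Y \<phi> \<in> bimod_hom k A B Pb Y"
proof -
 interpret Pl: left_module k R P by (rule lP)
 interpret YL: left_module k R "bimod_as_left k Y" by (rule as_left_left_module[OF Y Pl.k_algebra_axioms])
 note b = tav_bilinear[OF \<phi>]
 have "tav h Y \<phi> \<in> lmod_hom k R P (bimod_as_left k Y)"
 proof (rule lmod_homI)
  show "tav h Y \<phi> \<in> k_hom k P (bimod_as_left k Y)" unfolding tav_def using avg_k_hom[OF h mY b] by simp
  fix r x assume r: "r \<in> carrier R" and x: "x \<in> carrier P"
  have rk: "lact (bimod_as_left k Y) r \<in> k_hom k Y Y" using as_left_lact_k_hom2[OF Y] r by simp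
  have "tav h Y \<phi> (lact P r x) = avg k h Y (\<lambda>r' y. lact (bimod_as_left k Y) (r \<otimes>\<^bsub>R\<^esub> r') (\<phi> y)) x"
   unfolding tav_def by (rule avg_lact[OF h mY b r x])
  also have "\<dots> = avg k h Y (\<lambda>r' y. lact (bimod_as_left k Y) r (lact (bimod_as_left k Y) r' (\<phi> y))) x"
   by (rule avg_cong[OF h mY left_mult_bilinear[OF lP b r] bilinear_compose[OF b rk] _ x])
    (use YL.lact_mult[OF r] k_hom_closed[OF \<phi>] in simp)
  also have "\<dots> = lact (bimod_as_left k Y) r (tav h Y \<phi> x)"
   unfolding tav_def by (rule avg_nat[OF h mY mY rk b x, symmetric])
  finally show "tav h Y \<phi> (lact P r x) = lact (bimod_as_left k Y) r (tav h Y \<phi> x)" .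
 qed
 then have "tav h Y \<phi> \<in> lmod_hom k R (bimod_as_left k Pb) (bimod_as_left k Y)"
  by (auto simp: lmod_hom_def lact_bim_of[OF lP] simp del: R_simps)
 then show ?thesis using lmod_hom_as_left[OF bPb Y] by simp
qed

lemma lmod_hom_bim_of: "lmod_hom k R P (bimod_as_left k Y) = bimod_hom k A B Pb Y"
proof -
 have "lmod_hom k R P (bimod_as_left k Y) = lmod_hom k R (bimod_as_left k Pb) (bimod_as_left k Y)"
  by (auto simp: lmod_hom_def lact_bim_of[OF lP] simp del: R_simps)
 then show ?thesis using lmod_hom_as_left[OF bPb Y] by simp
qed

lemma tav_id:
 assumes \<phi>: "\<phi> \<in> bimod_hom k A B Pb Y" and x: "x \<in> carrier P" shows "tav h Y \<phi> x = \<phi> x"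
proof -
 have l: "\<phi> \<in> lmod_hom k R P (bimod_as_left k Y)" using \<phi> lmod_hom_bim_of by simp
 have \<phi>k: "\<phi> \<in> k_hom k P Y" using lmod_homD(1)[OF l] by simp
 have "tav h Y \<phi> x = avg k h Y (\<lambda>r y. \<phi> (lact P r y)) x"
  unfolding tav_def
  by (rule avg_cong[OF h mY tav_bilinear[OF \<phi>k] bilinear_compose[OF left_module_lact_bilinear[OF lP] \<phi>k] _ x])
   (use lmod_homD(2)[OF l] in simp)
 then show ?thesis using avg_lact_hom[OF h mY \<phi>k x] by simp
qed

end

context
 fixes Y :: "('k, 'a, 'b, 'y) bimod" and Y' :: "('k, 'a, 'b, 'y') bimod"
 assumes Y: "bimodule k A B Y" and Y': "bimodule k A B Y'"
begin

lemma lam_nat: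
 assumes g: "g \<in> right_hom Y Y'" and \<phi>: "E_bilinear Pb Y \<phi>" and x: "x \<in> carrier P"
 shows "E_bilinear Pb Y' (\<lambda>e y. g (\<phi> e y))" "g (lam h Y \<phi> x) = lam h Y' (\<lambda>e y. g (\<phi> e y)) x"
proof -
 note gk = right_homD(1)[OF g]
 have c: "\<phi> e y \<in> carrier Y" if "e \<in> carrier A" "y \<in> carrier Pb" for e y
  using k_hom_closed[OF E_bilinearD(2)[OF \<phi> that(2)] that(1)] .
 show E: "E_bilinear Pb Y' (\<lambda>e y. g (\<phi> e y))"
 proof (rule E_bilinearI)
  show "(\<lambda>y. g (\<phi> e y)) \<in> right_hom Pb Y'" if e: "e \<in> carrier A" for e
   by (rule right_homI[OF k_hom_compose[OF right_homD(1)[OF E_bilinearD(1)[OF \<phi> e]] gk]])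
    (simp only: right_homD(2)[OF E_bilinearD(1)[OF \<phi> e]] right_homD(2)[OF g c[OF e]])
  show "(\<lambda>e. g (\<phi> e y)) \<in> k_hom k A Y'" if "y \<in> carrier Pb" for y
   by (rule k_hom_compose[OF E_bilinearD(2)[OF \<phi> that] gk])
 qed
 have "g (lam h Y \<phi> x) = avg k h Y' (\<lambda>r y. g (lam_ext Y \<phi> r y)) x"
  unfolding lam_def by (rule avg_nat[OF h mY[OF Y] mY[OF Y'] gk lam_bilinear(1)[OF Y \<phi>] x])
 also have "\<dots> = lam h Y' (\<lambda>e y. g (\<phi> e y)) x"
 proof (rule lam_eqI[OF Y' bilinear_compose[OF lam_bilinear(1)[OF Y \<phi>] gk] E _ x])
  fix e b y assume e: "e \<in> carrier A" and b: "b \<in> carrier B" and y: "y \<in> carrier P"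
  have y': "y \<in> carrier Pb" using y by simp
  show "g (lam_ext Y \<phi> (pt e b) y) = ract Y' (g (\<phi> e y)) b"
   unfolding lam_bilinear(2)[OF Y \<phi> e b y] by (rule right_homD(2)[OF g c[OF e y'] b])
 qed
 finally show "g (lam h Y \<phi> x) = lam h Y' (\<lambda>e y. g (\<phi> e y)) x" .
qed

lemma tav_nat:
 assumes g: "g \<in> bimod_hom k A B Y Y'" and \<phi>: "\<phi> \<in> k_hom k P Y" and x: "x \<in> carrier P"
 shows "g (tav h Y \<phi> x) = tav h Y' (\<lambda>y. g (\<phi> y)) x"
proof -
 have gl: "g \<in> lmod_hom k R (bimod_as_left k Y) (bimod_as_left k Y')" using g lmod_hom_as_left[OF Y Y'] by simp
 have gk: "g \<in> k_hom k Y Y'" using lmod_homD(1)[OF gl] by simp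
 have "g (tav h Y \<phi> x) = avg k h Y' (\<lambda>r y. g (lact (bimod_as_left k Y) r (\<phi> y))) x"
  unfolding tav_def by (rule avg_nat[OF h mY[OF Y] mY[OF Y'] gk tav_bilinear[OF Y \<phi>] x])
 also have "\<dots> = tav h Y' (\<lambda>y. g (\<phi> y)) x"
  unfolding tav_def
  by (rule avg_cong[OF h mY[OF Y'] bilinear_compose[OF tav_bilinear[OF Y \<phi>] gk] tav_bilinear[OF Y' k_hom_compose[OF \<phi> gk]] _ x])
   (use lmod_homD(2)[OF gl] k_hom_closed[OF \<phi>] in simp)
 finally show ?thesis .
qed

end

lemma tlam_bimod_hom:
 fixes Y :: "('k, 'a, 'b, 'y) bimod"
 assumes Y: "bimodule k A B Y" and \<phi>: "\<phi> \<in> right_hom Pb Y"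
 shows "lam h Y (\<lambda>e y. lact Y e (\<phi> y)) \<in> bimod_hom k A B Pb Y"
proof (rule bimod_homI)
 interpret Y: bimodule k A B Y by (rule Y)
 note E = E_bilinear_lact[OF Y \<phi>]
 show "lam h Y (\<lambda>e y. lact Y e (\<phi> y)) \<in> right_hom Pb Y" by (rule lam_right_hom[OF Y E])
 fix a x assume a: "a \<in> carrier A" and "x \<in> carrier Pb"
 then have x: "x \<in> carrier P" by simp
 have c: "\<phi> y \<in> carrier Y" if "y \<in> carrier P" for y using k_hom_closed[OF right_homD(1)[OF \<phi>]] that by simp
 have ar: "lact Y a \<in> right_hom Y Y"
  by (rule right_homI[OF bimodule_lact_k_hom[OF Y a]]) (rule Y.lact_ract[OF a])
 note N = lam_nat[OF Y Y ar E x]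
 have "lam h Y (\<lambda>e y. lact Y e (\<phi> y)) (lact Pb a x) = lam h Y (\<lambda>e y. lact Y (a \<otimes>\<^bsub>A\<^esub> e) (\<phi> y)) x"
  by (rule lam_lact[OF Y E a x])
 also have "\<dots> = lam h Y (\<lambda>e y. lact Y a (lact Y e (\<phi> y))) x"
  by (rule lam_cong[OF Y E_bilinear_mult[OF Y E a] N(1) _ x]) (use a c in \<open>simp add: Y.lact_mult\<close>)
 also have "\<dots> = lact Y a (lam h Y (\<lambda>e y. lact Y e (\<phi> y)) x)" by (rule N(2)[symmetric])
 finally show "lam h Y (\<lambda>e y. lact Y e (\<phi> y)) (lact Pb a x) = lact Y a (lam h Y (\<lambda>e y. lact Y e (\<phi> y)) x)" .
qed

lemma tlam_id:
 fixes Y :: "('k, 'a, 'b, 'y) bimod"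
 assumes Y: "bimodule k A B Y" and \<phi>: "\<phi> \<in> bimod_hom k A B Pb Y" and x: "x \<in> carrier P"
 shows "lam h Y (\<lambda>e y. lact Y e (\<phi> y)) x = \<phi> x"
proof -
 note r = bimod_homD(1)[OF \<phi>] and I = lam_id[OF Y bimod_homD(1)[OF \<phi>] x]
 have "lam h Y (\<lambda>e y. lact Y e (\<phi> y)) x = lam h Y (\<lambda>e y. \<phi> (lact Pb e y)) x"
 proof (rule lam_cong[OF Y E_bilinear_lact[OF Y r] I(1) _ x])
  show "lact Y e (\<phi> y) = \<phi> (lact Pb e y)" if "e \<in> carrier A" "y \<in> carrier P" for e y
   using bimod_homD(2)[OF \<phi> that(1), of y] that(2) by (simp del: bim_of_simps(5))
 qed
 then show ?thesis using I(2) by simp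
qed

end

end

section \<open>Comparison of resolutions\<close>

text \<open>
 The pieces of the Hochschild differential for cochains of \<open>C\<close> whose values are maps \<open>Q \<rightarrow> Y\<close>; a letter
 acts on the right of such a map by precomposition with its left action \<open>la\<close> on \<open>Q\<close>.
\<close>

fun hDm :: "('k, 'a) module \<Rightarrow> ('k, 'a, 'b, 'y) bimod \<Rightarrow> ('a \<Rightarrow> 'q \<Rightarrow> 'q) \<Rightarrow> ('a list \<Rightarrow> 'q \<Rightarrow> 'y) \<Rightarrow> 'a \<Rightarrow> 'a list \<Rightarrow> 'q \<Rightarrow> 'y" where
 "hDm C Y la F e [] x = F [] (la e x)"
| "hDm C Y la F e (e' # l) x = F ((e \<otimes>\<^bsub>C\<^esub> e') # l) x \<ominus>\<^bsub>Y\<^esub> hDm C Y la (\<lambda>m. F (e # m)) e' l x"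

fun hdelm :: "('k, 'a) module \<Rightarrow> ('k, 'a, 'b, 'y) bimod \<Rightarrow> ('a \<Rightarrow> 'q \<Rightarrow> 'q) \<Rightarrow> ('a list \<Rightarrow> 'q \<Rightarrow> 'y) \<Rightarrow> 'a list \<Rightarrow> 'q \<Rightarrow> 'y" where
 "hdelm C Y la F [] x = \<zero>\<^bsub>Y\<^esub>"
| "hdelm C Y la F (e # l) x = lact Y e (F l x) \<ominus>\<^bsub>Y\<^esub> hDm C Y la F e l x"

lemma hDm_funs: "hDm C Y la F e [] = (\<lambda>x. F [] (la e x))"
 "hDm C Y la F e (e' # l) = (\<lambda>x. F ((e \<otimes>\<^bsub>C\<^esub> e') # l) x \<ominus>\<^bsub>Y\<^esub> hDm C Y la (\<lambda>m. F (e # m)) e' l x)"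
 "hdelm C Y la F (e # l) = (\<lambda>x. lact Y e (F l x) \<ominus>\<^bsub>Y\<^esub> hDm C Y la F e l x)"
 by (rule ext, simp)+

definition sg where "sg Y n x = (if even n then x else \<ominus>\<^bsub>Y\<^esub> x)"

context abelian_group
begin

lemma sg_closed [simp]: "x \<in> carrier G \<Longrightarrow> sg G n x \<in> carrier G" by (simp add: sg_def)
lemma sg_Suc: "x \<in> carrier G \<Longrightarrow> sg G (Suc n) x = \<ominus> sg G n x" by (simp add: sg_def)
lemma sg_zero: "sg G n \<zero> = \<zero>" by (simp add: sg_def)

lemma minus_minus_assoc: "\<lbrakk>a \<in> carrier G; b \<in> carrier G; c \<in> carrier G\<rbrakk> \<Longrightarrow> a \<ominus> (b \<ominus> c) = (a \<ominus> b) \<oplus> c"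
 by (simp add: a_minus_def minus_add a_assoc)

lemma minus_uminus: "\<lbrakk>a \<in> carrier G; b \<in> carrier G\<rbrakk> \<Longrightarrow> a \<ominus> \<ominus> b = a \<oplus> b"
 by (simp add: a_minus_def)

end

context two_algebras
begin

abbreviation "As \<equiv> lists (carrier A)"

text \<open>
 Cochains with values in the right \<open>B\<close>-linear maps from \<open>Q\<close> to \<open>Y\<close>.
\<close>

definition good where
 "good Q Y F \<longleftrightarrow> (\<forall>l\<in>As. F l \<in> right_hom Q Y) \<and> (\<forall>x\<in>carrier Q. multilinear k A Y (\<lambda>l. F l x))"

lemma goodI: "\<lbrakk>\<And>l. l \<in> As \<Longrightarrow> F l \<in> right_hom Q Y; \<And>x. x \<in> carrier Q \<Longrightarrow> multilinear k A Y (\<lambda>l. F l x)\<rbrakk> \<Longrightarrow> good Q Y F"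
 and goodD: "\<lbrakk>good Q Y F; l \<in> As\<rbrakk> \<Longrightarrow> F l \<in> right_hom Q Y" "\<lbrakk>good Q Y F; x \<in> carrier Q\<rbrakk> \<Longrightarrow> multilinear k A Y (\<lambda>l. F l x)"
 by (auto simp: good_def)

lemma good_closed: "\<lbrakk>good Q Y F; l \<in> As; x \<in> carrier Q\<rbrakk> \<Longrightarrow> F l x \<in> carrier Y"
 by (rule k_hom_closed[OF right_homD(1)[OF goodD(1)]])

lemma good_Cons: "\<lbrakk>good Q Y F; e \<in> carrier A\<rbrakk> \<Longrightarrow> good Q Y (\<lambda>l. F (e # l))"
proof (rule goodI)
 assume F: "good Q Y F" and e: "e \<in> carrier A"
 show "F (e # l) \<in> right_hom Q Y" if "l \<in> As" for l by (rule goodD(1)[OF F]) (use e that in simp)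
 show "multilinear k A Y (\<lambda>l. F (e # l) x)" if "x \<in> carrier Q" for x
  by (rule multilinear_Cons[OF goodD(2)[OF F that] e])
qed

lemma right_hom_comp:
 assumes "f \<in> right_hom Q Q'" "g \<in> right_hom Q' Y" shows "(\<lambda>x. g (f x)) \<in> right_hom Q Y"
proof (rule right_homI)
 show "(\<lambda>x. g (f x)) \<in> k_hom k Q Y" by (rule k_hom_compose[OF right_homD(1)[OF assms(1)] right_homD(1)[OF assms(2)]])
 show "g (f (ract Q x b)) = ract Y (g (f x)) b" if "x \<in> carrier Q" "b \<in> carrier B" for x b
  unfolding right_homD(2)[OF assms(1) that]
  by (rule right_homD(2)[OF assms(2) k_hom_closed[OF right_homD(1)[OF assms(1)] that(1)] that(2)])
qed

lemma bimod_hom_comp: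
 assumes "f \<in> bimod_hom k A B Q Q'" "g \<in> bimod_hom k A B Q' Y" shows "(\<lambda>x. g (f x)) \<in> bimod_hom k A B Q Y"
proof (rule bimod_homI[OF right_hom_comp[OF bimod_homD(1)[OF assms(1)] bimod_homD(1)[OF assms(2)]]])
 show "g (f (lact Q a x)) = lact Y a (g (f x))" if "a \<in> carrier A" "x \<in> carrier Q" for a x
  unfolding bimod_homD(2)[OF assms(1) that]
  by (rule bimod_homD(2)[OF assms(2) that(1) k_hom_closed[OF bimod_homK[OF assms(1)] that(2)]])
qed

lemma lact_right_hom: "\<lbrakk>bimodule k A B Q; a \<in> carrier A\<rbrakk> \<Longrightarrow> lact Q a \<in> right_hom Q Q"
proof -
 assume Q: "bimodule k A B Q" and a: "a \<in> carrier A"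
 interpret bimodule k A B Q by (rule Q)
 show ?thesis by (rule right_homI[OF bimodule_lact_k_hom[OF Q a]]) (rule lact_ract[OF a])
qed

lemma right_hom_minus:
 assumes Y: "bimodule k A B Y" and f: "f \<in> right_hom Q Y" and g: "g \<in> right_hom Q Y"
 shows "(\<lambda>x. f x \<ominus>\<^bsub>Y\<^esub> g x) \<in> right_hom Q Y"
proof (rule right_homI)
 note mY = bimodule_module[OF Y]
 show "(\<lambda>x. f x \<ominus>\<^bsub>Y\<^esub> g x) \<in> k_hom k Q Y" by (rule k_hom_sub[OF mY right_homD(1)[OF f] right_homD(1)[OF g]])
 fix x b assume x: "x \<in> carrier Q" and b: "b \<in> carrier B"
 show "f (ract Q x b) \<ominus>\<^bsub>Y\<^esub> g (ract Q x b) = ract Y (f x \<ominus>\<^bsub>Y\<^esub> g x) b"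
  unfolding right_homD(2)[OF f x b] right_homD(2)[OF g x b]
  by (rule k_hom_minus[OF mY mY bilinear_k_hom_right[OF bimodule_ract_bilinear[OF Y] b]
    k_hom_closed[OF right_homD(1)[OF f] x] k_hom_closed[OF right_homD(1)[OF g] x], symmetric])
qed

lemma bimod_hom_minus:
 assumes Y: "bimodule k A B Y" and f: "f \<in> bimod_hom k A B Q Y" and g: "g \<in> bimod_hom k A B Q Y"
 shows "(\<lambda>x. f x \<ominus>\<^bsub>Y\<^esub> g x) \<in> bimod_hom k A B Q Y"
proof (rule bimod_homI[OF right_hom_minus[OF Y bimod_homD(1)[OF f] bimod_homD(1)[OF g]]])
 note mY = bimodule_module[OF Y]
 fix a x assume a: "a \<in> carrier A" and x: "x \<in> carrier Q"
 show "f (lact Q a x) \<ominus>\<^bsub>Y\<^esub> g (lact Q a x) = lact Y a (f x \<ominus>\<^bsub>Y\<^esub> g x)"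
  unfolding bimod_homD(2)[OF f a x] bimod_homD(2)[OF g a x]
  by (rule k_hom_minus[OF mY mY bimodule_lact_k_hom[OF Y a]
    k_hom_closed[OF bimod_homK[OF f] x] k_hom_closed[OF bimod_homK[OF g] x], symmetric])
qed

context
 fixes Q :: "('k, 'a, 'b, 'q) bimod" and Y :: "('k, 'a, 'b, 'y) bimod" (structure)
 assumes Q: "bimodule k A B Q" and Y: "bimodule k A B Y"
begin

interpretation Y: bimodule k A B Y by (rule Y)

abbreviation "D \<equiv> hDm A Y (lact Q)"
abbreviation "DD \<equiv> hdelm A Y (lact Q)"

lemma hDm_right_hom:
 "\<lbrakk>\<And>l. l \<in> As \<Longrightarrow> F l \<in> right_hom Q Y; e \<in> carrier A; l \<in> As\<rbrakk> \<Longrightarrow> D F e l \<in> right_hom Q Y"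
proof (induct l arbitrary: F e)
 case Nil
 have "F [] \<in> right_hom Q Y" by (rule Nil(1)) simp
 from right_hom_comp[OF lact_right_hom[OF Q Nil(2)] this] show ?case by (simp add: right_hom_def k_hom_def)
next
 case (Cons e' l)
 have c: "e' \<in> carrier A" "l \<in> As" using Cons(4) by simp_all
 have "D (\<lambda>m. F (e # m)) e' l \<in> right_hom Q Y" by (rule Cons(1), rule Cons(2)) (use c Cons(3) in simp_all)
 moreover have "F ((e \<otimes>\<^bsub>A\<^esub> e') # l) \<in> right_hom Q Y" by (rule Cons(2)) (use c Cons(3) in simp)
 ultimately have "(\<lambda>x. F ((e \<otimes>\<^bsub>A\<^esub> e') # l) x \<ominus> D (\<lambda>m. F (e # m)) e' l x) \<in> right_hom Q Y"
  by (intro right_hom_minus[OF Y])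
 then show ?case by (simp add: right_hom_def k_hom_def)
qed

lemma hDm_closed:
 assumes "good Q Y F" "e \<in> carrier A" "l \<in> As" "x \<in> carrier Q" shows "D F e l x \<in> carrier Y"
 by (rule k_hom_closed[OF right_homD(1)[OF hDm_right_hom[OF goodD(1)[OF assms(1)] assms(2,3)]] assms(4)])

lemma hDm_param:
 "\<lbrakk>\<And>l x. \<lbrakk>l \<in> As; x \<in> carrier Q\<rbrakk> \<Longrightarrow> (\<lambda>v. F v l x) \<in> k_hom k V Y; e \<in> carrier A; l \<in> As; x \<in> carrier Q\<rbrakk> \<Longrightarrow>
  (\<lambda>v. D (F v) e l x) \<in> k_hom k V Y"
proof (induct l arbitrary: F e)
 case Nil
 have "lact Q e x \<in> carrier Q" by (rule k_hom_closed[OF bimodule_lact_k_hom[OF Q Nil(2)] Nil(4)])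
 then show ?case using Nil(1)[of "[]" "lact Q e x"] by simp
next
 case (Cons e' l)
 have c: "e' \<in> carrier A" "l \<in> As" using Cons(4) by simp_all
 have "(\<lambda>v. D (\<lambda>m. F v (e # m)) e' l x) \<in> k_hom k V Y" by (rule Cons(1), rule Cons(2)) (use c Cons(3,5) in simp_all)
 moreover have "(\<lambda>v. F v ((e \<otimes>\<^bsub>A\<^esub> e') # l) x) \<in> k_hom k V Y" by (rule Cons(2)) (use c Cons(3,5) in simp_all)
 ultimately show ?case by (simp add: k_hom_sub bimodule_module[OF Y])
qed

lemma hDm_linear:
 assumes F: "good Q Y F" and l: "l \<in> As" and x: "x \<in> carrier Q"
 shows "(\<lambda>e. D F e l x) \<in> k_hom k A Y"
proof (cases l)
 case Nil
 have "(\<lambda>e. F [] (lact Q e x)) \<in> k_hom k A Y"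
  by (rule k_hom_compose[OF bilinear_k_hom_right[OF bimodule_lact_bilinear[OF Q] x] right_homD(1)[OF goodD(1)[OF F]]]) simp
 then show ?thesis by (simp add: Nil)
next
 case (Cons e' l')
 have c: "e' \<in> carrier A" "l' \<in> As" using l Cons by simp_all
 have 1: "(\<lambda>e. F ((e \<otimes>\<^bsub>A\<^esub> e') # l') x) \<in> k_hom k A Y"
  by (rule k_hom_compose[OF alg_mult_k_hom(2)[OF A.k_algebra_axioms c(1)] multilinear_hd[OF goodD(2)[OF F x] c(2)]])
 have 2: "(\<lambda>e. D (\<lambda>m. F (e # m)) e' l' x) \<in> k_hom k A Y"
  by (rule hDm_param[OF multilinear_hd[OF goodD(2)[OF F]] c x])
 show ?thesis unfolding Cons hDm.simps by (rule k_hom_sub[OF bimodule_module[OF Y] 1 2])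
qed

lemma hDm_slot:
 "\<lbrakk>good Q Y F; e \<in> carrier A; l1 \<in> As; l2 \<in> As; x \<in> carrier Q\<rbrakk> \<Longrightarrow> (\<lambda>v. D F e (l1 @ v # l2) x) \<in> k_hom k A Y"
proof (induct l1 arbitrary: F e)
 case Nil
 have 1: "(\<lambda>v. F ((e \<otimes>\<^bsub>A\<^esub> v) # l2) x) \<in> k_hom k A Y"
  by (rule k_hom_compose[OF alg_mult_k_hom(1)[OF A.k_algebra_axioms Nil(2)] multilinear_hd[OF goodD(2)[OF Nil(1,5)] Nil(4)]])
 have 2: "(\<lambda>v. D (\<lambda>m. F (e # m)) v l2 x) \<in> k_hom k A Y" by (rule hDm_linear[OF good_Cons[OF Nil(1,2)] Nil(4,5)])
 show ?case unfolding append_Nil hDm.simps by (rule k_hom_sub[OF bimodule_module[OF Y] 1 2])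
next
 case (Cons e' l1)
 have c: "e' \<in> carrier A" "l1 \<in> As" using Cons(4) by simp_all
 have 1: "(\<lambda>v. F (((e \<otimes>\<^bsub>A\<^esub> e') # l1) @ v # l2) x) \<in> k_hom k A Y"
  by (rule multilinear_slot[OF goodD(2)[OF Cons(2,6)]]) (use c Cons(3,5) in simp_all)
 have 2: "(\<lambda>v. D (\<lambda>m. F (e # m)) e' (l1 @ v # l2) x) \<in> k_hom k A Y"
  by (rule Cons(1)[OF good_Cons[OF Cons(2,3)] c Cons(5,6)])
 show ?case using k_hom_sub[OF bimodule_module[OF Y] 1 2] by simp
qed

lemma good_E_bilinear:
 assumes F: "good Q Y F" and l: "l \<in> As" shows "E_bilinear Q Y (\<lambda>e. F (l @ [e]))"
proof (rule E_bilinearI)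
 show "F (l @ [e]) \<in> right_hom Q Y" if "e \<in> carrier A" for e by (rule goodD(1)[OF F]) (use l that in simp)
 show "(\<lambda>e. F (l @ [e]) x) \<in> k_hom k A Y" if "x \<in> carrier Q" for x
  by (rule multilinear_slot[OF goodD(2)[OF F that] l]) simp
qed

lemma hDm_E_bilinear:
 assumes F: "good Q Y F" and e0: "e0 \<in> carrier A" and l: "l \<in> As" shows "E_bilinear Q Y (\<lambda>e. D F e0 (l @ [e]))"
proof (rule E_bilinearI)
 show "D F e0 (l @ [e]) \<in> right_hom Q Y" if "e \<in> carrier A" for e
  by (rule hDm_right_hom[OF goodD(1)[OF F] e0]) (use l that in simp_all)
 show "(\<lambda>e. D F e0 (l @ [e]) x) \<in> k_hom k A Y" if "x \<in> carrier Q" for x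
  by (rule hDm_slot[OF F e0 l _ that]) simp
qed

lemma hDm_precomp:
 assumes g: "g \<in> bimod_hom k A B Q' Q" and x: "x \<in> carrier Q'"
 shows "e \<in> carrier A \<Longrightarrow> l \<in> As \<Longrightarrow> hDm A Y (lact Q') (\<lambda>l x. F l (g x)) e l x = D F e l (g x)"
proof (induct l arbitrary: F e)
 case Nil
 then show ?case using bimod_homD(2)[OF g Nil(1) x] by simp
next
 case (Cons e' l)
 have c: "e' \<in> carrier A" "l \<in> As" using Cons(3) by simp_all
 show ?case using Cons(1)[OF c, of "\<lambda>m. F (e # m)"] by simp
qed

lemma hdelm_precomp:
 assumes g: "g \<in> bimod_hom k A B Q' Q" and x: "x \<in> carrier Q'" and l: "l \<in> As"
 shows "hdelm A Y (lact Q') (\<lambda>l x. F l (g x)) l x = DD F l (g x)"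
 using l hDm_precomp[OF g x] by (cases l) simp_all

end

end

context two_algebras
begin

text \<open>
 Averaging over an appended letter lowers the degree by one. By \<open>contr_hdelm_Nil\<close> and \<open>contr_hdelm_Cons\<close>
 it is, up to sign, a contraction of the cochains on a relatively projective module in positive degrees; in
 degree zero the defect is \<open>tlam\<close>, which makes a right \<open>B\<close>-linear map linear over \<open>A\<close> as well.
\<close>

definition "contr h Y F l x = lam h Y (\<lambda>e. F (l @ [e])) x"
definition "tlam h Y \<phi> x = lam h Y (\<lambda>e y. lact Y e (\<phi> y)) x"

context
 fixes P :: "('k, ('a \<times> 'b \<Rightarrow> 'k) set, 'p) lmod" and h and Y :: "('k, 'a, 'b, 'y) bimod" (structure)
 assumes h: "rel_section k R P h" and Y: "bimodule k A B Y"
begin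

interpretation Y: bimodule k A B Y by (rule Y)

abbreviation "Qb \<equiv> bim_of P"

lemma Qb: "bimodule k A B Qb" by (rule bPb[OF h])

lemmas geb = good_E_bilinear[OF Qb Y]
lemmas deb = hDm_E_bilinear[OF Qb Y]

lemma contr_good:
 assumes F: "good Qb Y F" shows "good Qb Y (contr h Y F)"
proof (rule goodI)
 show rh: "contr h Y F l \<in> right_hom Qb Y" if "l \<in> As" for l
  unfolding contr_def by (rule lam_right_hom[OF h Y geb[OF F that]])
 fix x assume x: "x \<in> carrier Qb"
 then have x': "x \<in> carrier P" by simp
 show "multilinear k A Y (\<lambda>l. contr h Y F l x)"
 proof (rule multilinearI)
  show "contr h Y F l x \<in> carrier Y" if "l \<in> As" for l by (rule k_hom_closed[OF right_homD(1)[OF rh[OF that]] x])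
  fix l1 l2 assume l: "l1 \<in> As" "l2 \<in> As"
  show "(\<lambda>v. contr h Y F (l1 @ v # l2) x) \<in> k_hom k A Y"
   unfolding contr_def
  proof (rule lam_param[OF h Y mA _ _ x'])
   show "E_bilinear Qb Y (\<lambda>e. F ((l1 @ v # l2) @ [e]))" if "v \<in> carrier A" for v
    by (rule geb[OF F]) (use l that in simp)
   show "(\<lambda>v. F ((l1 @ v # l2) @ [e]) y) \<in> k_hom k A Y" if "e \<in> carrier A" "y \<in> carrier P" for e y
    using multilinear_slot[OF goodD(2)[OF F, of y] l(1), of "l2 @ [e]"] that l by simp
  qed
 qed
qed

text \<open>
 Only the last term of the differential sees the appended letter differently from the others: there
 it acts on the argument, and averaging returns \<open>F (e0 # l)\<close> by the section property.
\<close>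

lemma contr_hDm:
 "\<lbrakk>good Qb Y F; e0 \<in> carrier A; l \<in> As; x \<in> carrier P\<rbrakk> \<Longrightarrow>
  lam h Y (\<lambda>e. hDm A Y (lact Qb) F e0 (l @ [e])) x = hDm A Y (lact Qb) (contr h Y F) e0 l x \<ominus> sg Y (length l) (F (e0 # l) x)"
proof (induct l arbitrary: F e0)
 case Nil
 have r: "F [e0] \<in> right_hom Qb Y" by (rule goodD(1)[OF Nil(1)]) (use Nil(2) in simp)
 have E: "E_bilinear Qb Y (\<lambda>e. F [e])" using geb[OF Nil(1), of "[]"] by simp
 have "lam h Y (\<lambda>e y. F [e0 \<otimes>\<^bsub>A\<^esub> e] y \<ominus> F [e0] (lact Qb e y)) x
   = lam h Y (\<lambda>e. F [e0 \<otimes>\<^bsub>A\<^esub> e]) x \<ominus> lam h Y (\<lambda>e y. F [e0] (lact Qb e y)) x"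
  by (rule lam_minus[OF h Y E_bilinear_mult[OF h Y E Nil(2)] lam_id(1)[OF h Y r Nil(4)] Nil(4)])
 also have "lam h Y (\<lambda>e. F [e0 \<otimes>\<^bsub>A\<^esub> e]) x = contr h Y F [] (lact Qb e0 x)"
  unfolding contr_def append_Nil by (rule lam_lact[OF h Y E Nil(2,4), symmetric])
 also have "lam h Y (\<lambda>e y. F [e0] (lact Qb e y)) x = F [e0] x" by (rule lam_id(2)[OF h Y r Nil(4)])
 finally show ?case by (simp add: sg_def del: bim_of_simps)
next
 case (Cons e1 l)
 note F = Cons(2) and e0 = Cons(3) and x = Cons(5)
 have c: "e1 \<in> carrier A" "l \<in> As" using Cons(4) by simp_all
 have xQ: "x \<in> carrier Qb" using x by simp
 note Fe = good_Cons[OF F e0]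
 have ee: "(e0 \<otimes>\<^bsub>A\<^esub> e1) # l \<in> As" using e0 c by simp
 have IH: "lam h Y (\<lambda>e. hDm A Y (lact Qb) (\<lambda>m. F (e0 # m)) e1 (l @ [e])) x
  = hDm A Y (lact Qb) (contr h Y (\<lambda>m. F (e0 # m))) e1 l x \<ominus> sg Y (length l) (F (e0 # e1 # l) x)"
  by (rule Cons(1)[OF Fe c x])
 have sh: "contr h Y (\<lambda>m. F (e0 # m)) = (\<lambda>m. contr h Y F (e0 # m))" by (simp add: contr_def fun_eq_iff)
 have "lam h Y (\<lambda>e. hDm A Y (lact Qb) F e0 ((e1 # l) @ [e])) x =
   lam h Y (\<lambda>e y. F (((e0 \<otimes>\<^bsub>A\<^esub> e1) # l) @ [e]) y \<ominus> hDm A Y (lact Qb) (\<lambda>m. F (e0 # m)) e1 (l @ [e]) y) x"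
  unfolding append_Cons hDm_funs(2) ..
 also have "\<dots> = contr h Y F ((e0 \<otimes>\<^bsub>A\<^esub> e1) # l) x \<ominus> lam h Y (\<lambda>e. hDm A Y (lact Qb) (\<lambda>m. F (e0 # m)) e1 (l @ [e])) x"
  unfolding contr_def by (rule lam_minus[OF h Y geb[OF F ee] deb[OF Fe c] x])
 finally have 1: "lam h Y (\<lambda>e. hDm A Y (lact Qb) F e0 ((e1 # l) @ [e])) x = contr h Y F ((e0 \<otimes>\<^bsub>A\<^esub> e1) # l) x \<ominus>
   (hDm A Y (lact Qb) (\<lambda>m. contr h Y F (e0 # m)) e1 l x \<ominus> sg Y (length l) (F (e0 # e1 # l) x))"
  unfolding IH sh .
 have a: "contr h Y F ((e0 \<otimes>\<^bsub>A\<^esub> e1) # l) x \<in> carrier Y" by (rule good_closed[OF contr_good[OF F] ee xQ])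
 have b: "hDm A Y (lact Qb) (\<lambda>m. contr h Y F (e0 # m)) e1 l x \<in> carrier Y"
  by (rule hDm_closed[OF Qb Y good_Cons[OF contr_good[OF F] e0] c xQ])
 have fx: "F (e0 # e1 # l) x \<in> carrier Y" by (rule good_closed[OF F _ xQ]) (use e0 c in simp)
 show ?case unfolding 1 using a b fx
  by (simp add: Y.N.M.minus_minus_assoc Y.N.M.sg_Suc Y.N.M.minus_uminus del: bim_of_simps)
qed

lemma hdelm_E_bilinear:
 assumes F: "good Qb Y F" and l: "l \<in> As" shows "E_bilinear Qb Y (\<lambda>e. hdelm A Y (lact Qb) F (l @ [e]))"
proof (cases l)
 case Nil
 have r: "F [] \<in> right_hom Qb Y" by (rule goodD(1)[OF F]) simp
 have "E_bilinear Qb Y (\<lambda>e y. lact Y e (F [] y) \<ominus> F [] (lact Qb e y))"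
 proof (rule E_bilinearI)
  show "(\<lambda>y. lact Y e (F [] y) \<ominus> F [] (lact Qb e y)) \<in> right_hom Qb Y" if "e \<in> carrier A" for e
   by (rule right_hom_minus[OF Y right_hom_comp[OF r lact_right_hom[OF Y that]] right_hom_comp[OF lact_right_hom[OF Qb that] r]])
  show "(\<lambda>e. lact Y e (F [] y) \<ominus> F [] (lact Qb e y)) \<in> k_hom k A Y" if "y \<in> carrier Qb" for y
   by (rule k_hom_sub[OF bimodule_module[OF Y] bilinear_k_hom_right[OF bimodule_lact_bilinear[OF Y] k_hom_closed[OF right_homD(1)[OF r] that]]
     k_hom_compose[OF bilinear_k_hom_right[OF bimodule_lact_bilinear[OF Qb] that] right_homD(1)[OF r]]])
 qed
 then show ?thesis unfolding Nil append_Nil hDm_funs .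
next
 case (Cons e0 l')
 have c: "e0 \<in> carrier A" "l' \<in> As" using l Cons by simp_all
 have "E_bilinear Qb Y (\<lambda>e y. lact Y e0 (F (l' @ [e]) y) \<ominus> hDm A Y (lact Qb) F e0 (l' @ [e]) y)"
  by (rule E_bilinear_minus[OF h Y]) (rule E_bilinearI, rule right_hom_comp[OF E_bilinearD(1)[OF geb[OF F c(2)]] lact_right_hom[OF Y c(1)]],
   assumption, rule k_hom_compose[OF E_bilinearD(2)[OF geb[OF F c(2)]] bimodule_lact_k_hom[OF Y c(1)]], assumption, rule deb[OF F c])
 then show ?thesis unfolding Cons append_Cons hDm_funs(3) .
qed

lemma contr_hdelm_Nil:
 assumes F: "good Qb Y F" and x: "x \<in> carrier P"
 shows "contr h Y (hdelm A Y (lact Qb) F) [] x = tlam h Y (F []) x \<ominus> F [] x"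
proof -
 have r: "F [] \<in> right_hom Qb Y" by (rule goodD(1)[OF F]) simp
 have "lam h Y (\<lambda>e y. lact Y e (F [] y) \<ominus> F [] (lact Qb e y)) x = tlam h Y (F []) x \<ominus> lam h Y (\<lambda>e y. F [] (lact Qb e y)) x"
  unfolding tlam_def by (rule lam_minus[OF h Y E_bilinear_lact[OF h Y r] lam_id(1)[OF h Y r x] x])
 also have "lam h Y (\<lambda>e y. F [] (lact Qb e y)) x = F [] x" by (rule lam_id(2)[OF h Y r x])
 finally show ?thesis unfolding contr_def append_Nil hDm_funs .
qed

lemma contr_hdelm_Cons:
 assumes F: "good Qb Y F" and e0: "e0 \<in> carrier A" and l: "l \<in> As" and x: "x \<in> carrier P"
 shows "contr h Y (hdelm A Y (lact Qb) F) (e0 # l) x = hdelm A Y (lact Qb) (contr h Y F) (e0 # l) x \<oplus> sg Y (length l) (F (e0 # l) x)"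
proof -
 have xQ: "x \<in> carrier Qb" using x by simp
 note lr = lact_right_hom[OF Y e0]
 note N = lam_nat[OF h Y Y lr geb[OF F l] x]
 have "lam h Y (\<lambda>e y. lact Y e0 (F (l @ [e]) y) \<ominus> hDm A Y (lact Qb) F e0 (l @ [e]) y) x
  = lam h Y (\<lambda>e y. lact Y e0 (F (l @ [e]) y)) x \<ominus> lam h Y (\<lambda>e. hDm A Y (lact Qb) F e0 (l @ [e])) x"
  by (rule lam_minus[OF h Y N(1) deb[OF F e0 l] x])
 also have "lam h Y (\<lambda>e y. lact Y e0 (F (l @ [e]) y)) x = lact Y e0 (contr h Y F l x)"
  unfolding contr_def by (rule N(2)[symmetric])
 also have "lam h Y (\<lambda>e. hDm A Y (lact Qb) F e0 (l @ [e])) x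
   = hDm A Y (lact Qb) (contr h Y F) e0 l x \<ominus> sg Y (length l) (F (e0 # l) x)"
  by (rule contr_hDm[OF F e0 l x])
 finally have 1: "contr h Y (hdelm A Y (lact Qb) F) (e0 # l) x = lact Y e0 (contr h Y F l x) \<ominus>
   (hDm A Y (lact Qb) (contr h Y F) e0 l x \<ominus> sg Y (length l) (F (e0 # l) x))"
  unfolding contr_def[of h Y "hdelm A Y (lact Qb) F"] append_Cons hDm_funs(3) .
 have a: "lact Y e0 (contr h Y F l x) \<in> carrier Y" by (rule Y.lact_closed[OF e0 good_closed[OF contr_good[OF F] l xQ]])
 have b: "hDm A Y (lact Qb) (contr h Y F) e0 l x \<in> carrier Y" by (rule hDm_closed[OF Qb Y contr_good[OF F] e0 l xQ])
 have fx: "F (e0 # l) x \<in> carrier Y" by (rule good_closed[OF F _ xQ]) (use e0 l in simp)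
 show ?thesis unfolding 1 using a b fx by (simp add: Y.N.M.minus_minus_assoc del: bim_of_simps)
qed

end

end

text \<open>
 A resolution \<open>P\<close> of \<open>L\<close>, which is \<open>B\<close> with \<open>A\<close> acting through \<open>\<pi>\<close>, by modules with a relative section.
\<close>

locale comparison = two_algebras k A B for k :: "'k ring" and A :: "('k, 'a) module" and B :: "('k, 'b) module" +
 fixes \<pi> :: "'a \<Rightarrow> 'b" and P :: "nat \<Rightarrow> ('k, ('a \<times> 'b \<Rightarrow> 'k) set, 'p) lmod" and d :: "nat \<Rightarrow> 'p \<Rightarrow> 'p" and \<epsilon> :: "'p \<Rightarrow> 'b"
  and \<sigma> :: "'b \<Rightarrow> 'p" and s :: "nat \<Rightarrow> 'p \<Rightarrow> 'p" and h :: "nat \<Rightarrow> 'p \<Rightarrow> (('a \<times> 'b \<Rightarrow> 'k) set \<times> 'p \<Rightarrow> 'k) set"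
  and L :: "('k, 'a, 'b, 'b) bimod"
 assumes pi_hom: "\<pi> \<in> k_hom k A B" and pi_mult: "\<lbrakk>x \<in> carrier A; y \<in> carrier A\<rbrakk> \<Longrightarrow> \<pi> (x \<otimes>\<^bsub>A\<^esub> y) = \<pi> x \<otimes>\<^bsub>B\<^esub> \<pi> y"
  and pi_one: "\<pi> \<one>\<^bsub>A\<^esub> = \<one>\<^bsub>B\<^esub>"
  and L_def: "L = restrict_bimod (carrier B) \<pi> id (regular_bimod B)"
  and sec: "rel_section k R (P n) (h n)"
  and d_lmod: "d n \<in> lmod_hom k R (P (Suc n)) (P n)"
  and eps_lmod: "\<epsilon> \<in> lmod_hom k R (P 0) (bimod_as_left k L)"
  and eps_d: "z \<in> carrier (P (Suc 0)) \<Longrightarrow> \<epsilon> (d 0 z) = \<zero>\<^bsub>B\<^esub>"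
  and d_d: "z \<in> carrier (P (Suc (Suc n))) \<Longrightarrow> d n (d (Suc n) z) = \<zero>\<^bsub>P n\<^esub>"
  and sigma_hom: "\<sigma> \<in> k_hom k B (P 0)" and s_hom: "s n \<in> k_hom k (P n) (P (Suc n))"
  and eps_sigma: "w \<in> carrier B \<Longrightarrow> \<epsilon> (\<sigma> w) = w"
  and htpy_0: "z \<in> carrier (P 0) \<Longrightarrow> d 0 (s 0 z) \<oplus>\<^bsub>P 0\<^esub> \<sigma> (\<epsilon> z) = z"
  and htpy_Suc: "z \<in> carrier (P (Suc n)) \<Longrightarrow> d (Suc n) (s (Suc n) z) \<oplus>\<^bsub>P (Suc n)\<^esub> s n (d n z) = z"
begin

lemma L_simps [simp]: "carrier L = carrier B" "zero L = zero B" "add L = add B" "smult L = smult B"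
 "lact L a y = \<pi> a \<otimes>\<^bsub>B\<^esub> y" "ract L y b = y \<otimes>\<^bsub>B\<^esub> b"
 by (simp_all add: L_def restrict_bimod_def regular_bimod_def)

lemma pi_closed: "a \<in> carrier A \<Longrightarrow> \<pi> a \<in> carrier B" by (rule k_hom_closed[OF pi_hom])

lemma L_k_hom [simp]: "k_hom k L N = k_hom k B N" "k_hom k N L = k_hom k N B"
 by (rule k_hom_transfer_left k_hom_transfer_right; simp)+

lemma bL: "bimodule k A B L"
proof (intro bimodule.intro left_module.intro left_module_axioms.intro bimodule_axioms.intro A.k_algebra_axioms B.k_algebra_axioms)
 show "module k L" by (rule module_transfer[OF mB]) simp_all
qed (simp_all add: pi_closed pi_mult pi_one k_hom_add[OF pi_hom] k_hom_smult[OF pi_hom] B.A.l_distr B.A.r_distr B.A.m_assoc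
  B.smult_mult_left B.smult_mult_right[symmetric])

abbreviation "Pn n \<equiv> bim_of (P n)"

lemma lPn: "left_module k R (P n)" by (rule sec_left[OF sec])
lemma bPn: "bimodule k A B (Pn n)" by (rule bPb[OF sec])
lemma mPn: "module k (P n)" by (rule ext_mP[OF lPn])

lemma Pn_k_hom [simp]: "k_hom k (Pn n) N = k_hom k (P n) N" "k_hom k N (Pn n) = k_hom k N (P n)"
 by (rule k_hom_transfer_left k_hom_transfer_right; simp)+

lemma d_hom: "d n \<in> k_hom k (P (Suc n)) (P n)" by (rule lmod_homD(1)[OF d_lmod])
lemma d_closed: "x \<in> carrier (P (Suc n)) \<Longrightarrow> d n x \<in> carrier (P n)" by (rule k_hom_closed[OF d_hom])

lemma d_bimod: "d n \<in> bimod_hom k A B (Pn (Suc n)) (Pn n)"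
proof (rule bimod_homI, rule right_homI)
 have one: "\<one>\<^bsub>A\<^esub> \<in> carrier A" "\<one>\<^bsub>B\<^esub> \<in> carrier B" by simp_all
 show "d n \<in> k_hom k (Pn (Suc n)) (Pn n)" using d_hom by simp
 show "d n (ract (Pn (Suc n)) x b) = ract (Pn n) (d n x) b" if "x \<in> carrier (Pn (Suc n))" "b \<in> carrier B" for x b
  using lmod_homD(2)[OF d_lmod, of "pt \<one>\<^bsub>A\<^esub> b" x n] pt_closed[OF one(1) that(2)] that by simp
 show "d n (lact (Pn (Suc n)) a x) = lact (Pn n) a (d n x)" if "a \<in> carrier A" "x \<in> carrier (Pn (Suc n))" for a x
  using lmod_homD(2)[OF d_lmod, of "pt a \<one>\<^bsub>B\<^esub>" x n] pt_closed[OF that(1) one(2)] that by simp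
qed

lemma eps_bimod: "\<epsilon> \<in> bimod_hom k A B (Pn 0) L"
 using eps_lmod lmod_hom_bim_of[OF sec bL] by simp

lemma eps_hom: "\<epsilon> \<in> k_hom k (P 0) B" using bimod_homK[OF eps_bimod] by simp

lemma eps_closed: "x \<in> carrier (P 0) \<Longrightarrow> \<epsilon> x \<in> carrier B" by (rule k_hom_closed[OF eps_hom])

text \<open>
 \<open>Y\<close> as an \<open>A\<close>-bimodule through \<open>\<pi>\<close>.
\<close>

definition pp :: "('k, 'a, 'b, 'y) bimod \<Rightarrow> ('k, 'a, 'a, 'y) bimod" where
 "pp Y = restrict_bimod (carrier Y) id \<pi> Y"

lemma pp_simps [simp]: "carrier (pp Y) = carrier Y" "zero (pp Y) = zero Y" "add (pp Y) = add Y" "smult (pp Y) = smult Y"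
 "lact (pp Y) a y = lact Y a y" "ract (pp Y) y a = ract Y y (\<pi> a)"
 by (simp_all add: pp_def restrict_bimod_def)

lemma pp_minus [simp]: "x \<ominus>\<^bsub>pp Y\<^esub> y = x \<ominus>\<^bsub>Y\<^esub> y" by (rule a_minus_transfer) simp_all

lemma pp_k_hom [simp]: "k_hom k (pp Y) N = k_hom k Y N" "k_hom k N (pp Y) = k_hom k N Y"
 by (rule k_hom_transfer_left k_hom_transfer_right; simp)+

lemma pp_multilinear [simp]: "multilinear k C (pp Y) f = multilinear k C Y f"
 by (simp add: multilinear_def)

lemma bpp: "bimodule k A B Y \<Longrightarrow> bimodule k A A (pp Y)"
proof -
 assume Y: "bimodule k A B Y"
 interpret Y: bimodule k A B Y by (rule Y)
 show ?thesis
 proof (intro bimodule.intro left_module.intro left_module_axioms.intro bimodule_axioms.intro A.k_algebra_axioms)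
  show "module k (pp Y)" by (rule module_transfer[OF bimodule_module[OF Y]]) simp_all
 qed (simp_all add: pi_closed pi_mult pi_one k_hom_add[OF pi_hom] k_hom_smult[OF pi_hom] Y.lact_closed Y.ract_closed
  Y.lact_add_left Y.lact_add_right Y.lact_mult Y.lact_one Y.lact_smult Y.ract_add_left Y.ract_add_right Y.ract_mult Y.ract_one
  Y.ract_smult Y.lact_ract)
qed

lemma hoch_pp: "bimodule k A B Y \<Longrightarrow> hoch k A (pp Y)"
 by (rule hoch.intro[OF bpp])

end

section \<open>From cochains to the resolution and back\<close>

context comparison
begin

lemma right_hom_zero:
 assumes "f \<in> right_hom Q Y" "module k Q" "module k Y" shows "f \<zero>\<^bsub>Q\<^esub> = \<zero>\<^bsub>Y\<^esub>"
 by (rule k_hom_zero[OF assms(2,3) right_homD(1)[OF assms(1)]])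

text \<open>
 The image of the bar resolution in \<open>P\<close>, on the generators: degree zero lifts \<open>1\<close> along \<open>\<epsilon>\<close>, and each
 coboundary is lifted along \<open>d\<close> by means of the \<open>k\<close>-linear contraction.
\<close>

primrec uc :: "nat \<Rightarrow> 'a list \<Rightarrow> 'p" where
 "uc 0 = (\<lambda>l. if l = [] then \<sigma> \<one>\<^bsub>B\<^esub> else \<zero>\<^bsub>P 0\<^esub>)"
| "uc (Suc n) = (\<lambda>l. s n (hdel A (pp (Pn n)) (uc n) l))"

lemma multilinear_const:
 assumes N: "module k N" and c: "c \<in> carrier N"
 shows "multilinear k A N (\<lambda>l. if l = [] then c else \<zero>\<^bsub>N\<^esub>)"
proof (rule multilinearI)
 interpret N: module k N by (rule N)
 show "(if l = [] then c else \<zero>\<^bsub>N\<^esub>) \<in> carrier N" for l using c by simp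
 show "(\<lambda>x. if l1 @ x # l2 = [] then c else \<zero>\<^bsub>N\<^esub>) \<in> k_hom k A N" for l1 l2
  using k_hom_const_zero[OF N] by simp
qed

lemma uc_multilinear: "multilinear k A (P n) (uc n)"
proof (induct n)
 case 0
 show ?case unfolding uc.simps
  by (rule multilinear_const[OF mPn k_hom_closed[OF sigma_hom]]) simp
next
 case (Suc n)
 interpret H: hoch k A "pp (Pn n)" by (rule hoch_pp[OF bPn])
 have P1: "multilinear k A (pp (Pn n)) f = multilinear k A (P n) f" for f by (simp add: multilinear_def)
 have "multilinear k A (pp (Pn n)) (hdel A (pp (Pn n)) (uc n))"
  by (rule H.hdel_multilinear) (use Suc P1 in simp)
 then show ?case unfolding uc.simps P1 by (rule multilinear_comp[OF _ s_hom])
qed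

lemma uc_multilinear_b: "multilinear k A (Pn n) (uc n)"
 using uc_multilinear[of n] by (simp add: multilinear_def)

lemma uc_closed: "l \<in> As \<Longrightarrow> uc n l \<in> carrier (P n)"
 by (rule multilinear_closed[OF uc_multilinear])

lemma hdel_bimod_nat:
 assumes Y: "bimodule k A B Y" and Y': "bimodule k A B Y'" and g: "g \<in> bimod_hom k A B Y Y'"
  and f: "\<And>m. m \<in> As \<Longrightarrow> f m \<in> carrier Y" and l: "l \<in> As"
 shows "g (hdel A (pp Y) f l) = hdel A (pp Y') (\<lambda>m. g (f m)) l"
proof -
 interpret H: hoch k A "pp Y" by (rule hoch_pp[OF Y])
 note gr = bimod_homD(1)[OF g] and gl = bimod_homD(2)[OF g]
 note gk = right_homD(1)[OF gr]
 note mm = bimodule_module[OF Y] bimodule_module[OF Y']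
 show ?thesis
 proof (cases l)
  case Nil
  then show ?thesis using k_hom_zero[OF mm gk] by simp
 next
  case (Cons e l')
  have c: "e \<in> carrier A" "l' \<in> As" using l Cons by simp_all
  have 1: "g (hD A (pp Y) f e l') = hD A (pp Y') (\<lambda>m. g (f m)) e l'"
   by (rule H.hD_nat[OF bpp[OF Y']]) (use gk right_homD(2)[OF gr] pi_closed f c in simp_all)
  have h: "hD A (pp Y) f e l' \<in> carrier Y" using H.hD_closed[of f e l'] f c by simp
  interpret Y: bimodule k A B Y by (rule Y)
  have a: "lact Y e (f l') \<in> carrier Y" by (rule Y.lact_closed[OF c(1) f[OF c(2)]])
  show ?thesis unfolding Cons hdel.simps
   using k_hom_minus[OF mm gk a h] 1 gl[OF c(1) f[OF c(2)]] by simp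
 qed
qed

text \<open>
 The coboundary of \<open>uc n\<close> is killed by the next map of the resolution: in degree zero since the
 constant cochain \<open>1\<close> of \<open>L\<close> is a cocycle, in higher degrees by induction and \<open>d d = 0\<close> for cochains.
\<close>

lemma uc_d: "l \<in> As \<Longrightarrow> d n (uc (Suc n) l) = hdel A (pp (Pn n)) (uc n) l"
proof (induct n arbitrary: l)
 case 0
 interpret H: hoch k A "pp (Pn 0)" by (rule hoch_pp[OF bPn])
 let ?v = "hdel A (pp (Pn 0)) (uc 0) l"
 interpret P0: module k "P 0" by (rule mPn)
 have uc0: "uc 0 m \<in> carrier (Pn 0)" if "m \<in> As" for m using uc_closed[OF that, of 0] by simp
 have vc: "?v \<in> carrier (P 0)" using H.hdel_closed[of "uc 0" l] uc0 0 by simp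
 interpret HL: hoch k A "pp L" by (rule hoch_pp[OF bL])
 have "\<epsilon> ?v = hdel A (pp L) (\<lambda>m. \<epsilon> (uc 0 m)) l"
  by (rule hdel_bimod_nat[OF bPn bL eps_bimod uc0 0])
 also have "\<dots> = \<zero>\<^bsub>B\<^esub>"
 proof -
  have e0: "\<epsilon> (uc 0 m) = (if m = [] then \<one>\<^bsub>B\<^esub> else \<zero>\<^bsub>B\<^esub>)" for m
   using eps_sigma k_hom_zero[OF mPn mB eps_hom] by simp
  have lm: "x \<ominus>\<^bsub>L\<^esub> y = x \<ominus>\<^bsub>B\<^esub> y" for x y by (simp add: a_minus_transfer[of L B])
  have bb: "b \<ominus>\<^bsub>B\<^esub> b = \<zero>\<^bsub>B\<^esub>" if "b \<in> carrier B" for b using that by (simp add: a_minus_def B.M.r_neg)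
  show ?thesis
  proof (cases l)
   case (Cons e l')
   have c: "e \<in> carrier A" "l' \<in> As" using 0 Cons by simp_all
   show ?thesis
   proof (cases l')
    case Nil
    then show ?thesis unfolding Cons e0 using pi_closed[OF c(1)] by (simp add: lm bb)
   next
    case c2: (Cons e' l'')
    have "hD A (pp L) (\<lambda>m. if m = [] then \<one>\<^bsub>B\<^esub> else \<zero>\<^bsub>B\<^esub>) e l' = hD A (pp L) (\<lambda>m. \<zero>\<^bsub>pp L\<^esub>) e l'"
     by (rule hD_cong[OF _ A.A.ring_axioms c]) (use c2 in auto)
    also have "\<dots> = \<zero>\<^bsub>pp L\<^esub>" by (rule HL.hD_zero[OF c])
    finally show ?thesis unfolding Cons e0 using c2 pi_closed[OF c(1)]
     by (simp add: lm bb)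
   qed
  qed simp
 qed
 finally have ev: "\<epsilon> ?v = \<zero>\<^bsub>B\<^esub>" .
 have "d 0 (s 0 ?v) \<oplus>\<^bsub>P 0\<^esub> \<sigma> (\<epsilon> ?v) = ?v" by (rule htpy_0[OF vc])
 then have "d 0 (s 0 ?v) \<oplus>\<^bsub>P 0\<^esub> \<zero>\<^bsub>P 0\<^esub> = ?v" unfolding ev k_hom_zero[OF mB mPn sigma_hom] .
 then show ?case using d_closed[OF k_hom_closed[OF s_hom vc]] by simp
next
 case (Suc n)
 interpret H: hoch k A "pp (Pn (Suc n))" by (rule hoch_pp[OF bPn])
 interpret H': hoch k A "pp (Pn n)" by (rule hoch_pp[OF bPn])
 let ?v = "hdel A (pp (Pn (Suc n))) (uc (Suc n)) l"
 interpret Pm: module k "P (Suc n)" by (rule mPn)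
 have ucc: "uc n m \<in> carrier (Pn n)" if "m \<in> As" for m n using uc_closed[OF that, of n] by simp
 have vc: "?v \<in> carrier (P (Suc n))" using H.hdel_closed[OF _ Suc(2), of "uc (Suc n)"] ucc by (simp del: uc.simps)
 have "d n ?v = hdel A (pp (Pn n)) (\<lambda>m. d n (uc (Suc n) m)) l"
  by (rule hdel_bimod_nat[OF bPn bPn d_bimod ucc Suc(2)])
 also have "\<dots> = hdel A (pp (Pn n)) (hdel A (pp (Pn n)) (uc n)) l"
  by (rule H'.hdel_cong[OF Suc(1) Suc(2)])
 also have "\<dots> = \<zero>\<^bsub>P n\<^esub>" using H'.hdel_hdel[OF _ Suc(2), of "uc n"] ucc by simp
 finally have ev: "d n ?v = \<zero>\<^bsub>P n\<^esub>" .
 have "d (Suc n) (s (Suc n) ?v) \<oplus>\<^bsub>P (Suc n)\<^esub> s n (d n ?v) = ?v" by (rule htpy_Suc[OF vc])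
 then have "d (Suc n) (s (Suc n) ?v) \<oplus>\<^bsub>P (Suc n)\<^esub> \<zero>\<^bsub>P (Suc n)\<^esub> = ?v" unfolding ev k_hom_zero[OF mPn mPn s_hom] .
 then have "d (Suc n) (s (Suc n) ?v) = ?v" using d_closed[OF k_hom_closed[OF s_hom vc]] by simp
 then show ?case by simp
qed

text \<open>
 A cochain \<open>f\<close> with values in \<open>Y\<close> becomes the cochain \<open>f \<epsilon>\<close> on \<open>P 0\<close>; then the last letters are traded
 one at a time for a step in the resolution. If \<open>f\<close> has degree \<open>n\<close>, then \<open>push Y f n []\<close> is a map \<open>P n \<rightarrow> Y\<close>.
\<close>

primrec push :: "('k, 'a, 'b, 'y) bimod \<Rightarrow> ('a list \<Rightarrow> 'y) \<Rightarrow> nat \<Rightarrow> 'a list \<Rightarrow> 'p \<Rightarrow> 'y" where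
 "push Y f 0 = (\<lambda>l x. ract Y (f l) (\<epsilon> x))"
| "push Y f (Suc i) = (\<lambda>l x. contr (h i) Y (push Y f i) l (d i x))"

abbreviation "Dl Y i F \<equiv> hdelm A Y (lact (Pn i)) F"

context
 fixes Y :: "('k, 'a, 'b, 'y) bimod" (structure)
 assumes Y: "bimodule k A B Y"
begin

interpretation Y: bimodule k A B Y by (rule Y)
interpretation HY: hoch k A "pp Y" by (rule hoch_pp[OF Y])

lemma moY: "module k Y" by (rule bimodule_module[OF Y])

lemma push_good:
 assumes f: "multilinear k A Y f" shows "good (Pn i) Y (push Y f i)"
proof (induct i)
 case 0
 show ?case unfolding push.simps
 proof (rule goodI)
  note rb = bimodule_ract_bilinear[OF Y]
  show "(\<lambda>x. ract Y (f l) (\<epsilon> x)) \<in> right_hom (Pn 0) Y" if l: "l \<in> As" for l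
  proof (rule right_homI)
   have fl: "f l \<in> carrier Y" by (rule multilinear_closed[OF f l])
   show "(\<lambda>x. ract Y (f l) (\<epsilon> x)) \<in> k_hom k (Pn 0) Y"
    using k_hom_compose[OF eps_hom bilinear_k_hom_left[OF rb fl]] by simp
   show "ract Y (f l) (\<epsilon> (ract (Pn 0) x b)) = ract Y (ract Y (f l) (\<epsilon> x)) b" if x: "x \<in> carrier (Pn 0)" and b: "b \<in> carrier B" for x b
   proof -
    have "\<epsilon> (ract (Pn 0) x b) = \<epsilon> x \<otimes>\<^bsub>B\<^esub> b" using right_homD(2)[OF bimod_homD(1)[OF eps_bimod] x b] by simp
    then show ?thesis using Y.ract_mult[OF fl eps_closed b, of x] x by simp
   qed
  qed
  show "multilinear k A Y (\<lambda>l. ract Y (f l) (\<epsilon> x))" if "x \<in> carrier (Pn 0)" for x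
   by (rule multilinear_comp[OF f bilinear_k_hom_right[OF rb eps_closed]]) (use that in simp)
 qed
next
 case (Suc i)
 note g = contr_good[OF sec Y Suc]
 note dr = bimod_homD(1)[OF d_bimod[of i]]
 show ?case unfolding push.simps
 proof (rule goodI)
  show "(\<lambda>x. contr (h i) Y (push Y f i) l (d i x)) \<in> right_hom (Pn (Suc i)) Y" if l: "l \<in> As" for l
   by (rule right_hom_comp[OF dr goodD(1)[OF g l]])
  show "multilinear k A Y (\<lambda>l. contr (h i) Y (push Y f i) l (d i x))" if "x \<in> carrier (Pn (Suc i))" for x
   by (rule goodD(2)[OF g k_hom_closed[OF right_homD(1)[OF dr] that]])
 qed
qed

lemma push_d:
 assumes f: "multilinear k A Y f" and l: "l \<in> As" and x: "x \<in> carrier (P (Suc i))"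
 shows "push Y f i l (d i x) = \<zero>"
proof (cases i)
 case 0
 have "\<epsilon> (d 0 x) = \<zero>\<^bsub>B\<^esub>" by (rule eps_d) (use x 0 in simp)
 then show ?thesis
  using k_hom_zero[OF mB moY bilinear_k_hom_left[OF bimodule_ract_bilinear[OF Y] multilinear_closed[OF f l]]] 0 by simp
next
 case (Suc j)
 note g = contr_good[OF sec Y push_good[OF f], of j]
 have dd: "d j (d i x) = \<zero>\<^bsub>P j\<^esub>" unfolding Suc by (rule d_d) (use x Suc in simp)
 have "contr (h j) Y (push Y f j) l \<zero>\<^bsub>P j\<^esub> = \<zero>"
  using right_hom_zero[OF goodD(1)[OF g l] bimodule_module[OF bPn] moY] by simp
 then show ?thesis using dd by (simp add: Suc)
qed

lemma hD_push:
 "\<lbrakk>\<And>m. m \<in> As \<Longrightarrow> f m \<in> carrier Y; e \<in> carrier A; l \<in> As; x \<in> carrier (P 0)\<rbrakk> \<Longrightarrow>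
  ract Y (hD A (pp Y) f e l) (\<epsilon> x) = hDm A Y (lact (Pn 0)) (\<lambda>l x. ract Y (f l) (\<epsilon> x)) e l x"
proof (induct l arbitrary: f e)
 case Nil
 have "\<epsilon> (lact (Pn 0) e x) = \<pi> e \<otimes>\<^bsub>B\<^esub> \<epsilon> x" using bimod_homD(2)[OF eps_bimod Nil(2), of x] Nil(4) by simp
 moreover have "ract Y (ract Y (f []) (\<pi> e)) (\<epsilon> x) = ract Y (f []) (\<pi> e \<otimes>\<^bsub>B\<^esub> \<epsilon> x)"
  by (rule Y.ract_mult[OF Nil(1) pi_closed[OF Nil(2)] eps_closed[OF Nil(4)], symmetric]) simp
 ultimately show ?case by simp
next
 case (Cons e' l)
 have c: "e' \<in> carrier A" "l \<in> As" using Cons(4) by simp_all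
 have fe: "f (e # m) \<in> carrier Y" if "m \<in> As" for m by (rule Cons(2)) (use that Cons(3) in simp)
 have IH: "ract Y (hD A (pp Y) (\<lambda>m. f (e # m)) e' l) (\<epsilon> x) = hDm A Y (lact (Pn 0)) (\<lambda>l x. ract Y (f (e # l)) (\<epsilon> x)) e' l x"
  by (rule Cons(1)[OF fe c Cons(5)])
 have a: "f ((e \<otimes>\<^bsub>A\<^esub> e') # l) \<in> carrier Y" by (rule Cons(2)) (use c Cons(3) in simp)
 have b: "hD A (pp Y) (\<lambda>m. f (e # m)) e' l \<in> carrier Y" using HY.hD_closed[of "\<lambda>m. f (e # m)" e' l] fe c by simp
 show ?case unfolding hD.simps hDm.simps pp_minus IH[symmetric]
  by (rule k_hom_minus[OF moY moY bilinear_k_hom_right[OF bimodule_ract_bilinear[OF Y] eps_closed[OF Cons(5)]] a b])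
qed

lemma hdel_multilinear_Y: "multilinear k A Y f \<Longrightarrow> multilinear k A Y (hdel A (pp Y) f)"
 using HY.hdel_multilinear[of f] by simp

text \<open>
 The homotopy formula for \<open>contr\<close> produces the extra term \<open>push Y f i (e0 # l) (d i x)\<close>, which vanishes
 by \<open>push_d\<close>; therefore \<open>push\<close> commutes with coboundaries.
\<close>

lemma push_hdel:
 assumes f: "multilinear k A Y f"
 shows "e0 \<in> carrier A \<Longrightarrow> l \<in> As \<Longrightarrow> x \<in> carrier (P i) \<Longrightarrow>
  push Y (hdel A (pp Y) f) i (e0 # l) x = Dl Y i (push Y f i) (e0 # l) x"
proof (induct i arbitrary: e0 l x)
 case 0
 have fl: "f l \<in> carrier Y" by (rule multilinear_closed[OF f 0(2)])
 have hc: "hD A (pp Y) f e0 l \<in> carrier Y" using HY.hD_closed[OF _ 0(1,2), of f] multilinear_closed[OF f] by simp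
 have 1: "ract Y (hD A (pp Y) f e0 l) (\<epsilon> x) = hDm A Y (lact (Pn 0)) (\<lambda>l x. ract Y (f l) (\<epsilon> x)) e0 l x"
  by (rule hD_push[OF multilinear_closed[OF f] 0])
 have "ract Y (lact Y e0 (f l) \<ominus> hD A (pp Y) f e0 l) (\<epsilon> x) =
   ract Y (lact Y e0 (f l)) (\<epsilon> x) \<ominus> ract Y (hD A (pp Y) f e0 l) (\<epsilon> x)"
  by (rule k_hom_minus[OF moY moY bilinear_k_hom_right[OF bimodule_ract_bilinear[OF Y] eps_closed[OF 0(3)]] Y.lact_closed[OF 0(1) fl] hc])
 also have "ract Y (lact Y e0 (f l)) (\<epsilon> x) = lact Y e0 (ract Y (f l) (\<epsilon> x))"
  by (rule Y.lact_ract[OF 0(1) fl eps_closed[OF 0(3)], symmetric])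
 finally show ?case unfolding push.simps hdel.simps hdelm.simps pp_minus 1 pp_simps .
next
 case (Suc i)
 note F = push_good[OF f, of i] and F' = push_good[OF hdel_multilinear_Y[OF f], of i]
 have dx: "d i x \<in> carrier (P i)" by (rule d_closed[OF Suc(4)])
 have xP: "x \<in> carrier (Pn (Suc i))" using Suc(4) by simp
 have c: "e0 # l \<in> As" using Suc(2,3) by simp
 have "push Y (hdel A (pp Y) f) (Suc i) (e0 # l) x = contr (h i) Y (Dl Y i (push Y f i)) (e0 # l) (d i x)"
  unfolding push.simps contr_def
 proof (rule lam_cong[OF sec Y good_E_bilinear[OF bPn Y F' c] hdelm_E_bilinear[OF sec Y F c] _ dx])
  show "push Y (hdel A (pp Y) f) i ((e0 # l) @ [e]) y = Dl Y i (push Y f i) ((e0 # l) @ [e]) y"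
   if "e \<in> carrier A" "y \<in> carrier (P i)" for e y
   unfolding append_Cons by (rule Suc(1)) (use that Suc(2,3) in simp_all)
 qed
 also have "\<dots> = Dl Y i (contr (h i) Y (push Y f i)) (e0 # l) (d i x) \<oplus> sg Y (length l) (push Y f i (e0 # l) (d i x))"
  by (rule contr_hdelm_Cons[OF sec Y F Suc(2,3) dx])
 also have "push Y f i (e0 # l) (d i x) = \<zero>" by (rule push_d[OF f c Suc(4)])
 also have "Dl Y i (contr (h i) Y (push Y f i)) (e0 # l) (d i x) = Dl Y (Suc i) (push Y f (Suc i)) (e0 # l) x"
  unfolding push.simps by (rule hdelm_precomp[OF bPn Y d_bimod xP c, symmetric])
 also have "\<dots> \<oplus> sg Y (length l) \<zero> = \<dots>"
 proof -
  note G = push_good[OF f, of "Suc i"]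
  have "Dl Y (Suc i) (push Y f (Suc i)) (e0 # l) x \<in> carrier Y"
   unfolding hdelm.simps
   by (rule Y.N.M.minus_closed[OF Y.lact_closed[OF Suc(2) good_closed[OF G Suc(3) xP]] hDm_closed[OF bPn Y G Suc(2,3) xP]])
  then show ?thesis unfolding Y.N.M.sg_zero by (rule Y.N.M.r_zero)
 qed
 finally show ?case .
qed

text \<open>
 When no letter is left, the defect of the contraction in degree zero survives.
\<close>

lemma push_Suc_hdel:
 assumes f: "multilinear k A Y f" and x: "x \<in> carrier (P (Suc i))"
 shows "push Y (hdel A (pp Y) f) (Suc i) [] x = tlam (h i) Y (push Y f i []) (d i x)"
proof -
 note F = push_good[OF f, of i] and F' = push_good[OF hdel_multilinear_Y[OF f], of i]
 have dx: "d i x \<in> carrier (P i)" by (rule d_closed[OF x])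
 have dx': "d i x \<in> carrier (Pn i)" using dx by simp
 have "push Y (hdel A (pp Y) f) (Suc i) [] x = contr (h i) Y (Dl Y i (push Y f i)) [] (d i x)"
  unfolding push.simps contr_def
 proof (rule lam_cong[OF sec Y good_E_bilinear[OF bPn Y F' lists.Nil] hdelm_E_bilinear[OF sec Y F lists.Nil] _ dx])
  show "push Y (hdel A (pp Y) f) i ([] @ [e]) y = Dl Y i (push Y f i) ([] @ [e]) y"
   if "e \<in> carrier A" "y \<in> carrier (P i)" for e y
   unfolding append_Nil by (rule push_hdel[OF f]) (use that in simp_all)
 qed
 also have "\<dots> = tlam (h i) Y (push Y f i []) (d i x) \<ominus> push Y f i [] (d i x)"
  by (rule contr_hdelm_Nil[OF sec Y F dx])
 also have "push Y f i [] (d i x) = \<zero>" by (rule push_d[OF f _ x]) simp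
 also have "tlam (h i) Y (push Y f i []) (d i x) \<ominus> \<zero> = tlam (h i) Y (push Y f i []) (d i x)"
 proof (rule Y.N.M.minus_zero_right)
  have "tlam (h i) Y (push Y f i []) \<in> bimod_hom k A B (Pn i) Y"
   using tlam_bimod_hom[OF sec Y goodD(1)[OF F lists.Nil]] by (simp add: tlam_def[abs_def])
  from k_hom_closed[OF bimod_homK[OF this] dx']
  show "tlam (h i) Y (push Y f i []) (d i x) \<in> carrier Y" .
 qed
 finally show ?thesis .
qed

lemma push_cong:
 assumes f: "multilinear k A Y f" and g: "multilinear k A Y g"
 shows "(\<And>m. m \<in> As \<Longrightarrow> length m = length l + i \<Longrightarrow> f m = g m) \<Longrightarrow> l \<in> As \<Longrightarrow> x \<in> carrier (P i) \<Longrightarrow> push Y f i l x = push Y g i l x"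
proof (induct i arbitrary: l x)
 case 0
 then show ?case by simp
next
 case (Suc i)
 show ?case unfolding push.simps contr_def
 proof (rule lam_cong[OF sec Y good_E_bilinear[OF bPn Y push_good[OF f] Suc(3)] good_E_bilinear[OF bPn Y push_good[OF g] Suc(3)] _ d_closed[OF Suc(4)]])
  show "push Y f i (l @ [e]) y = push Y g i (l @ [e]) y" if "e \<in> carrier A" "y \<in> carrier (P i)" for e y
   by (rule Suc(1), rule Suc(2)) (use that Suc(3) in simp_all)
 qed
qed

lemma zero_E_bilinear: "E_bilinear (Pn i) Y (\<lambda>e y. \<zero>)"
 by (intro E_bilinearI right_homI k_hom_const_zero moY)
  (simp add: k_hom_zero[OF moY moY bilinear_k_hom_right[OF bimodule_ract_bilinear[OF Y]]])

lemma push_zero: "l \<in> As \<Longrightarrow> x \<in> carrier (P i) \<Longrightarrow> push Y (\<lambda>l. \<zero>) i l x = \<zero>"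
proof (induct i arbitrary: l x)
 case 0
 then show ?case using k_hom_zero[OF moY moY bilinear_k_hom_right[OF bimodule_ract_bilinear[OF Y] eps_closed]] by simp
next
 case (Suc i)
 note F = push_good[OF multilinear_const_zero[OF moY], of i]
 have "push Y (\<lambda>l. \<zero>) (Suc i) l x = lam (h i) Y (\<lambda>e y. \<zero>) (d i x)"
  unfolding push.simps contr_def
 proof (rule lam_cong[OF sec Y good_E_bilinear[OF bPn Y F Suc(2)] zero_E_bilinear _ d_closed[OF Suc(3)]])
  show "push Y (\<lambda>l. \<zero>) i (l @ [e]) y = \<zero>" if "e \<in> carrier A" "y \<in> carrier (P i)" for e y
   by (rule Suc(1)) (use that Suc(2) in simp_all)
 qed
 also have "\<dots> = \<zero>" by (rule lam_zero[OF sec Y d_closed[OF Suc(3)]])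
 finally show ?case .
qed

lemma tlam_hom: "\<phi> \<in> right_hom (Pn n) Y \<Longrightarrow> tlam (h n) Y \<phi> \<in> bimod_hom k A B (Pn n) Y"
 using tlam_bimod_hom[OF sec Y] by (simp add: tlam_def[abs_def])

lemma tlam_fix: "\<phi> \<in> bimod_hom k A B (Pn n) Y \<Longrightarrow> x \<in> carrier (P n) \<Longrightarrow> tlam (h n) Y \<phi> x = \<phi> x"
 using tlam_id[OF sec Y] by (simp add: tlam_def)

lemma tlam_cong:
 assumes \<phi>: "\<phi> \<in> right_hom (Pn n) Y" and \<psi>: "\<psi> \<in> right_hom (Pn n) Y"
  and eq: "\<And>y. y \<in> carrier (P n) \<Longrightarrow> \<phi> y = \<psi> y" and x: "x \<in> carrier (P n)"
 shows "tlam (h n) Y \<phi> x = tlam (h n) Y \<psi> x"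
 unfolding tlam_def
 by (rule lam_cong[OF sec Y E_bilinear_lact[OF sec Y \<phi>] E_bilinear_lact[OF sec Y \<psi>] _ x]) (simp add: eq)

definition "cup q F v l = F (take q l) (v (drop q l))"

lemma take_drop_As: "l \<in> As \<Longrightarrow> take q l \<in> As" "l \<in> As \<Longrightarrow> drop q l \<in> As"
 by (meson in_lists_conv_set in_set_takeD, meson in_lists_conv_set in_set_dropD)

lemma cup_closed:
 assumes F: "good (Pn i) Y F" and v: "\<And>m. m \<in> As \<Longrightarrow> v m \<in> carrier (P i)" and l: "l \<in> As"
 shows "cup q F v l \<in> carrier Y"
 unfolding cup_def by (rule good_closed[OF F take_drop_As(1)[OF l]]) (use v take_drop_As(2)[OF l] in simp)

lemma cup_multilinear:
 assumes F: "good (Pn i) Y F" and v: "multilinear k A (P i) v"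
 shows "multilinear k A Y (cup q F v)"
proof (rule multilinearI)
 note vc = multilinear_closed[OF v]
 show "cup q F v l \<in> carrier Y" if "l \<in> As" for l by (rule cup_closed[OF F vc that])
 fix l1 l2 assume l: "l1 \<in> As" "l2 \<in> As"
 show "(\<lambda>x. cup q F v (l1 @ x # l2)) \<in> k_hom k A Y"
 proof (cases "q \<le> length l1")
  case True
  then have eq: "cup q F v (l1 @ x # l2) = F (take q l1) (v (drop q l1 @ x # l2))" for x by (simp add: cup_def)
  show ?thesis unfolding eq
   using k_hom_compose[OF multilinear_slot[OF v take_drop_As(2)[OF l(1)] l(2)], of "F (take q l1)" Y]
    right_homD(1)[OF goodD(1)[OF F take_drop_As(1)[OF l(1)]]] by simp
 next
  case False
  then obtain j where q: "q = length l1 + Suc j" by (metis add_Suc_right less_imp_Suc_add not_le)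
  have eq: "cup q F v (l1 @ x # l2) = F (l1 @ x # take j l2) (v (drop j l2))" for x by (simp add: cup_def q)
  show ?thesis unfolding eq
   by (rule multilinear_slot[OF goodD(2)[OF F] l(1) take_drop_As(1)[OF l(2)]]) (use vc take_drop_As(2)[OF l(2)] in simp)
 qed
qed

lemma hD_cup:
 assumes v: "\<And>m. m \<in> As \<Longrightarrow> v m \<in> carrier (P i)"
 shows "\<lbrakk>good (Pn i) Y F; e \<in> carrier A; l \<in> As; q \<le> length l\<rbrakk> \<Longrightarrow>
  hD A (pp Y) (cup q F v) e l = hDm A Y (lact (Pn i)) F e (take q l) (v (drop q l)) \<ominus>
   sg Y q (F (take q (e # l)) (hdel A (pp (Pn i)) v (drop q (e # l))))"
proof (induct q arbitrary: F e l)
 case 0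
 interpret HP: hoch k A "pp (Pn i)" by (rule hoch_pp[OF bPn])
 have v': "v m \<in> carrier (pp (Pn i))" if "m \<in> As" for m using v[OF that] by simp
 have r: "F [] \<in> right_hom (Pn i) Y" by (rule goodD(1)[OF 0(1)]) simp
 note rk = right_homD(1)[OF r]
 have h: "hD A (pp (Pn i)) v e l \<in> carrier (Pn i)" using HP.hD_closed[OF v' 0(2,3)] by simp
 have w: "lact (Pn i) e (v l) \<in> carrier (Pn i)"
  by (rule k_hom_closed[OF bimodule_lact_k_hom[OF bPn 0(2)]]) (use v[OF 0(3)] in simp)
 have 1: "F [] (hD A (pp (Pn i)) v e l) = hD A (pp Y) (\<lambda>m. F [] (v m)) e l"
  by (rule HP.hD_nat[OF bpp[OF Y] _ _ v' 0(2,3)]) (use rk right_homD(2)[OF r] pi_closed in \<open>simp_all del: bim_of_simps\<close>)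
 have a: "F [] (lact (Pn i) e (v l)) \<in> carrier Y" and b: "F [] (hD A (pp (Pn i)) v e l) \<in> carrier Y"
  by (rule k_hom_closed[OF rk w], rule k_hom_closed[OF rk h])
 have 2: "F [] (lact (Pn i) e (v l) \<ominus>\<^bsub>Pn i\<^esub> hD A (pp (Pn i)) v e l) = F [] (lact (Pn i) e (v l)) \<ominus> F [] (hD A (pp (Pn i)) v e l)"
  by (rule k_hom_minus[OF bimodule_module[OF bPn] moY rk w h])
 have sw: "x \<ominus> (x \<ominus> y) = y" if "x \<in> carrier Y" "y \<in> carrier Y" for x y
  using that by (simp add: a_minus_def Y.N.M.minus_add Y.N.M.a_assoc[symmetric] Y.N.M.r_neg)
 have "hD A (pp Y) (cup 0 F v) e l = hD A (pp Y) (\<lambda>m. F [] (v m)) e l" by (simp add: cup_def[abs_def])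
 also have "\<dots> = F [] (lact (Pn i) e (v l)) \<ominus> F [] (lact (Pn i) e (v l) \<ominus>\<^bsub>Pn i\<^esub> hD A (pp (Pn i)) v e l)"
  by (simp only: 2 sw[OF a b] 1[symmetric])
 finally show ?case by (simp add: sg_def del: bim_of_simps)
next
 case (Suc q)
 note F = Suc(2) and e = Suc(3)
 obtain e' l' where l: "l = e' # l'" using Suc(5) by (cases l) auto
 have c: "e' \<in> carrier A" "l' \<in> As" "q \<le> length l'" using Suc(4,5) l by simp_all
 note Fe = good_Cons[OF F e]
 interpret HP: hoch k A "pp (Pn i)" by (rule hoch_pp[OF bPn])
 have v': "v m \<in> carrier (pp (Pn i))" if "m \<in> As" for m using v[OF that] by simp
 have IH: "hD A (pp Y) (cup q (\<lambda>m. F (e # m)) v) e' l' = hDm A Y (lact (Pn i)) (\<lambda>m. F (e # m)) e' (take q l') (v (drop q l')) \<ominus>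
   sg Y q (F (e # take q (e' # l')) (hdel A (pp (Pn i)) v (drop q (e' # l'))))"
  by (rule Suc(1)[OF Fe c])
 let ?a = "F ((e \<otimes>\<^bsub>A\<^esub> e') # take q l') (v (drop q l'))"
 let ?b = "hDm A Y (lact (Pn i)) (\<lambda>m. F (e # m)) e' (take q l') (v (drop q l'))"
 let ?c = "F (e # take q (e' # l')) (hdel A (pp (Pn i)) v (drop q (e' # l')))"
 have vd: "v (drop q l') \<in> carrier (Pn i)" using v[OF take_drop_As(2)[OF c(2)]] by simp
 have a: "?a \<in> carrier Y" by (rule good_closed[OF F _ vd]) (use e c take_drop_As(1)[OF c(2)] in simp)
 have b: "?b \<in> carrier Y" by (rule hDm_closed[OF bPn Y Fe c(1) take_drop_As(1)[OF c(2)] vd])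
 have el: "e' # l' \<in> As" using c by simp
 have hv: "hdel A (pp (Pn i)) v (drop q (e' # l')) \<in> carrier (Pn i)"
  using HP.hdel_closed[OF v' take_drop_As(2)[OF el]] by simp
 have cc: "?c \<in> carrier Y" by (rule good_closed[OF Fe take_drop_As(1)[OF el] hv])
 have sh: "(\<lambda>m. cup (Suc q) F v (e # m)) = cup q (\<lambda>m. F (e # m)) v" by (simp add: cup_def fun_eq_iff)
 have "hD A (pp Y) (cup (Suc q) F v) e l = ?a \<ominus> (?b \<ominus> sg Y q ?c)"
  unfolding l hD.simps sh IH pp_minus by (simp add: cup_def)
 also have "\<dots> = (?a \<ominus> ?b) \<ominus> sg Y (Suc q) ?c"
  using a b cc by (simp add: Y.N.M.minus_minus_assoc Y.N.M.sg_Suc Y.N.M.minus_uminus)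
 finally show ?case unfolding l take_Suc_Cons drop_Suc_Cons hDm.simps .
qed

text \<open>
 Leibniz' rule, for splitting a list after \<open>q\<close> letters.
\<close>

lemma hdel_cup:
 assumes F: "good (Pn i) Y F" and v: "\<And>m. m \<in> As \<Longrightarrow> v m \<in> carrier (P i)" and e: "e \<in> carrier A" and l: "l \<in> As" "q \<le> length l"
 shows "hdel A (pp Y) (cup q F v) (e # l) = Dl Y i F (e # take q l) (v (drop q l)) \<oplus>
   sg Y q (F (take q (e # l)) (hdel A (pp (Pn i)) v (drop q (e # l))))"
proof -
 interpret HP: hoch k A "pp (Pn i)" by (rule hoch_pp[OF bPn])
 have v': "v m \<in> carrier (pp (Pn i))" if "m \<in> As" for m using v[OF that] by simp
 let ?a = "lact Y e (F (take q l) (v (drop q l)))"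
 let ?b = "hDm A Y (lact (Pn i)) F e (take q l) (v (drop q l))"
 let ?c = "F (take q (e # l)) (hdel A (pp (Pn i)) v (drop q (e # l)))"
 have vd: "v (drop q l) \<in> carrier (Pn i)" using v[OF take_drop_As(2)[OF l(1)]] by simp
 have a: "?a \<in> carrier Y" by (rule Y.lact_closed[OF e good_closed[OF F take_drop_As(1)[OF l(1)] vd]])
 have b: "?b \<in> carrier Y" by (rule hDm_closed[OF bPn Y F e take_drop_As(1)[OF l(1)] vd])
 have el: "e # l \<in> As" using e l by simp
 have hv: "hdel A (pp (Pn i)) v (drop q (e # l)) \<in> carrier (Pn i)"
  using HP.hdel_closed[OF v' take_drop_As(2)[OF el]] by simp
 have cc: "?c \<in> carrier Y" by (rule good_closed[OF F take_drop_As(1)[OF el] hv])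
 have H: "hD A (pp Y) (cup q F v) e l = ?b \<ominus> sg Y q ?c" by (rule hD_cup[OF v F e l])
 have "hdel A (pp Y) (cup q F v) (e # l) = ?a \<ominus> (?b \<ominus> sg Y q ?c)"
  unfolding hdel.simps H pp_minus by (simp add: cup_def)
 also have "\<dots> = (?a \<ominus> ?b) \<oplus> sg Y q ?c"
  using a b cc by (simp add: Y.N.M.minus_minus_assoc)
 finally show ?thesis by simp
qed

end

lemma push_nat:
 fixes Y :: "('k, 'a, 'b, 'y) bimod" and Y' :: "('k, 'a, 'b, 'y') bimod"
 assumes Y: "bimodule k A B Y" and Y': "bimodule k A B Y'" and g: "g \<in> bimod_hom k A B Y Y'" and f: "multilinear k A Y f"
 shows "l \<in> As \<Longrightarrow> x \<in> carrier (P i) \<Longrightarrow> g (push Y f i l x) = push Y' (\<lambda>m. g (f m)) i l x"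
proof (induct i arbitrary: l x)
 case 0
 show ?case using right_homD(2)[OF bimod_homD(1)[OF g] multilinear_closed[OF f 0(1)] eps_closed[OF 0(2)]] by simp
next
 case (Suc i)
 have gk: "g \<in> k_hom k Y Y'" by (rule bimod_homK[OF g])
 note gf = multilinear_comp[OF f gk]
 note E = good_E_bilinear[OF bPn Y push_good[OF Y f] Suc(2), of i]
 note N = lam_nat[OF sec Y Y' bimod_homD(1)[OF g] E d_closed[OF Suc(3)]]
 have "g (push Y f (Suc i) l x) = lam (h i) Y' (\<lambda>e y. g (push Y f i (l @ [e]) y)) (d i x)"
  unfolding push.simps contr_def by (rule N(2))
 also have "\<dots> = push Y' (\<lambda>m. g (f m)) (Suc i) l x"
  unfolding push.simps contr_def
  by (rule lam_cong[OF sec Y' N(1) good_E_bilinear[OF bPn Y' push_good[OF Y' gf] Suc(2)] Suc(1) d_closed[OF Suc(3)]])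
   (use Suc(2) in simp_all)
 finally show ?case .
qed

lemma tlam_nat:
 fixes Y :: "('k, 'a, 'b, 'y) bimod" and Y' :: "('k, 'a, 'b, 'y') bimod"
 assumes Y: "bimodule k A B Y" and Y': "bimodule k A B Y'" and g: "g \<in> bimod_hom k A B Y Y'" and \<phi>: "\<phi> \<in> right_hom (Pn n) Y"
  and x: "x \<in> carrier (P n)"
 shows "g (tlam (h n) Y \<phi> x) = tlam (h n) Y' (\<lambda>y. g (\<phi> y)) x"
proof -
 note gr = bimod_homD(1)[OF g]
 note N = lam_nat[OF sec Y Y' gr E_bilinear_lact[OF sec Y \<phi>] x]
 have "g (tlam (h n) Y \<phi> x) = lam (h n) Y' (\<lambda>e y. g (lact Y e (\<phi> y))) x" unfolding tlam_def by (rule N(2))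
 also have "\<dots> = tlam (h n) Y' (\<lambda>y. g (\<phi> y)) x" unfolding tlam_def
 proof (rule lam_cong[OF sec Y' N(1) E_bilinear_lact[OF sec Y' right_hom_comp[OF \<phi> gr]] _ x])
  show "g (lact Y e (\<phi> y)) = lact Y' e (g (\<phi> y))" if "e \<in> carrier A" "y \<in> carrier (P n)" for e y
   by (rule bimod_homD(2)[OF g that(1) k_hom_closed[OF right_homD(1)[OF \<phi>]]]) (use that in simp)
 qed
 finally show ?thesis .
qed

end

section \<open>The comparison endomorphism of the resolution\<close>

context comparison
begin

lemma tav_cong:
 assumes Y: "bimodule k A B Y" and \<phi>: "\<phi> \<in> k_hom k (P n) Y" and \<psi>: "\<psi> \<in> k_hom k (P n) Y"
  and eq: "\<And>y. y \<in> carrier (P n) \<Longrightarrow> \<phi> y = \<psi> y" and x: "x \<in> carrier (P n)"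
 shows "tav (h n) Y \<phi> x = tav (h n) Y \<psi> x"
 unfolding tav_def
 by (rule avg_cong[OF sec bimodule_module[OF Y] tav_bilinear[OF sec Y \<phi>] tav_bilinear[OF sec Y \<psi>] _ x]) (simp add: eq)

lemma tlam_push_Suc:
 fixes Y :: "('k, 'a, 'b, 'y) bimod"
 assumes Y: "bimodule k A B Y" and f: "multilinear k A Y f" and x: "x \<in> carrier (P (Suc i))"
 shows "tlam (h (Suc i)) Y (push Y (hdel A (pp Y) f) (Suc i) []) x = tlam (h i) Y (push Y f i []) (d i x)"
proof -
 let ?g = "\<lambda>x. tlam (h i) Y (push Y f i []) (d i x)"
 have g: "?g \<in> bimod_hom k A B (Pn (Suc i)) Y"
  by (rule bimod_hom_comp[OF d_bimod tlam_hom[OF Y goodD(1)[OF push_good[OF Y f] lists.Nil]]])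
 have "tlam (h (Suc i)) Y (push Y (hdel A (pp Y) f) (Suc i) []) x = tlam (h (Suc i)) Y ?g x"
  by (rule tlam_cong[OF Y goodD(1)[OF push_good[OF Y hdel_multilinear_Y[OF Y f]] lists.Nil] bimod_homD(1)[OF g] push_Suc_hdel[OF Y f] x])
 also have "\<dots> = ?g x" by (rule tlam_fix[OF Y g x])
 finally show ?thesis .
qed

text \<open>
 Pushing the cochains \<open>uc n\<close> themselves gives an endomorphism of the resolution over the identity of \<open>L\<close>,
 hence one which is homotopic to the identity (\<open>eta_props\<close>).
\<close>

definition "theta n = tlam (h n) (Pn n) (push (Pn n) (uc n) n [])"

lemma push_uc_right_hom: "push (Pn n) (uc n) n [] \<in> right_hom (Pn n) (Pn n)"
 by (rule goodD(1)[OF push_good[OF bPn uc_multilinear_b] lists.Nil])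

lemma theta_bimod: "theta n \<in> bimod_hom k A B (Pn n) (Pn n)"
 unfolding theta_def by (rule tlam_hom[OF bPn push_uc_right_hom])

lemma theta_d:
 assumes x: "x \<in> carrier (P (Suc n))"
 shows "d n (theta (Suc n) x) = theta n (d n x)"
proof -
 note pr = push_uc_right_hom[of "Suc n"]
 have dm: "multilinear k A (Pn n) (\<lambda>m. d n (uc (Suc n) m))"
  by (rule multilinear_comp[OF uc_multilinear_b bimod_homK[OF d_bimod]])
 note um = hdel_multilinear_Y[OF bPn uc_multilinear_b]
 have "d n (theta (Suc n) x) = tlam (h (Suc n)) (Pn n) (\<lambda>y. d n (push (Pn (Suc n)) (uc (Suc n)) (Suc n) [] y)) x"
  unfolding theta_def by (rule tlam_nat[OF bPn bPn d_bimod pr x])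
 also have "\<dots> = tlam (h (Suc n)) (Pn n) (push (Pn n) (hdel A (pp (Pn n)) (uc n)) (Suc n) []) x"
 proof (rule tlam_cong[OF bPn right_hom_comp[OF pr bimod_homD(1)[OF d_bimod]] goodD(1)[OF push_good[OF bPn um] lists.Nil] _ x])
  fix y assume y: "y \<in> carrier (P (Suc n))"
  have "d n (push (Pn (Suc n)) (uc (Suc n)) (Suc n) [] y) = push (Pn n) (\<lambda>m. d n (uc (Suc n) m)) (Suc n) [] y"
   by (rule push_nat[OF bPn bPn d_bimod uc_multilinear_b lists.Nil y])
  also have "\<dots> = push (Pn n) (hdel A (pp (Pn n)) (uc n)) (Suc n) [] y"
   by (rule push_cong[OF bPn dm um _ lists.Nil y]) (rule uc_d)
  finally show "d n (push (Pn (Suc n)) (uc (Suc n)) (Suc n) [] y) = push (Pn n) (hdel A (pp (Pn n)) (uc n)) (Suc n) [] y" .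
 qed
 also have "\<dots> = theta n (d n x)" unfolding theta_def by (rule tlam_push_Suc[OF bPn uc_multilinear_b x])
 finally show ?thesis .
qed

lemma theta_eps:
 assumes x: "x \<in> carrier (P 0)" shows "\<epsilon> (theta 0 x) = \<epsilon> x"
proof -
 note pr = push_uc_right_hom[of 0]
 have s1: "\<sigma> \<one>\<^bsub>B\<^esub> \<in> carrier (P 0)" by (rule k_hom_closed[OF sigma_hom]) simp
 have "\<epsilon> (theta 0 x) = tlam (h 0) L (\<lambda>y. \<epsilon> (push (Pn 0) (uc 0) 0 [] y)) x"
  unfolding theta_def by (rule tlam_nat[OF bPn bL eps_bimod pr x])
 also have "\<dots> = tlam (h 0) L \<epsilon> x"
 proof (rule tlam_cong[OF bL right_hom_comp[OF pr bimod_homD(1)[OF eps_bimod]] bimod_homD(1)[OF eps_bimod] _ x])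
  fix y assume y: "y \<in> carrier (P 0)"
  have s1': "\<sigma> \<one>\<^bsub>B\<^esub> \<in> carrier (Pn 0)" using s1 by simp
  have "\<epsilon> (ract (Pn 0) (\<sigma> \<one>\<^bsub>B\<^esub>) (\<epsilon> y)) = ract L (\<epsilon> (\<sigma> \<one>\<^bsub>B\<^esub>)) (\<epsilon> y)"
   by (rule right_homD(2)[OF bimod_homD(1)[OF eps_bimod] s1' eps_closed[OF y]])
  also have "\<dots> = \<epsilon> y" using eps_sigma eps_closed[OF y] by simp
  finally show "\<epsilon> (push (Pn 0) (uc 0) 0 [] y) = \<epsilon> y" by (simp del: bim_of_simps)
 qed
 also have "\<dots> = \<epsilon> x" by (rule tlam_fix[OF bL eps_bimod x])
 finally show ?thesis .
qed

text \<open>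
 Averaging the \<open>k\<close>-linear lift \<open>s \<circ> \<rho>\<close> keeps it a lift of \<open>\<rho>\<close>, because \<open>tav\<close> is natural and fixes \<open>\<rho>\<close>.
\<close>

lemma lift_homotopy:
 assumes \<rho>: "\<rho> \<in> bimod_hom k A B (Pn n) (Pn n)" and ds: "\<And>x. x \<in> carrier (P n) \<Longrightarrow> d n (s n (\<rho> x)) = \<rho> x"
 shows "tav (h n) (Pn (Suc n)) (\<lambda>x. s n (\<rho> x)) \<in> bimod_hom k A B (Pn n) (Pn (Suc n))"
  and "x \<in> carrier (P n) \<Longrightarrow> d n (tav (h n) (Pn (Suc n)) (\<lambda>x. s n (\<rho> x)) x) = \<rho> x"
proof -
 have rk: "\<rho> \<in> k_hom k (P n) (P n)" using bimod_homK[OF \<rho>] by simp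
 have sr: "(\<lambda>x. s n (\<rho> x)) \<in> k_hom k (P n) (Pn (Suc n))" using k_hom_compose[OF rk s_hom] by simp
 show "tav (h n) (Pn (Suc n)) (\<lambda>x. s n (\<rho> x)) \<in> bimod_hom k A B (Pn n) (Pn (Suc n))"
  by (rule tav_bimod_hom[OF sec bPn sr])
 assume x: "x \<in> carrier (P n)"
 have "d n (tav (h n) (Pn (Suc n)) (\<lambda>x. s n (\<rho> x)) x) = tav (h n) (Pn n) (\<lambda>x. d n (s n (\<rho> x))) x"
  by (rule tav_nat[OF sec bPn bPn d_bimod sr x])
 also have "\<dots> = tav (h n) (Pn n) \<rho> x"
  by (rule tav_cong[OF bPn _ _ ds x]) (use k_hom_compose[OF k_hom_compose[OF rk s_hom] d_hom] rk in simp_all)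
 also have "\<dots> = \<rho> x" by (rule tav_id[OF sec bPn \<rho> x])
 finally show "d n (tav (h n) (Pn (Suc n)) (\<lambda>x. s n (\<rho> x)) x) = \<rho> x" .
qed

text \<open>
 The usual recursive construction of a homotopy from \<open>theta\<close> to the identity.
\<close>

primrec eta :: "nat \<Rightarrow> 'p \<Rightarrow> 'p" where
 "eta 0 = tav (h 0) (Pn (Suc 0)) (\<lambda>x. s 0 (x \<ominus>\<^bsub>Pn 0\<^esub> theta 0 x))"
| "eta (Suc n) = tav (h (Suc n)) (Pn (Suc (Suc n))) (\<lambda>x. s (Suc n) ((x \<ominus>\<^bsub>Pn (Suc n)\<^esub> theta (Suc n) x) \<ominus>\<^bsub>Pn (Suc n)\<^esub> eta n (d n x)))"

lemma id_bimod: "bimodule k A B Y \<Longrightarrow> (\<lambda>x. x) \<in> bimod_hom k A B Y Y"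
 by (intro bimod_homI right_homI k_hom_id refl)

lemma id_theta: "(\<lambda>x. x \<ominus>\<^bsub>Pn n\<^esub> theta n x) \<in> bimod_hom k A B (Pn n) (Pn n)"
 by (rule bimod_hom_minus[OF bPn id_bimod[OF bPn] theta_bimod])

lemma theta_closed: "x \<in> carrier (P n) \<Longrightarrow> theta n x \<in> carrier (P n)"
 using k_hom_closed[OF bimod_homK[OF theta_bimod], of x n] by simp

lemma eta_props:
 "eta n \<in> bimod_hom k A B (Pn n) (Pn (Suc n)) \<and>
  (\<forall>x\<in>carrier (P n). d n (eta n x) = (case n of 0 \<Rightarrow> x \<ominus>\<^bsub>Pn n\<^esub> theta n x | Suc m \<Rightarrow> (x \<ominus>\<^bsub>Pn n\<^esub> theta n x) \<ominus>\<^bsub>Pn n\<^esub> eta m (d m x))) \<and>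
  (\<forall>x\<in>carrier (P (Suc n)). d n (eta n (d n x)) = d n x \<ominus>\<^bsub>Pn n\<^esub> theta n (d n x))"
proof (induct n)
 case 0
 let ?r = "\<lambda>x. x \<ominus>\<^bsub>Pn 0\<^esub> theta 0 x"
 have ds: "d 0 (s 0 (?r x)) = ?r x" if x: "x \<in> carrier (P 0)" for x
 proof -
  have x': "x \<in> carrier (Pn 0)" "theta 0 x \<in> carrier (Pn 0)" using x theta_closed[OF x] by simp_all
  have c: "?r x \<in> carrier (P 0)"
   using k_hom_closed[OF bimod_homK[OF id_theta] x'(1)] by simp
  have "\<epsilon> (?r x) = \<epsilon> x \<ominus>\<^bsub>L\<^esub> \<epsilon> (theta 0 x)"
   by (rule k_hom_minus[OF bimodule_module[OF bPn] bimodule_module[OF bL] bimod_homK[OF eps_bimod] x'])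
  also have "\<dots> = \<epsilon> x \<ominus>\<^bsub>B\<^esub> \<epsilon> x" unfolding theta_eps[OF x] by (rule a_minus_transfer) simp_all
  also have "\<dots> = \<zero>\<^bsub>B\<^esub>" using eps_closed[OF x] by (simp add: a_minus_def B.M.r_neg)
  finally have e: "\<epsilon> (?r x) = \<zero>\<^bsub>B\<^esub>" .
  interpret P0: module k "P 0" by (rule mPn)
  have "d 0 (s 0 (?r x)) \<oplus>\<^bsub>P 0\<^esub> \<zero>\<^bsub>P 0\<^esub> = ?r x"
   using htpy_0[OF c] unfolding e k_hom_zero[OF mB mPn sigma_hom] .
  then show ?thesis using d_closed[OF k_hom_closed[OF s_hom c]] by (simp del: bim_of_simps)
 qed
 note H = lift_homotopy[OF id_theta ds]
 show ?case unfolding eta.simps nat.case by (intro conjI ballI H d_closed)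
next
 case (Suc n)
 let ?r = "\<lambda>x. (x \<ominus>\<^bsub>Pn (Suc n)\<^esub> theta (Suc n) x) \<ominus>\<^bsub>Pn (Suc n)\<^esub> eta n (d n x)"
 have eb: "eta n \<in> bimod_hom k A B (Pn n) (Pn (Suc n))" by (rule conjunct1[OF Suc])
 have r: "?r \<in> bimod_hom k A B (Pn (Suc n)) (Pn (Suc n))"
  by (rule bimod_hom_minus[OF bPn id_theta bimod_hom_comp[OF d_bimod eb]])
 note dk = bimod_homK[OF d_bimod[of n]]
 note ek = bimod_homK[OF eb]
 note mm = bimodule_module[OF bPn]
 interpret Q: module k "Pn n" by (rule mm)
 have ds: "d (Suc n) (s (Suc n) (?r x)) = ?r x" if x: "x \<in> carrier (P (Suc n))" for x
 proof -
  have x': "x \<in> carrier (Pn (Suc n))" "theta (Suc n) x \<in> carrier (Pn (Suc n))" using x theta_closed[OF x] by simp_all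
  have y: "d n x \<in> carrier (Pn n)" "theta n (d n x) \<in> carrier (Pn n)" using d_closed[OF x] theta_closed by simp_all
  have ey: "eta n (d n x) \<in> carrier (Pn (Suc n))" by (rule k_hom_closed[OF ek y(1)])
  have xt: "x \<ominus>\<^bsub>Pn (Suc n)\<^esub> theta (Suc n) x \<in> carrier (Pn (Suc n))"
   by (rule k_hom_closed[OF bimod_homK[OF id_theta] x'(1)])
  have c: "?r x \<in> carrier (P (Suc n))" using k_hom_closed[OF bimod_homK[OF r] x'(1)] by simp
  (* the last conjunct of the induction hypothesis: d d = 0 kills the correction term in eta n *)
  have de: "d n (eta n (d n x)) = d n x \<ominus>\<^bsub>Pn n\<^esub> theta n (d n x)"
   using Suc x by blast
  have "d n (?r x) = (d n x \<ominus>\<^bsub>Pn n\<^esub> theta n (d n x)) \<ominus>\<^bsub>Pn n\<^esub> d n (eta n (d n x))"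
   unfolding k_hom_minus[OF mm mm dk xt ey] k_hom_minus[OF mm mm dk x'] theta_d[OF x] ..
  also have "\<dots> = \<zero>\<^bsub>Pn n\<^esub>"
   unfolding de using y Q.minus_closed by (simp add: a_minus_def Q.r_neg del: bim_of_simps)
  finally have e: "d n (?r x) = \<zero>\<^bsub>P n\<^esub>" by simp
  interpret Ps: module k "P (Suc n)" by (rule mPn)
  have "d (Suc n) (s (Suc n) (?r x)) \<oplus>\<^bsub>P (Suc n)\<^esub> \<zero>\<^bsub>P (Suc n)\<^esub> = ?r x"
   using htpy_Suc[OF c] unfolding e k_hom_zero[OF mPn mPn s_hom] .
  then show ?thesis using d_closed[OF k_hom_closed[OF s_hom c]] by (simp del: bim_of_simps)
 qed
 have H1: "eta (Suc n) \<in> bimod_hom k A B (Pn (Suc n)) (Pn (Suc (Suc n)))"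
  unfolding eta.simps by (rule lift_homotopy(1)[OF r]) (rule ds)
 have H2: "d (Suc n) (eta (Suc n) x) = ?r x" if x: "x \<in> carrier (P (Suc n))" for x
  unfolding eta.simps by (rule lift_homotopy(2)[OF r _ x]) (rule ds)
 have z: "(y \<ominus>\<^bsub>Pn (Suc n)\<^esub> theta (Suc n) y) \<ominus>\<^bsub>Pn (Suc n)\<^esub> eta n (d n y) = y \<ominus>\<^bsub>Pn (Suc n)\<^esub> theta (Suc n) y"
  if x: "x \<in> carrier (P (Suc (Suc n)))" and y: "y = d (Suc n) x" for x y
 proof -
  interpret Q': module k "Pn (Suc n)" by (rule mm)
  have "d n y = \<zero>\<^bsub>Pn n\<^esub>" unfolding y using d_d[OF x] by simp
  then have e: "eta n (d n y) = \<zero>\<^bsub>Pn (Suc n)\<^esub>" using k_hom_zero[OF mm mm ek] by simp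
  have "y \<in> carrier (Pn (Suc n))" unfolding y using d_closed[OF x] by simp
  then show ?thesis unfolding e
   by (intro Q'.minus_zero_right k_hom_closed[OF bimod_homK[OF id_theta]])
 qed
 have "d (Suc n) (eta (Suc n) (d (Suc n) x)) = d (Suc n) x \<ominus>\<^bsub>Pn (Suc n)\<^esub> theta (Suc n) (d (Suc n) x)"
  if x: "x \<in> carrier (P (Suc (Suc n)))" for x
  unfolding H2[OF d_closed[OF x]] by (rule z[OF x refl])
 then show ?case unfolding nat.case using H1 H2 by blast
qed

end

section \<open>Relative Ext as cohomology of cochains\<close>

lemma k_hom_sg:
 "\<lbrakk>module k M; module k N; f \<in> k_hom k M N; x \<in> carrier M\<rbrakk> \<Longrightarrow> f (sg M n x) = sg N n (f x)"
 by (simp add: sg_def k_hom_a_inv)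

lemma coch_minus_eval:
 assumes "hoch k C N" "f \<in> carrier (coch k C N n)" "g \<in> carrier (coch k C N n)"
 shows "(f \<ominus>\<^bsub>coch k C N n\<^esub> g) l = f l \<ominus>\<^bsub>N\<^esub> g l"
proof -
 interpret hoch k C N by (rule assms(1))
 show ?thesis by (rule k_hom_minus[OF module_coch[OF mN] mN coch_eval_k_hom assms(2,3)])
qed

context comparison
begin

context
 fixes Y :: "('k, 'a, 'b, 'y) bimod" (structure)
 assumes Y: "bimodule k A B Y"
begin

interpretation Y: bimodule k A B Y by (rule Y)
interpretation HY: hoch k A "pp Y" by (rule hoch_pp[OF Y])

abbreviation "CY \<equiv> coch k A (pp Y)"
abbreviation "dY \<equiv> coch_d A (pp Y)"
abbreviation "HK n \<equiv> hom_module k R (P n) (bimod_as_left k Y)"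
abbreviation "hd' n f \<equiv> compose (carrier (P (Suc n))) f (d n)"

lemma HK_iff: "g \<in> carrier (HK n) \<longleftrightarrow> g \<in> bimod_hom k A B (Pn n) Y \<and> g \<in> extensional (carrier (P n))"
 by (simp add: lmod_hom_bim_of[OF sec Y])

lemma mY': "module k (bimod_as_left k Y)"
 by (rule module_transfer[OF moY[OF Y]]) simp_all

lemma lP_closed: "\<lbrakk>r \<in> carrier R; x \<in> carrier (P n)\<rbrakk> \<Longrightarrow> lact (P n) r x \<in> carrier (P n)"
 by (rule left_module.lact_closed[OF lPn])

lemma HK_mod: "module k (HK n)"
proof (rule module_hom_module[OF mPn mY' lP_closed])
 show "lact (bimod_as_left k Y) r \<in> k_hom k (bimod_as_left k Y) (bimod_as_left k Y)" if "r \<in> carrier R" for r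
  using as_left_lact_k_hom2[OF Y, of r] that by simp
qed

lemma restrict_HK:
 assumes "g \<in> bimod_hom k A B (Pn n) Y" shows "restrict g (carrier (P n)) \<in> carrier (HK n)"
 unfolding HK_iff by (rule conjI[OF bimod_hom_cong[OF assms bPn]]) simp_all

lemma hd'_closed: "g \<in> carrier (HK n) \<Longrightarrow> hd' n g \<in> carrier (HK (Suc n))"
 using restrict_HK[OF bimod_hom_comp[OF d_bimod], of g n] unfolding HK_iff compose_def by simp

lemma HK_hom: "g \<in> carrier (HK n) \<Longrightarrow> g \<in> k_hom k (P n) Y"
 unfolding HK_iff using right_homD(1)[OF bimod_homD(1)] by fastforce

lemma HK_cx: "cx k HK hd'"
proof (rule cx.intro)
 show "module k (HK n)" for n by (rule HK_mod)
 show "hd' n \<in> k_hom k (HK n) (HK (Suc n))" for n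
  by (rule k_homI[OF hd'_closed]) (simp_all add: compose_def fun_eq_iff d_closed)
 fix n g assume g: "g \<in> carrier (HK n)"
 have "g (d n (d (Suc n) x)) = \<zero>" if "x \<in> carrier (P (Suc (Suc n)))" for x
  unfolding d_d[OF that] by (rule k_hom_zero[OF mPn moY[OF Y] HK_hom[OF g]])
 then show "hd' (Suc n) (hd' n g) = \<zero>\<^bsub>HK (Suc (Suc n))\<^esub>"
  by (auto simp add: compose_def fun_eq_iff d_closed)
qed

definition "ev n g = trunc A (pp Y) n (\<lambda>l. g (uc n l))"

lemma gens_As: "l \<in> power_gens A n \<Longrightarrow> l \<in> As" "l \<in> power_gens A n \<Longrightarrow> length l = n"
 by (auto simp add: power_gens_def lists_eq_set)

lemma HK_uc_multilinear: "g \<in> carrier (HK n) \<Longrightarrow> multilinear k A Y (\<lambda>l. g (uc n l))"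
 by (rule multilinear_comp[OF uc_multilinear HK_hom])

lemma ev_closed: "g \<in> carrier (HK n) \<Longrightarrow> ev n g \<in> carrier (CY n)"
 unfolding ev_def by (rule trunc_coch[OF HY.mC HY.mN]) (simp add: HK_uc_multilinear)

lemma ev_gen: "l \<in> power_gens A n \<Longrightarrow> ev n g l = g (uc n l)"
 by (simp add: ev_def trunc_def)

lemma hdel_ev:
 assumes g: "g \<in> carrier (HK n)" and l: "l \<in> As"
 shows "hdel A (pp Y) (\<lambda>m. g (uc n m)) l = g (d n (uc (Suc n) l))"
proof -
 have gb: "g \<in> bimod_hom k A B (Pn n) Y" using g HK_iff by blast
 have "g (hdel A (pp (Pn n)) (uc n) l) = hdel A (pp Y) (\<lambda>m. g (uc n m)) l"
  by (rule hdel_bimod_nat[OF bPn Y gb _ l]) (use uc_closed in simp)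
 then show ?thesis unfolding uc_d[OF l] by simp
qed

lemma ev_chain: "chain_map k HK hd' CY dY ev"
proof (intro chain_map.intro chain_map_axioms.intro HK_cx HY.coch_cx)
 show "ev n \<in> k_hom k (HK n) (CY n)" for n
 proof (rule k_homI[OF ev_closed])
  show "ev n (f \<oplus>\<^bsub>HK n\<^esub> g) = ev n f \<oplus>\<^bsub>CY n\<^esub> ev n g" for f g
   using uc_closed gens_As(1) k_hom_zero[OF moY[OF Y] moY[OF Y] k_hom_id]
   by (auto simp add: ev_def trunc_def fun_eq_iff)
  show "ev n (c \<odot>\<^bsub>HK n\<^esub> g) = c \<odot>\<^bsub>CY n\<^esub> ev n g" if "c \<in> carrier k" for c g
   using uc_closed gens_As(1) that by (auto simp add: ev_def trunc_def fun_eq_iff Y.N.smult_r_null)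
 qed
 fix n g assume g: "g \<in> carrier (HK n)"
 show "ev (Suc n) (hd' n g) = dY n (ev n g)"
 proof (rule coch_eqI[OF ev_closed[OF hd'_closed[OF g]] k_hom_closed[OF HY.coch_d_k_hom ev_closed[OF g]]])
  fix l assume l: "l \<in> power_gens A (Suc n)"
  note la = gens_As[OF l]
  have "dY n (ev n g) l = hdel A (pp Y) (ev n g) l" by (rule HY.hdel_eq_coch_d[OF ev_closed[OF g] la(1), symmetric])
  also have "\<dots> = hdel A (pp Y) (\<lambda>m. g (uc n m)) l"
   by (rule HY.hdel_cong[OF ev_gen la(1)]) (use la in \<open>simp add: power_gens_def lists_eq_set\<close>)
  also have "\<dots> = g (d n (uc (Suc n) l))" by (rule hdel_ev[OF g la(1)])
  finally show "ev (Suc n) (hd' n g) l = dY n (ev n g) l"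
   unfolding ev_gen[OF l] using uc_closed[OF la(1), of "Suc n"] by (simp add: compose_def del: uc.simps)
 qed
qed

context
 fixes f n
 assumes fc: "f \<in> carrier (cyc CY dY n)"
begin

lemma f_coch: "f \<in> carrier (CY n)" and f_multilinear: "multilinear k A Y f"
 using fc coch_multilinear[of f k A "pp Y" n] by (simp_all add: cyc_carrier)

lemma f_cocycle: "l \<in> As \<Longrightarrow> hdel A (pp Y) f l = \<zero>"
 using HY.hdel_eq_coch_d[OF f_coch, of l] fc by (simp add: cyc_carrier)

lemma push_cocycle:
 assumes "e0 \<in> carrier A" "l \<in> As" "x \<in> carrier (P i)"
 shows "Dl Y i (push Y f i) (e0 # l) x = \<zero>"
proof -
 have el: "e0 # l \<in> As" using assms by simp
 have "Dl Y i (push Y f i) (e0 # l) x = push Y (hdel A (pp Y) f) i (e0 # l) x"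
  by (rule push_hdel[OF Y f_multilinear assms, symmetric])
 also have "\<dots> = push Y (\<lambda>l. \<zero>) i (e0 # l) x"
  by (rule push_cong[OF Y hdel_multilinear_Y[OF Y f_multilinear] multilinear_const_zero[OF moY[OF Y]] f_cocycle el assms(3)])
 also have "\<dots> = \<zero>" by (rule push_zero[OF Y el assms(3)])
 finally show ?thesis .
qed

abbreviation "GG i \<equiv> contr (h i) Y (push Y f i)"

lemma good_GG: "good (Pn i) Y (GG i)" by (rule contr_good[OF sec Y push_good[OF Y f_multilinear]])

lemma Dl_GG:
 assumes e0: "e0 \<in> carrier A" and l: "l \<in> As" and x: "x \<in> carrier (P i)"
 shows "Dl Y i (GG i) (e0 # l) x = \<ominus> sg Y (length l) (push Y f i (e0 # l) x)"
proof -
 note F = push_good[OF Y f_multilinear, of i]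
 have el: "e0 # l \<in> As" using e0 l by simp
 have x': "x \<in> carrier (Pn i)" using x by simp
 have "contr (h i) Y (Dl Y i (push Y f i)) (e0 # l) x = lam (h i) Y (\<lambda>e y. \<zero>) x"
  unfolding contr_def
 proof (rule lam_cong[OF sec Y hdelm_E_bilinear[OF sec Y F el] zero_E_bilinear[OF Y] _ x])
  show "Dl Y i (push Y f i) ((e0 # l) @ [e]) y = \<zero>" if "e \<in> carrier A" "y \<in> carrier (P i)" for e y
   unfolding append_Cons by (rule push_cocycle) (use that e0 l in simp_all)
 qed
 also have "\<dots> = \<zero>" by (rule lam_zero[OF sec Y x])
 finally have z: "Dl Y i (GG i) (e0 # l) x \<oplus> sg Y (length l) (push Y f i (e0 # l) x) = \<zero>"
  unfolding contr_hdelm_Cons[OF sec Y F e0 l x] .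
 have a: "Dl Y i (GG i) (e0 # l) x \<in> carrier Y"
  unfolding hdelm.simps
  by (rule Y.N.M.minus_closed[OF Y.lact_closed[OF e0 good_closed[OF good_GG l x']] hDm_closed[OF bPn Y good_GG e0 l x']])
 have b: "sg Y (length l) (push Y f i (e0 # l) x) \<in> carrier Y" by (rule Y.N.M.sg_closed[OF good_closed[OF F el x']])
 show ?thesis by (rule Y.N.M.minus_equality[OF z b a, symmetric])
qed

lemma hdel_cup_GG:
 assumes w: "w \<in> As" "length w = Suc n'" and q: "q \<le> n'"
 shows "hdel A (pp Y) (cup q (GG i) (uc i)) w =
   sg Y q (cup q (push Y f (Suc i)) (uc (Suc i)) w \<ominus> cup (Suc q) (push Y f i) (uc i) w)"
proof -
 obtain e l where wl: "w = e # l" using w(2) by (cases w) auto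
 have c: "e \<in> carrier A" "l \<in> As" "q \<le> length l" using w q wl by simp_all
 have tq: "take q l \<in> As" "drop q l \<in> As" "take q w \<in> As" "drop q w \<in> As" using take_drop_As[OF Y, of l] take_drop_As[OF Y, of w] c w by auto
 have uq: "uc i (drop q l) \<in> carrier (P i)" by (rule uc_closed[OF tq(2)])
 have cl1: "cup q (push Y f (Suc i)) (uc (Suc i)) w \<in> carrier Y"
  by (rule cup_closed[OF Y push_good[OF Y f_multilinear] uc_closed w(1)])
 have cl2: "cup (Suc q) (push Y f i) (uc i) w \<in> carrier Y"
  by (rule cup_closed[OF Y push_good[OF Y f_multilinear] uc_closed w(1)])
 have 1: "Dl Y i (GG i) (e # take q l) (uc i (drop q l)) = \<ominus> sg Y q (cup (Suc q) (push Y f i) (uc i) w)"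
  unfolding Dl_GG[OF c(1) tq(1) uq] using c(3) by (simp add: cup_def[OF Y] wl)
 have 2: "GG i (take q w) (hdel A (pp (Pn i)) (uc i) (drop q w)) = cup q (push Y f (Suc i)) (uc (Suc i)) w"
  unfolding uc_d[OF tq(4), symmetric] by (simp add: cup_def[OF Y])
 have "hdel A (pp Y) (cup q (GG i) (uc i)) w =
   \<ominus> sg Y q (cup (Suc q) (push Y f i) (uc i) w) \<oplus> sg Y q (cup q (push Y f (Suc i)) (uc (Suc i)) w)"
  using hdel_cup[OF Y good_GG _ c, of "uc i" i] uc_closed unfolding 1 wl[symmetric] 2 by blast
 then show ?thesis using cl1 cl2
  by (simp add: sg_def a_minus_def Y.N.M.a_comm Y.N.M.minus_add)
qed

text \<open>
 The products \<open>c\<^sub>i\<close> of \<open>push Y f i\<close> with \<open>uc i\<close> interpolate between \<open>c\<^sub>0 = f\<close> and \<open>c\<^sub>n\<close>, the image of the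
 pushed cocycle. By \<open>hdel_cup_GG\<close> consecutive ones differ by the coboundary of the product of the contraction of
 \<open>push Y f i\<close> with \<open>uc i\<close>.
\<close>

lemma push_telescope:
 assumes n: "n = Suc m"
 shows "i \<le> n \<Longrightarrow> \<exists>g\<in>carrier (CY m). \<forall>l\<in>power_gens A n. f l \<ominus> cup (n - i) (push Y f i) (uc i) l = hdel A (pp Y) g l"
proof (induct i)
 case 0
 (* the product with uc 0 restores f, since uc 0 [] lifts the unit of B *)
 have s1: "ract Y (f l) (\<epsilon> (\<sigma> \<one>\<^bsub>B\<^esub>)) = f l" if "l \<in> As" for l
  using eps_sigma[of "\<one>\<^bsub>B\<^esub>"] Y.ract_one[OF multilinear_closed[OF f_multilinear that]] by simp
 show ?case
 proof (intro bexI ballI)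
  show z: "\<zero>\<^bsub>CY m\<^esub> \<in> carrier (CY m)" by (rule abelian_groupE(2)[OF module.axioms(2)[OF module_coch[OF HY.mN]]])
  fix l assume l: "l \<in> power_gens A n"
  note la = gens_As[OF l]
  have "hdel A (pp Y) \<zero>\<^bsub>CY m\<^esub> l = dY m \<zero>\<^bsub>CY m\<^esub> l" by (rule HY.hdel_eq_coch_d[OF z la(1)])
  also have "\<dots> = \<zero>"
   unfolding k_hom_zero[OF module_coch[OF HY.mN] module_coch[OF HY.mN] HY.coch_d_k_hom] by simp
  finally show "f l \<ominus> cup (n - 0) (push Y f 0) (uc 0) l = hdel A (pp Y) \<zero>\<^bsub>CY m\<^esub> l"
   using la multilinear_closed[OF f_multilinear la(1)] s1[OF la(1)] by (simp add: cup_def[OF Y] a_minus_def Y.N.M.r_neg)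
 qed
next
 case (Suc i)
 define q where "q = n - Suc i"
 have q: "n - i = Suc q" "q \<le> m" using Suc(2) n by (simp_all add: q_def)
 obtain g where g: "g \<in> carrier (CY m)"
  and ge: "\<And>l. l \<in> power_gens A n \<Longrightarrow> f l \<ominus> cup (Suc q) (push Y f i) (uc i) l = hdel A (pp Y) g l"
  using Suc q(1) by auto
 let ?c = "cup q (GG i) (uc i)"
 have cm: "multilinear k A Y ?c" by (rule cup_multilinear[OF Y good_GG uc_multilinear])
 let ?t = "trunc A (pp Y) m ?c"
 have t: "?t \<in> carrier (CY m)" by (rule trunc_coch[OF HY.mC HY.mN]) (use cm in simp)
 note mC' = module_coch[OF HY.mN, of A]
 interpret C: module k "CY m" by (rule mC')
 have st: "sg (CY m) q ?t \<in> carrier (CY m)" by (rule C.sg_closed[OF t])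
 have gt: "g \<ominus>\<^bsub>CY m\<^esub> sg (CY m) q ?t \<in> carrier (CY m)" by (rule C.minus_closed[OF g st])
 show ?case unfolding q_def[symmetric]
 proof (intro bexI[OF _ gt] ballI)
  fix l assume l: "l \<in> power_gens A n"
  note la = gens_As[OF l]
  have ln: "length l = Suc m" using la(2) n by simp
  have lin: "(\<lambda>v. dY m v l) \<in> k_hom k (CY m) (pp Y)" by (rule k_hom_compose[OF HY.coch_d_k_hom HY.coch_eval_k_hom])
  have td: "dY m ?t l = hdel A (pp Y) ?c l"
   unfolding HY.hdel_eq_coch_d[OF t la(1), symmetric]
   by (rule HY.hdel_cong[OF _ la(1)]) (use ln in \<open>simp add: trunc_def power_gens_def lists_eq_set\<close>)
  have "hdel A (pp Y) (g \<ominus>\<^bsub>CY m\<^esub> sg (CY m) q ?t) l = dY m g l \<ominus>\<^bsub>pp Y\<^esub> sg (pp Y) q (dY m ?t l)"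
   unfolding HY.hdel_eq_coch_d[OF gt la(1)] k_hom_minus[OF mC' HY.mN lin g st] k_hom_sg[OF mC' HY.mN lin t] ..
  also have "\<dots> = (f l \<ominus> cup (Suc q) (push Y f i) (uc i) l) \<ominus>
    sg Y q (sg Y q (cup q (push Y f (Suc i)) (uc (Suc i)) l \<ominus> cup (Suc q) (push Y f i) (uc i) l))"
   unfolding HY.hdel_eq_coch_d[OF g la(1), symmetric] ge[OF l, symmetric] td hdel_cup_GG[OF la(1) ln q(2)]
   by (simp add: sg_def a_inv_transfer[of "pp Y" Y])
  also have "\<dots> = f l \<ominus> cup q (push Y f (Suc i)) (uc (Suc i)) l"
  proof -
   have a: "f l \<in> carrier Y" by (rule multilinear_closed[OF f_multilinear la(1)])
   have b: "cup q (push Y f (Suc i)) (uc (Suc i)) l \<in> carrier Y" "cup (Suc q) (push Y f i) (uc i) l \<in> carrier Y"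
    by (rule cup_closed[OF Y push_good[OF Y f_multilinear] _ la(1)], erule uc_closed)+
   have ss: "sg Y q (sg Y q x) = x" if "x \<in> carrier Y" for x using that by (simp add: sg_def)
   show ?thesis unfolding ss[OF Y.N.M.minus_closed[OF b]] by (rule Y.N.M.minus_minus_cancel[OF a b(2) b(1)])
  qed
  finally show "f l \<ominus> cup q (push Y f (Suc i)) (uc (Suc i)) l = hdel A (pp Y) (g \<ominus>\<^bsub>CY m\<^esub> sg (CY m) q ?t) l" by simp
 qed
qed

lemma push_bimod_hom: "push Y f n [] \<in> bimod_hom k A B (Pn n) Y"
proof (rule bimod_homI)
 note F = push_good[OF Y f_multilinear, of n]
 show "push Y f n [] \<in> right_hom (Pn n) Y" by (rule goodD(1)[OF F lists.Nil])
 fix a x assume a: "a \<in> carrier A" and x: "x \<in> carrier (Pn n)"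
 have x': "x \<in> carrier (P n)" using x by simp
 have ax: "lact (Pn n) a x \<in> carrier (Pn n)" by (rule k_hom_closed[OF bimodule_lact_k_hom[OF bPn a] x])
 have "lact Y a (push Y f n [] x) \<ominus> push Y f n [] (lact (Pn n) a x) = \<zero>"
  using push_cocycle[OF a lists.Nil x'] unfolding hdelm.simps hDm.simps .
 from Y.N.M.minus_eq_zeroD[OF this Y.lact_closed[OF a good_closed[OF F lists.Nil x]] good_closed[OF F lists.Nil ax]]
 show "push Y f n [] (lact (Pn n) a x) = lact Y a (push Y f n [] x)" by (rule sym)
qed

lemma ev_surj: "\<exists>g\<in>carrier (cyc HK hd' n). f \<ominus>\<^bsub>CY n\<^esub> ev n g \<in> bdry CY dY n"
proof
 let ?g = "restrict (push Y f n []) (carrier (P n))"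
 have g: "?g \<in> carrier (HK n)" by (rule restrict_HK[OF push_bimod_hom])
 show "?g \<in> carrier (cyc HK hd' n)"
  using push_d[OF Y f_multilinear lists.Nil] g by (simp add: cyc_carrier compose_def fun_eq_iff d_closed)
 have e: "ev n ?g l = push Y f n [] (uc n l)" if "l \<in> power_gens A n" for l
  using uc_closed[OF gens_As(1)[OF that], of n] by (simp add: ev_gen[OF that])
 note mC' = module_coch[OF HY.mN, of A]
 interpret C: module k "CY n" by (rule mC')
 have fe: "f \<ominus>\<^bsub>CY n\<^esub> ev n ?g \<in> carrier (CY n)" by (rule C.minus_closed[OF f_coch ev_closed[OF g]])
 have fl: "(f \<ominus>\<^bsub>CY n\<^esub> ev n ?g) l = f l \<ominus> cup (n - n) (push Y f n) (uc n) l" if "l \<in> power_gens A n" for l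
  unfolding coch_minus_eval[OF HY.hoch_axioms f_coch ev_closed[OF g]] e[OF that] by (simp add: cup_def[OF Y])
 show "f \<ominus>\<^bsub>CY n\<^esub> ev n ?g \<in> bdry CY dY n"
 proof (cases n)
  case 0
  have "f \<ominus>\<^bsub>CY n\<^esub> ev n ?g = \<zero>\<^bsub>CY n\<^esub>"
  proof (rule coch_eqI[OF fe C.zero_closed])
   fix l assume l: "l \<in> power_gens A n"
   have s1: "ract Y (f []) (\<epsilon> (\<sigma> \<one>\<^bsub>B\<^esub>)) = f []"
    using eps_sigma[of "\<one>\<^bsub>B\<^esub>"] Y.ract_one[OF multilinear_closed[OF f_multilinear lists.Nil]] by simp
   show "(f \<ominus>\<^bsub>CY n\<^esub> ev n ?g) l = \<zero>\<^bsub>CY n\<^esub> l"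
    unfolding fl[OF l] using gens_As(2)[OF l] s1 multilinear_closed[OF f_multilinear lists.Nil]
    by (simp add: 0 cup_def[OF Y] a_minus_def Y.N.M.r_neg)
  qed
  then show ?thesis by (simp add: bdry_def 0)
 next
  case (Suc m)
  obtain gm where gm: "gm \<in> carrier (CY m)"
   and ge: "\<And>l. l \<in> power_gens A n \<Longrightarrow> f l \<ominus> cup (n - n) (push Y f n) (uc n) l = hdel A (pp Y) gm l"
   using push_telescope[OF Suc order_refl] by auto
  have "f \<ominus>\<^bsub>CY n\<^esub> ev n ?g = dY m gm"
  proof (rule coch_eqI[OF fe])
   show "dY m gm \<in> carrier (CY n)" unfolding Suc by (rule k_hom_closed[OF HY.coch_d_k_hom gm])
   fix l assume l: "l \<in> power_gens A n"
   show "(f \<ominus>\<^bsub>CY n\<^esub> ev n ?g) l = dY m gm l"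
    unfolding fl[OF l] ge[OF l] by (rule HY.hdel_eq_coch_d[OF gm gens_As(1)[OF l]])
  qed
  then show ?thesis using gm by (simp add: bdry_def Suc)
 qed
qed

end

text \<open>
 Pushing \<open>g \<circ> uc n\<close> gives \<open>g \<circ> theta n\<close> by naturality. If \<open>g \<circ> uc n\<close> is the coboundary of \<open>f\<close>, then it is also
 a map composed with \<open>d\<close>; the homotopy \<open>eta\<close> then shows the same for \<open>g\<close>, using \<open>g \<circ> d = 0\<close>.
\<close>

lemma ev_inj:
 assumes gc: "g \<in> carrier (cyc HK hd' n)" and b: "ev n g \<in> bdry CY dY n"
 shows "g \<in> bdry HK hd' n"
proof -
 have g: "g \<in> carrier (HK n)" and dg: "hd' n g = \<zero>\<^bsub>HK (Suc n)\<^esub>" using gc by (simp_all add: cyc_carrier)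
 have gb: "g \<in> bimod_hom k A B (Pn n) Y" and ge: "g \<in> extensional (carrier (P n))" using g HK_iff by blast+
 note gk = HK_hom[OF g]
 have gd: "g (d n x) = \<zero>" if "x \<in> carrier (P (Suc n))" for x
  using fun_cong[OF dg, of x] that by (simp add: compose_def)
 note gm = HK_uc_multilinear[OF g]
 note pr = push_uc_right_hom[of n]
 have gt: "g (theta n x) = tlam (h n) Y (\<lambda>y. g (push (Pn n) (uc n) n [] y)) x" if "x \<in> carrier (P n)" for x
  unfolding theta_def by (rule tlam_nat[OF bPn Y gb pr that])
 have gp: "g (push (Pn n) (uc n) n [] y) = push Y (\<lambda>m. g (uc n m)) n [] y" if "y \<in> carrier (P n)" for y
  by (rule push_nat[OF bPn Y gb uc_multilinear_b lists.Nil that])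
 have gt': "g (theta n x) = tlam (h n) Y (push Y f n []) x" if x: "x \<in> carrier (P n)"
  and f: "multilinear k A Y f" "\<And>m. m \<in> power_gens A n \<Longrightarrow> g (uc n m) = f m" for f x
  unfolding gt[OF x]
 proof (rule tlam_cong[OF Y right_hom_comp[OF pr bimod_homD(1)[OF gb]] goodD(1)[OF push_good[OF Y f(1)] lists.Nil] _ x])
  fix y assume y: "y \<in> carrier (P n)"
  show "g (push (Pn n) (uc n) n [] y) = push Y f n [] y"
   unfolding gp[OF y] by (rule push_cong[OF Y gm f(1) _ lists.Nil y], rule f(2)) (simp add: power_gens_def lists_eq_set)
 qed
 show ?thesis
 proof (cases n)
  case 0
  have "ev n g [] = \<zero>" using b by (simp add: bdry_def 0)
  moreover have nil: "[] \<in> power_gens A n" by (simp add: power_gens_def 0)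
  ultimately have u0: "g (uc n []) = \<zero>" unfolding ev_gen[OF nil] by blast
  have g0: "g x = \<zero>" if x: "x \<in> carrier (P n)" for x
  proof -
   have x': "x \<in> carrier (Pn n)" "theta n x \<in> carrier (Pn n)" using x theta_closed[OF x] by simp_all
   note pz = push_good[OF Y multilinear_const_zero[OF moY[OF Y]], of n]
   have "g (theta n x) = tlam (h n) Y (push Y (\<lambda>l. \<zero>) n []) x"
    by (rule gt'[OF x multilinear_const_zero[OF moY[OF Y]]]) (use u0 in \<open>simp add: power_gens_def 0\<close>)
   also have "\<dots> = lam (h n) Y (\<lambda>e y. \<zero>) x" unfolding tlam_def
   proof (rule lam_cong[OF sec Y E_bilinear_lact[OF sec Y goodD(1)[OF pz lists.Nil]] zero_E_bilinear[OF Y] _ x])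
    show "lact Y e (push Y (\<lambda>l. \<zero>) n [] y) = \<zero>" if "e \<in> carrier A" "y \<in> carrier (P n)" for e y
     unfolding push_zero[OF Y lists.Nil that(2)]
     by (rule k_hom_zero[OF moY[OF Y] moY[OF Y] bimodule_lact_k_hom[OF Y that(1)]])
   qed
   also have "\<dots> = \<zero>" by (rule lam_zero[OF sec Y x])
   finally have t: "g (theta n x) = \<zero>" .
   have "x \<ominus>\<^bsub>Pn n\<^esub> theta n x = d n (eta n x)" using eta_props[of n] x 0 by simp
   then have "g (x \<ominus>\<^bsub>Pn n\<^esub> theta n x) = g (d n (eta n x))" by (rule arg_cong)
   also have "\<dots> = \<zero>"
    by (rule gd) (use k_hom_closed[OF bimod_homK[OF conjunct1[OF eta_props]] x'(1)] in simp)
   finally have "g x \<ominus> \<zero> = \<zero>"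
    unfolding k_hom_minus[OF bimodule_module[OF bPn] moY[OF Y] bimod_homK[OF gb] x'] t .
   then show ?thesis unfolding Y.N.M.minus_zero_right[OF k_hom_closed[OF gk x]] .
  qed
  have "g = \<zero>\<^bsub>HK 0\<^esub>" using g0 ge by (auto simp add: fun_eq_iff extensional_def 0)
  then show ?thesis by (simp add: bdry_def 0)
 next
  case (Suc m)
  obtain f where f: "f \<in> carrier (CY m)" and fe: "ev n g = dY m f" using b by (auto simp add: bdry_def Suc)
  have fm: "multilinear k A Y f" using coch_multilinear[OF f] by simp
  let ?\<phi> = "push Y f m []"
  let ?t = "tlam (h m) Y ?\<phi>"
  have tb: "?t \<in> bimod_hom k A B (Pn m) Y" by (rule tlam_hom[OF Y goodD(1)[OF push_good[OF Y fm] lists.Nil]])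
  have eb: "(\<lambda>x. g (eta m x)) \<in> bimod_hom k A B (Pn m) Y"
   by (rule bimod_hom_comp[OF conjunct1[OF eta_props] gb[unfolded Suc]])
  (* written with two differences to remain within the closure properties of bimod_hom *)
  let ?g = "\<lambda>x. ?t x \<ominus> (\<zero> \<ominus> g (eta m x))"
  have zb: "(\<lambda>x. \<zero>) \<in> bimod_hom k A B (Pn m) Y"
   by (intro bimod_homI right_homI k_hom_const_zero moY[OF Y])
    (simp_all add: k_hom_zero[OF moY[OF Y] moY[OF Y] bimodule_lact_k_hom[OF Y]]
     k_hom_zero[OF moY[OF Y] moY[OF Y] bilinear_k_hom_right[OF bimodule_ract_bilinear[OF Y]]])
  have gg: "restrict ?g (carrier (P m)) \<in> carrier (HK m)"
   by (rule restrict_HK[OF bimod_hom_minus[OF Y tb bimod_hom_minus[OF Y zb eb]]])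
  have gx: "g x = ?g (d m x)" if x: "x \<in> carrier (P n)" for x
  proof -
   have x': "x \<in> carrier (Pn n)" "theta n x \<in> carrier (Pn n)" using x theta_closed[OF x] by simp_all
   have xs: "x \<in> carrier (P (Suc m))" using x Suc by simp
   have dx: "d m x \<in> carrier (Pn m)" using d_closed[OF xs] by simp
   have ed: "eta m (d m x) \<in> carrier (Pn n)" unfolding Suc
    by (rule k_hom_closed[OF bimod_homK[OF conjunct1[OF eta_props]] dx])
   have xt: "x \<ominus>\<^bsub>Pn n\<^esub> theta n x \<in> carrier (Pn n)"
    by (rule k_hom_closed[OF bimod_homK[OF id_theta] x'(1)])
   note gk' = bimod_homK[OF gb]
   note mm = bimodule_module[OF bPn] moY[OF Y]
   have "g (theta n x) = tlam (h n) Y (push Y (hdel A (pp Y) f) n []) x"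
   proof (rule gt'[OF x hdel_multilinear_Y[OF Y fm]])
    fix l assume l: "l \<in> power_gens A n"
    show "g (uc n l) = hdel A (pp Y) f l"
     unfolding ev_gen[OF l, symmetric] fe by (rule HY.hdel_eq_coch_d[OF f gens_As(1)[OF l], symmetric])
   qed
   also have "\<dots> = ?t (d m x)" unfolding Suc by (rule tlam_push_Suc[OF Y fm xs])
   finally have t: "g (theta n x) = ?t (d m x)" .
   have "(x \<ominus>\<^bsub>Pn n\<^esub> theta n x) \<ominus>\<^bsub>Pn n\<^esub> eta m (d m x) = d n (eta n x)" using eta_props[of n] x Suc by simp
   then have "g ((x \<ominus>\<^bsub>Pn n\<^esub> theta n x) \<ominus>\<^bsub>Pn n\<^esub> eta m (d m x)) = g (d n (eta n x))" by (rule arg_cong)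
   also have "\<dots> = \<zero>"
    by (rule gd) (use k_hom_closed[OF bimod_homK[OF conjunct1[OF eta_props]] x'(1)] in simp)
   finally have z: "(g x \<ominus> ?t (d m x)) \<ominus> g (eta m (d m x)) = \<zero>"
    unfolding k_hom_minus[OF mm gk' xt ed] k_hom_minus[OF mm gk' x'] t .
   have a: "g x \<in> carrier Y" "?t (d m x) \<in> carrier Y" "g (eta m (d m x)) \<in> carrier Y"
    by (rule k_hom_closed[OF gk' x'(1)], rule k_hom_closed[OF bimod_homK[OF tb] dx], rule k_hom_closed[OF gk' ed])
   have z1: "g x \<ominus> ?t (d m x) = g (eta m (d m x))"
    by (rule Y.N.M.minus_eq_zeroD[OF z Y.N.M.minus_closed[OF a(1,2)] a(3)])
   have "?t (d m x) \<ominus> (\<zero> \<ominus> (g x \<ominus> ?t (d m x))) = g x"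
    using a(1,2) by (simp add: a_minus_def Y.N.M.minus_add Y.N.M.a_ac Y.N.M.r_neg1 Y.N.M.r_neg)
   then show ?thesis unfolding z1 by (rule sym)
  qed
  have "g = hd' m (restrict ?g (carrier (P m)))"
  proof
   fix x show "g x = hd' m (restrict ?g (carrier (P m))) x"
   proof (cases "x \<in> carrier (P n)")
    case True
    then have "x \<in> carrier (P (Suc m))" using Suc by simp
    then show ?thesis unfolding gx[OF True] by (simp add: compose_def d_closed)
   next
    case False
    then have "x \<notin> carrier (P (Suc m))" using Suc by simp
    then show ?thesis using ge False by (simp add: compose_def extensional_def)
   qed
  qed
  then show ?thesis using gg by (auto simp add: bdry_def Suc)
 qed
qed

theorem rel_Ext_iso:
 "induced HK hd' n CY dY n (ev n) \<in> k_hom k (rel_Ext k R P d (bimod_as_left k Y) n) (cohomology CY dY n)"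
 "bij_betw (induced HK hd' n CY dY n (ev n)) (carrier (rel_Ext k R P d (bimod_as_left k Y) n)) (carrier (cohomology CY dY n))"
 unfolding rel_Ext_def hom_cohomology_def
 by (rule chain_map.ind(1)[OF ev_chain], rule chain_map.quasi_iso_bij[OF ev_chain ev_surj ev_inj])

lemma module_rel_Ext: "module k (rel_Ext k R P d (bimod_as_left k Y) n)"
 unfolding rel_Ext_def hom_cohomology_def by (rule cx.mod_H[OF HK_cx])

end

end

section \<open>Triangular matrix algebras\<close>

lemma coch_map_k_hom:
 assumes N: "module k N" and N': "module k N'" and g: "g \<in> k_hom k N N'"
 shows "(\<lambda>f l. g (f l)) \<in> k_hom k (coch k C N n) (coch k C N' n)"
proof (rule k_homI)
 show "(\<lambda>l. g (f l)) \<in> carrier (coch k C N' n)" if "f \<in> carrier (coch k C N n)" for f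
  using that multilinear_comp[OF _ g, of C f] k_hom_zero[OF N N' g] unfolding coch_carrier by auto
qed (simp_all add: fun_eq_iff k_hom_add[OF g] k_hom_smult[OF g] coch_closed[OF _ N])

lemma coch_map_d:
 assumes N: "bimodule k C C N" and N': "bimodule k C C N'" and g: "g \<in> k_hom k N N'"
  and gl: "\<And>x e. \<lbrakk>x \<in> carrier N; e \<in> carrier C\<rbrakk> \<Longrightarrow> g (lact N e x) = lact N' e (g x)"
  and gr: "\<And>x e. \<lbrakk>x \<in> carrier N; e \<in> carrier C\<rbrakk> \<Longrightarrow> g (ract N x e) = ract N' (g x) e"
  and f: "f \<in> carrier (coch k C N n)"
 shows "(\<lambda>l. g (coch_d C N n f l)) = coch_d C N' n (\<lambda>l. g (f l))"
proof -
 interpret H: hoch k C N by (rule hoch.intro[OF N])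
 interpret H': hoch k C N' by (rule hoch.intro[OF N'])
 have gf: "(\<lambda>l. g (f l)) \<in> carrier (coch k C N' n)"
  by (rule k_hom_closed[OF coch_map_k_hom[OF H.mN H'.mN g] f])
 have fc: "f m \<in> carrier N" for m by (rule coch_closed[OF f H.mN])
 show ?thesis
 proof (rule coch_eqI[OF k_hom_closed[OF coch_map_k_hom[OF H.mN H'.mN g] k_hom_closed[OF H.coch_d_k_hom f]]
   k_hom_closed[OF H'.coch_d_k_hom gf]])
  fix l assume "l \<in> power_gens C (Suc n)"
  then have l: "l \<in> lists (carrier C)" "length l = Suc n" by (simp_all add: power_gens_def lists_eq_set)
  then obtain e m where em: "l = e # m" by (cases l) auto
  have c: "e \<in> carrier C" "m \<in> lists (carrier C)" using l em by simp_all
  have D: "hD C N f e m \<in> carrier N" by (rule H.hD_closed[OF fc c])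
  have gD: "g (hD C N f e m) = hD C N' (\<lambda>l. g (f l)) e m" by (rule H.hD_nat[OF N' g gr fc c])
  have "g (hdel C N f l) = hdel C N' (\<lambda>l. g (f l)) l"
   unfolding em hdel.simps k_hom_minus[OF H.mN H'.mN g H.N.lact_closed[OF c(1) fc] D] gl[OF fc c(1)] gD ..
  then show "g (coch_d C N n f l) = coch_d C N' n (\<lambda>l. g (f l)) l"
   unfolding H.hdel_eq_coch_d[OF f l(1)] H'.hdel_eq_coch_d[OF gf l(1)] .
 qed
qed

text \<open>
 Multiplication by the idempotent \<open>\<phi> 1\<close> on the right projects onto the subset. Both pieces of \<open>X\<close> are of
 this form: \<open>\<phi>\<close> is the inclusion of \<open>B\<close>, or the composite \<open>E \<rightarrow> A \<rightarrow> E\<close>.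
\<close>

lemma right_corner_bimodule:
 fixes k :: "'k ring" and E :: "('k, 'e) module" and C :: "('k, 'c) module" and X :: "('k, 'e, 'e, 'x) bimod"
 assumes X: "bimodule k E E X" and C: "k_algebra k C" and \<phi>: "\<phi> \<in> k_hom k C E"
  and mult: "\<And>x y. \<lbrakk>x \<in> carrier C; y \<in> carrier C\<rbrakk> \<Longrightarrow> \<phi> (x \<otimes>\<^bsub>C\<^esub> y) = \<phi> x \<otimes>\<^bsub>E\<^esub> \<phi> y"
  and S: "S = {ract X x (\<phi> \<one>\<^bsub>C\<^esub>) | x. x \<in> carrier X}"
 shows "bimodule k E C (restrict_bimod S id \<phi> X)" and "x \<in> S \<longleftrightarrow> x \<in> carrier X \<and> ract X x (\<phi> \<one>\<^bsub>C\<^esub>) = x"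
proof -
 interpret X: hoch k E X by (rule hoch.intro[OF X])
 interpret C: k_algebra k C by (rule C)
 let ?u = "\<phi> \<one>\<^bsub>C\<^esub>"
 have pc: "\<phi> c \<in> carrier E" if "c \<in> carrier C" for c by (rule k_hom_closed[OF \<phi> that])
 have uc: "?u \<in> carrier E" by (simp add: pc)
 have pu: "\<phi> c \<otimes>\<^bsub>E\<^esub> ?u = \<phi> c" if "c \<in> carrier C" for c using mult[OF that, of "\<one>\<^bsub>C\<^esub>"] that by simp
 have S_iff: "x \<in> S \<longleftrightarrow> x \<in> carrier X \<and> ract X x ?u = x" for x
  using X.N.ract_mult[OF _ uc uc] pu[of "\<one>\<^bsub>C\<^esub>"] X.N.ract_closed[OF _ uc] unfolding S by force
 then show "x \<in> S \<longleftrightarrow> x \<in> carrier X \<and> ract X x (\<phi> \<one>\<^bsub>C\<^esub>) = x" .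
 note ru = X.ract_k_hom(1)[OF uc]
 have sm: "submodule S k X"
 proof (rule X.N.N.submoduleI)
  show "S \<subseteq> carrier X" using S_iff by blast
  show "\<zero>\<^bsub>X\<^esub> \<in> S" unfolding S_iff using k_hom_zero[OF X.mN X.mN ru] by simp
  show "\<ominus>\<^bsub>X\<^esub> a \<in> S" if "a \<in> S" for a
   using that unfolding S_iff using k_hom_a_inv[OF X.mN X.mN ru] by simp
  show "a \<oplus>\<^bsub>X\<^esub> b \<in> S" if "a \<in> S" "b \<in> S" for a b
   using that unfolding S_iff using k_hom_add[OF ru] by simp
  show "c \<odot>\<^bsub>X\<^esub> b \<in> S" if "c \<in> carrier k" "b \<in> S" for c b
   using that unfolding S_iff using k_hom_smult[OF ru] by simp
 qed
 let ?S = "restrict_bimod S id \<phi> X"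
 have s: "carrier ?S = S" "zero ?S = zero X" "add ?S = add X" "smult ?S = smult X" "lact ?S = lact X"
  "ract ?S = (\<lambda>x b. ract X x (\<phi> b))" by (simp_all add: restrict_bimod_def)
 have mS: "module k ?S"
  by (rule module_transfer[OF submodule.submodule_is_module[OF sm X.mN]]) (simp_all add: s)
 have lc: "lact X e x \<in> S" if "e \<in> carrier E" "x \<in> S" for e x
  using that unfolding S_iff using X.N.lact_ract[OF that(1) _ uc, of x] by (simp add: X.N.lact_closed)
 have rc: "ract X x (\<phi> c) \<in> S" if "x \<in> S" "c \<in> carrier C" for c x
  using that unfolding S_iff using X.N.ract_mult[OF _ pc[OF that(2)] uc, of x] pu by (simp add: X.N.ract_closed pc)
 have sX: "x \<in> carrier X" "ract X x ?u = x" if "x \<in> S" for x using that S_iff by blast+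
 show "bimodule k E C ?S"
 proof (intro bimodule.intro left_module.intro left_module_axioms.intro bimodule_axioms.intro X.N.k_algebra_axioms C mS; (unfold s)?)
  show "lact X e x \<in> S" if "e \<in> carrier E" "x \<in> S" for e x by (rule lc[OF that])
  show "ract X x (\<phi> c) \<in> S" if "x \<in> S" "c \<in> carrier C" for x c by (rule rc[OF that])
 qed (simp_all add: sX pc k_hom_add[OF \<phi>] k_hom_smult[OF \<phi>] mult
  X.N.lact_add_left X.N.lact_add_right X.N.lact_mult X.N.lact_one X.N.lact_smult X.N.ract_add_left X.N.ract_add_right X.N.ract_mult
  X.N.ract_smult X.N.lact_ract)
qed

locale triangular_bimodule =
 fixes k :: "'k ring"
  and A :: "('k, 'a) module" and B :: "('k, 'b) module"
  and M :: "('k, 'a, 'b, 'm) bimod"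
  and E :: "('k, 'a \<times> 'm \<times> 'b) module"
  and X :: "('k, 'a \<times> 'm \<times> 'b, 'a \<times> 'm \<times> 'b, 'x) bimod"
 assumes bM: "bimodule k A B M" and E_def: "E = triangular A M B" and bX: "bimodule k E E X"
begin

sublocale X: hoch k E X by (rule hoch.intro[OF bX])
sublocale M: bimodule k A B M by (rule bM)

lemma kE: "k_algebra k E" and kA: "k_algebra k A" and kB: "k_algebra k B"
 by (rule X.N.k_algebra_axioms M.k_algebra_axioms M.B.k_algebra_axioms)+

lemma E_carrier: "carrier E = carrier A \<times> carrier M \<times> carrier B"
 and E_mult: "(a, m, b) \<otimes>\<^bsub>E\<^esub> (a', m', b') = (a \<otimes>\<^bsub>A\<^esub> a', lact M a m' \<oplus>\<^bsub>M\<^esub> ract M m b', b \<otimes>\<^bsub>B\<^esub> b')"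
 and E_one: "\<one>\<^bsub>E\<^esub> = (\<one>\<^bsub>A\<^esub>, \<zero>\<^bsub>M\<^esub>, \<one>\<^bsub>B\<^esub>)"
 and E_add: "(a, m, b) \<oplus>\<^bsub>E\<^esub> (a', m', b') = (a \<oplus>\<^bsub>A\<^esub> a', m \<oplus>\<^bsub>M\<^esub> m', b \<oplus>\<^bsub>B\<^esub> b')"
 and E_smult: "c \<odot>\<^bsub>E\<^esub> (a, m, b) = (c \<odot>\<^bsub>A\<^esub> a, c \<odot>\<^bsub>M\<^esub> m, c \<odot>\<^bsub>B\<^esub> b)"
 by (simp_all add: E_def triangular_def)

lemma M_zero: "a \<in> carrier A \<Longrightarrow> lact M a \<zero>\<^bsub>M\<^esub> = \<zero>\<^bsub>M\<^esub>" "b \<in> carrier B \<Longrightarrow> ract M \<zero>\<^bsub>M\<^esub> b = \<zero>\<^bsub>M\<^esub>"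
 "m \<in> carrier M \<Longrightarrow> lact M \<zero>\<^bsub>A\<^esub> m = \<zero>\<^bsub>M\<^esub>" "m \<in> carrier M \<Longrightarrow> ract M m \<zero>\<^bsub>B\<^esub> = \<zero>\<^bsub>M\<^esub>"
proof -
 note mM = M.N.module_axioms and mA = M.module_axioms and mB = M.B.module_axioms
 note l = bimodule_lact_bilinear[OF bM] and r = bimodule_ract_bilinear[OF bM]
 show "a \<in> carrier A \<Longrightarrow> lact M a \<zero>\<^bsub>M\<^esub> = \<zero>\<^bsub>M\<^esub>" by (rule k_hom_zero[OF mM mM bilinear_k_hom_left[OF l]])
 show "b \<in> carrier B \<Longrightarrow> ract M \<zero>\<^bsub>M\<^esub> b = \<zero>\<^bsub>M\<^esub>" by (rule k_hom_zero[OF mM mM bilinear_k_hom_right[OF r]])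
 show "m \<in> carrier M \<Longrightarrow> lact M \<zero>\<^bsub>A\<^esub> m = \<zero>\<^bsub>M\<^esub>" by (rule k_hom_zero[OF mA mM bilinear_k_hom_right[OF l]])
 show "m \<in> carrier M \<Longrightarrow> ract M m \<zero>\<^bsub>B\<^esub> = \<zero>\<^bsub>M\<^esub>" by (rule k_hom_zero[OF mB mM bilinear_k_hom_left[OF r]])
qed

abbreviation "jA \<equiv> inA M B"
abbreviation "jB \<equiv> inB A M"

lemma jA_hom: "jA \<in> k_hom k A E"
 by (rule k_homI) (simp_all add: inA_def E_carrier E_add E_smult M.N.smult_r_null M.B.smult_r_null)

lemma jB_hom: "jB \<in> k_hom k B E"
 by (rule k_homI) (simp_all add: inB_def E_carrier E_add E_smult M.N.smult_r_null M.smult_r_null)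

lemma jA_mult: "\<lbrakk>a \<in> carrier A; a' \<in> carrier A\<rbrakk> \<Longrightarrow> jA (a \<otimes>\<^bsub>A\<^esub> a') = jA a \<otimes>\<^bsub>E\<^esub> jA a'"
 by (simp add: inA_def E_mult M_zero)

lemma jB_mult: "\<lbrakk>b \<in> carrier B; b' \<in> carrier B\<rbrakk> \<Longrightarrow> jB (b \<otimes>\<^bsub>B\<^esub> b') = jB b \<otimes>\<^bsub>E\<^esub> jB b'"
 by (simp add: inB_def E_mult M_zero)

lemma fst_hom: "fst \<in> k_hom k E A" and proj_B_hom: "proj_B \<in> k_hom k E B"
 by (rule k_homI; auto simp add: E_carrier E_add E_smult proj_B_def)+

lemma fst_mult: "\<lbrakk>x \<in> carrier E; y \<in> carrier E\<rbrakk> \<Longrightarrow> fst (x \<otimes>\<^bsub>E\<^esub> y) = fst x \<otimes>\<^bsub>A\<^esub> fst y"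
 and proj_B_mult: "\<lbrakk>x \<in> carrier E; y \<in> carrier E\<rbrakk> \<Longrightarrow> proj_B (x \<otimes>\<^bsub>E\<^esub> y) = proj_B x \<otimes>\<^bsub>B\<^esub> proj_B y"
 by (auto simp add: E_carrier E_mult proj_B_def)

lemma fst_jA: "fst (jA a) = a" by (simp add: inA_def)
lemma jA_fst_one: "jA (fst \<one>\<^bsub>E\<^esub>) = jA \<one>\<^bsub>A\<^esub>" by (simp add: E_one)

lemma mult_unit_A: "x \<in> carrier E \<Longrightarrow> x \<otimes>\<^bsub>E\<^esub> jA \<one>\<^bsub>A\<^esub> = jA (fst x)"
 by (auto simp add: E_carrier inA_def E_mult M_zero)

lemma unit_mult_B: "x \<in> carrier E \<Longrightarrow> jB \<one>\<^bsub>B\<^esub> \<otimes>\<^bsub>E\<^esub> x = jB (proj_B x)"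
 by (auto simp add: E_carrier inB_def E_mult M_zero proj_B_def)

lemma unit_sum: "jB \<one>\<^bsub>B\<^esub> \<oplus>\<^bsub>E\<^esub> jA \<one>\<^bsub>A\<^esub> = \<one>\<^bsub>E\<^esub>"
 by (simp add: inA_def inB_def E_add E_one)

lemma units_closed: "jA \<one>\<^bsub>A\<^esub> \<in> carrier E" "jB \<one>\<^bsub>B\<^esub> \<in> carrier E"
 by (rule k_hom_closed[OF jA_hom], simp, rule k_hom_closed[OF jB_hom], simp)

lemmas jfst_hom = k_hom_compose[OF fst_hom jA_hom]

lemma jfst_mult: "\<lbrakk>x \<in> carrier E; y \<in> carrier E\<rbrakk> \<Longrightarrow> jA (fst (x \<otimes>\<^bsub>E\<^esub> y)) = jA (fst x) \<otimes>\<^bsub>E\<^esub> jA (fst y)"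
 unfolding fst_mult by (rule jA_mult) (auto simp add: E_carrier)

text \<open>
 The quotient of \<open>X\<close> by \<open>X1\<^sub>B\<close>, realised on the complement \<open>X1\<^sub>A\<close>.
\<close>

definition XA :: "('k, 'a \<times> 'm \<times> 'b, 'a \<times> 'm \<times> 'b, 'x) bimod" where
 "XA = restrict_bimod {ract X x (jA \<one>\<^bsub>A\<^esub>) | x. x \<in> carrier X} id (\<lambda>x. jA (fst x)) X"

lemma XA_simps: "zero XA = zero X" "add XA = add X" "smult XA = smult X" "lact XA = lact X" "ract XA x e = ract X x (jA (fst e))"
 by (simp_all add: XA_def restrict_bimod_def)

lemma bXB: "bimodule k E B (X_B A M B X)"
 unfolding X_B_def by (rule right_corner_bimodule(1)[OF bX kB jB_hom jB_mult refl])

lemma XB_iff: "x \<in> carrier (X_B A M B X) \<longleftrightarrow> x \<in> carrier X \<and> ract X x (jB \<one>\<^bsub>B\<^esub>) = x"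
 using right_corner_bimodule(2)[OF bX kB jB_hom jB_mult refl, of x] by (simp add: X_B_def restrict_bimod_def)

lemma bXA: "bimodule k E E XA"
 unfolding XA_def by (rule right_corner_bimodule(1)[OF bX kE jfst_hom jfst_mult]) (simp_all only: jA_fst_one)

lemma XA_iff: "x \<in> carrier XA \<longleftrightarrow> x \<in> carrier X \<and> ract X x (jA \<one>\<^bsub>A\<^esub>) = x"
 using right_corner_bimodule(2)[OF bX kE jfst_hom jfst_mult refl, of x] unfolding jA_fst_one
 by (simp add: XA_def restrict_bimod_def)

lemma corner_XA: "corner k E XA A jA fst"
proof (intro corner.intro corner_axioms.intro hoch.intro bXA kA jA_hom jA_mult fst_hom fst_mult fst_jA mult_unit_A)
 show "ract XA z x = ract XA z (jA (fst x))" if "z \<in> carrier XA" "x \<in> carrier E" for z x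
  by (simp add: XA_simps fst_jA)
qed

lemma ZA_XA: "corner.ZA XA A jA = X_AA A M B X"
proof -
 have "{lact XA (jA \<one>\<^bsub>A\<^esub>) z |z. z \<in> carrier XA} = {lact X (jA \<one>\<^bsub>A\<^esub>) (ract X x (jA \<one>\<^bsub>A\<^esub>)) |x. x \<in> carrier X}"
  by (auto simp add: XA_def restrict_bimod_def)
 then show ?thesis
  unfolding corner.ZA_def[OF corner_XA] X_AA_def by (simp add: restrict_bimod_def XA_def fst_jA)
qed

text \<open>
 The subbimodule \<open>X1\<^sub>B\<close> of \<open>X\<close>, written as it arises in the comparison with relative Ext: \<open>E\<close> acts on
 the right through \<open>B\<close>.
\<close>

definition XBE :: "('k, 'a \<times> 'm \<times> 'b, 'a \<times> 'm \<times> 'b, 'x) bimod" where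
 "XBE = restrict_bimod (carrier (X_B A M B X)) id proj_B (X_B A M B X)"

lemma XBE_simps: "carrier XBE = carrier (X_B A M B X)" "zero XBE = zero X" "add XBE = add X" "smult XBE = smult X"
 "lact XBE = lact X" "ract XBE x e = ract X x (jB (proj_B e))"
 by (simp_all add: XBE_def restrict_bimod_def X_B_def)

lemma les_cochains:
 assumes bU: "bimodule k E E XBE"
 shows "has_long_exact_sequence k (cohomology (coch k E XBE) (coch_d E XBE)) (cohomology (coch k E X) (coch_d E X))
  (cohomology (coch k E XA) (coch_d E XA))"
proof -
 interpret U: hoch k E XBE by (rule hoch.intro[OF bU])
 interpret W: hoch k E XA by (rule hoch.intro[OF bXA])
 have Ui: "x \<in> carrier XBE \<longleftrightarrow> x \<in> carrier X \<and> ract X x (jB \<one>\<^bsub>B\<^esub>) = x" for x by (simp add: XBE_simps XB_iff)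
 have uuA: "jA \<one>\<^bsub>A\<^esub> \<otimes>\<^bsub>E\<^esub> jA \<one>\<^bsub>A\<^esub> = jA \<one>\<^bsub>A\<^esub>" and uuB: "jB \<one>\<^bsub>B\<^esub> \<otimes>\<^bsub>E\<^esub> jB \<one>\<^bsub>B\<^esub> = jB \<one>\<^bsub>B\<^esub>"
  using jA_mult[of "\<one>\<^bsub>A\<^esub>" "\<one>\<^bsub>A\<^esub>"] jB_mult[of "\<one>\<^bsub>B\<^esub>" "\<one>\<^bsub>B\<^esub>"] by simp_all
 have iU: "(\<lambda>x. x) \<in> k_hom k XBE X" by (rule k_homI) (auto simp add: XBE_simps XB_iff)
 have iW: "(\<lambda>x. x) \<in> k_hom k XA X" by (rule k_homI) (auto simp add: XA_simps XA_iff)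
 have rA: "ract X x (jA \<one>\<^bsub>A\<^esub>) \<in> carrier XA" if "x \<in> carrier X" for x
  unfolding XA_iff X.N.ract_mult[OF that units_closed(1) units_closed(1), symmetric] uuA by (simp add: X.N.ract_closed[OF that] units_closed)
 have rB: "ract X x (jB \<one>\<^bsub>B\<^esub>) \<in> carrier XBE" if "x \<in> carrier X" for x
  unfolding Ui X.N.ract_mult[OF that units_closed(2) units_closed(2), symmetric] uuB by (simp add: X.N.ract_closed[OF that] units_closed)
 have pA: "(\<lambda>x. ract X x (jA \<one>\<^bsub>A\<^esub>)) \<in> k_hom k X XA"
  by (rule k_homI[OF rA]) (simp_all add: XA_simps k_hom_add[OF X.ract_k_hom(1)[OF units_closed(1)]] k_hom_smult[OF X.ract_k_hom(1)[OF units_closed(1)]])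
 have pB: "(\<lambda>x. ract X x (jB \<one>\<^bsub>B\<^esub>)) \<in> k_hom k X XBE"
  by (rule k_homI[OF rB]) (simp_all add: XBE_simps k_hom_add[OF X.ract_k_hom(1)[OF units_closed(2)]] k_hom_smult[OF X.ract_k_hom(1)[OF units_closed(2)]])
 have jc: "jA (fst e) \<in> carrier E" "jB (proj_B e) \<in> carrier E" if "e \<in> carrier E" for e
  by (rule k_hom_closed[OF jfst_hom that], rule k_hom_closed[OF k_hom_compose[OF proj_B_hom jB_hom] that])
 (* 1_B e = 1_B e 1_B, so that this is the action inherited from X *)
 have Ur: "ract XBE x e = ract X x e" if x: "x \<in> carrier XBE" and e: "e \<in> carrier E" for x e
  using X.N.ract_mult[OF _ units_closed(2) e, of x] x unfolding XBE_simps unit_mult_B[OF e] Ui[unfolded XBE_simps] by simp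
 (* e 1_A = 1_A e 1_A, so that the projection to X 1_A is a bimodule map *)
 have Wr: "ract X (ract X x e) (jA \<one>\<^bsub>A\<^esub>) = ract XA (ract X x (jA \<one>\<^bsub>A\<^esub>)) e" if x: "x \<in> carrier X" and e: "e \<in> carrier E" for x e
 proof -
  have "jA \<one>\<^bsub>A\<^esub> \<otimes>\<^bsub>E\<^esub> jA (fst e) = jA (fst e)"
   using jA_mult[of "\<one>\<^bsub>A\<^esub>" "fst e"] k_hom_closed[OF fst_hom e] by simp
  then show ?thesis
   unfolding XA_simps X.N.ract_mult[OF x e units_closed(1), symmetric] X.N.ract_mult[OF x units_closed(1) jc(1)[OF e], symmetric]
    mult_unit_A[OF e] by simp
 qed
 note cm = coch_map_k_hom[OF _ _ _, where k = k and C = E]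
 have ses: "split_ses k (coch k E XBE) (coch_d E XBE) (coch k E X) (coch_d E X) (coch k E XA) (coch_d E XA)
   (\<lambda>n f l. f l) (\<lambda>n f l. ract X (f l) (jA \<one>\<^bsub>A\<^esub>)) (\<lambda>n f l. f l) (\<lambda>n f l. ract X (f l) (jB \<one>\<^bsub>B\<^esub>))"
 proof (intro split_ses.intro split_ses_axioms.intro U.coch_cx X.coch_cx W.coch_cx)
  fix n
  show "(\<lambda>f l. f l) \<in> k_hom k (coch k E XBE n) (coch k E X n)" by (rule cm[OF U.mN X.mN iU])
  show "(\<lambda>f l. f l) \<in> k_hom k (coch k E XA n) (coch k E X n)" by (rule cm[OF W.mN X.mN iW])
  show "(\<lambda>f l. ract X (f l) (jA \<one>\<^bsub>A\<^esub>)) \<in> k_hom k (coch k E X n) (coch k E XA n)" by (rule cm[OF X.mN W.mN pA])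
  show "(\<lambda>f l. ract X (f l) (jB \<one>\<^bsub>B\<^esub>)) \<in> k_hom k (coch k E X n) (coch k E XBE n)" by (rule cm[OF X.mN U.mN pB])
  show "(\<lambda>l. coch_d E XBE n f l) = coch_d E X n (\<lambda>l. f l)" if "f \<in> carrier (coch k E XBE n)" for f
   by (rule coch_map_d[OF bU bX iU _ Ur that]) (simp_all add: XBE_simps)
  show "(\<lambda>l. ract X (coch_d E X n f l) (jA \<one>\<^bsub>A\<^esub>)) = coch_d E XA n (\<lambda>l. ract X (f l) (jA \<one>\<^bsub>A\<^esub>))" if "f \<in> carrier (coch k E X n)" for f
   by (rule coch_map_d[OF bX bXA pA _ Wr that]) (simp_all add: XA_simps X.N.lact_ract units_closed)
  show "(\<lambda>l. ract X (f l) (jB \<one>\<^bsub>B\<^esub>)) = f" if "f \<in> carrier (coch k E XBE n)" for f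
   using coch_closed[OF that U.mN] Ui by (simp add: fun_eq_iff)
  show "(\<lambda>l. ract X (f l) (jA \<one>\<^bsub>A\<^esub>)) = f" if "f \<in> carrier (coch k E XA n)" for f
   using coch_closed[OF that W.mN] XA_iff by (simp add: fun_eq_iff)
  show "(\<lambda>l. ract X (f l) (jB \<one>\<^bsub>B\<^esub>)) \<oplus>\<^bsub>coch k E X n\<^esub> (\<lambda>l. ract X (f l) (jA \<one>\<^bsub>A\<^esub>)) = f" if "f \<in> carrier (coch k E X n)" for f
   using X.N.ract_add_right[OF coch_closed[OF that X.mN] units_closed(2,1)] X.N.ract_one[OF coch_closed[OF that X.mN]]
   by (simp add: fun_eq_iff unit_sum)
 qed
 show ?thesis by (rule split_ses.long_exact_sequence[OF ses])
qed

end

theorem theorem2: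
  fixes k :: "'k ring"
    and A :: "('k, 'a) module" and B :: "('k, 'b) module"
    and M :: "('k, 'a, 'b, 'm) bimod"
    and E :: "('k, 'a \<times> 'm \<times> 'b) module"
    and X :: "('k, 'a \<times> 'm \<times> 'b, 'a \<times> 'm \<times> 'b, 'x) bimod"
    and R :: "('k, (('a \<times> 'm \<times> 'b) \<times> 'b \<Rightarrow> 'k) set) module"
    and P :: "nat \<Rightarrow> ('k, (('a \<times> 'm \<times> 'b) \<times> 'b \<Rightarrow> 'k) set, 'p) lmod"
    and d :: "nat \<Rightarrow> 'p \<Rightarrow> 'p" and \<epsilon> :: "'p \<Rightarrow> 'b"
  assumes "cring k"
    and "k_algebra k A" and "k_algebra k B"
    and "bimodule k A B M"
    and "E = triangular A M B"
    and "bimodule k E E X"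
    and "R = tensor_algebra k E (opposite B)"
    and "rel_projective_resolution k R (bimod_as_left k (B_E B)) P d \<epsilon>"
  shows "has_long_exact_sequence k
           (rel_Ext k R P d (bimod_as_left k (X_B A M B X)))
           (hochschild k E X)
           (hochschild k A (X_AA A M B X))"
proof -
  interpret triangular_bimodule k A B M E X by (rule triangular_bimodule.intro) fact+
  note res = assms(8)[unfolded rel_projective_resolution_def]
  have rp: "rel_projective k R (P n)" for n using res by blast
  have "\<forall>n. \<exists>h. rel_section k R (P n) h"
    using rel_projective_section[OF _ rp] rp unfolding rel_projective_def by blast
  then obtain h where h: "\<And>n. rel_section k R (P n) (h n)" by metis
  have Bs: "zero (B_E B) = zero B" "carrier (B_E B) = carrier B" "add (B_E B) = add B" "smult (B_E B) = smult B"
    by (simp_all add: B_E_def restrict_bimod_def regular_bimod_def)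
  have Bh: "k_hom k (B_E B) N = k_hom k B N" for N :: "('k, 'p, 'z) module_scheme"
    by (rule k_hom_transfer_left) (simp_all add: Bs)
  obtain \<sigma> s where sg: "\<sigma> \<in> k_hom k B (P 0)" and s: "\<And>n. s n \<in> k_hom k (P n) (P (Suc n))"
    and es: "\<And>y. y \<in> carrier B \<Longrightarrow> \<epsilon> (\<sigma> y) = y"
    and h0: "\<And>x. x \<in> carrier (P 0) \<Longrightarrow> d 0 (s 0 x) \<oplus>\<^bsub>P 0\<^esub> \<sigma> (\<epsilon> x) = x"
    and hS: "\<And>n x. x \<in> carrier (P (Suc n)) \<Longrightarrow> d (Suc n) (s (Suc n) x) \<oplus>\<^bsub>P (Suc n)\<^esub> s n (d n x) = x"
    using res unfolding bimod_as_left_simps bimod_as_left_k_hom Bs Bh by blast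
  interpret cmp: comparison k E B proj_B P d \<epsilon> \<sigma> s h "B_E B"
  proof (intro comparison.intro two_algebras.intro comparison_axioms.intro kE kB proj_B_hom proj_B_mult B_E_def
      sg s es h0 hS h[unfolded assms(7)])
    show "proj_B \<one>\<^bsub>E\<^esub> = \<one>\<^bsub>B\<^esub>" by (simp add: E_one proj_B_def)
    show "d n \<in> lmod_hom k (tensor_algebra k E (opposite B)) (P (Suc n)) (P n)" for n using res unfolding assms(7) by blast
    show "\<epsilon> \<in> lmod_hom k (tensor_algebra k E (opposite B)) (P 0) (bimod_as_left k (B_E B))" using res unfolding assms(7) by blast
    show "\<epsilon> (d 0 z) = \<zero>\<^bsub>B\<^esub>" if "z \<in> carrier (P (Suc 0))" for z using res that by (simp add: Bs)
    show "d n (d (Suc n) z) = \<zero>\<^bsub>P n\<^esub>" if "z \<in> carrier (P (Suc (Suc n)))" for z n using res that by blast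
  qed
  let ?Y = "X_B A M B X"
  have pp: "cmp.pp ?Y = XBE" by (simp add: cmp.pp_def XBE_def)
  interpret U: hoch k E XBE using cmp.hoch_pp[OF bXB] unfolding pp .
  interpret W: corner k E XA A jA fst by (rule corner_XA)
  interpret XAA: hoch k A "X_AA A M B X" by (rule hoch.intro) (use W.bimodule_ZA in \<open>simp add: ZA_XA\<close>)
  note ext = cmp.rel_Ext_iso[OF bXB, unfolded pp] and mext = cmp.module_rel_Ext[OF bXB]
  note ci = W.corner_iso[unfolded ZA_XA]
  show ?thesis unfolding assms(7)
    by (rule has_long_exact_sequence_transfer[OF les_cochains[OF U.bN] cx.mod_H[OF U.coch_cx] mext
        cx.mod_H[OF X.coch_cx] X.module_hochschild cx.mod_H[OF W.Z.coch_cx] XAA.module_hochschild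
        ext X.hochschild_iso k_hom_compose[OF ci(1) XAA.hochschild_iso(1)]
        bij_betw_trans[OF ci(2) XAA.hochschild_iso(2), unfolded comp_def]])
qed

end
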